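(* Let $n\ge1$, $0\le k\le n-1$ and $r\ge1$. The operator $$E_n^k u=\frac1n\sum_{m=1}^{n}\ \sum_{I\in\Gamma_m}(-1)^{m+1}\sum_{s=0}^{k}\ \sum_{J\in\Gamma_s(I)}\frac{\phi_J}{\lambda_I^{s+1}}\wedge A_{I,J}^k u$$ maps $\Lambda^k(\partial S_n)$ into $\Lambda^k(S_n)$, maps $\mathcal P_r\Lambda^k(\partial S_n)$ into $\mathcal P_r\Lambda^k(S_n)$, and maps $\mathcal P_r^-\Lambda^k(\partial S_n)$ into $\mathcal P_r^-\Lambda^k(S_n)$.
   Context: Simplex and forms. $n\ge1$ is fixed and $S_n=[x_0,\dots,x_n]\subset\mathbb R^n$ is a fixed (nondegenerate) $n$-simplex with barycentric coordinates $\lambda_0,\dots,\lambda_n$ (so $\lambda_i$ is affine, $\lambda_i(x_j)=\delta_{ij}$) and boundary $\partial S_n=\{x\in S_n:\lambda_i(x)=0\text{ for some }i\}$. $\Lambda^k(S_n)$ is the space of smooth $k$-forms on $S_n$. $\Lambda^k(\partial S_n)$ is the space of piecewise smooth $k$-forms on $\partial S_n$: smooth on each $(n-1)$-dimensional face, with single-valued traces at the interfaces; equivalently $\Lambda^k(\partial S_n)=\operatorname{tr}_{\partial S_n}\Lambda^k(S_n)$, where $\operatorname{tr}_{\partial S_n}$ is the (facewise) pullback under the inclusion $\partial S_n\to S_n$. Polynomial spaces. $\mathcal P_r\Lambda^k(S_n)$ consists of the $u\in\Lambda^k(S_n)$ such that $x\mapsto u_x(v_1,\dots,v_k)$ is a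 polynomial of degree $\le r$ for all fixed $v_1,\dots,v_k$. $\mathcal P_r^-\Lambda^k(S_n)$ consists of the $u\in\mathcal P_r\Lambda^k(S_n)$ such that $u\lrcorner(x-a)\in\mathcal P_r\Lambda^{k-1}(S_n)$ for any fixed $a\in\mathbb R^n$, where $(u\lrcorner(x-a))_x(v_1,\dots,v_{k-1})=u_x(x-a,v_1,\dots,v_{k-1})$ (no condition if $k=0$). $\mathcal P_r\Lambda^k(\partial S_n)=\operatorname{tr}_{\partial S_n}\mathcal P_r\Lambda^k(S_n)$ and $\mathcal P_r^-\Lambda^k(\partial S_n)=\operatorname{tr}_{\partial S_n}\mathcal P_r^-\Lambda^k(S_n)$. Index sets. An index set $J=\{j_0,\dots,j_s\}$ is an ordered list of distinct elements of $\{0,\dots,n\}$ (not necessarily increasing); $|J|$ is its number of elements, $J^c$ its complement in $\{0,\dots,n\}$, $J(\hat i)$ is $J$ with the entry $j_i$ removed, $\{p,J\}$ is $J$ with $p$ placed in front, and $[x_J]$ is the simplex spanned by $\{x_j\}_{j\in J}$ with orientation induced by the order of $J$. $\Gamma$ is the set of (nonempty) increasingly ordered index sets, $\Gamma_m=\{J\in\Gamma:|J|=m+1\}$, $\Gamma_m(I)=\{J\in\Gamma_m: J\subset I\}$. $\lambda_J=\sum_{j\in J}\lambda_j$, and the Whitney form of $J=\{j_0,\dots,j_s\}$ is $\phi_J=\sum_{i=0}^s(-1)^i\lambda_{j_i}\,d\lambda_{j_0}\wedge\cdots\wedge\widehat{d\lambda_{j_i}}\wedge\cdots\wedge d\lambda_{j_s}$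 (hat: omitted), so $\phi_{\{j\}}=\lambda_j$. Operators $R$. For $I\in\Gamma$ put $F_I(x,y)=x+\sum_{i\in I}\lambda_i(x)(y-x_i)$ and $P_{I,j}x=F_I(x,x_j)$. One has $D_yF_I=\lambda_I(x)\,\mathrm{Id}$. For an index set $J$ with $|J|=s+1$, $s\le k$, $R_{I,J}^ku$ is the $(k-s)$-form on $S_n$ $$(R_{I,J}^ku)_x(v_1,\dots,v_{k-s})=\lambda_I(x)^s\int_{[x_J]}u_{F_I(x,y)}(D_xF_I v_1,\dots,D_xF_I v_{k-s},t_1,\dots,t_s)\,dy,$$ where $t_1,\dots,t_s$ is an (oriented) orthonormal basis of the tangent space of $[x_J]$; for $s=0$, $J=\{j\}$, $R_{I,J}^k=P_{I,j}^*$ (pullback). $R_{I,J}^k=0$ for $s>k$. If $I\cap J^c\neq\emptyset$, then for any $i\in I\cap J^c$ the map $F_I$ sends $S_n\times[x_J]$ into $\{\lambda_i=0\}\subset\partial S_n$, and $R_{I,J}^ku$ is defined by the same formula for $u\in\Lambda^k(\partial S_n)$ (equivalently, by applying it to any smooth form with trace $u$). Operators $A$. For $I\in\Gamma_m$, $1\le m\le n$, and $J\in\Gamma_s(I)$, $0\le s\le k\le n-1$: $A_{I,J}^k:\Lambda^k(\partial S_n)\to\Lambda^{k-s}(S_n)$ is given by $A_{I,\{j\}}^ku=P_{I,j}^*u$ for $s=0$, and for $s\ge1$ $$A_{I,J}^k=c_{s,n}^k\sum_{p\in J^c}\sum_{i=0}^s(-1)^iR^k_{I,\{p,J(\hat i)\}},\qquad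 c_{s,n}^k=\frac{(-1)^{1+ks}(s!)^2}{(n-1)\cdots(n-s)}.$$ The rational expression defining $E_n^ku$ is a priori defined at points where the denominators $\lambda_I$ do not vanish; that $E_n^ku$ belongs to one of the spaces on $S_n$ means that this expression coincides there with an element of that space. *)

theory Defs
  imports "HOL-Analysis.Analysis"
begin

text \<open>
  The ambient space is a Euclidean space \<open>'a\<close> of dimension \<open>n = DIM('a)\<close>, and the simplex is given by
  its vertices \<open>X 0, \<dots>, X n\<close>.  A \<open>k\<close>-form is a function \<open>u :: 'a \<Rightarrow> 'a list \<Rightarrow> real\<close>, where \<open>u y vs\<close> is
  the value at the point \<open>y\<close> on the \<open>k\<close> tangent vectors \<open>vs\<close>.  Values outside the domain of a form,
  or on lists of vectors that are not tangent or have the wrong length, carry no meaning and are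
  left unconstrained.
\<close>

section \<open>Simplex and barycentric coordinates\<close>

definition nondegenerate :: "(nat \<Rightarrow> 'a::euclidean_space) \<Rightarrow> bool" where
  "nondegenerate X \<longleftrightarrow> inj_on X {..DIM('a)} \<and> \<not> affine_dependent (X ` {..DIM('a)})"

definition the_simplex :: "(nat \<Rightarrow> 'a::euclidean_space) \<Rightarrow> 'a set" where
  "the_simplex X = convex hull (X ` {..DIM('a)})"

definition bary :: "(nat \<Rightarrow> 'a::euclidean_space) \<Rightarrow> nat \<Rightarrow> 'a \<Rightarrow> real" where
  "bary X i = (THE l. (\<exists>g c. linear g \<and> l = (\<lambda>y. g y + c)) \<and>
                      (\<forall>j\<le>DIM('a). l (X j) = (if i = j then 1 else 0)))"

definition bary_sum :: "(nat \<Rightarrow> 'a::euclidean_space) \<Rightarrow> nat list \<Rightarrow> 'a \<Rightarrow> real" where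
  "bary_sum X J y = (\<Sum>j\<in>set J. bary X j y)"

definition dbary :: "(nat \<Rightarrow> 'a::euclidean_space) \<Rightarrow> nat \<Rightarrow> 'a \<Rightarrow> 'a \<Rightarrow> real" where
  "dbary X i y v = frechet_derivative (bary X i) (at y) v"

definition facet :: "(nat \<Rightarrow> 'a::euclidean_space) \<Rightarrow> nat \<Rightarrow> 'a set" where
  "facet X i = {y \<in> the_simplex X. bary X i y = 0}"

definition tangent :: "(nat \<Rightarrow> 'a::euclidean_space) \<Rightarrow> nat set \<Rightarrow> 'a set" where
  "tangent X K = span {X a - X b | a b. a \<in> K \<and> b \<in> K}"

abbreviation facet_tangent :: "(nat \<Rightarrow> 'a::euclidean_space) \<Rightarrow> nat \<Rightarrow> 'a set" where
  "facet_tangent X i \<equiv> tangent X ({..DIM('a)} - {i})"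

section \<open>Smooth forms\<close>

primrec Ck_on :: "nat \<Rightarrow> 'a::euclidean_space set \<Rightarrow> ('a \<Rightarrow> real) \<Rightarrow> bool" where
  "Ck_on 0 U f \<longleftrightarrow> continuous_on U f"
| "Ck_on (Suc m) U f \<longleftrightarrow> (\<forall>y\<in>U. f differentiable (at y)) \<and>
     (\<forall>v. Ck_on m U (\<lambda>y. frechet_derivative f (at y) v))"

text \<open>Smoothness on a closed set \<open>M\<close>: restriction of a smooth function on an open neighbourhood.\<close>

definition smooth_on :: "'a::euclidean_space set \<Rightarrow> ('a \<Rightarrow> real) \<Rightarrow> bool" where
  "smooth_on M f \<longleftrightarrow> (\<exists>U g. open U \<and> M \<subseteq> U \<and> (\<forall>m. Ck_on m U g) \<and> (\<forall>y\<in>M. f y = g y))"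

definition alternating_on :: "'a::real_vector set \<Rightarrow> nat \<Rightarrow> ('a list \<Rightarrow> real) \<Rightarrow> bool" where
  "alternating_on T k w \<longleftrightarrow> (\<forall>vs. length vs = k \<and> set vs \<subseteq> T \<longrightarrow>
     (\<forall>i<k. (\<forall>a\<in>T. \<forall>b\<in>T. w (vs[i := a + b]) = w (vs[i := a]) + w (vs[i := b])) \<and>
            (\<forall>a\<in>T. \<forall>c. w (vs[i := c *\<^sub>R a]) = c * w (vs[i := a]))) \<and>
     (\<forall>i<k. \<forall>j<k. i \<noteq> j \<and> vs ! i = vs ! j \<longrightarrow> w vs = 0))"

text \<open>Smooth \<open>k\<close>-forms on \<open>M\<close>, where \<open>M\<close> has the tangent space \<open>T\<close> at each point.\<close>

definition smooth_forms :: "'a::euclidean_space set \<Rightarrow> 'a set \<Rightarrow> nat \<Rightarrow> ('a \<Rightarrow> 'a list \<Rightarrow> real) set" where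
  "smooth_forms T M k =
     {u. (\<forall>y\<in>M. alternating_on T k (u y)) \<and>
         (\<forall>vs. length vs = k \<and> set vs \<subseteq> T \<longrightarrow> smooth_on M (\<lambda>y. u y vs))}"

definition Lam :: "(nat \<Rightarrow> 'a::euclidean_space) \<Rightarrow> nat \<Rightarrow> ('a \<Rightarrow> 'a list \<Rightarrow> real) set" where
  "Lam X k = smooth_forms UNIV (the_simplex X) k"

text \<open>
  A form \<open>u\<close> on the boundary is meaningful at \<open>y\<close> and \<open>vs\<close> if some facet contains \<open>y\<close> and has all of
  \<open>vs\<close> as tangent vectors.  The value \<open>u y vs\<close> does not depend on the facet; as \<open>y\<close> and \<open>vs\<close> may belong
  to several facets, this expresses that the traces at the interfaces are single-valued.
\<close>

definition Lam_bd :: "(nat \<Rightarrow> 'a::euclidean_space) \<Rightarrow> nat \<Rightarrow> ('a \<Rightarrow> 'a list \<Rightarrow> real) set" where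
  "Lam_bd X k = {u. \<forall>i\<le>DIM('a). u \<in> smooth_forms (facet_tangent X i) (facet X i) k}"

definition tr_bd ::
  "(nat \<Rightarrow> 'a::euclidean_space) \<Rightarrow> ('a \<Rightarrow> 'a list \<Rightarrow> real) \<Rightarrow> 'a \<Rightarrow> 'a list \<Rightarrow> real" where
  "tr_bd X u y vs =
     (if \<exists>i\<le>DIM('a). y \<in> facet X i \<and> set vs \<subseteq> facet_tangent X i then u y vs else 0)"

section \<open>Polynomial forms\<close>

definition poly_fun_on :: "'a::euclidean_space set \<Rightarrow> nat \<Rightarrow> ('a \<Rightarrow> real) \<Rightarrow> bool" where
  "poly_fun_on M r f \<longleftrightarrow> (\<exists>c :: ('a \<Rightarrow> nat) \<Rightarrow> real. \<forall>y\<in>M.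
     f y = (\<Sum>\<alpha> | \<alpha> \<in> Basis \<rightarrow>\<^sub>E UNIV \<and> (\<Sum>b\<in>Basis. \<alpha> b) \<le> r. c \<alpha> * (\<Prod>b\<in>Basis. (y \<bullet> b) ^ \<alpha> b)))"

definition PLam :: "(nat \<Rightarrow> 'a::euclidean_space) \<Rightarrow> nat \<Rightarrow> nat \<Rightarrow> ('a \<Rightarrow> 'a list \<Rightarrow> real) set" where
  "PLam X r k = {u \<in> Lam X k. \<forall>vs. length vs = k \<longrightarrow> poly_fun_on (the_simplex X) r (\<lambda>y. u y vs)}"

definition contract :: "'a::real_vector \<Rightarrow> ('a \<Rightarrow> 'a list \<Rightarrow> real) \<Rightarrow> 'a \<Rightarrow> 'a list \<Rightarrow> real" where
  "contract a u y vs = u y ((y - a) # vs)"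

definition PLam_minus :: "(nat \<Rightarrow> 'a::euclidean_space) \<Rightarrow> nat \<Rightarrow> nat \<Rightarrow> ('a \<Rightarrow> 'a list \<Rightarrow> real) set" where
  "PLam_minus X r k = {u \<in> PLam X r k. k > 0 \<longrightarrow> (\<forall>a. contract a u \<in> PLam X r (k - 1))}"

definition PLam_bd :: "(nat \<Rightarrow> 'a::euclidean_space) \<Rightarrow> nat \<Rightarrow> nat \<Rightarrow> ('a \<Rightarrow> 'a list \<Rightarrow> real) set" where
  "PLam_bd X r k = tr_bd X ` PLam X r k"

definition PLam_minus_bd :: "(nat \<Rightarrow> 'a::euclidean_space) \<Rightarrow> nat \<Rightarrow> nat \<Rightarrow> ('a \<Rightarrow> 'a list \<Rightarrow> real) set" where
  "PLam_minus_bd X r k = tr_bd X ` PLam_minus X r k"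

section \<open>Wedge products and Whitney forms\<close>

text \<open>
  The normalisation is the one for which \<open>(\<alpha> \<and> \<beta>)(v, w) = \<alpha> v \<beta> w - \<alpha> w \<beta> v\<close> for 1-forms; for
  alternating \<open>\<alpha>\<close>, \<open>\<beta>\<close> this is the signed sum over all \<open>(p, q)\<close>-shuffles.
\<close>

definition wedge :: "nat \<Rightarrow> nat \<Rightarrow> ('a list \<Rightarrow> real) \<Rightarrow> ('a list \<Rightarrow> real) \<Rightarrow> 'a list \<Rightarrow> real" where
  "wedge p q \<alpha> \<beta> vs =
     (\<Sum>\<sigma> | \<sigma> permutes {..<p + q}. of_int (sign \<sigma>) *
        \<alpha> (map (\<lambda>i. vs ! \<sigma> i) [0..<p]) * \<beta> (map (\<lambda>i. vs ! \<sigma> i) [p..<p + q])) / (fact p * fact q)"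

primrec wedge_list :: "('a \<Rightarrow> real) list \<Rightarrow> 'a list \<Rightarrow> real" where
  "wedge_list [] = (\<lambda>vs. 1)"
| "wedge_list (\<alpha> # \<alpha>s) = wedge 1 (length \<alpha>s) (\<lambda>vs. \<alpha> (hd vs)) (wedge_list \<alpha>s)"

definition remove_nth :: "nat \<Rightarrow> 'b list \<Rightarrow> 'b list" where
  "remove_nth i J = take i J @ drop (Suc i) J"

definition whitney :: "(nat \<Rightarrow> 'a::euclidean_space) \<Rightarrow> nat list \<Rightarrow> 'a \<Rightarrow> 'a list \<Rightarrow> real" where
  "whitney X J y vs = (\<Sum>i<length J. (-1) ^ i * bary X (J ! i) y *
     wedge_list (map (\<lambda>j. dbary X j y) (remove_nth i J)) vs)"

section \<open>Integration over oriented subsimplices\<close>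

text \<open>\<open>Gam m K\<close> is the set of increasing index sets with \<open>m + 1\<close> elements, all in \<open>K\<close>.\<close>

definition Gam :: "nat \<Rightarrow> nat set \<Rightarrow> nat list set" where
  "Gam m K = {J. sorted_wrt (<) J \<and> length J = m + 1 \<and> set J \<subseteq> K}"

definition leibniz_det :: "nat \<Rightarrow> (nat \<Rightarrow> nat \<Rightarrow> real) \<Rightarrow> real" where
  "leibniz_det s M = (\<Sum>\<sigma> | \<sigma> permutes {..<s}. of_int (sign \<sigma>) * (\<Prod>i<s. M i (\<sigma> i)))"

definition edge :: "(nat \<Rightarrow> 'a::euclidean_space) \<Rightarrow> nat list \<Rightarrow> nat \<Rightarrow> 'a" where
  "edge X J i = X (J ! Suc i) - X (J ! 0)"

definition std_simplex :: "nat \<Rightarrow> (nat \<Rightarrow> real) set" where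
  "std_simplex s = {\<tau> \<in> {..<s} \<rightarrow>\<^sub>E UNIV. (\<forall>i<s. 0 \<le> \<tau> i) \<and> (\<Sum>i<s. \<tau> i) \<le> 1}"

text \<open>
  The integral of \<open>g\<close> over the simplex spanned by \<open>X j\<close>, \<open>j \<in> set J\<close>, with respect to its
  \<open>s\<close>-dimensional surface measure: the affine parametrisation over the standard simplex, weighted with
  the square root of the Gram determinant.
\<close>

definition simplex_integral ::
  "(nat \<Rightarrow> 'a::euclidean_space) \<Rightarrow> nat list \<Rightarrow> ('a \<Rightarrow> real) \<Rightarrow> real" where
  "simplex_integral X J g = (let s = length J - 1 in
     sqrt (leibniz_det s (\<lambda>i l. edge X J i \<bullet> edge X J l)) *
     (LINT \<tau>:std_simplex s|PiM {..<s} (\<lambda>_. lborel). g (X (J ! 0) + (\<Sum>i<s. \<tau> i *\<^sub>R edge X J i))))"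

definition oriented_onb :: "(nat \<Rightarrow> 'a::euclidean_space) \<Rightarrow> nat list \<Rightarrow> 'a list" where
  "oriented_onb X J = (SOME ts.
     length ts = length J - 1 \<and> set ts \<subseteq> tangent X (set J) \<and>
     (\<forall>i<length ts. \<forall>l<length ts. ts ! i \<bullet> ts ! l = (if i = l then 1 else 0)) \<and>
     leibniz_det (length ts) (\<lambda>i l. ts ! i \<bullet> edge X J l) > 0)"

section \<open>The operators\<close>

definition Fmap :: "(nat \<Rightarrow> 'a::euclidean_space) \<Rightarrow> nat list \<Rightarrow> 'a \<Rightarrow> 'a \<Rightarrow> 'a" where
  "Fmap X I x y = x + (\<Sum>i\<in>set I. bary X i x *\<^sub>R (y - X i))"

definition pullback ::
  "('a::real_normed_vector \<Rightarrow> 'a) \<Rightarrow> ('a \<Rightarrow> 'a list \<Rightarrow> real) \<Rightarrow> 'a \<Rightarrow> 'a list \<Rightarrow> real" where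
  "pullback f u x vs = u (f x) (map (frechet_derivative f (at x)) vs)"

definition Pmap :: "(nat \<Rightarrow> 'a::euclidean_space) \<Rightarrow> nat list \<Rightarrow> nat \<Rightarrow> 'a \<Rightarrow> 'a" where
  "Pmap X I j x = Fmap X I x (X j)"

text \<open>
  If some \<open>i \<in> set I\<close> does not occur in \<open>J\<close>, then for \<open>x\<close> in the simplex \<open>u\<close> is evaluated in \<open>R_op\<close> only
  at points of \<open>facet X i\<close> and on vectors tangent to it, so that \<open>u\<close> may be a form on the boundary.
\<close>

definition R_op :: "(nat \<Rightarrow> 'a::euclidean_space) \<Rightarrow> nat \<Rightarrow> nat list \<Rightarrow> nat list \<Rightarrow>
    ('a \<Rightarrow> 'a list \<Rightarrow> real) \<Rightarrow> 'a \<Rightarrow> 'a list \<Rightarrow> real" where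
  "R_op X k I J u x vs = (let s = length J - 1 in
     if s = 0 then pullback (Pmap X I (J ! 0)) u x vs
     else if s > k then 0
     else bary_sum X I x ^ s *
       simplex_integral X J (\<lambda>y. u (Fmap X I x y)
         (map (frechet_derivative (\<lambda>x'. Fmap X I x' y) (at x)) vs @ oriented_onb X J)))"

definition A_coeff :: "nat \<Rightarrow> nat \<Rightarrow> nat \<Rightarrow> real" where
  "A_coeff n k s = (-1) ^ (1 + k * s) * (fact s)\<^sup>2 / (\<Prod>i=1..s. real n - real i)"

definition A_op :: "(nat \<Rightarrow> 'a::euclidean_space) \<Rightarrow> nat \<Rightarrow> nat list \<Rightarrow> nat list \<Rightarrow>
    ('a \<Rightarrow> 'a list \<Rightarrow> real) \<Rightarrow> 'a \<Rightarrow> 'a list \<Rightarrow> real" where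
  "A_op X k I J u x vs = (let s = length J - 1 in
     if s = 0 then pullback (Pmap X I (J ! 0)) u x vs
     else A_coeff DIM('a) k s *
       (\<Sum>p\<in>{..DIM('a)} - set J. \<Sum>i=0..s. (-1) ^ i * R_op X k I (p # remove_nth i J) u x vs))"

definition E_op :: "(nat \<Rightarrow> 'a::euclidean_space) \<Rightarrow> nat \<Rightarrow>
    ('a \<Rightarrow> 'a list \<Rightarrow> real) \<Rightarrow> 'a \<Rightarrow> 'a list \<Rightarrow> real" where
  "E_op X k u x vs = 1 / real DIM('a) *
     (\<Sum>m=1..DIM('a). \<Sum>I\<in>Gam m {..DIM('a)}. (-1) ^ (m + 1) *
       (\<Sum>s=0..k. \<Sum>J\<in>Gam s (set I).
          wedge s (k - s) (\<lambda>ws. whitney X J x ws / bary_sum X I x ^ (s + 1)) (A_op X k I J u x) vs))"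

text \<open>The points of the simplex at which no denominator in \<open>E_op\<close> vanishes.\<close>

definition E_domain :: "(nat \<Rightarrow> 'a::euclidean_space) \<Rightarrow> 'a set" where
  "E_domain X = {x \<in> the_simplex X. \<forall>m\<in>{1..DIM('a)}. \<forall>I\<in>Gam m {..DIM('a)}. bary_sum X I x \<noteq> 0}"

definition E_maps_into :: "(nat \<Rightarrow> 'a::euclidean_space) \<Rightarrow> nat \<Rightarrow>
    ('a \<Rightarrow> 'a list \<Rightarrow> real) set \<Rightarrow> ('a \<Rightarrow> 'a list \<Rightarrow> real) set \<Rightarrow> bool" where
  "E_maps_into X k V W \<longleftrightarrow>
     (\<forall>u\<in>V. \<exists>w\<in>W. \<forall>x\<in>E_domain X. \<forall>vs. length vs = k \<longrightarrow> E_op X k u x vs = w x vs)"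

end

theory Submission
  imports Defs "HOL-Combinatorics.Multiset_Permutations"
begin

text \<open>
  The operator is a signed sum over the index sets \<open>I\<close> with at least two elements.  Different \<open>I\<close> do
  not interact: every summand \<open>I_term k u I\<close> extends by itself to a form in the required space.

  Let \<open>z\<close> be an index outside \<open>I\<close>, write \<open>\<Lambda>\<close> for \<open>\<lambda>\<^sub>I\<close> and \<open>Q x\<close> for \<open>F\<^sub>I(x, x\<^sub>z)\<close>.  Then
  \<open>F\<^sub>I(x, y) = Q x + \<Lambda>(x) (y - x\<^sub>z)\<close>, and \<open>Q\<close> maps the simplex into every facet opposite to a vertex
  \<open>x\<^sub>i\<close>, \<open>i \<in> I\<close>.  In the integral defining \<open>R\<close> the orthonormal frame can be replaced by the edges of
  the simplex of integration, and these absorb the dependence of \<open>D\<^sub>x F\<^sub>I\<close> on \<open>y\<close>, so that \<open>u\<close> is evaluated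
  on vectors that depend neither on \<open>x\<close> nor on \<open>y\<close> (\<open>R_op_eq\<close>).  A first order Taylor expansion at \<open>Q x\<close>
  therefore splits \<open>R\<close> into \<open>\<Lambda>\<^sup>s\<close> times a leading term, which is the value of \<open>u\<close> at \<open>Q x\<close> divided by \<open>s!\<close>, and
  \<open>\<Lambda>\<^sup>s\<^sup>+\<^sup>1\<close> times a smooth remainder (\<open>hadamard_integral\<close>, \<open>R_op_decomposition\<close>).  Since the denominators
  are \<open>\<Lambda>\<^sup>s\<^sup>+\<^sup>1\<close>, only the leading terms are singular, like \<open>1 / \<Lambda>\<close>.

  The sum of the leading terms is divisible by \<open>\<Lambda>\<close>, by multilinear algebra at the point \<open>Q x\<close>
  (\<open>sum_leading\<close>).  Because the traces of \<open>u\<close> are single-valued, its values on the tangent spaces of the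
  facets through \<open>Q x\<close> are those of one alternating form \<open>\<omega>\<close> on the whole space (\<open>ext_form_eq\<close>).  The
  identity \<open>\<Sum>\<^sub>j \<phi>\<^sub>j\<^sub>K = \<Lambda> d\<lambda>\<^sub>K - d\<Lambda> \<and> \<phi>\<^sub>K\<close>, where \<open>j\<close> ranges over \<open>I\<close>, leaves multiples of \<open>\<Lambda>\<close> and terms
  \<open>d\<Lambda> \<and> \<phi>\<^sub>K \<and> \<omega>(\<dots>, e\<^sub>K)\<close>, where \<open>e\<^sub>K\<close> consists of the vectors \<open>x\<^sub>j - x\<^sub>z\<close>, \<open>j \<in> K\<close>.  Call the terms with
  \<open>J \<in> \<Gamma>\<^sub>s\<close> those of level \<open>s\<close>.  Then the defects with \<open>s + 1\<close> indices in \<open>K\<close> arise once from level \<open>s + 1\<close>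
  and once from level \<open>s\<close>, and the recursion between the coefficients \<open>c\<^sub>s\<close> is what makes them cancel.

  If \<open>I\<close> contains all indices, then \<open>F\<^sub>I(x, y) = y\<close> and \<open>\<Lambda> = 1\<close>, so there is no singularity, and the
  summand is a combination of Whitney forms with constant coefficients.

  This yields a smooth function for every list of vectors.  The extension is again alternating because
  it is so in the interior of the simplex, where \<open>\<Lambda>\<close> is positive (\<open>Lam_extension\<close>).

  For the polynomial spaces, a smooth function on the simplex is a polynomial of degree at most \<open>r\<close> if it
  is one along all segments from a fixed vertex to interior points: its Taylor coefficients at the vertex
  are homogeneous polynomials in the direction (\<open>poly_fun_on_rays\<close>).  On the ray from \<open>x\<^sub>z\<close> through \<open>x\<close>,
  both \<open>\<phi>\<^sub>J\<close> and \<open>\<Lambda>\<close> are homogeneous of degree one, and \<open>F\<^sub>I(_, y)\<close> maps this ray affinely to the one through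
  \<open>F\<^sub>I(x, y)\<close>.  Hence the quotients \<open>\<phi>\<^sub>J / \<Lambda>\<close> are constant there and the degree is that of \<open>u\<close> on a line
  (\<open>I_term_ray\<close>).  For the trimmed spaces the contraction with \<open>x - a\<close> is the sum of those with \<open>x - x\<^sub>z\<close>
  and the constant \<open>x\<^sub>z - a\<close>.  The Whitney forms involved vanish on \<open>x - x\<^sub>z\<close> (\<open>whitney_radial\<close>), so that
  this vector ends up as an argument of \<open>u\<close>; there \<open>D\<^sub>x F\<^sub>I\<close> turns it into \<open>F\<^sub>I(x, y) - x\<^sub>z\<close>, and the degree
  condition on the contraction of \<open>u\<close> applies (\<open>I_term_ray_radial\<close>).
\<close>

section \<open>Multilinear functions on lists and antisymmetrisation\<close>

definition multilin :: "nat \<Rightarrow> ('a::real_vector list \<Rightarrow> real) \<Rightarrow> bool" where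
  "multilin k f \<longleftrightarrow> (\<forall>vs. length vs = k \<longrightarrow> (\<forall>i<k.
     (\<forall>a b. f (vs[i := a + b]) = f (vs[i := a]) + f (vs[i := b])) \<and>
     (\<forall>a c. f (vs[i := c *\<^sub>R a]) = c * f (vs[i := a]))))"

lemma alternating_on_UNIV_iff:
  "alternating_on UNIV k w \<longleftrightarrow> multilin k w \<and>
     (\<forall>vs. length vs = k \<longrightarrow> (\<forall>i<k. \<forall>j<k. i \<noteq> j \<and> vs ! i = vs ! j \<longrightarrow> w vs = 0))"
  by (auto simp: alternating_on_def multilin_def)

lemma multilin_add:
  assumes "multilin k f" "length vs = k" "i < k"
  shows "f (vs[i := a + b]) = f (vs[i := a]) + f (vs[i := b])"
  using assms by (auto simp: multilin_def)

lemma multilin_scale: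
  assumes "multilin k f" "length vs = k" "i < k"
  shows "f (vs[i := c *\<^sub>R a]) = c * f (vs[i := a])"
  using assms by (auto simp: multilin_def)

lemma multilin_zero:
  assumes "multilin k f" "length vs = k" "i < k" "vs ! i = 0"
  shows "f vs = 0"
  using multilin_scale[OF assms(1-3), of 0 0] assms(4) by (metis list_update_id mult_zero_left scaleR_zero_left)

lemma permute_list_transpose:
  assumes "i < length vs" "j < length vs"
  shows "permute_list (Transposition.transpose i j) vs = vs[i := vs ! j, j := vs ! i]"
  using assms by (intro nth_equalityI) (auto simp: permute_list_def transpose_def nth_list_update)

lemma alternating_swap:
  assumes alt: "alternating_on UNIV k w" and len: "length vs = k" and ij: "i < k" "j < k" "i \<noteq> j"
  shows "w (permute_list (Transposition.transpose i j) vs) = - w vs"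
proof -
  define g where "g a b = w (vs[i := a, j := b])" for a b
  have ml: "multilin k w" and z: "\<And>us. length us = k \<Longrightarrow> us ! i = us ! j \<Longrightarrow> w us = 0"
    using alt ij by (auto simp: alternating_on_UNIV_iff)
  have add2: "g a (b + c) = g a b + g a c" for a b c
    unfolding g_def using multilin_add[OF ml, of "vs[i := a]" j b c] len ij by simp
  have add1: "g (b + c) a = g b a + g c a" for a b c
    unfolding g_def using multilin_add[OF ml, of "vs[j := a]" i b c] len ij
    by (simp add: list_update_swap)
  have diag: "g a a = 0" for a
    unfolding g_def using z[of "vs[i := a, j := a]"] len ij by simp
  have "g (vs!i) (vs!j) + g (vs!j) (vs!i) = 0"
    using diag[of "vs!i + vs!j"] diag[of "vs!i"] diag[of "vs!j"] by (simp add: add1 add2)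
  moreover have "g (vs!i) (vs!j) = w vs" by (simp add: g_def)
  moreover have "g (vs!j) (vs!i) = w (permute_list (Transposition.transpose i j) vs)"
    using len ij by (simp add: g_def permute_list_transpose)
  ultimately show ?thesis by linarith
qed

lemma permute_list_sign:
  assumes "finite S" "\<sigma> permutes S" "S \<subseteq> {..<k}"
    and swap: "\<And>vs i j. length vs = k \<Longrightarrow> i \<in> S \<Longrightarrow> j \<in> S \<Longrightarrow> i \<noteq> j \<Longrightarrow>
           (f (permute_list (Transposition.transpose i j) vs) :: real) = - f vs"
    and len: "length vs = k"
  shows "f (permute_list \<sigma> vs) = of_int (sign \<sigma>) * f vs"
  using assms(1,2)
proof (induction rule: permutes_rev_induct)
  case id
  then show ?case by (simp add: sign_id)
next
  case (swap i j p)
  have tp: "Transposition.transpose i j permutes {..<k}"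
    using swap assms(3) by (auto intro!: permutes_swap_id)
  have "f (permute_list (p \<circ> Transposition.transpose i j) vs) =
        f (permute_list (Transposition.transpose i j) (permute_list p vs))"
    using tp len by (simp add: permute_list_compose)
  also have "\<dots> = - f (permute_list p vs)"
    using swap len by (intro assms(4)) auto
  also have "\<dots> = - (of_int (sign p) * f vs)" using swap by simp
  also have "\<dots> = of_int (- sign p) * f vs" by simp
  also have "- sign p = sign (p \<circ> Transposition.transpose i j)"
    using swap assms(1) permutes_imp_permutation[of S p]
    by (simp add: sign_compose sign_swap_id permutation_swap_id)
  finally show ?case .
qed

lemma alternating_permute:
  assumes "alternating_on UNIV k w" "\<sigma> permutes {..<k}" "length vs = k"
  shows "w (permute_list \<sigma> vs) = of_int (sign \<sigma>) * w vs"
  by (rule permute_list_sign[of "{..<k}" \<sigma> k w vs]) (use assms in \<open>auto intro: alternating_swap\<close>)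

text \<open>The entries have an arbitrary type because covectors are antisymmetrised as well as vectors.\<close>

definition Alt :: "nat \<Rightarrow> ('b list \<Rightarrow> real) \<Rightarrow> 'b list \<Rightarrow> real" where
  "Alt k f vs = (\<Sum>\<sigma> | \<sigma> permutes {..<k}. of_int (sign \<sigma>) * f (permute_list \<sigma> vs))"

lemma Alt_cong:
  assumes "length vs = k" "\<And>ws. length ws = k \<Longrightarrow> f ws = g ws"
  shows "Alt k f vs = Alt k g vs"
  unfolding Alt_def using assms by (intro sum.cong) auto

lemma Alt_sum: "Alt k (\<lambda>ws. \<Sum>x\<in>A. f x ws) vs = (\<Sum>x\<in>A. Alt k (f x) vs)"
  unfolding Alt_def sum_distrib_left by (rule sum.swap)

lemma Alt_mult: "Alt k (\<lambda>ws. c * f ws) vs = c * Alt k f vs"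
  by (simp add: Alt_def sum_distrib_left mult_ac)

lemma Alt_add: "Alt k (\<lambda>ws. f ws + g ws) vs = Alt k f vs + Alt k g vs"
  by (simp add: Alt_def sum.distrib algebra_simps)

text \<open>Substitution in the sum over the symmetric group: \<open>\<sigma>\<close> is replaced by \<open>\<sigma> \<circ> inv \<pi>\<close>.\<close>

lemma Alt_permute_inside:
  assumes "\<pi> permutes {..<k}" "length vs = k"
  shows "Alt k (\<lambda>ws. f (permute_list \<pi> ws)) vs = of_int (sign \<pi>) * Alt k f vs"
proof -
  have perm: "permutation \<pi>" using assms permutes_imp_permutation by blast
  have "Alt k f vs = (\<Sum>\<sigma> | \<sigma> permutes {..<k}. of_int (sign (\<sigma> \<circ> \<pi>)) * f (permute_list (\<sigma> \<circ> \<pi>) vs))"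
    unfolding Alt_def by (rule sum_permutations_compose_right[OF assms(1)])
  also have "\<dots> = (\<Sum>\<sigma> | \<sigma> permutes {..<k}. of_int (sign \<pi>) *
                    (of_int (sign \<sigma>) * f (permute_list \<pi> (permute_list \<sigma> vs))))"
    using assms perm
    by (intro sum.cong refl)
       (auto simp: permute_list_compose sign_compose permutes_imp_permutation[OF finite_lessThan])
  also have "\<dots> = of_int (sign \<pi>) * Alt k (\<lambda>ws. f (permute_list \<pi> ws)) vs"
    by (simp add: Alt_def sum_distrib_left)
  finally have "of_int (sign \<pi>) * Alt k f vs =
      (of_int (sign \<pi>) * of_int (sign \<pi>)) * Alt k (\<lambda>ws. f (permute_list \<pi> ws)) vs"
    by (simp add: mult.assoc)
  also have "of_int (sign \<pi>) * of_int (sign \<pi>) = (1::real)"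
    by (metis of_int_1 of_int_mult sign_idempotent)
  finally show ?thesis by simp
qed

lemma Alt_permute_outside:
  assumes "\<pi> permutes {..<k}" "length vs = k"
  shows "Alt k f (permute_list \<pi> vs) = of_int (sign \<pi>) * Alt k f vs"
proof -
  have perm: "permutation \<pi>" using assms permutes_imp_permutation by blast
  have "Alt k f vs = (\<Sum>\<sigma> | \<sigma> permutes {..<k}. of_int (sign (\<pi> \<circ> \<sigma>)) * f (permute_list (\<pi> \<circ> \<sigma>) vs))"
    unfolding Alt_def by (rule setum_permutations_compose_left[OF assms(1)])
  also have "\<dots> = (\<Sum>\<sigma> | \<sigma> permutes {..<k}. of_int (sign \<pi>) *
                    (of_int (sign \<sigma>) * f (permute_list \<sigma> (permute_list \<pi> vs))))"
    using assms perm
    by (intro sum.cong refl)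
       (auto simp: permute_list_compose sign_compose permutes_imp_permutation[OF finite_lessThan])
  also have "\<dots> = of_int (sign \<pi>) * Alt k f (permute_list \<pi> vs)"
    by (simp add: Alt_def sum_distrib_left)
  finally have "of_int (sign \<pi>) * Alt k f vs =
      (of_int (sign \<pi>) * of_int (sign \<pi>)) * Alt k f (permute_list \<pi> vs)"
    by (simp add: mult.assoc)
  also have "of_int (sign \<pi>) * of_int (sign \<pi>) = (1::real)"
    by (metis of_int_1 of_int_mult sign_idempotent)
  finally show ?thesis by simp
qed

lemma permute_list_update:
  assumes "\<sigma> permutes {..<length vs}" "i < length vs"
  shows "permute_list \<sigma> (vs[i := a]) = (permute_list \<sigma> vs)[inv \<sigma> i := a]"
proof (rule nth_equalityI)
  fix j assume j: "j < length (permute_list \<sigma> (vs[i := a]))"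
  have b: "\<sigma> j < length vs" using assms j permutes_in_image[OF assms(1), of j] by simp
  have "inv \<sigma> i = j \<longleftrightarrow> i = \<sigma> j" using assms(1) by (metis permutes_inverses)
  then show "permute_list \<sigma> (vs[i := a]) ! j = (permute_list \<sigma> vs)[inv \<sigma> i := a] ! j"
    using assms j b by (auto simp: permute_list_nth nth_list_update)
qed simp

lemma multilin_permute:
  assumes "multilin k f" "\<sigma> permutes {..<k}"
  shows "multilin k (\<lambda>vs. f (permute_list \<sigma> vs))"
  unfolding multilin_def
proof (intro allI impI conjI)
  fix vs :: "'a list" and i assume len: "length vs = k" and i: "i < k"
  have ii: "inv \<sigma> i < k" using assms(2) i by (metis lessThan_iff permutes_in_image permutes_inv)
  have u: "permute_list \<sigma> (vs[i := a]) = (permute_list \<sigma> vs)[inv \<sigma> i := a]" for a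
    using assms(2) i len by (simp add: permute_list_update)
  show "f (permute_list \<sigma> (vs[i := a + b])) = f (permute_list \<sigma> (vs[i := a])) + f (permute_list \<sigma> (vs[i := b]))" for a b
    unfolding u using multilin_add[OF assms(1) _ ii] len by simp
  show "f (permute_list \<sigma> (vs[i := c *\<^sub>R a])) = c * f (permute_list \<sigma> (vs[i := a]))" for a c
    unfolding u using multilin_scale[OF assms(1) _ ii] len by simp
qed

lemma multilin_sum:
  assumes "\<And>x. x \<in> A \<Longrightarrow> multilin k (f x)"
  shows "multilin k (\<lambda>vs. \<Sum>x\<in>A. f x vs)"
  using assms by (auto simp: multilin_def sum.distrib[symmetric] sum_distrib_left intro!: sum.cong)

lemma multilin_mult:
  assumes "multilin k f"
  shows "multilin k (\<lambda>vs. c * f vs)"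
  using assms by (auto simp: multilin_def algebra_simps)

lemma alternating_Alt:
  assumes "multilin k f"
  shows "alternating_on UNIV k (Alt k f)"
  unfolding alternating_on_UNIV_iff
proof (intro conjI allI impI)
  show "multilin k (Alt k f)"
    unfolding Alt_def by (intro multilin_sum multilin_mult multilin_permute assms) auto
  fix vs :: "'a list" and i j
  assume *: "length vs = k" "i < k" "j < k" "i \<noteq> j \<and> vs ! i = vs ! j"
  then have "permute_list (Transposition.transpose i j) vs = vs"
    by (metis list_update_id permute_list_transpose)
  moreover have "Transposition.transpose i j permutes {..<k}" using * by (intro permutes_swap_id) auto
  ultimately have "Alt k f vs = - Alt k f vs"
    using Alt_permute_outside[of "Transposition.transpose i j" k vs f] * by (simp add: sign_swap_id)
  then show "Alt k f vs = 0" by simp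
qed

lemma multilin_tensor:
  assumes f: "multilin p f" and g: "multilin q g"
  shows "multilin (p + q) (\<lambda>vs. f (take p vs) * g (drop p vs))"
  unfolding multilin_def
proof (intro allI impI conjI)
  fix vs :: "'a list" and i assume len: "length vs = p + q" and i: "i < p + q"
  show "f (take p (vs[i := a + b])) * g (drop p (vs[i := a + b])) =
      f (take p (vs[i := a])) * g (drop p (vs[i := a])) + f (take p (vs[i := b])) * g (drop p (vs[i := b]))" for a b
    using multilin_add[OF f, of "take p vs" i a b] multilin_add[OF g, of "drop p vs" "i - p" a b] len i
    by (cases "i < p") (auto simp: take_update_swap drop_update_swap list_update_beyond algebra_simps)
  show "f (take p (vs[i := c *\<^sub>R a])) * g (drop p (vs[i := c *\<^sub>R a])) =
      c * (f (take p (vs[i := a])) * g (drop p (vs[i := a])))" for a c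
    using multilin_scale[OF f, of "take p vs" i c a] multilin_scale[OF g, of "drop p vs" "i - p" c a] len i
    by (cases "i < p") (auto simp: take_update_swap drop_update_swap list_update_beyond algebra_simps)
qed

lemma permute_list_take:
  assumes "\<pi> permutes {..<p}" "p \<le> length ws"
  shows "take p (permute_list \<pi> ws) = permute_list \<pi> (take p ws)"
    and "drop p (permute_list \<pi> ws) = drop p ws"
proof -
  have "\<pi> i < p" if "i < p" for i using assms(1) that permutes_in_image[of \<pi> "{..<p}" i] by simp
  then show "take p (permute_list \<pi> ws) = permute_list \<pi> (take p ws)"
    using assms by (intro nth_equalityI) (auto simp: permute_list_def)
  show "drop p (permute_list \<pi> ws) = drop p ws"
    using assms permutes_not_in[OF assms(1)] by (intro nth_equalityI) (auto simp: permute_list_def)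
qed

text \<open>
  A permutation of the first \<open>p\<close> places is absorbed by the outer antisymmetrisation, so all \<open>p!\<close> terms
  of the inner one contribute equally.
\<close>

lemma Alt_take:
  assumes len: "length vs = p + q"
  shows "Alt (p + q) (\<lambda>ws. Alt p g (take p ws) * h (drop p ws)) vs =
    fact p * Alt (p + q) (\<lambda>ws. g (take p ws) * h (drop p ws)) vs"
proof -
  let ?F = "\<lambda>ws. g (take p ws) * h (drop p ws)"
  have "Alt (p + q) (\<lambda>ws. Alt p g (take p ws) * h (drop p ws)) vs =
     Alt (p + q) (\<lambda>ws. \<Sum>\<pi> | \<pi> permutes {..<p}. of_int (sign \<pi>) * ?F (permute_list \<pi> ws)) vs"
    using len by (intro Alt_cong) (auto simp: Alt_def sum_distrib_right permute_list_take intro!: sum.cong)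
  also have "\<dots> = (\<Sum>\<pi> | \<pi> permutes {..<p}. of_int (sign \<pi>) *
                     Alt (p + q) (\<lambda>ws. ?F (permute_list \<pi> ws)) vs)"
    unfolding Alt_sum Alt_mult ..
  also have "\<dots> = (\<Sum>\<pi> | \<pi> permutes {..<p}. Alt (p + q) ?F vs)"
  proof (intro sum.cong refl)
    fix \<pi> assume "\<pi> \<in> {\<pi>. \<pi> permutes {..<p}}"
    then have "\<pi> permutes {..<p + q}" by (auto intro: permutes_subset)
    then have "Alt (p + q) (\<lambda>ws. ?F (permute_list \<pi> ws)) vs = of_int (sign \<pi>) * Alt (p + q) ?F vs"
      using len by (intro Alt_permute_inside)
    then show "of_int (sign \<pi>) * Alt (p + q) (\<lambda>ws. ?F (permute_list \<pi> ws)) vs = Alt (p + q) ?F vs"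
      by (simp add: mult.assoc[symmetric] of_int_mult[symmetric] del: of_int_mult)
  qed
  also have "\<dots> = fact p * Alt (p + q) ?F vs" by (simp add: card_permutations)
  finally show ?thesis .
qed

lemma permute_list_drop:
  assumes \<pi>: "\<pi> permutes {..<q}" and len: "length ws = p + q"
  defines "\<rho> \<equiv> map_permutation {..<q} ((+) p) \<pi>"
  shows "\<rho> permutes {..<p + q}" "sign \<rho> = sign \<pi>"
    "take p (permute_list \<rho> ws) = take p ws" "drop p (permute_list \<rho> ws) = permute_list \<pi> (drop p ws)"
proof -
  have "\<rho> permutes (+) p ` {..<q}"
    unfolding \<rho>_def using \<pi> by (intro map_permutation_permutes) (auto simp: bij_betw_def)
  moreover have im: "(+) p ` {..<q} = {p..<p + q}" by (simp add: lessThan_atLeast0 image_add_atLeastLessThan add.commute)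
  ultimately have \<rho>: "\<rho> permutes {p..<p + q}" by simp
  then show "\<rho> permutes {..<p + q}" by (rule permutes_subset) auto
  show "sign \<rho> = sign \<pi>" unfolding \<rho>_def using \<pi> by (intro sign_map_permutation) auto
  have lt: "\<rho> i = i" if "i < p" for i using permutes_not_in[OF \<rho>, of i] that by simp
  have ge: "\<rho> (p + i) = p + \<pi> i" if "i < q" for i
    unfolding \<rho>_def using that \<pi> by (intro map_permutation_apply) auto
  have pq: "\<pi> i < q" if "i < q" for i using \<pi> that permutes_in_image[of \<pi> "{..<q}" i] by simp
  show "take p (permute_list \<rho> ws) = take p ws"
    using len by (intro nth_equalityI) (auto simp: permute_list_def lt)
  show "drop p (permute_list \<rho> ws) = permute_list \<pi> (drop p ws)"
    using len by (intro nth_equalityI) (auto simp: permute_list_def ge pq)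
qed

lemma Alt_drop:
  assumes len: "length vs = p + q"
  shows "Alt (p + q) (\<lambda>ws. h (take p ws) * Alt q g (drop p ws)) vs =
    fact q * Alt (p + q) (\<lambda>ws. h (take p ws) * g (drop p ws)) vs"
proof -
  let ?F = "\<lambda>ws. h (take p ws) * g (drop p ws)" and ?\<rho> = "map_permutation {..<q} ((+) p)"
  have "Alt (p + q) (\<lambda>ws. h (take p ws) * Alt q g (drop p ws)) vs =
     Alt (p + q) (\<lambda>ws. \<Sum>\<pi> | \<pi> permutes {..<q}. of_int (sign \<pi>) * ?F (permute_list (?\<rho> \<pi>) ws)) vs"
    using len by (intro Alt_cong) (auto simp: Alt_def sum_distrib_left permute_list_drop mult_ac intro!: sum.cong)
  also have "\<dots> = (\<Sum>\<pi> | \<pi> permutes {..<q}. of_int (sign \<pi>) *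
                     Alt (p + q) (\<lambda>ws. ?F (permute_list (?\<rho> \<pi>) ws)) vs)"
    unfolding Alt_sum Alt_mult ..
  also have "\<dots> = (\<Sum>\<pi> | \<pi> permutes {..<q}. Alt (p + q) ?F vs)"
  proof (intro sum.cong refl)
    fix \<pi> assume "\<pi> \<in> {\<pi>. \<pi> permutes {..<q}}"
    then have "?\<rho> \<pi> permutes {..<p + q}" "sign (?\<rho> \<pi>) = sign \<pi>" using permute_list_drop[of \<pi> q vs p] len by auto
    then have "Alt (p + q) (\<lambda>ws. ?F (permute_list (?\<rho> \<pi>) ws)) vs = of_int (sign \<pi>) * Alt (p + q) ?F vs"
      using len Alt_permute_inside[of "?\<rho> \<pi>" "p + q" vs ?F] by simp
    then show "of_int (sign \<pi>) * Alt (p + q) (\<lambda>ws. ?F (permute_list (?\<rho> \<pi>) ws)) vs = Alt (p + q) ?F vs"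
      by (simp add: mult.assoc[symmetric] of_int_mult[symmetric] del: of_int_mult)
  qed
  also have "\<dots> = fact q * Alt (p + q) ?F vs" by (simp add: card_permutations)
  finally show ?thesis .
qed

section \<open>Wedge products as antisymmetrisations\<close>

lemma wedge_eq_Alt:
  assumes "length vs = p + q"
  shows "wedge p q \<alpha> \<beta> vs = Alt (p + q) (\<lambda>ws. \<alpha> (take p ws) * \<beta> (drop p ws)) vs / (fact p * fact q)"
proof -
  have "map (\<lambda>i. vs ! \<sigma> i) [0..<p] = take p (permute_list \<sigma> vs)"
       "map (\<lambda>i. vs ! \<sigma> i) [p..<p + q] = drop p (permute_list \<sigma> vs)" for \<sigma>
    using assms by (auto simp: permute_list_def take_map drop_map)
  then show ?thesis by (simp add: wedge_def Alt_def mult_ac)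
qed

text \<open>
  Iterated wedge products collapse to a single antisymmetrisation, by repeated use of \<open>Alt_drop\<close>; the
  normalising factorials cancel.
\<close>

lemma wedge_list_eq_Alt:
  assumes "length vs = length as"
  shows "wedge_list as vs = Alt (length as) (\<lambda>ws. \<Prod>a<length as. (as ! a) (ws ! a)) vs"
  using assms
proof (induction as arbitrary: vs)
  case Nil
  then show ?case by (simp add: Alt_def sign_id)
next
  case (Cons \<alpha> as)
  let ?m = "length as" and ?g = "\<lambda>ws. \<Prod>a<length as. (as ! a) (ws ! a)"
  have h: "hd ws = ws ! 0" if "length ws = 1 + ?m" for ws :: "'a list"
    using that by (cases ws) auto
  have Q: "Alt (1 + ?m) (\<lambda>ws. \<alpha> (hd (take 1 ws)) * ?g (drop 1 ws)) vs =
      Alt (1 + ?m) (\<lambda>ws. \<Prod>a<Suc ?m. ((\<alpha> # as) ! a) (ws ! a)) vs"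
    using Cons.prems
    by (intro Alt_cong) (simp_all add: prod.lessThan_Suc_shift h del: prod.lessThan_Suc)
  have "wedge_list (\<alpha> # as) vs =
     Alt (1 + ?m) (\<lambda>ws. \<alpha> (hd (take 1 ws)) * wedge_list as (drop 1 ws)) vs / fact ?m"
    using Cons.prems by (simp add: wedge_eq_Alt)
  also have "Alt (1 + ?m) (\<lambda>ws. \<alpha> (hd (take 1 ws)) * wedge_list as (drop 1 ws)) vs =
      Alt (1 + ?m) (\<lambda>ws. \<alpha> (hd (take 1 ws)) * Alt ?m ?g (drop 1 ws)) vs"
    using Cons.prems Cons.IH by (intro Alt_cong) auto
  also have "\<dots> = fact ?m * Alt (1 + ?m) (\<lambda>ws. \<alpha> (hd (take 1 ws)) * ?g (drop 1 ws)) vs"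
    by (rule Alt_drop) (use Cons.prems in simp)
  also note Q
  finally show ?case by simp
qed

lemma multilin_prod:
  assumes "length as = k" "\<And>\<alpha>. \<alpha> \<in> set as \<Longrightarrow> linear \<alpha>"
  shows "multilin k (\<lambda>ws. \<Prod>a<length as. (as ! a) (ws ! a))"
  unfolding multilin_def
proof (intro allI impI conjI)
  fix vs :: "'a list" and i assume len: "length vs = k" and i: "i < k"
  have lin: "linear (as ! i)" using assms i by auto
  have split: "(\<Prod>a<length as. (as ! a) (vs[i := z] ! a)) =
       (as ! i) z * (\<Prod>a\<in>{..<length as} - {i}. (as ! a) (vs ! a))" for z
    using assms(1) i len
    by (subst prod.remove[of _ i]) (auto intro!: prod.cong simp: nth_list_update)
  show "(\<Prod>a<length as. (as ! a) (vs[i := y + z] ! a)) =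
    (\<Prod>a<length as. (as ! a) (vs[i := y] ! a)) + (\<Prod>a<length as. (as ! a) (vs[i := z] ! a))" for y z
    unfolding split linear_add[OF lin] by (simp add: algebra_simps)
  show "(\<Prod>a<length as. (as ! a) (vs[i := c *\<^sub>R y] ! a)) =
    c * (\<Prod>a<length as. (as ! a) (vs[i := y] ! a))" for y c
    unfolding split linear_cmul[OF lin] by simp
qed

lemma multilin_cong:
  assumes "multilin k f" "\<And>vs. length vs = k \<Longrightarrow> f vs = g vs"
  shows "multilin k g"
  using assms(1) by (auto simp: multilin_def assms(2)[symmetric])

lemma alternating_cong:
  assumes "alternating_on UNIV k f" "\<And>vs. length vs = k \<Longrightarrow> f vs = g vs"
  shows "alternating_on UNIV k g"
  using assms(1) by (auto simp: alternating_on_def assms(2)[symmetric])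

lemma alternating_wedge_list:
  assumes "\<And>\<alpha>. \<alpha> \<in> set as \<Longrightarrow> linear \<alpha>"
  shows "alternating_on UNIV (length as) (wedge_list as)"
  by (rule alternating_cong[OF alternating_Alt[OF multilin_prod]]) (auto simp: wedge_list_eq_Alt assms)

lemma alternating_wedge:
  assumes "multilin p \<alpha>" "multilin q \<beta>"
  shows "alternating_on UNIV (p + q) (wedge p q \<alpha> \<beta>)"
proof (rule alternating_cong)
  show "alternating_on UNIV (p + q)
     (Alt (p + q) (\<lambda>ws. (1 / (fact p * fact q)) * (\<alpha> (take p ws) * \<beta> (drop p ws))))"
    by (intro alternating_Alt multilin_mult multilin_tensor assms)
qed (subst Alt_mult, simp add: wedge_eq_Alt)

text \<open>
  \<open>wedge_cov k [\<alpha>\<^sub>1, \<dots>, \<alpha>\<^sub>s] \<beta>\<close> is \<open>\<alpha>\<^sub>1 \<and> \<dots> \<and> \<alpha>\<^sub>s \<and> \<beta>\<close> for covectors \<open>\<alpha>\<^sub>i\<close> and a form \<open>\<beta>\<close> of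
  degree \<open>k - s\<close>.  A single antisymmetrisation instead of iterated ones makes associativity and the
  sign rules immediate.
\<close>

definition wedge_cov :: "nat \<Rightarrow> ('a \<Rightarrow> real) list \<Rightarrow> ('a list \<Rightarrow> real) \<Rightarrow> 'a list \<Rightarrow> real" where
  "wedge_cov k as \<beta> vs = Alt k (\<lambda>ws. (\<Prod>a<length as. (as ! a) (ws ! a)) * \<beta> (drop (length as) ws)) vs
     / fact (k - length as)"

lemma wedge_wedge_list:
  assumes "length vs = k" "length as \<le> k"
  shows "wedge (length as) (k - length as) (wedge_list as) \<beta> vs = wedge_cov k as \<beta> vs"
proof -
  let ?s = "length as" and ?g = "\<lambda>ws. \<Prod>a<length as. (as ! a) (ws ! a)"
  have k: "k = ?s + (k - ?s)" using assms by simp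
  have "wedge ?s (k - ?s) (wedge_list as) \<beta> vs =
     Alt (?s + (k - ?s)) (\<lambda>ws. wedge_list as (take ?s ws) * \<beta> (drop ?s ws)) vs / (fact ?s * fact (k - ?s))"
    using assms by (intro wedge_eq_Alt) simp
  also have "Alt (?s + (k - ?s)) (\<lambda>ws. wedge_list as (take ?s ws) * \<beta> (drop ?s ws)) vs =
      Alt (?s + (k - ?s)) (\<lambda>ws. Alt ?s ?g (take ?s ws) * \<beta> (drop ?s ws)) vs"
    using assms by (intro Alt_cong) (auto simp: wedge_list_eq_Alt)
  also have "\<dots> = fact ?s * Alt (?s + (k - ?s)) (\<lambda>ws. ?g (take ?s ws) * \<beta> (drop ?s ws)) vs"
    using assms by (intro Alt_take) simp
  also have "Alt (?s + (k - ?s)) (\<lambda>ws. ?g (take ?s ws) * \<beta> (drop ?s ws)) vs =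
     Alt k (\<lambda>ws. ?g ws * \<beta> (drop ?s ws)) vs"
    using assms by (subst k[symmetric], intro Alt_cong) auto
  finally show ?thesis by (simp add: wedge_cov_def)
qed

lemma wedge_cov_cong:
  assumes "length vs = k" "length as \<le> k" "\<And>ws. length ws = k - length as \<Longrightarrow> \<beta> ws = \<beta>' ws"
  shows "wedge_cov k as \<beta> vs = wedge_cov k as \<beta>' vs"
  unfolding wedge_cov_def
  by (rule arg_cong[where f = "\<lambda>t. t / _"], rule Alt_cong) (use assms in auto)

lemma wedge_cov_add: "wedge_cov k as (\<lambda>ws. \<beta> ws + \<beta>' ws) vs = wedge_cov k as \<beta> vs + wedge_cov k as \<beta>' vs"
  by (simp add: wedge_cov_def distrib_left Alt_add add_divide_distrib)

lemma wedge_cov_mult: "wedge_cov k as (\<lambda>ws. c * \<beta> ws) vs = c * wedge_cov k as \<beta> vs"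
  using Alt_mult[of k c "\<lambda>ws. (\<Prod>a<length as. (as ! a) (ws ! a)) * \<beta> (drop (length as) ws)" vs]
  by (simp add: wedge_cov_def mult_ac)

lemma wedge_cov_sum: "wedge_cov k as (\<lambda>ws. \<Sum>x\<in>A. \<beta> x ws) vs = (\<Sum>x\<in>A. wedge_cov k as (\<beta> x) vs)"
  by (simp add: wedge_cov_def sum_distrib_left Alt_sum sum_divide_distrib)

lemma wedge_cov_sum_head:
  "wedge_cov k ((\<lambda>v. \<Sum>x\<in>A. \<alpha> x v) # as) \<beta> vs = (\<Sum>x\<in>A. wedge_cov k (\<alpha> x # as) \<beta> vs)"
  by (simp add: wedge_cov_def prod.lessThan_Suc_shift sum_distrib_right sum_distrib_left Alt_sum
       sum_divide_distrib del: prod.lessThan_Suc)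

section \<open>Antisymmetric functions of a list\<close>

text \<open>
  Antisymmetry is stated for adjacent entries because the operations on index lists used below
  (prepending, splitting off the head) are easily tracked in this form.
\<close>

definition antisym_list :: "nat \<Rightarrow> ('b list \<Rightarrow> real) \<Rightarrow> bool" where
  "antisym_list m f \<longleftrightarrow> (\<forall>xs a b ys. length xs + length ys + 2 = m \<longrightarrow>
     f (xs @ a # b # ys) = - f (xs @ b # a # ys))"

lemma antisym_listD:
  "antisym_list m f \<Longrightarrow> length xs + length ys + 2 = m \<Longrightarrow> f (xs @ a # b # ys) = - f (xs @ b # a # ys)"
  unfolding antisym_list_def by blast

lemma antisym_list_move:
  assumes "antisym_list m f" "length zs + length xs + length ys + 1 = m"
  shows "f (zs @ a # xs @ ys) = (-1) ^ length xs * f (zs @ xs @ a # ys)"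
  using assms(2)
proof (induction xs arbitrary: zs)
  case (Cons x xs)
  have "f (zs @ a # x # (xs @ ys)) = - f (zs @ x # a # (xs @ ys))"
    using Cons.prems by (intro antisym_listD[OF assms(1)]) simp
  also have "f (zs @ x # a # (xs @ ys)) = (-1) ^ length xs * f ((zs @ [x]) @ xs @ a # ys)"
    using Cons.IH[of "zs @ [x]"] Cons.prems by simp
  finally show ?case by simp
qed simp

lemma antisym_list_swap:
  assumes "antisym_list m f" "length xs + length ys + length zs + 2 = m"
  shows "f (xs @ a # ys @ b # zs) = - f (xs @ b # ys @ a # zs)"
proof -
  have "f (xs @ a # (ys @ [b]) @ zs) = (-1) ^ length (ys @ [b]) * f (xs @ (ys @ [b]) @ a # zs)"
    using assms(2) by (intro antisym_list_move[OF assms(1)]) simp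
  moreover have "f (xs @ b # ys @ (a # zs)) = (-1) ^ length ys * f (xs @ ys @ b # (a # zs))"
    using assms(2) by (intro antisym_list_move[OF assms(1)]) simp
  ultimately show ?thesis by (simp only: append_assoc append_Cons append_Nil length_append) simp
qed

lemma real_eq_neg_self: "(x::real) = - x \<Longrightarrow> x = 0"
  by simp

lemma antisym_list_repeat:
  assumes "antisym_list m f" "length xs = m" "\<not> distinct xs"
  shows "f xs = 0"
proof -
  obtain as bs cs y where "xs = as @ [y] @ bs @ [y] @ cs"
    using not_distinct_decomp[OF assms(3)] by blast
  then have xs: "xs = as @ y # bs @ y # cs" by simp
  have "f (as @ y # bs @ y # cs) = - f (as @ y # bs @ y # cs)"
    by (rule antisym_list_swap[OF assms(1)]) (use assms(2) in \<open>simp add: xs\<close>)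
  then show ?thesis unfolding xs by (rule real_eq_neg_self)
qed

lemma symmetric_list_mset:
  assumes sw: "\<And>xs a b ys. length xs + length ys + 2 = m \<Longrightarrow> f (xs @ a # b # ys) = f (xs @ b # a # ys)"
    and "length xs = m" "mset xs = mset ys"
  shows "f xs = f ys"
proof -
  have move: "f (zs @ a # us @ vs) = f (zs @ us @ a # vs)" if "length zs + length us + length vs + 1 = m" for zs a us vs
    using that
  proof (induction us arbitrary: zs)
    case (Cons x us)
    have "f (zs @ a # x # (us @ vs)) = f (zs @ x # a # (us @ vs))"
      by (rule sw) (use Cons.prems in simp)
    also have "\<dots> = f ((zs @ [x]) @ us @ a # vs)"
      using Cons.IH[of "zs @ [x]"] Cons.prems by simp
    finally show ?case by (simp only: append_Cons append_Nil append_assoc)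
  qed simp
  have "f (zs @ xs) = f (zs @ ys)" if "length zs + length xs = m" "mset xs = mset ys" for zs
    using that
  proof (induction xs arbitrary: zs ys)
    case (Cons x xs)
    have "x \<in> set ys" using mset_eq_setD[OF Cons.prems(2)] by auto
    then obtain us vs where ys: "ys = us @ x # vs" by (meson split_list)
    have ms: "mset xs = mset (us @ vs)" using Cons.prems(2) ys by simp
    have l: "length xs = length us + length vs" using mset_eq_length[OF ms] by simp
    have "f (zs @ x # xs) = f ((zs @ [x]) @ us @ vs)"
      using Cons.IH[of "zs @ [x]" "us @ vs", OF _ ms] Cons.prems(1) by simp
    also have "\<dots> = f (zs @ us @ x # vs)"
      using move[of zs us vs x] Cons.prems(1) l by simp
    finally show ?case by (simp only: ys)
  qed simp
  from this[of "[]", OF _ assms(3)] assms(2) show ?thesis by (simp only: append_Nil list.size add_0)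
qed

lemma alternating_antisym_list:
  assumes "alternating_on UNIV k w"
  shows "antisym_list k w"
  unfolding antisym_list_def
proof (intro allI impI)
  fix xs ys :: "'a list" and a b assume l: "length xs + length ys + 2 = k"
  let ?i = "length xs"
  have "permute_list (Transposition.transpose ?i (Suc ?i)) (xs @ b # a # ys) = xs @ a # b # ys"
    by (subst permute_list_transpose) (auto simp: list_update_append nth_append)
  then show "w (xs @ a # b # ys) = - w (xs @ b # a # ys)"
    using alternating_swap[OF assms, of "xs @ b # a # ys" ?i "Suc ?i"] l by simp
qed

lemma alternating_distinct:
  assumes "alternating_on UNIV k w" "length vs = k" "\<not> distinct vs"
  shows "w vs = 0"
  using antisym_list_repeat[OF alternating_antisym_list[OF assms(1)] assms(2,3)] .

lemma antisym_list_map: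
  fixes f :: "'b list \<Rightarrow> real" and g :: "'c \<Rightarrow> 'b"
  assumes "antisym_list m f"
  shows "antisym_list m (\<lambda>xs. f (map g xs))"
  unfolding antisym_list_def
proof (intro allI impI)
  fix xs ys :: "'c list" and a b assume "length xs + length ys + 2 = m"
  then show "f (map g (xs @ a # b # ys)) = - f (map g (xs @ b # a # ys))"
    using antisym_listD[OF assms, of "map g xs" "map g ys" "g a" "g b"] by simp
qed

lemma antisym_list_prefix:
  assumes "antisym_list (length us + m) f"
  shows "antisym_list m (\<lambda>xs. f (us @ xs))"
  unfolding antisym_list_def
proof (intro allI impI)
  fix xs ys :: "'a list" and a b assume "length xs + length ys + 2 = m"
  then show "f (us @ xs @ a # b # ys) = - f (us @ xs @ b # a # ys)"
    using antisym_listD[OF assms, of "us @ xs" ys a b] by simp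
qed

text \<open>The shifts are all multiples of the same vector \<open>w\<close>, so by alternation no term with two shifts survives.\<close>

lemma alternating_affine:
  assumes alt: "alternating_on UNIV k f" and "length ps + length as = k" "length cs = length as"
  shows "f (ps @ map2 (\<lambda>a c. a + c *\<^sub>R w) as cs) =
           f (ps @ as) + (\<Sum>m<length as. cs ! m * f (ps @ as[m := w]))"
  using assms(2,3)
proof (induction as arbitrary: ps cs)
  case (Cons a as)
  then obtain c cs' where cs: "cs = c # cs'" by (cases cs) auto
  let ?r = "map2 (\<lambda>a c. a + c *\<^sub>R w) as cs'"
  have ml: "multilin k f" using alt by (simp add: alternating_on_UNIV_iff)
  have len: "length ps + Suc (length ?r) = k" using Cons.prems cs by simp
  have add: "f (ps @ (x + y) # zs) = f (ps @ x # zs) + f (ps @ y # zs)" if "length zs = length ?r" for x y zs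
    using multilin_add[OF ml, of "ps @ 0 # zs" "length ps" x y] len that by (simp add: list_update_append)
  have scale: "f (ps @ (c *\<^sub>R x) # zs) = c * f (ps @ x # zs)" if "length zs = length ?r" for x zs
    using multilin_scale[OF ml, of "ps @ 0 # zs" "length ps" c x] len that by (simp add: list_update_append)
  have IH1: "f ((ps @ [a]) @ ?r) = f ((ps @ [a]) @ as) + (\<Sum>m<length as. cs' ! m * f ((ps @ [a]) @ as[m := w]))"
    using Cons.prems cs by (intro Cons.IH) auto
  have IH2: "f ((ps @ [w]) @ ?r) = f ((ps @ [w]) @ as) + (\<Sum>m<length as. cs' ! m * f ((ps @ [w]) @ as[m := w]))"
    using Cons.prems cs by (intro Cons.IH) auto
  have "f ((ps @ [w]) @ as[m := w]) = 0" if "m < length as" for m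
  proof (rule alternating_distinct[OF alt])
    show "length ((ps @ [w]) @ as[m := w]) = k" using Cons.prems by simp
    show "\<not> distinct ((ps @ [w]) @ as[m := w])" using that by (auto simp: set_update_memI)
  qed
  then have IH2': "f (ps @ w # ?r) = f (ps @ w # as)" using IH2 by simp
  have "f (ps @ map2 (\<lambda>a c. a + c *\<^sub>R w) (a # as) cs) = f (ps @ (a + c *\<^sub>R w) # ?r)" by (simp add: cs)
  also have "\<dots> = f (ps @ a # ?r) + c * f (ps @ w # ?r)" by (simp add: add scale)
  also have "\<dots> = f (ps @ a # as) + (\<Sum>m<length as. cs' ! m * f (ps @ a # as[m := w])) + c * f (ps @ w # as)"
    using IH1 IH2' by simp
  also have "\<dots> = f (ps @ a # as) + (\<Sum>m<length (a # as). cs ! m * f (ps @ (a # as)[m := w]))"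
    by (simp add: cs sum.lessThan_Suc_shift del: sum.lessThan_Suc)
  finally show ?case .
qed simp

section \<open>Alternating sums over the entries of an index list\<close>

text \<open>
  For \<open>c = \<lambda>\<close> and \<open>f L = d\<lambda>\<^sub>L\<close> this is the Whitney form of \<open>J\<close>.
\<close>

definition alt_sum :: "('b \<Rightarrow> real) \<Rightarrow> ('b list \<Rightarrow> real) \<Rightarrow> 'b list \<Rightarrow> real" where
  "alt_sum c f J = (\<Sum>i<length J. (-1) ^ i * c (J ! i) * f (remove_nth i J))"

lemma remove_nth_simps [simp]:
  "remove_nth 0 (j # K) = K" "remove_nth (Suc i) (j # K) = j # remove_nth i K"
  by (auto simp: remove_nth_def)

lemma length_remove_nth [simp]: "i < length J \<Longrightarrow> length (remove_nth i J) = length J - 1"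
  by (auto simp: remove_nth_def)

lemma remove_nth_map: "remove_nth i (map f J) = map f (remove_nth i J)"
  by (simp add: remove_nth_def take_map drop_map)

lemma alt_sum_Nil [simp]: "alt_sum c f [] = 0"
  by (simp add: alt_sum_def)

lemma alt_sum_Cons: "alt_sum c f (j # K) = c j * f K - alt_sum c (\<lambda>L. f (j # L)) K"
  by (simp add: alt_sum_def sum.lessThan_Suc_shift sum_negf[symmetric] del: sum.lessThan_Suc)

lemma alt_sum_add: "alt_sum c (\<lambda>L. f L + g L) J = alt_sum c f J + alt_sum c g J"
  by (simp add: alt_sum_def distrib_left sum.distrib)

lemma alt_sum_mult: "alt_sum c (\<lambda>L. b * f L) J = b * alt_sum c f J"
  by (simp add: alt_sum_def sum_distrib_left mult_ac)

lemma alt_sum_sum: "alt_sum c (\<lambda>L. \<Sum>x\<in>A. f x L) J = (\<Sum>x\<in>A. alt_sum c (f x) J)"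
  unfolding alt_sum_def sum_distrib_left by (rule sum.swap)

lemma alt_sum_cong:
  "(\<And>L. length L + 1 = length J \<Longrightarrow> f L = g L) \<Longrightarrow> alt_sum c f J = alt_sum c g J"
  unfolding alt_sum_def by (intro sum.cong) auto

lemma antisym_list_alt_sum:
  fixes f :: "'b list \<Rightarrow> real"
  assumes "antisym_list m f"
  shows "antisym_list (Suc m) (alt_sum c f)"
proof -
  have "alt_sum c f (zs @ a # b # ys) + alt_sum c f (zs @ b # a # ys) = 0"
    if "antisym_list m f" "length zs + length ys + 1 = m" for f :: "'b list \<Rightarrow> real" and m and zs ys :: "'b list" and a b
    using that
  proof (induction zs arbitrary: f m)
    case Nil
    have "alt_sum c (\<lambda>L. f (a # b # L)) ys = alt_sum c (\<lambda>L. (-1) * f (b # a # L)) ys"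
      using antisym_listD[OF Nil(1), of "[]" _ a b] Nil(2) by (intro alt_sum_cong) auto
    also have "\<dots> = - alt_sum c (\<lambda>L. f (b # a # L)) ys" by (subst alt_sum_mult) simp
    finally show ?case by (simp add: alt_sum_Cons)
  next
    case (Cons z zs)
    obtain m' where m: "m = Suc m'" using Cons.prems by (cases m) auto
    have as: "antisym_list m' (\<lambda>L. f (z # L))"
      using antisym_list_prefix[of "[z]" m' f] Cons.prems m by simp
    have "f (zs @ a # b # ys) = - f (zs @ b # a # ys)"
      using Cons.prems by (intro antisym_listD) auto
    then show ?case
      using Cons.IH[OF as] Cons.prems m by (simp add: alt_sum_Cons algebra_simps)
  qed
  note swap = this[OF assms]
  show ?thesis
    unfolding antisym_list_def
  proof (intro allI impI)
    fix xs ys :: "'b list" and a b assume "length xs + length ys + 2 = Suc m"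
    then show "alt_sum c f (xs @ a # b # ys) = - alt_sum c f (xs @ b # a # ys)"
      using swap[of xs ys a b] by simp
  qed
qed

lemma sum_remove_nth_sorted:
  fixes h :: "nat \<Rightarrow> nat list \<Rightarrow> real"
  assumes "finite S"
  shows "(\<Sum>i<card S. h (sorted_list_of_set S ! i) (remove_nth i (sorted_list_of_set S))) =
         (\<Sum>j\<in>S. h j (sorted_list_of_set (S - {j})))"
proof -
  let ?J = "sorted_list_of_set S"
  have len: "length ?J = card S" and d: "distinct ?J" and st: "set ?J = S" using assms by auto
  have rem: "remove_nth i ?J = sorted_list_of_set (S - {?J ! i})" if "i < card S" for i
  proof -
    have i: "i < length ?J" using that len by simp
    have "?J ! i \<notin> set (take i ?J)"
    proof
      assume "?J ! i \<in> set (take i ?J)"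
      then obtain l where "l < i" "?J ! l = ?J ! i" using i by (auto simp: in_set_conv_nth)
      then show False using nth_eq_iff_index_eq[OF d, of l i] i by simp
    qed
    then have "remove1 (?J ! i) (take i ?J @ ?J ! i # drop (Suc i) ?J) = remove_nth i ?J"
      by (simp add: remove_nth_def remove1_append)
    then have "remove1 (?J ! i) ?J = remove_nth i ?J"
      using id_take_nth_drop[OF i] by simp
    then show ?thesis using assms that st len by (simp add: sorted_list_of_set_remove)
  qed
  have "bij_betw (\<lambda>i. ?J ! i) {..<card S} S"
    using bij_betw_nth[of ?J "{..<card S}" S] d st len by auto
  then have "(\<Sum>j\<in>S. h j (sorted_list_of_set (S - {j}))) =
      (\<Sum>i<card S. h (?J ! i) (sorted_list_of_set (S - {?J ! i})))"
    by (rule sum.reindex_bij_betw[symmetric])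
  then show ?thesis using rem by simp
qed

lemma Gam_eq_sorted:
  assumes "finite I"
  shows "Gam s I = sorted_list_of_set ` {S. S \<subseteq> I \<and> card S = Suc s}"
proof (intro set_eqI iffI)
  fix J assume J: "J \<in> Gam s I"
  then have "sorted_list_of_set (set J) = J"
    unfolding Gam_def by (auto intro!: sorted_list_of_set.idem_if_sorted_distinct simp: strict_sorted_iff)
  moreover have "card (set J) = Suc s" using J by (auto simp: Gam_def strict_sorted_iff distinct_card)
  ultimately show "J \<in> sorted_list_of_set ` {S. S \<subseteq> I \<and> card S = Suc s}"
    using J by (intro image_eqI[of _ _ "set J"]) (auto simp: Gam_def)
next
  fix J assume "J \<in> sorted_list_of_set ` {S. S \<subseteq> I \<and> card S = Suc s}"
  then show "J \<in> Gam s I" using assms by (auto simp: Gam_def finite_subset)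
qed

lemma finite_Gam: "finite I \<Longrightarrow> finite (Gam s I)"
  by (simp add: Gam_eq_sorted)

lemma sum_distinct_lists:
  fixes h :: "nat list \<Rightarrow> real"
  assumes "finite I"
    and sym: "\<And>xs ys. set xs \<subseteq> I \<Longrightarrow> distinct xs \<Longrightarrow> length xs = s \<Longrightarrow> mset xs = mset ys \<Longrightarrow> h xs = h ys"
  shows "(\<Sum>K | length K = s \<and> distinct K \<and> set K \<subseteq> I. h K) =
         fact s * (\<Sum>A | A \<subseteq> I \<and> card A = s. h (sorted_list_of_set A))"
proof -
  have eq: "{K. length K = s \<and> distinct K \<and> set K \<subseteq> I} =
     (\<Union>A\<in>{A. A \<subseteq> I \<and> card A = s}. permutations_of_set A)"
    by (auto simp: permutations_of_set_def distinct_card)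
  have "(\<Sum>K | length K = s \<and> distinct K \<and> set K \<subseteq> I. h K) =
     (\<Sum>A | A \<subseteq> I \<and> card A = s. \<Sum>K\<in>permutations_of_set A. h K)"
    unfolding eq
  proof (rule sum.UNION_disjoint)
    show "finite {A. A \<subseteq> I \<and> card A = s}" using assms(1) by simp
    show "\<forall>A\<in>{A. A \<subseteq> I \<and> card A = s}. finite (permutations_of_set A)" by simp
    show "\<forall>A\<in>{A. A \<subseteq> I \<and> card A = s}. \<forall>B\<in>{A. A \<subseteq> I \<and> card A = s}. A \<noteq> B \<longrightarrow>
            permutations_of_set A \<inter> permutations_of_set B = {}"
      by (auto dest!: permutations_of_setD(1))
  qed
  also have "\<dots> = (\<Sum>A | A \<subseteq> I \<and> card A = s. \<Sum>K\<in>permutations_of_set A. h (sorted_list_of_set A))"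
  proof (intro sum.cong refl)
    fix A K assume A: "A \<in> {A. A \<subseteq> I \<and> card A = s}" and K: "K \<in> permutations_of_set A"
    have fA: "finite A" using A assms(1) finite_subset by auto
    show "h K = h (sorted_list_of_set A)"
    proof (rule sym)
      show "mset K = mset (sorted_list_of_set A)"
        using K fA by (metis distinct_sorted_list_of_set permutations_of_setD set_eq_iff_mset_eq_distinct set_sorted_list_of_set)
    qed (use A K in \<open>auto simp: permutations_of_set_def distinct_card\<close>)
  qed
  also have "\<dots> = fact s * (\<Sum>A | A \<subseteq> I \<and> card A = s. h (sorted_list_of_set A))"
    using assms(1) by (auto simp: sum_distrib_left finite_subset intro!: sum.cong)
  finally show ?thesis .
qed

text \<open>
  Each increasing index set with a marked entry \<open>j\<close> corresponds to \<open>s!\<close> tuples \<open>(j, K)\<close>, one for each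
  order of the remaining entries, and tuples with repetitions contribute nothing.  On the side of the
  tuples \<open>j\<close> and \<open>K\<close> vary independently, which is what the Whitney identity \<open>sum_whit\<close> needs.
\<close>

lemma sum_Gam_marked:
  fixes h :: "nat \<Rightarrow> nat list \<Rightarrow> real"
  assumes "finite I"
    and sym: "\<And>j xs ys. j \<in> I \<Longrightarrow> j \<notin> set xs \<Longrightarrow> set xs \<subseteq> I \<Longrightarrow> distinct xs \<Longrightarrow> length xs = s \<Longrightarrow>
                 mset xs = mset ys \<Longrightarrow> h j xs = h j ys"
    and nd: "\<And>j K. j \<in> I \<Longrightarrow> set K \<subseteq> I \<Longrightarrow> length K = s \<Longrightarrow> \<not> distinct (j # K) \<Longrightarrow> h j K = 0"
  shows "fact s * (\<Sum>J\<in>Gam s I. \<Sum>i\<le>s. h (J ! i) (remove_nth i J)) =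
         (\<Sum>K | length K = s \<and> set K \<subseteq> I. \<Sum>j\<in>I. h j K)"
proof -
  let ?P = "{S. S \<subseteq> I \<and> card S = Suc s}"
  have fin: "finite S" if "S \<subseteq> I" for S using that assms(1) finite_subset by auto
  have ci: "card (insert j A) = Suc (card A)" if "A \<subseteq> I - {j}" for j A
    using that assms(1) by (subst card_insert_disjoint) (auto intro: finite_subset[of A I])
  have finP: "finite ?P" "finite {A. A \<subseteq> I \<and> card A = s}" using assms(1) by auto
  have "(\<Sum>J\<in>Gam s I. \<Sum>i\<le>s. h (J ! i) (remove_nth i J)) =
     (\<Sum>S\<in>?P. \<Sum>i\<le>s. h (sorted_list_of_set S ! i) (remove_nth i (sorted_list_of_set S)))"
    unfolding Gam_eq_sorted[OF assms(1)]
    by (subst sum.reindex) (auto intro!: inj_onI dest!: arg_cong[where f = set] simp: fin)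
  also have "\<dots> = (\<Sum>S\<in>?P. \<Sum>j\<in>S. h j (sorted_list_of_set (S - {j})))"
  proof (rule sum.cong, rule refl)
    fix S assume "S \<in> ?P"
    then show "(\<Sum>i\<le>s. h (sorted_list_of_set S ! i) (remove_nth i (sorted_list_of_set S))) =
       (\<Sum>j\<in>S. h j (sorted_list_of_set (S - {j})))"
      using sum_remove_nth_sorted[OF fin, of S h] by (simp add: lessThan_Suc_atMost)
  qed
  also have "\<dots> = (\<Sum>(S, j)\<in>Sigma ?P (\<lambda>S. S). h j (sorted_list_of_set (S - {j})))"
    using finP fin by (subst sum.Sigma) auto
  also have "\<dots> = (\<Sum>(j, A)\<in>Sigma I (\<lambda>j. {A. A \<subseteq> I - {j} \<and> card A = s}). h j (sorted_list_of_set A))"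
    by (rule sum.reindex_bij_witness[of _ "\<lambda>(j, A). (insert j A, j)" "\<lambda>(S, j). (j, S - {j})"])
       (auto simp: fin ci insert_absorb)
  also have "\<dots> = (\<Sum>j\<in>I. \<Sum>A | A \<subseteq> I - {j} \<and> card A = s. h j (sorted_list_of_set A))"
    using assms(1) by (subst sum.Sigma) auto
  finally have "fact s * (\<Sum>J\<in>Gam s I. \<Sum>i\<le>s. h (J ! i) (remove_nth i J)) =
    (\<Sum>j\<in>I. fact s * (\<Sum>A | A \<subseteq> I - {j} \<and> card A = s. h j (sorted_list_of_set A)))"
    by (simp add: sum_distrib_left)
  also have "\<dots> = (\<Sum>j\<in>I. \<Sum>K | length K = s \<and> distinct K \<and> set K \<subseteq> I - {j}. h j K)"
  proof (rule sum.cong, rule refl, rule sum_distinct_lists[symmetric])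
    fix j xs ys assume "j \<in> I" "set xs \<subseteq> I - {j}" "distinct xs" "length xs = s" "mset xs = mset ys"
    then show "h j xs = h j ys" by (intro sym) auto
  qed (use assms(1) in auto)
  also have "\<dots> = (\<Sum>j\<in>I. \<Sum>K | length K = s \<and> set K \<subseteq> I. h j K)"
  proof (rule sum.cong, rule refl, rule sum.mono_neutral_left)
    show "finite {K. length K = s \<and> set K \<subseteq> I}"
      using finite_lists_length_eq[OF assms(1), of s] by (simp add: conj_commute)
  qed (auto intro!: nd)
  also have "\<dots> = (\<Sum>K | length K = s \<and> set K \<subseteq> I. \<Sum>j\<in>I. h j K)" by (rule sum.swap)
  finally show ?thesis .
qed

lemma wedge_cov_swap:
  assumes "i < length as" "j < length as" "i \<noteq> j" "length as \<le> k" "length vs = k"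
  shows "wedge_cov k (permute_list (Transposition.transpose i j) as) \<beta> vs = - wedge_cov k as \<beta> vs"
proof -
  let ?t = "Transposition.transpose i j" and ?s = "length as"
  let ?f = "\<lambda>ws. (\<Prod>a<?s. (as ! a) (ws ! a)) * \<beta> (drop ?s ws)"
  have ts: "?t permutes {..<?s}" and tk: "?t permutes {..<k}"
    using assms by (auto intro!: permutes_swap_id)
  have "(\<Prod>a<?s. (permute_list ?t as ! a) (ws ! a)) * \<beta> (drop ?s ws) = ?f (permute_list ?t ws)"
    if ws: "length ws = k" for ws
  proof -
    have "(\<Prod>a<?s. (permute_list ?t as ! a) (ws ! a)) = (\<Prod>a<?s. (as ! ?t a) (ws ! a))"
      using ts by (intro prod.cong) (auto simp: permute_list_nth)
    also have "\<dots> = (\<Prod>a<?s. (as ! ?t (?t a)) (ws ! ?t a))"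
      using prod.permute[OF ts, of "\<lambda>a. (as ! ?t a) (ws ! a)"] by (simp add: o_def)
    also have "\<dots> = (\<Prod>a<?s. (as ! a) (permute_list ?t ws ! a))"
      using tk ws assms by (intro prod.cong) (auto simp: permute_list_nth)
    finally show ?thesis using permute_list_take(2)[OF ts, of ws] ws assms by simp
  qed
  then have "wedge_cov k (permute_list ?t as) \<beta> vs = Alt k (\<lambda>ws. ?f (permute_list ?t ws)) vs / fact (k - ?s)"
    unfolding wedge_cov_def length_permute_list
    by (intro arg_cong[where f = "\<lambda>t. t / _"] Alt_cong assms) auto
  also have "Alt k (\<lambda>ws. ?f (permute_list ?t ws)) vs = of_int (sign ?t) * Alt k ?f vs"
    by (rule Alt_permute_inside[OF tk assms(5)])
  finally show ?thesis using assms(3) by (simp add: wedge_cov_def sign_swap_id)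
qed

lemma antisym_list_wedge_cov:
  assumes "m \<le> k" "length vs = k"
  shows "antisym_list m (\<lambda>as. wedge_cov k as \<beta> vs)"
  unfolding antisym_list_def
proof (intro allI impI)
  fix xs ys :: "('a \<Rightarrow> real) list" and a b assume l: "length xs + length ys + 2 = m"
  let ?i = "length xs"
  have "permute_list (Transposition.transpose ?i (Suc ?i)) (xs @ b # a # ys) = xs @ a # b # ys"
    by (subst permute_list_transpose) (auto simp: list_update_append nth_append)
  then show "wedge_cov k (xs @ a # b # ys) \<beta> vs = - wedge_cov k (xs @ b # a # ys) \<beta> vs"
    using wedge_cov_swap[of ?i "xs @ b # a # ys" "Suc ?i" k vs \<beta>] l assms by simp
qed

lemma sum_lessThan_add:
  fixes f :: "nat \<Rightarrow> real"
  shows "(\<Sum>m<a + b. f m) = (\<Sum>m<a. f m) + (\<Sum>m<b. f (a + m))"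
  by (induction b) auto

text \<open>
  The derivation \<open>ws \<mapsto> \<Sum>\<^sub>m \<alpha>(w\<^sub>m) G(\<dots>, w, \<dots>)\<close>, with \<open>w\<close> in place of \<open>w\<^sub>m\<close>, is the wedge product of \<open>\<alpha>\<close>
  with the contraction of \<open>G\<close> by \<open>w\<close>.  All \<open>m\<close> contribute equally after antisymmetrisation.
\<close>

lemma wedge_cov_derivation:
  fixes M :: "'a::real_vector \<Rightarrow> 'a"
  assumes alt: "alternating_on UNIV k G" and vs: "length vs = k"
    and l: "length as < k" "length us = length as"
  shows "wedge_cov k as (\<lambda>ws. \<Sum>m<length ws. \<alpha> (ws ! m) * G ((map M ws)[m := w] @ us)) vs =
         wedge_cov k (as @ [\<alpha>]) (\<lambda>ws. G (w # map M ws @ us)) vs"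
proof -
  let ?s = "length as" and ?P = "\<lambda>ws. \<Prod>a<length as. (as ! a) (ws ! a)"
  define f where "f m ws = ?P ws * (\<alpha> (ws ! (?s + m)) * G ((map M (drop ?s ws))[m := w] @ us))" for m ws
  have eq: "Alt k (f m) vs = Alt k (f 0) vs" if m: "m < k - ?s" for m
  proof (cases "m = 0")
    case False
    let ?t = "Transposition.transpose ?s (?s + m)"
    have tk: "?t permutes {..<k}" using m l by (intro permutes_swap_id) auto
    have "f 0 (permute_list ?t ws) = (-1) * f m ws" if ws: "length ws = k" for ws
    proof -
      define L where "L = (map M (drop ?s ws))[m := w] @ us"
      have lL: "length L = k" using ws l by (simp add: L_def)
      have t: "permute_list ?t ws = ws[?s := ws ! (?s + m), ?s + m := ws ! ?s]"
        using ws m l by (intro permute_list_transpose) auto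
      have "?P (permute_list ?t ws) = ?P ws"
        unfolding t by (intro prod.cong) auto
      moreover have "permute_list ?t ws ! (?s + 0) = ws ! (?s + m)"
        unfolding t using ws m l False by simp
      moreover have "(map M (drop ?s (permute_list ?t ws)))[0 := w] @ us =
          permute_list (Transposition.transpose 0 m) L"
      proof -
        have "permute_list (Transposition.transpose 0 m) L = L[0 := L ! m, m := L ! 0]"
          using lL m l by (intro permute_list_transpose) auto
        also have "\<dots> = (map M (drop ?s (permute_list ?t ws)))[0 := w] @ us"
          unfolding t L_def using ws m l False
          by (intro nth_equalityI) (auto simp: nth_append nth_list_update)
        finally show ?thesis by simp
      qed
      moreover have "G (permute_list (Transposition.transpose 0 m) L) = - G L"
        using lL m l False by (intro alternating_swap[OF alt]) auto
      ultimately show ?thesis by (simp add: f_def L_def)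
    qed
    then have "Alt k (\<lambda>ws. f 0 (permute_list ?t ws)) vs = Alt k (\<lambda>ws. (-1) * f m ws) vs"
      by (intro Alt_cong vs)
    then show ?thesis
      unfolding Alt_mult Alt_permute_inside[OF tk vs] using False by (simp add: sign_swap_id)
  qed simp
  have "wedge_cov k as (\<lambda>ws. \<Sum>m<length ws. \<alpha> (ws ! m) * G ((map M ws)[m := w] @ us)) vs =
     Alt k (\<lambda>ws. \<Sum>m<k - ?s. f m ws) vs / fact (k - ?s)"
    unfolding wedge_cov_def f_def
    by (intro arg_cong[where f = "\<lambda>t. t / _"] Alt_cong vs)
       (use l in \<open>auto simp: sum_distrib_left intro!: sum.cong\<close>)
  also have "\<dots> = Alt k (f 0) vs * (real (k - ?s) / fact (k - ?s))"
  proof -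
    have "(\<Sum>m<k - ?s. Alt k (f m) vs) = (\<Sum>m<k - ?s. Alt k (f 0) vs)"
      by (intro sum.cong refl eq) auto
    then show ?thesis unfolding Alt_sum by simp
  qed
  also have "real (k - ?s) / fact (k - ?s) = 1 / fact (k - Suc ?s)"
    using l by (simp add: fact_reduce[of "k - ?s"])
  also have "Alt k (f 0) vs =
     Alt k (\<lambda>ws. (\<Prod>a<length (as @ [\<alpha>]). ((as @ [\<alpha>]) ! a) (ws ! a)) *
                  G (w # map M (drop (length (as @ [\<alpha>])) ws) @ us)) vs"
  proof (intro Alt_cong vs)
    fix ws :: "'a list" assume ws: "length ws = k"
    have "drop ?s ws = ws ! ?s # drop (Suc ?s) ws" using ws l by (simp add: Cons_nth_drop_Suc)
    then show "f 0 ws = (\<Prod>a<length (as @ [\<alpha>]). ((as @ [\<alpha>]) ! a) (ws ! a)) *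
                  G (w # map M (drop (length (as @ [\<alpha>])) ws) @ us)"
      by (simp add: f_def nth_append)
  qed
  finally show ?thesis by (simp add: wedge_cov_def)
qed

section \<open>Cancellation of the leading terms\<close>

text \<open>
  The algebraic situation at one point \<open>x\<close>: \<open>lam\<close> are the values and \<open>d\<close> the differentials of the
  barycentric coordinates, \<open>e j\<close> is \<open>X j - X z\<close>, the derivative of \<open>Fmap X I _ (X z)\<close> is \<open>M\<close>, and \<open>Om\<close> is the
  alternating form at the point \<open>Fmap X I x (X z)\<close>.
\<close>

locale leading_term =
  fixes I :: "nat set" and n k :: nat and lam :: "nat \<Rightarrow> real"
    and d :: "nat \<Rightarrow> 'a::real_vector \<Rightarrow> real" and e :: "nat \<Rightarrow> 'a" and M :: "'a \<Rightarrow> 'a"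
    and Om :: "'a list \<Rightarrow> real" and vs :: "'a list"
  assumes I: "I \<subseteq> {..n}" and kn: "k < n" and alt: "alternating_on UNIV k Om" and vs: "length vs = k"
begin

text \<open>
  \<open>edg p K\<close> is the form \<open>Om\<close> evaluated on the arguments that occur in the operator \<open>R\<close> for the index
  set \<open>p # K\<close>: the vectors \<open>e j - e p\<close> are the edges, and \<open>M v + dI v *\<^sub>R e p\<close> is the derivative of
  \<open>Fmap X I _ (X p)\<close>.  The other three are the pieces of its multilinear expansion: \<open>om\<close> without any
  \<open>e p\<close>, \<open>mid\<close> with \<open>e p\<close> in place of the entry \<open>e (K ! a)\<close>, and \<open>sh\<close> with \<open>e p\<close> in place of one of
  the first arguments.
\<close>

definition "lamI = sum lam I"
definition "dI v = (\<Sum>i\<in>I. d i v)"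
definition "whit J \<beta> = alt_sum lam (\<lambda>L. wedge_cov k (map d L) \<beta> vs) J"
definition "dwhit J \<beta> = alt_sum lam (\<lambda>L. wedge_cov k (dI # map d L) \<beta> vs) J"
definition "om K ws = Om (map M ws @ map e K)"
definition "sh p K ws = (\<Sum>m<length ws. dI (ws ! m) * Om ((map M ws)[m := e p] @ map e K))"
definition "mid a p K ws = Om (map M ws @ (map e K)[a := e p])"
definition "edg p K ws = Om (map (\<lambda>v. M v + dI v *\<^sub>R e p) ws @ map (\<lambda>j. e j - e p) K)"
definition "tup s = {K. length K = s \<and> set K \<subseteq> I}"

lemma finI [simp]: "finite I" using I finite_subset by blast

lemma whit_add: "whit J (\<lambda>ws. \<beta> ws + \<beta>' ws) = whit J \<beta> + whit J \<beta>'"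
  by (simp add: whit_def wedge_cov_add alt_sum_add)

lemma whit_mult: "whit J (\<lambda>ws. c * \<beta> ws) = c * whit J \<beta>"
  by (simp add: whit_def wedge_cov_mult alt_sum_mult)

lemma whit_sum: "whit J (\<lambda>ws. \<Sum>x\<in>A. \<beta> x ws) = (\<Sum>x\<in>A. whit J (\<beta> x))"
  by (simp add: whit_def wedge_cov_sum alt_sum_sum)

lemma whit_cong:
  assumes "length J = Suc s" "s \<le> k" "\<And>ws. length ws = k - s \<Longrightarrow> \<beta> ws = \<beta>' ws"
  shows "whit J \<beta> = whit J \<beta>'"
  unfolding whit_def using assms by (intro alt_sum_cong wedge_cov_cong vs) auto

lemma whit_zero: "whit J (\<lambda>ws. 0) = 0"
  using whit_mult[of J 0 "\<lambda>ws. 0"] by simp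

lemma antisym_whit: "s \<le> k \<Longrightarrow> antisym_list (Suc s) (\<lambda>J. whit J \<beta>)"
  unfolding whit_def
  by (intro antisym_list_alt_sum antisym_list_map antisym_list_wedge_cov vs)

lemma whit_Cons: "whit (j # K) \<beta> = lam j * wedge_cov k (map d K) \<beta> vs -
    alt_sum lam (\<lambda>L. wedge_cov k (d j # map d L) \<beta> vs) K"
  by (simp add: whit_def alt_sum_Cons)

text \<open>
  The identity \<open>\<Sum>\<^sub>j \<phi>\<^sub>j\<^sub>K = \<lambda>\<^sub>I d\<lambda>\<^sub>K - d\<lambda>\<^sub>I \<and> \<phi>\<^sub>K\<close>.  It is the only source of a factor \<open>lamI\<close>; the defect
  \<open>dwhit K\<close> has to be cancelled.
\<close>

lemma sum_whit: "(\<Sum>j\<in>I. whit (j # K) \<beta>) = lamI * wedge_cov k (map d K) \<beta> vs - dwhit K \<beta>"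
proof -
  have "dwhit K \<beta> = (\<Sum>j\<in>I. alt_sum lam (\<lambda>L. wedge_cov k (d j # map d L) \<beta> vs) K)"
    unfolding dwhit_def dI_def wedge_cov_sum_head alt_sum_sum ..
  then show ?thesis by (simp add: whit_Cons sum_subtractf lamI_def sum_distrib_right)
qed

lemma whit_nondistinct: "length J = Suc s \<Longrightarrow> s \<le> k \<Longrightarrow> \<not> distinct J \<Longrightarrow> whit J \<beta> = 0"
  using antisym_list_repeat[OF antisym_whit] by blast

lemma sh_top: "length K = k \<Longrightarrow> length ws = k - k \<Longrightarrow> sh p K ws = 0"
  by (simp add: sh_def)

lemma wedge_cov_sh:
  assumes "length as = s" "length K = s" "s < k"
  shows "wedge_cov k as (sh p K) vs = wedge_cov k (as @ [dI]) (\<lambda>ws. Om (e p # map M ws @ map e K)) vs"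
  unfolding sh_def using assms by (intro wedge_cov_derivation alt vs) auto

text \<open>By \<open>wedge_cov_derivation\<close> the summand \<open>sh\<close> carries a second factor \<open>dI\<close>.\<close>

lemma dwhit_sh:
  assumes "length K = s" "s \<le> k"
  shows "dwhit K (sh p K) = 0"
proof (cases "s < k")
  case True
  have "wedge_cov k (dI # map d L) (sh p K) vs = 0" if "length L + 1 = length K" for L
  proof -
    have "wedge_cov k ((dI # map d L) @ [dI]) (\<lambda>ws. Om (e p # map M ws @ map e K)) vs = 0"
      using True assms that
      by (intro antisym_list_repeat[OF antisym_list_wedge_cov[of "Suc s" k]] vs) auto
    then show ?thesis using that True assms by (subst wedge_cov_sh[of _ s]) auto
  qed
  then have "dwhit K (sh p K) = alt_sum lam (\<lambda>L. 0) K"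
    unfolding dwhit_def by (intro alt_sum_cong)
  then show ?thesis by (simp add: alt_sum_def)
next
  case False
  then have s: "s = k" using assms by simp
  have "dwhit K (sh p K) = alt_sum lam (\<lambda>L. wedge_cov k (dI # map d L) (\<lambda>ws. 0 * 0) vs) K"
    unfolding dwhit_def using assms s by (intro alt_sum_cong wedge_cov_cong vs) (auto simp: sh_top)
  then show ?thesis unfolding wedge_cov_mult by (simp add: alt_sum_def)
qed

text \<open>
  Here the index \<open>p\<close> moves from the frame into the index list, so a term of level \<open>s\<close> takes the form of the
  defect of level \<open>s + 1\<close>.
\<close>

lemma whit_sh:
  assumes "length K = s" "s < k"
  shows "whit (p # K) (sh p K) = - ((-1) ^ k * dwhit (p # K) (om (p # K)))"
proof -
  have "wedge_cov k (map d L) (sh p K) vs = (-1) ^ (k - 1) * wedge_cov k (dI # map d L) (om (p # K)) vs"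
    if L: "length L = s" for L
  proof -
    have sgn: "(-1 :: real) ^ s * (-1) ^ (k - Suc s) = (-1) ^ (k - 1)"
      using assms by (simp add: power_add[symmetric])
    have "wedge_cov k ([] @ dI # map d L @ []) \<beta> vs = (-1) ^ length (map d L) * wedge_cov k ([] @ map d L @ dI # []) \<beta> vs" for \<beta>
      using assms L by (intro antisym_list_move[OF antisym_list_wedge_cov[of "Suc s" k]] vs) auto
    then have mv: "wedge_cov k (map d L @ [dI]) \<beta> vs = (-1) ^ s * wedge_cov k (dI # map d L) \<beta> vs" for \<beta>
      by (simp add: L)
    have "wedge_cov k (map d L) (sh p K) vs = (-1) ^ s * wedge_cov k (dI # map d L) (\<lambda>ws. Om (e p # map M ws @ map e K)) vs"
      using assms L by (subst wedge_cov_sh[of _ s]) (auto simp: mv)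
    also have "wedge_cov k (dI # map d L) (\<lambda>ws. Om (e p # map M ws @ map e K)) vs =
       wedge_cov k (dI # map d L) (\<lambda>ws. (-1) ^ (k - Suc s) * om (p # K) ws) vs"
    proof (intro wedge_cov_cong vs)
      fix ws :: "'a list" assume ws: "length ws = k - length (dI # map d L)"
      have "Om ([] @ e p # map M ws @ map e K) = (-1) ^ length (map M ws) * Om ([] @ map M ws @ e p # map e K)"
        using assms L ws by (intro antisym_list_move[OF alternating_antisym_list[OF alt]]) auto
      then show "Om (e p # map M ws @ map e K) = (-1) ^ (k - Suc s) * om (p # K) ws"
        using ws L by (simp add: om_def)
    qed (use assms L in auto)
    also have "\<dots> = (-1) ^ (k - Suc s) * wedge_cov k (dI # map d L) (om (p # K)) vs"
      by (rule wedge_cov_mult)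
    finally show ?thesis unfolding mult.assoc[symmetric] sgn .
  qed
  then have "whit (p # K) (sh p K) =
      alt_sum lam (\<lambda>L. (-1) ^ (k - 1) * wedge_cov k (dI # map d L) (om (p # K)) vs) (p # K)"
    unfolding whit_def using assms by (intro alt_sum_cong) auto
  also have "\<dots> = (-1) ^ (k - 1) * dwhit (p # K) (om (p # K))"
    by (simp add: alt_sum_mult dwhit_def)
  also have "(-1 :: real) ^ (k - 1) = - ((-1) ^ k)" using assms by (cases k) auto
  finally show ?thesis by simp
qed

lemma edg_expand:
  assumes "length ws + length K = k"
  shows "edg p K ws = om K ws + (\<Sum>a<length K. (-1) * mid a p K ws) + sh p K ws"
proof -
  let ?as = "map M ws @ map e K" and ?cs = "map dI ws @ replicate (length K) (-1)"
  have "map (\<lambda>v. M v + dI v *\<^sub>R e p) ws @ map (\<lambda>j. e j - e p) K = map2 (\<lambda>a c. a + c *\<^sub>R e p) ?as ?cs"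
    by (intro nth_equalityI) (auto simp: nth_append)
  then have "edg p K ws = Om ([] @ map2 (\<lambda>a c. a + c *\<^sub>R e p) ?as ?cs)" by (simp add: edg_def)
  also have "\<dots> = Om ([] @ ?as) + (\<Sum>m<length ?as. ?cs ! m * Om ([] @ ?as[m := e p]))"
    using assms by (intro alternating_affine[OF alt]) auto
  also have "(\<Sum>m<length ?as. ?cs ! m * Om ([] @ ?as[m := e p])) =
     sh p K ws + (\<Sum>a<length K. (-1) * mid a p K ws)"
    unfolding length_append length_map sum_lessThan_add sh_def mid_def
    by (intro arg_cong2[where f = "(+)"] sum.cong) (auto simp: nth_append list_update_append)
  finally show ?thesis by (simp add: om_def)
qed

lemma whit_edg:
  assumes "length K = s" "s \<le> k"
  shows "whit (j # K) (edg p K) =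
    whit (j # K) (om K) - (\<Sum>a<s. whit (j # K) (mid a p K)) + whit (j # K) (sh p K)"
proof -
  have "whit (j # K) (edg p K) = whit (j # K) (\<lambda>ws. om K ws + (\<Sum>a<s. (-1) * mid a p K ws) + sh p K ws)"
    using assms edg_expand[of _ K p] by (intro whit_cong[of _ s]) auto
  then show ?thesis by (simp only: whit_add whit_sum whit_mult) (simp add: sum_negf)
qed

text \<open>The form \<open>om K\<close> does not depend on \<open>p\<close>, and \<open>n - s\<close> indices are available for it.\<close>

lemma sum_om_part:
  assumes "s \<le> k"
  shows "(\<Sum>K\<in>tup s. \<Sum>j\<in>I. \<Sum>p\<in>{..n} - set (j # K). whit (j # K) (om K)) =
    (real n - real s) * (\<Sum>K\<in>tup s. lamI * wedge_cov k (map d K) (om K) vs - dwhit K (om K))"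
proof -
  have "(\<Sum>p\<in>{..n} - set (j # K). whit (j # K) (om K)) = (real n - real s) * whit (j # K) (om K)"
    if "K \<in> tup s" "j \<in> I" for K j
  proof (cases "distinct (j # K)")
    case True
    have "card ({..n} - set (j # K)) = Suc n - card (set (j # K))"
      using that I by (subst card_Diff_subset) (auto simp: tup_def)
    also have "card (set (j # K)) = Suc s" using True that by (simp only: distinct_card) (simp add: tup_def)
    finally have "real (card ({..n} - set (j # K))) = real n - real s" using assms kn by simp
    then show ?thesis by simp
  next
    case False
    then show ?thesis using that assms whit_nondistinct[of "j # K" s] by (simp add: tup_def)
  qed
  then have "(\<Sum>K\<in>tup s. \<Sum>j\<in>I. \<Sum>p\<in>{..n} - set (j # K). whit (j # K) (om K)) =
      (\<Sum>K\<in>tup s. \<Sum>j\<in>I. (real n - real s) * whit (j # K) (om K))"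
    by (intro sum.cong refl)
  then show ?thesis by (simp only: sum_distrib_left[symmetric] sum_whit)
qed

text \<open>Exchanging the entry at \<open>a\<close> with the marked one changes the sign of the Whitney factor only.\<close>

lemma sum_mid_part:
  assumes "s \<le> k" "a < s"
  shows "(\<Sum>K\<in>tup s. \<Sum>j\<in>I. \<Sum>p\<in>{..n} - set (j # K). whit (j # K) (mid a p K)) = 0"
proof -
  \<comment> \<open>The involution \<open>\<tau>\<close> exchanges \<open>j\<close> with the entry of \<open>K\<close> at \<open>a\<close>.\<close>
  define q where "q = (\<lambda>(K, j). \<Sum>p\<in>{..n} - set (j # K). whit (j # K) (mid a p K))"
  define \<tau> where "\<tau> = (\<lambda>(K :: nat list, j). (K[a := j], K ! a))"
  have neg: "q (\<tau> (K, j)) = - q (K, j)" if K: "K \<in> tup s" for K j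
  proof -
    have a: "a < length K" using K assms by (simp add: tup_def)
    have setq: "set (K ! a # K[a := j]) = set (j # K)"
    proof -
      have "K = take a K @ K ! a # drop (Suc a) K" using a by (rule id_take_nth_drop)
      then have "set (j # K) = insert j (set (take a K) \<union> insert (K ! a) (set (drop (Suc a) K)))"
        by (metis list.simps(15) set_append)
      moreover have "set (K[a := j]) = set (take a K) \<union> insert j (set (drop (Suc a) K))"
        using a by (simp add: upd_conv_take_nth_drop)
      ultimately show ?thesis by auto
    qed
    have w: "whit (K ! a # K[a := j]) \<beta> = - whit (j # K) \<beta>" for \<beta>
    proof -
      have "whit ([] @ K ! a # take a K @ j # drop (Suc a) K) \<beta> =
           - whit ([] @ j # take a K @ K ! a # drop (Suc a) K) \<beta>"
        using a K assms by (intro antisym_list_swap[OF antisym_whit[of s]]) (auto simp: tup_def)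
      then show ?thesis using a by (simp add: upd_conv_take_nth_drop id_take_nth_drop[symmetric])
    qed
    have m: "mid a p (K[a := j]) = mid a p K" for p by (simp add: mid_def map_update fun_eq_iff)
    show ?thesis unfolding q_def \<tau>_def case_prod_conv setq w m by (simp add: sum_negf)
  qed
  have inv: "\<tau> (\<tau> x) = x" "\<tau> x \<in> tup s \<times> I" if x: "x \<in> tup s \<times> I" for x
  proof -
    obtain K j where xKj: "x = (K, j)" and K: "K \<in> tup s" and j: "j \<in> I" using x by auto
    have a: "a < length K" using K assms by (simp add: tup_def)
    have "set (K[a := j]) \<subseteq> insert j (set K)" by (rule set_update_subset_insert)
    then have "K[a := j] \<in> tup s" "K ! a \<in> I" using K j a by (auto simp: tup_def)
    then show "\<tau> (\<tau> x) = x" "\<tau> x \<in> tup s \<times> I" using a by (auto simp: xKj \<tau>_def)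
  qed
  have "sum q (tup s \<times> I) = (\<Sum>x\<in>tup s \<times> I. q (\<tau> x))"
    by (rule sum.reindex_bij_witness[of _ \<tau> \<tau>]) (use inv in auto)
  also have "\<dots> = - sum q (tup s \<times> I)"
    unfolding sum_negf[symmetric] by (intro sum.cong) (auto simp: neg)
  finally have "sum q (tup s \<times> I) = 0" by simp
  then show ?thesis by (simp add: q_def sum.cartesian_product)
qed

lemma sh_repeat:
  assumes "length ws + length K = k" "p \<in> set K"
  shows "sh p K ws = 0"
proof -
  have "Om ((map M ws)[m := e p] @ map e K) = 0" if "m < length ws" for m
  proof (rule alternating_distinct[OF alt])
    have "e p \<in> set ((map M ws)[m := e p])" using that by (simp add: set_update_memI)
    then show "\<not> distinct ((map M ws)[m := e p] @ map e K)" using assms(2) by auto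
  qed (use assms in simp)
  then show ?thesis by (simp add: sh_def)
qed

text \<open>
  \<open>Xs\<close> collects the defects that must cancel between consecutive levels, \<open>Ps\<close> and \<open>Qs\<close> the
  cofactors of \<open>lamI\<close>.
\<close>

definition "Xs s = (\<Sum>K\<in>tup s. dwhit K (om K))"
definition "Qs s = (\<Sum>K\<in>tup s. \<Sum>p\<le>n. wedge_cov k (map d K) (sh p K) vs)"
definition "Ps s = (\<Sum>K\<in>tup s. wedge_cov k (map d K) (om K) vs)"

lemma sum_whit_sh:
  assumes "s \<le> k"
  shows "(\<Sum>K\<in>tup s. \<Sum>p\<in>I. whit (p # K) (sh p K)) = (if s < k then - ((-1) ^ k * Xs (Suc s)) else 0)"
proof (cases "s < k")
  case True
  have "Xs (Suc s) = (\<Sum>(K, p)\<in>tup s \<times> I. dwhit (p # K) (om (p # K)))"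
    unfolding Xs_def
    by (rule sum.reindex_bij_witness[of _ "\<lambda>(K, p). p # K" "\<lambda>K. (tl K, hd K)"])
       (auto simp: tup_def length_Suc_conv)
  then have "Xs (Suc s) = (\<Sum>K\<in>tup s. \<Sum>p\<in>I. dwhit (p # K) (om (p # K)))"
    by (simp add: sum.cartesian_product)
  moreover have "(\<Sum>K\<in>tup s. \<Sum>p\<in>I. whit (p # K) (sh p K)) =
      (\<Sum>K\<in>tup s. \<Sum>p\<in>I. - ((-1) ^ k * dwhit (p # K) (om (p # K))))"
    using True by (intro sum.cong refl whit_sh[of _ s]) (auto simp: tup_def)
  ultimately show ?thesis using True by (simp add: sum_negf sum_distrib_left)
next
  case False
  then have s: "s = k" using assms by simp
  have "whit (p # K) (sh p K) = 0" if "K \<in> tup s" for p K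
  proof -
    have "whit (p # K) (sh p K) = whit (p # K) (\<lambda>ws. 0)"
      using that s by (intro whit_cong[of _ s]) (auto simp: tup_def sh_top)
    then show ?thesis by (simp add: whit_zero)
  qed
  then show ?thesis using False by simp
qed

text \<open>
  The sum over all \<open>p\<close> is a multiple of \<open>lamI\<close> because \<open>dwhit_sh\<close> kills the defect.  The values
  \<open>p \<in> set K\<close> can be added freely, while \<open>p = j\<close> has to be removed again and is what remains.
\<close>

lemma sum_sh_part:
  assumes "s \<le> k"
  shows "(\<Sum>K\<in>tup s. \<Sum>j\<in>I. \<Sum>p\<in>{..n} - set (j # K). whit (j # K) (sh p K)) =
    lamI * Qs s + (if s < k then (-1) ^ k * Xs (Suc s) else 0)"
proof -
  have "(\<Sum>j\<in>I. \<Sum>p\<in>{..n} - set (j # K). whit (j # K) (sh p K)) =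
     (\<Sum>p\<le>n. lamI * wedge_cov k (map d K) (sh p K) vs) - (\<Sum>p\<in>I. whit (p # K) (sh p K))"
    if K: "K \<in> tup s" for K
  proof -
    have z: "whit (j # K) (sh p K) = 0" if "p \<in> set K" for j p
    proof -
      have "whit (j # K) (sh p K) = whit (j # K) (\<lambda>ws. 0)"
        using K that assms by (intro whit_cong[of _ s]) (auto simp: tup_def intro!: sh_repeat)
      then show ?thesis by (simp add: whit_zero)
    qed
    have "(\<Sum>j\<in>I. \<Sum>p\<in>{..n} - set (j # K). whit (j # K) (sh p K)) =
      (\<Sum>j\<in>I. \<Sum>p\<in>{..n} - {j}. whit (j # K) (sh p K))"
      by (intro sum.cong refl sum.mono_neutral_left) (auto simp: z)
    also have "\<dots> = (\<Sum>j\<in>I. (\<Sum>p\<le>n. whit (j # K) (sh p K)) - whit (j # K) (sh j K))"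
      using I by (intro sum.cong refl) (auto simp: sum_diff1)
    also have "\<dots> = (\<Sum>p\<le>n. \<Sum>j\<in>I. whit (j # K) (sh p K)) - (\<Sum>j\<in>I. whit (j # K) (sh j K))"
      unfolding sum_subtractf by (subst sum.swap) simp
    also have "(\<Sum>p\<le>n. \<Sum>j\<in>I. whit (j # K) (sh p K)) = (\<Sum>p\<le>n. lamI * wedge_cov k (map d K) (sh p K) vs)"
      using K assms by (intro sum.cong refl) (simp add: sum_whit dwhit_sh[of K s] tup_def)
    finally show ?thesis .
  qed
  then have "(\<Sum>K\<in>tup s. \<Sum>j\<in>I. \<Sum>p\<in>{..n} - set (j # K). whit (j # K) (sh p K)) =
     lamI * Qs s - (\<Sum>K\<in>tup s. \<Sum>p\<in>I. whit (p # K) (sh p K))"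
    by (simp add: sum_subtractf Qs_def sum_distrib_left)
  then show ?thesis using sum_whit_sh[OF assms] by simp
qed

lemma level_sum:
  assumes "s \<le> k"
  shows "fact s * (\<Sum>J\<in>Gam s I. \<Sum>p\<in>{..n} - set J. \<Sum>i\<le>s. (-1) ^ i * whit J (edg p (remove_nth i J))) =
    (real n - real s) * (lamI * Ps s - Xs s) + lamI * Qs s + (if s < k then (-1) ^ k * Xs (Suc s) else 0)"
proof -
  define h where "h j K = (\<Sum>p\<in>{..n} - set (j # K). whit (j # K) (edg p K))" for j K
  have "(\<Sum>p\<in>{..n} - set J. \<Sum>i\<le>s. (-1) ^ i * whit J (edg p (remove_nth i J))) =
     (\<Sum>i\<le>s. h (J ! i) (remove_nth i J))" if J: "J \<in> Gam s I" for J
  proof -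
    have l: "length J = Suc s" using J by (simp add: Gam_def)
    have "(-1) ^ i * whit J (edg p (remove_nth i J)) = whit (J ! i # remove_nth i J) (edg p (remove_nth i J))"
      and "set J = set (J ! i # remove_nth i J)" if "i \<le> s" for i p
    proof -
      have J: "take i J @ J ! i # drop (Suc i) J = J" using l that by (simp add: id_take_nth_drop[symmetric])
      then show "set J = set (J ! i # remove_nth i J)"
        unfolding remove_nth_def by (metis Un_insert_right list.simps(15) set_append)
      have "whit ([] @ J ! i # take i J @ drop (Suc i) J) \<beta> = (-1) ^ length (take i J) * whit ([] @ take i J @ J ! i # drop (Suc i) J) \<beta>" for \<beta>
        using l that assms by (intro antisym_list_move[OF antisym_whit[of s]]) auto
      then have "whit (J ! i # remove_nth i J) \<beta> = (-1) ^ i * whit J \<beta>" for \<beta>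
        using l that J by (simp add: remove_nth_def)
      then show "(-1) ^ i * whit J (edg p (remove_nth i J)) = whit (J ! i # remove_nth i J) (edg p (remove_nth i J))"
        by simp
    qed
    then show ?thesis unfolding h_def by (subst sum.swap) (intro sum.cong; auto)
  qed
  then have "fact s * (\<Sum>J\<in>Gam s I. \<Sum>p\<in>{..n} - set J. \<Sum>i\<le>s. (-1) ^ i * whit J (edg p (remove_nth i J))) =
     fact s * (\<Sum>J\<in>Gam s I. \<Sum>i\<le>s. h (J ! i) (remove_nth i J))" by simp
  also have "\<dots> = (\<Sum>K | length K = s \<and> set K \<subseteq> I. \<Sum>j\<in>I. h j K)"
  proof (rule sum_Gam_marked)
    fix j and xs ys :: "nat list" assume l: "length xs = s" and m: "mset xs = mset ys"
    show "h j xs = h j ys"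
    proof (rule symmetric_list_mset[of s "h j", OF _ l m])
      fix us vs' :: "nat list" and a b assume l: "length us + length vs' + 2 = s"
      have st: "set (j # us @ a # b # vs') = set (j # us @ b # a # vs')" by auto
      have e: "whit (j # us @ b # a # vs') (edg p (us @ b # a # vs')) =
            - whit (j # us @ b # a # vs') (edg p (us @ a # b # vs'))" for p
      proof -
        have "whit (j # us @ b # a # vs') (edg p (us @ b # a # vs')) =
            whit (j # us @ b # a # vs') (\<lambda>ws. (-1) * edg p (us @ a # b # vs') ws)"
        proof (rule whit_cong[of _ s])
          fix ws :: "'a list" assume ws: "length ws = k - s"
          have "antisym_list s (\<lambda>zs. Om (map (\<lambda>v. M v + dI v *\<^sub>R e p) ws @ zs))"
            using assms ws alternating_antisym_list[OF alt] by (intro antisym_list_prefix) simp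
          then have "antisym_list s (\<lambda>zs. Om (map (\<lambda>v. M v + dI v *\<^sub>R e p) ws @ map (\<lambda>j. e j - e p) zs))"
            by (rule antisym_list_map)
          from antisym_listD[OF this l, of b a] show "edg p (us @ b # a # vs') ws = (-1) * edg p (us @ a # b # vs') ws"
            unfolding edg_def by simp
        qed (use l assms in auto)
        then show ?thesis unfolding whit_mult by simp
      qed
      have w: "whit (j # us @ a # b # vs') \<beta> = - whit (j # us @ b # a # vs') \<beta>" for \<beta>
        using antisym_listD[OF antisym_whit[OF assms], of "j # us" vs' a b \<beta>] l by simp
      show "h j (us @ a # b # vs') = h j (us @ b # a # vs')"
        unfolding h_def st w e by simp
    qed
  qed (use whit_nondistinct[of "_ # _" s] assms in \<open>auto simp: h_def\<close>)
  also have "\<dots> = (\<Sum>K\<in>tup s. \<Sum>j\<in>I. \<Sum>p\<in>{..n} - set (j # K).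
       whit (j # K) (om K) - (\<Sum>a<s. whit (j # K) (mid a p K)) + whit (j # K) (sh p K))"
    unfolding tup_def[symmetric] h_def using assms
    by (intro sum.cong refl whit_edg) (auto simp: tup_def)
  also have "\<dots> = (\<Sum>K\<in>tup s. \<Sum>j\<in>I. \<Sum>p\<in>{..n} - set (j # K). whit (j # K) (om K))
      - (\<Sum>K\<in>tup s. \<Sum>j\<in>I. \<Sum>p\<in>{..n} - set (j # K). \<Sum>a<s. whit (j # K) (mid a p K))
      + (\<Sum>K\<in>tup s. \<Sum>j\<in>I. \<Sum>p\<in>{..n} - set (j # K). whit (j # K) (sh p K))"
    by (simp only: sum.distrib sum_subtractf)
  also have "(\<Sum>K\<in>tup s. \<Sum>j\<in>I. \<Sum>p\<in>{..n} - set (j # K). \<Sum>a<s. whit (j # K) (mid a p K)) =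
      (\<Sum>a<s. \<Sum>K\<in>tup s. \<Sum>j\<in>I. \<Sum>p\<in>{..n} - set (j # K). whit (j # K) (mid a p K))"
    by (simp only: sum.swap[of _ "{..<s}"])
  also have "\<dots> = 0" using assms by (intro sum.neutral ballI sum_mid_part) auto
  finally show ?thesis
    unfolding sum_om_part[OF assms] sum_sh_part[OF assms]
    by (simp add: Ps_def Xs_def sum_subtractf sum_distrib_left algebra_simps)
qed

lemma level_zero:
  "(\<Sum>J\<in>Gam 0 I. whit J (edg (J ! 0) [])) = lamI * Ps 0 - (if 0 < k then (-1) ^ k * Xs 1 else 0)"
proof -
  have G: "Gam 0 I = (\<lambda>j. [j]) ` I" by (auto simp: Gam_def length_Suc_conv)
  have t: "tup 0 = {[]}" by (auto simp: tup_def)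
  have "(\<Sum>J\<in>Gam 0 I. whit J (edg (J ! 0) [])) = (\<Sum>j\<in>I. whit [j] (edg j []))"
    unfolding G by (subst sum.reindex) (auto simp: inj_on_def)
  also have "\<dots> = (\<Sum>j\<in>I. whit [j] (om [])) + (\<Sum>j\<in>I. whit [j] (sh j []))"
    by (simp add: whit_edg[of "[]" 0, simplified] sum.distrib)
  also have "(\<Sum>j\<in>I. whit [j] (om [])) = lamI * Ps 0"
    using sum_whit[of "[]" "om []"] by (simp add: Ps_def t dwhit_def)
  also have "(\<Sum>j\<in>I. whit [j] (sh j [])) = - (if 0 < k then (-1) ^ k * Xs 1 else 0)"
    using sum_whit_sh[of 0] by (simp add: t)
  finally show ?thesis by simp
qed

text \<open>The factor \<open>1 / fact s\<close> is the volume of the standard simplex over which the operators integrate.\<close>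

definition "leading s = (if s = 0 then (\<Sum>J\<in>Gam 0 I. whit J (edg (J ! 0) []))
   else A_coeff n k s / fact s *
     (\<Sum>J\<in>Gam s I. \<Sum>p\<in>{..n} - set J. \<Sum>i\<le>s. (-1) ^ i * whit J (edg p (remove_nth i J))))"

text \<open>
  With \<open>a s = A_coeff n k s / (fact s)\<^sup>2\<close>, the defect \<open>Xs (s + 1)\<close> appears with the factor
  \<open>(-1)\<^sup>k a s\<close> from level \<open>s\<close> and with \<open>- (n - s - 1) a (s + 1)\<close> from level \<open>s + 1\<close>.  The coefficients satisfy
  exactly the recursion that makes the two equal up to sign.
\<close>

theorem sum_leading:
  "(\<Sum>s\<le>k. leading s) =
     lamI * (Ps 0 + (\<Sum>s=1..k. A_coeff n k s / (fact s)\<^sup>2 * ((real n - real s) * Ps s + Qs s)))"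
proof -
  define a where "a s = A_coeff n k s / (fact s)\<^sup>2" for s
  define X' where "X' s = (if s < k then (-1) ^ k * Xs (Suc s) else 0)" for s
  \<comment> \<open>Level \<open>0\<close> has the coefficient \<open>1\<close>, but enters the telescoping sum through \<open>a 0 = -1\<close>, since its
    defect \<open>Xs 1\<close> has the sign opposite to that of the other levels.\<close>
  have a0: "a 0 = -1" by (simp add: a_def A_coeff_def)
  have a': "a s = (-1) ^ (1 + k * s) / (\<Prod>i=1..s. real n - real i)" for s
    by (simp add: a_def A_coeff_def)
  have rec: "(real n - real (Suc s)) * a (Suc s) = (-1) ^ k * a s" if "Suc s \<le> k" for s
  proof -
    have "real n - real (Suc s) \<noteq> 0" using that kn by simp
    then have "(real n - real (Suc s)) * a (Suc s) = (-1) ^ (1 + k * Suc s) / (\<Prod>i=1..s. real n - real i)"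
      unfolding a' by (simp add: prod.nat_ivl_Suc' del: of_nat_Suc)
    then show ?thesis unfolding a' by (simp add: power_add)
  qed
  have lev: "leading s = a s * (lamI * ((real n - real s) * Ps s + Qs s)) +
      a s * (X' s - (real n - real s) * Xs s)" if s: "s \<in> {1..k}" for s
  proof -
    define T where "T = (\<Sum>J\<in>Gam s I. \<Sum>p\<in>{..n} - set J. \<Sum>i\<le>s. (-1) ^ i * whit J (edg p (remove_nth i J)))"
    have T: "fact s * T = (real n - real s) * (lamI * Ps s - Xs s) + lamI * Qs s + X' s"
      using level_sum[of s] s by (simp add: T_def X'_def)
    have "leading s = A_coeff n k s / fact s * T" using s by (simp add: leading_def T_def)
    also have "\<dots> = a s * (fact s * T)" by (simp add: a_def power2_eq_square)
    finally show ?thesis unfolding T by (simp add: algebra_simps)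
  qed
  have tele: "(\<Sum>s=1..m. a s * (real n - real s) * Xs s) = (\<Sum>s<m. a s * ((-1) ^ k * Xs (Suc s)))"
    if "m \<le> k" for m
    using that
  proof (induction m)
    case (Suc m)
    have "(\<Sum>s=1..Suc m. a s * (real n - real s) * Xs s) =
       (\<Sum>s<m. a s * ((-1) ^ k * Xs (Suc s))) + (real n - real (Suc m)) * a (Suc m) * Xs (Suc m)"
      using Suc by (simp add: mult_ac)
    then show ?case using rec[OF Suc.prems] by (simp add: mult_ac)
  qed simp
  have X: "(\<Sum>s=1..k. a s * X' s) + a 0 * X' 0 = (\<Sum>s<k. a s * ((-1) ^ k * Xs (Suc s)))"
  proof -
    have "(\<Sum>s=1..k. a s * X' s) + a 0 * X' 0 = (\<Sum>s\<le>k. a s * X' s)"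
      by (simp add: sum.atLeast1_atMost_eq sum.atMost_shift)
    also have "\<dots> = (\<Sum>s<k. a s * X' s)" by (simp add: lessThan_Suc_atMost[symmetric] X'_def)
    also have "\<dots> = (\<Sum>s<k. a s * ((-1) ^ k * Xs (Suc s)))" by (simp add: X'_def)
    finally show ?thesis .
  qed
  have "(\<Sum>s\<le>k. leading s) = leading 0 + (\<Sum>s=1..k. leading s)"
    by (simp add: sum.atLeast1_atMost_eq sum.atMost_shift)
  also have "leading 0 = lamI * Ps 0 + a 0 * X' 0"
    using level_zero by (simp add: leading_def a0 X'_def)
  also have "(\<Sum>s=1..k. leading s) = (\<Sum>s=1..k. a s * (lamI * ((real n - real s) * Ps s + Qs s)) +
      a s * (X' s - (real n - real s) * Xs s))"
    by (intro sum.cong refl lev)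
  also have "\<dots> =
      (\<Sum>s=1..k. a s * (lamI * ((real n - real s) * Ps s + Qs s))) +
      ((\<Sum>s=1..k. a s * X' s) - (\<Sum>s=1..k. a s * (real n - real s) * Xs s))"
    unfolding sum.distrib sum_subtractf[symmetric] by (simp add: algebra_simps)
  finally have "(\<Sum>s\<le>k. leading s) = lamI * Ps 0 + (\<Sum>s=1..k. a s * (lamI * ((real n - real s) * Ps s + Qs s)))"
    using tele[of k] X by simp
  then show ?thesis by (simp add: a_def sum_distrib_left distrib_left mult_ac)
qed

end

section \<open>Calculus of smooth functions\<close>

lemma frechet_derivative_local:
  assumes "open U" "y \<in> U" "\<And>z. z \<in> U \<Longrightarrow> f z = g z"
  shows "frechet_derivative f (at y) = frechet_derivative g (at y)"
proof -
  have "(f has_derivative D) (at y) \<longleftrightarrow> (g has_derivative D) (at y)" for D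
    using has_derivative_transform_within_open[of f D y UNIV U g]
          has_derivative_transform_within_open[of g D y UNIV U f] assms by auto
  then show ?thesis by (simp add: frechet_derivative_def)
qed

lemma differentiable_local:
  assumes "open U" "y \<in> U" "\<And>z. z \<in> U \<Longrightarrow> f z = g z" "f differentiable (at y)"
  shows "g differentiable (at y)"
  using has_derivative_transform_within_open[of f _ y UNIV U g] assms
  unfolding differentiable_def by auto

text \<open>
  The derivatives in \<open>Ck_on\<close> are two-sided, so that a change of the function outside the open set \<open>U\<close>
  is harmless.
\<close>

lemma Ck_on_cong:
  assumes "open U" "\<And>z. z \<in> U \<Longrightarrow> f z = g z" "Ck_on m U f"
  shows "Ck_on m U g"
  using assms(2,3)
proof (induction m arbitrary: f g)
  case 0
  then show ?case by (simp cong: continuous_on_cong)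
next
  case (Suc m)
  have "g differentiable (at y)" if "y \<in> U" for y
    using differentiable_local[OF assms(1) that Suc.prems(1)] Suc.prems(2) that by auto
  moreover have "Ck_on m U (\<lambda>y. frechet_derivative g (at y) v)" for v
  proof (rule Suc.IH)
    show "Ck_on m U (\<lambda>y. frechet_derivative f (at y) v)" using Suc.prems(2) by simp
    show "frechet_derivative f (at z) v = frechet_derivative g (at z) v" if "z \<in> U" for z
      using frechet_derivative_local[OF assms(1) that Suc.prems(1)] by simp
  qed
  ultimately show ?case by simp
qed

lemma Ck_on_subset: "Ck_on m U f \<Longrightarrow> V \<subseteq> U \<Longrightarrow> Ck_on m V f"
  by (induction m arbitrary: f) (auto intro: continuous_on_subset)

lemma Ck_on_Suc_lower: "Ck_on (Suc m) U f \<Longrightarrow> Ck_on m U f"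
proof (induction m arbitrary: f)
  case 0
  then show ?case
    by (auto intro!: continuous_at_imp_continuous_on differentiable_imp_continuous_within)
next
  case (Suc m)
  then show ?case by auto
qed

lemma Ck_on_const: "Ck_on m U (\<lambda>_. c)"
  by (induction m arbitrary: c) (auto simp: frechet_derivative_const)

lemma Ck_on_add:
  assumes "open U"
  shows "Ck_on m U f \<Longrightarrow> Ck_on m U g \<Longrightarrow> Ck_on m U (\<lambda>y. f y + g y)"
proof (induction m arbitrary: f g)
  case 0
  then show ?case by (auto intro: continuous_intros)
next
  case (Suc m)
  have "Ck_on m U (\<lambda>y. frechet_derivative (\<lambda>y. f y + g y) (at y) v)" for v
  proof (rule Ck_on_cong[OF assms])
    show "Ck_on m U (\<lambda>y. frechet_derivative f (at y) v + frechet_derivative g (at y) v)"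
      using Suc by auto
    show "frechet_derivative f (at z) v + frechet_derivative g (at z) v =
        frechet_derivative (\<lambda>y. f y + g y) (at z) v" if "z \<in> U" for z
    proof -
      have "f differentiable (at z)" "g differentiable (at z)" using Suc.prems that by auto
      then have "(f has_derivative frechet_derivative f (at z)) (at z)" "(g has_derivative frechet_derivative g (at z)) (at z)"
        by (simp_all only: frechet_derivative_works)
      from frechet_derivative_at[OF has_derivative_add[OF this]] show ?thesis by metis
    qed
  qed
  then show ?case using Suc.prems by auto
qed

lemma Ck_on_mult:
  assumes "open U"
  shows "Ck_on m U f \<Longrightarrow> Ck_on m U g \<Longrightarrow> Ck_on m U (\<lambda>y. f y * g y)"
proof (induction m arbitrary: f g)
  case 0
  then show ?case by (auto intro: continuous_intros)
next
  case (Suc m)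
  have "Ck_on m U (\<lambda>y. frechet_derivative (\<lambda>y. f y * g y) (at y) v)" for v
  proof (rule Ck_on_cong[OF assms])
    have l: "Ck_on m U f" "Ck_on m U g" using Suc.prems Ck_on_Suc_lower by auto
    show "Ck_on m U (\<lambda>y. f y * frechet_derivative g (at y) v + frechet_derivative f (at y) v * g y)"
      using Suc.prems l by (intro Ck_on_add[OF assms] Suc.IH) auto
    fix z assume z: "z \<in> U"
    have "f differentiable (at z)" "g differentiable (at z)" using Suc.prems z by auto
    then have "(f has_derivative frechet_derivative f (at z)) (at z)" "(g has_derivative frechet_derivative g (at z)) (at z)"
      by (simp_all only: frechet_derivative_works)
    then have "((\<lambda>y. f y * g y) has_derivative
        (\<lambda>v. f z * frechet_derivative g (at z) v + frechet_derivative f (at z) v * g z)) (at z)"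
      by (rule has_derivative_mult)
    from frechet_derivative_at[OF this, symmetric]
    show "f z * frechet_derivative g (at z) v + frechet_derivative f (at z) v * g z =
        frechet_derivative (\<lambda>y. f y * g y) (at z) v" by simp
  qed
  then show ?case using Suc.prems by auto
qed

text \<open>
  The extensions whose existence \<open>smooth_on\<close> asserts.  Working with them makes differentiation possible
  and restricts the calculus to open sets.
\<close>

definition smooth_open :: "'a::euclidean_space set \<Rightarrow> ('a \<Rightarrow> real) \<Rightarrow> bool" where
  "smooth_open U f \<longleftrightarrow> open U \<and> (\<forall>m. Ck_on m U f)"

lemma smooth_open_open: "smooth_open U f \<Longrightarrow> open U"
  by (simp add: smooth_open_def)

lemma smooth_openD:
  assumes "smooth_open U f"
  shows "y \<in> U \<Longrightarrow> f differentiable (at y)" "smooth_open U (\<lambda>y. frechet_derivative f (at y) v)"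
    "continuous_on U f"
proof -
  have C: "Ck_on (Suc m) U f" "Ck_on 0 U f" for m using assms by (auto simp: smooth_open_def simp del: Ck_on.simps)
  show "y \<in> U \<Longrightarrow> f differentiable (at y)" "continuous_on U f" using C by auto
  show "smooth_open U (\<lambda>y. frechet_derivative f (at y) v)"
    unfolding smooth_open_def
  proof (intro conjI allI)
    show "open U" using assms by (simp add: smooth_open_def)
    show "Ck_on m U (\<lambda>y. frechet_derivative f (at y) v)" for m using C(1)[of m] by simp
  qed
qed

lemma smooth_open_has_derivative:
  "smooth_open U f \<Longrightarrow> y \<in> U \<Longrightarrow> (f has_derivative frechet_derivative f (at y)) (at y)"
  using smooth_openD(1) frechet_derivative_works by blast

lemma smooth_open_subset: "smooth_open U f \<Longrightarrow> open V \<Longrightarrow> V \<subseteq> U \<Longrightarrow> smooth_open V f"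
  using Ck_on_subset unfolding smooth_open_def by blast

lemma smooth_open_const: "open U \<Longrightarrow> smooth_open U (\<lambda>_. c)"
  by (simp add: smooth_open_def Ck_on_const)

lemma smooth_open_add: "smooth_open U f \<Longrightarrow> smooth_open U g \<Longrightarrow> smooth_open U (\<lambda>y. f y + g y)"
  by (simp add: smooth_open_def Ck_on_add)

lemma smooth_open_mult: "smooth_open U f \<Longrightarrow> smooth_open U g \<Longrightarrow> smooth_open U (\<lambda>y. f y * g y)"
  by (simp add: smooth_open_def Ck_on_mult)

lemma smooth_open_sum:
  "open U \<Longrightarrow> (\<And>i. i \<in> A \<Longrightarrow> smooth_open U (f i)) \<Longrightarrow> smooth_open U (\<lambda>y. \<Sum>i\<in>A. f i y)"
  by (induction A rule: infinite_finite_induct) (auto intro: smooth_open_const smooth_open_add)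

lemma smooth_open_linear:
  assumes "linear f" "open U"
  shows "smooth_open U f"
proof -
  have d: "(f has_derivative f) (at y)" for y
    using assms(1) by (simp add: bounded_linear_imp_has_derivative linear_conv_bounded_linear)
  then have fd: "frechet_derivative f (at y) = f" for y using frechet_derivative_at by metis
  have "Ck_on m U f" for m
  proof (cases m)
    case 0
    then show ?thesis using assms(1) by (simp add: linear_continuous_on linear_conv_bounded_linear)
  next
    case (Suc m')
    then show ?thesis using d by (auto simp: fd Ck_on_const differentiable_def)
  qed
  then show ?thesis using assms by (simp add: smooth_open_def)
qed

text \<open>
  The chain rule expresses the derivative of the composition by sums of products of compositions of
  lower order, which the induction hypothesis covers.
\<close>

lemma Ck_on_compose:
  fixes h :: "'a::euclidean_space \<Rightarrow> 'b::euclidean_space"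
  assumes "open U" "\<And>y. y \<in> U \<Longrightarrow> h y \<in> V"
  shows "Ck_on m V g \<Longrightarrow> (\<And>b. b \<in> Basis \<Longrightarrow> Ck_on m U (\<lambda>y. h y \<bullet> b)) \<Longrightarrow> Ck_on m U (\<lambda>y. g (h y))"
proof (induction m arbitrary: g)
  case 0
  have "continuous_on U h" by (subst continuous_on_componentwise) (use 0 in auto)
  then show ?case using 0 assms by (auto intro!: continuous_on_compose2[of V g])
next
  case (Suc m)
  have dh: "h differentiable (at y)" if "y \<in> U" for y
    using Suc.prems(2) that by (simp add: differentiable_componentwise_within[of h])
  have dg: "g differentiable (at (h y))" if "y \<in> U" for y
    using Suc.prems(1) assms(2)[OF that] by simp
  have diff: "(\<lambda>y. g (h y)) differentiable (at y)" if "y \<in> U" for y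
    using differentiable_chain_at[OF dh[OF that] dg[OF that]] by (simp add: o_def)
  have "Ck_on m U (\<lambda>y. frechet_derivative (\<lambda>y. g (h y)) (at y) v)" for v
  proof (rule Ck_on_cong[OF assms(1)])
    let ?R = "\<lambda>y. \<Sum>b\<in>Basis. frechet_derivative (\<lambda>y. h y \<bullet> b) (at y) v * frechet_derivative g (at (h y)) b"
    have "Ck_on m U (\<lambda>y. frechet_derivative g (at (h y)) b)" for b
    proof (rule Suc.IH)
      show "Ck_on m V (\<lambda>z. frechet_derivative g (at z) b)" using Suc.prems(1) by simp
      show "Ck_on m U (\<lambda>y. h y \<bullet> b)" if "b \<in> Basis" for b
        using Suc.prems(2)[OF that] by (rule Ck_on_Suc_lower)
    qed
    then have prodC: "Ck_on m U (\<lambda>y. frechet_derivative (\<lambda>y. h y \<bullet> b) (at y) v * frechet_derivative g (at (h y)) b)"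
      if "b \<in> Basis" for b
      using that Suc.prems by (intro Ck_on_mult[OF assms(1)]) auto
    have sumC: "Ck_on m U (\<lambda>y. \<Sum>b\<in>A. f b y)" if "\<And>b. b \<in> A \<Longrightarrow> Ck_on m U (f b)" for A f
      using that by (induction A rule: infinite_finite_induct) (auto intro: Ck_on_const Ck_on_add[OF assms(1)])
    show "Ck_on m U ?R" by (rule sumC, rule prodC)
    fix y assume y: "y \<in> U"
    have hd: "(h has_derivative frechet_derivative h (at y)) (at y)"
      using dh[OF y] frechet_derivative_works by blast
    have comp: "frechet_derivative (\<lambda>y. h y \<bullet> b) (at y) v = frechet_derivative h (at y) v \<bullet> b" for b
      using frechet_derivative_at[OF has_derivative_inner_left[OF hd, of b]] by metis
    have lin: "linear (frechet_derivative g (at (h y)))" using dg[OF y] by (rule linear_frechet_derivative)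
    have "frechet_derivative (\<lambda>y. g (h y)) (at y) v = frechet_derivative g (at (h y)) (frechet_derivative h (at y) v)"
      using frechet_derivative_compose[OF dh[OF y] dg[OF y]] by (simp add: o_def)
    also have "\<dots> = frechet_derivative g (at (h y)) (\<Sum>b\<in>Basis. (frechet_derivative h (at y) v \<bullet> b) *\<^sub>R b)"
      by (simp add: euclidean_representation)
    also have "\<dots> = ?R y"
      unfolding linear_sum[OF lin] linear_cmul[OF lin] comp by simp
    finally show "?R y = frechet_derivative (\<lambda>y. g (h y)) (at y) v" by simp
  qed
  then show ?case using diff by simp
qed

lemma smooth_open_compose:
  fixes h :: "'a::euclidean_space \<Rightarrow> 'b::euclidean_space"
  assumes "smooth_open V g" "\<And>b. b \<in> Basis \<Longrightarrow> smooth_open U (\<lambda>y. h y \<bullet> b)" "\<And>y. y \<in> U \<Longrightarrow> h y \<in> V"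
  shows "smooth_open U (\<lambda>y. g (h y))"
proof -
  obtain b :: 'b where "b \<in> Basis" using nonempty_Basis by blast
  then have "open U" using assms(2) smooth_open_open by blast
  moreover have "Ck_on m U (\<lambda>y. g (h y))" for m
    by (rule Ck_on_compose[OF \<open>open U\<close>, of h V]) (use assms in \<open>simp_all add: smooth_open_def\<close>)
  ultimately show ?thesis by (simp add: smooth_open_def)
qed

lemma smooth_on_iff: "smooth_on M f \<longleftrightarrow> (\<exists>U g. smooth_open U g \<and> M \<subseteq> U \<and> (\<forall>y\<in>M. f y = g y))"
  unfolding smooth_on_def smooth_open_def by blast

lemma smooth_on_cong: "smooth_on M f \<Longrightarrow> (\<And>y. y \<in> M \<Longrightarrow> f y = g y) \<Longrightarrow> smooth_on M g"
  unfolding smooth_on_def by metis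

lemma smooth_on_subset: "smooth_on M f \<Longrightarrow> N \<subseteq> M \<Longrightarrow> smooth_on N f"
  unfolding smooth_on_def by blast

lemma smooth_on_const: "smooth_on M (\<lambda>_. c)"
  unfolding smooth_on_iff using smooth_open_const[of UNIV c] by blast

lemma smooth_on_linear: "linear f \<Longrightarrow> smooth_on M f"
  unfolding smooth_on_iff using smooth_open_linear[of f UNIV] by blast

lemma smooth_on_add: "smooth_on M f \<Longrightarrow> smooth_on M g \<Longrightarrow> smooth_on M (\<lambda>y. f y + g y)"
  unfolding smooth_on_iff
proof (elim exE conjE)
  fix U f' V g' assume *: "smooth_open U f'" "M \<subseteq> U" "\<forall>y\<in>M. f y = f' y" "smooth_open V g'" "M \<subseteq> V" "\<forall>y\<in>M. g y = g' y"
  then have "open (U \<inter> V)" using smooth_open_open by blast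
  then have "smooth_open (U \<inter> V) (\<lambda>y. f' y + g' y)"
    using * smooth_open_subset[of U f' "U \<inter> V"] smooth_open_subset[of V g' "U \<inter> V"] by (intro smooth_open_add) auto
  then show "\<exists>U h. smooth_open U h \<and> M \<subseteq> U \<and> (\<forall>y\<in>M. f y + g y = h y)"
    using * by (intro exI[of _ "U \<inter> V"] exI[of _ "\<lambda>y. f' y + g' y"]) auto
qed

lemma smooth_on_mult: "smooth_on M f \<Longrightarrow> smooth_on M g \<Longrightarrow> smooth_on M (\<lambda>y. f y * g y)"
  unfolding smooth_on_iff
proof (elim exE conjE)
  fix U f' V g' assume *: "smooth_open U f'" "M \<subseteq> U" "\<forall>y\<in>M. f y = f' y" "smooth_open V g'" "M \<subseteq> V" "\<forall>y\<in>M. g y = g' y"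
  then have "open (U \<inter> V)" using smooth_open_open by blast
  then have "smooth_open (U \<inter> V) (\<lambda>y. f' y * g' y)"
    using * smooth_open_subset[of U f' "U \<inter> V"] smooth_open_subset[of V g' "U \<inter> V"] by (intro smooth_open_mult) auto
  then show "\<exists>U h. smooth_open U h \<and> M \<subseteq> U \<and> (\<forall>y\<in>M. f y * g y = h y)"
    using * by (intro exI[of _ "U \<inter> V"] exI[of _ "\<lambda>y. f' y * g' y"]) auto
qed

lemma smooth_on_sum: "(\<And>i. i \<in> A \<Longrightarrow> smooth_on M (f i)) \<Longrightarrow> smooth_on M (\<lambda>y. \<Sum>i\<in>A. f i y)"
  by (induction A rule: infinite_finite_induct) (auto intro: smooth_on_const smooth_on_add)

lemma smooth_on_continuous: "smooth_on M f \<Longrightarrow> continuous_on M f"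
  unfolding smooth_on_iff using smooth_openD(3) continuous_on_subset continuous_on_cong by metis

lemma smooth_on_compose:
  fixes h :: "'a::euclidean_space \<Rightarrow> 'b::euclidean_space"
  assumes "smooth_on N g" "\<And>b. b \<in> Basis \<Longrightarrow> smooth_open UNIV (\<lambda>y. h y \<bullet> b)" "\<And>y. y \<in> M \<Longrightarrow> h y \<in> N"
  shows "smooth_on M (\<lambda>y. g (h y))"
proof -
  obtain V g' where V: "smooth_open V g'" "N \<subseteq> V" "\<forall>y\<in>N. g y = g' y"
    using assms(1) unfolding smooth_on_iff by auto
  have "continuous_on UNIV h"
    using assms(2) smooth_openD(3) by (subst continuous_on_componentwise) blast
  then have "open (h -` V)" using V(1) smooth_open_open open_vimage by blast
  then have "smooth_open (h -` V) (\<lambda>y. g' (h y))"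
    using smooth_open_subset[OF assms(2)] by (intro smooth_open_compose[OF V(1)]) auto
  moreover have "M \<subseteq> h -` V" "\<forall>y\<in>M. g (h y) = g' (h y)" using assms(3) V by auto
  ultimately show ?thesis unfolding smooth_on_iff by blast
qed

section \<open>Smooth dependence of integrals on parameters\<close>

lemma integrable_continuous_compact:
  fixes g :: "'b::euclidean_space \<Rightarrow> real"
  assumes "finite_measure \<mu>" and c: "c \<in> borel_measurable \<mu>" and C: "compact C" "c ` space \<mu> \<subseteq> C"
    and g: "continuous_on C g"
  shows "integrable \<mu> (\<lambda>t. g (c t))"
proof -
  interpret finite_measure \<mu> by fact
  have "(\<lambda>z. indicator C z *\<^sub>R g z) \<in> borel_measurable borel"
    using C(1) g by (intro borel_measurable_continuous_on_indicator) (auto intro: borel_compact)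
  from measurable_compose[OF c this] have "(\<lambda>t. indicator C (c t) *\<^sub>R g (c t)) \<in> borel_measurable \<mu>" .
  moreover have "indicator C (c t) *\<^sub>R g (c t) = g (c t)" if "t \<in> space \<mu>" for t using that C(2) by auto
  ultimately have m: "(\<lambda>t. g (c t)) \<in> borel_measurable \<mu>" using measurable_cong[of \<mu> "\<lambda>t. indicator C (c t) *\<^sub>R g (c t)" "\<lambda>t. g (c t)" borel] by blast
  obtain B where "\<And>z. z \<in> C \<Longrightarrow> norm (g z) \<le> B"
    using compact_imp_bounded[OF compact_continuous_image[OF g C(1)]] by (auto simp: bounded_iff)
  then have "AE t in \<mu>. norm (g (c t)) \<le> B" using C(2) by (intro AE_I2) auto
  then show ?thesis using m by (rule integrable_const_bound)
qed

lemma open_parameters: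
  assumes "open W" "compact C"
  shows "open {x. \<forall>z\<in>C. (x, z) \<in> W}"
proof (subst open_subopen, intro ballI)
  fix x assume "x \<in> {x. \<forall>z\<in>C. (x, z) \<in> W}"
  then have "{x} \<times> C \<subseteq> W" by auto
  from Elementary_Topology.tube_lemma[OF assms(2,1) this] obtain X where "x \<in> X" "open X" "X \<times> C \<subseteq> W" by auto
  then show "\<exists>T. open T \<and> x \<in> T \<and> T \<subseteq> {x. \<forall>z\<in>C. (x, z) \<in> W}" by (intro exI[of _ X]) auto
qed

text \<open>
  The integration variable enters only through its image in the compact set \<open>C\<close>.  The partial
  derivatives of \<open>G\<close> are therefore continuous in the parameter uniformly over \<open>C\<close>, which bounds the
  linearisation error of the integrand and hence that of the integral.
\<close>

lemma has_derivative_parameter_integral: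
  fixes G :: "'a::euclidean_space \<times> 'b::euclidean_space \<Rightarrow> real"
  assumes fm: "finite_measure \<mu>" and c: "c \<in> borel_measurable \<mu>" and C: "compact C" "c ` space \<mu> \<subseteq> C"
    and G: "smooth_open W G" and x0: "\<forall>z\<in>C. (x0, z) \<in> W"
  shows "((\<lambda>x. \<integral>t. G (x, c t) \<partial>\<mu>) has_derivative
           (\<lambda>v. \<integral>t. frechet_derivative G (at (x0, c t)) (v, 0) \<partial>\<mu>)) (at x0)"
proof -
  interpret finite_measure \<mu> by fact
  define U where "U = {x. \<forall>z\<in>C. (x, z) \<in> W}"
  have openU: "open U" unfolding U_def using G smooth_open_open C(1) by (intro open_parameters) auto
  have int: "integrable \<mu> (\<lambda>t. g (x, c t))" if "smooth_open W g" "x \<in> U" for g x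
  proof (rule integrable_continuous_compact[OF fm c C])
    have "continuous_on W g" using that smooth_openD(3) by blast
    then show "continuous_on C (\<lambda>z. g (x, z))"
      by (rule continuous_on_compose2[of W g]) (use that(2) in \<open>auto simp: U_def intro!: continuous_intros\<close>)
  qed
  define D where "D v w = frechet_derivative G (at w) (v, 0)" for v w
  have sD: "smooth_open W (D v)" for v unfolding D_def using smooth_openD(2)[OF G] .
  have linD: "linear (\<lambda>v. D v w)" if "w \<in> W" for w
  proof -
    have "linear (frechet_derivative G (at w))"
      using smooth_openD(1)[OF G that] by (rule linear_frechet_derivative)
    moreover have "linear (\<lambda>v::'a. (v, 0::'b))" by (intro linearI) auto
    ultimately show ?thesis unfolding D_def using linear_compose[of "\<lambda>v. (v, 0)"] by (simp add: o_def)
  qed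
  have x0U: "x0 \<in> U" using x0 by (simp add: U_def)
  have cW: "(x, c t) \<in> W" if "x \<in> U" "t \<in> space \<mu>" for x t using that C(2) by (auto simp: U_def)
  have "linear (\<lambda>v. \<integral>t. D v (x0, c t) \<partial>\<mu>)"
  proof (rule linearI)
    fix u v
    have "(\<integral>t. D (u + v) (x0, c t) \<partial>\<mu>) = (\<integral>t. D u (x0, c t) + D v (x0, c t) \<partial>\<mu>)"
      using linear_add[OF linD] cW[OF x0U] by (intro Bochner_Integration.integral_cong) auto
    then show "(\<integral>t. D (u + v) (x0, c t) \<partial>\<mu>) = (\<integral>t. D u (x0, c t) \<partial>\<mu>) + (\<integral>t. D v (x0, c t) \<partial>\<mu>)"
      using int[OF sD x0U] by simp
  next
    fix r v
    have "(\<integral>t. D (r *\<^sub>R v) (x0, c t) \<partial>\<mu>) = (\<integral>t. r * D v (x0, c t) \<partial>\<mu>)"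
      using linear_cmul[OF linD] cW[OF x0U] by (intro Bochner_Integration.integral_cong) auto
    then show "(\<integral>t. D (r *\<^sub>R v) (x0, c t) \<partial>\<mu>) = r *\<^sub>R (\<integral>t. D v (x0, c t) \<partial>\<mu>)" by simp
  qed
  then have bl: "bounded_linear (\<lambda>v. \<integral>t. D v (x0, c t) \<partial>\<mu>)" by (simp add: linear_conv_bounded_linear)
  have "\<exists>\<delta>>0. \<forall>x. norm (x - x0) < \<delta> \<longrightarrow>
      norm ((\<integral>t. G (x, c t) \<partial>\<mu>) - (\<integral>t. G (x0, c t) \<partial>\<mu>) - (\<integral>t. D (x - x0) (x0, c t) \<partial>\<mu>)) \<le> \<epsilon> * norm (x - x0)"
    if "\<epsilon> > 0" for \<epsilon>
  proof -
    define mm where "mm = measure \<mu> (space \<mu>)"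
    define \<eta> where "\<eta> = \<epsilon> / (mm + 1)"
    have mm: "mm \<ge> 0" by (simp add: mm_def)
    then have \<eta>: "\<eta> > 0" and \<eta>mm: "\<eta> * mm \<le> \<epsilon>" using that by (auto simp: \<eta>_def field_simps)
    have "\<exists>X. x0 \<in> X \<and> open X \<and> (\<forall>x\<in>X \<inter> U. \<forall>z\<in>C. dist (D b (x, z)) (D b (x0, z)) \<le> \<eta> / DIM('a))" for b
    proof -
      have cont: "continuous_on (U \<times> C) (D b)"
        using smooth_openD(3)[OF sD] by (rule continuous_on_subset) (auto simp: U_def)
      from \<eta> have "\<eta> / DIM('a) > 0" by simp
      from continuous_on_prod_compactE[OF cont C(1) x0U this] show ?thesis by metis
    qed
    then obtain X where X: "\<And>b. x0 \<in> X b" "\<And>b. open (X b)"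
      "\<And>b x z. x \<in> X b \<inter> U \<Longrightarrow> z \<in> C \<Longrightarrow> dist (D b (x, z)) (D b (x0, z)) \<le> \<eta> / DIM('a)"
      by metis
    have "open (U \<inter> (\<Inter>b\<in>(Basis :: 'a set). X b))" using openU X(2) by (intro open_Int open_INT finite_Basis) auto
    then obtain \<delta> where \<delta>: "\<delta> > 0" "ball x0 \<delta> \<subseteq> U \<inter> (\<Inter>b\<in>(Basis :: 'a set). X b)"
      using X(1) x0U by (meson IntI INT_I open_contains_ball)
    \<comment> \<open>The mean value inequality on the ball, applied to \<open>G\<close> minus its linear part at \<open>x0\<close>.\<close>
    have est: "norm (G (x, z) - G (x0, z) - D (x - x0) (x0, z)) \<le> norm (x - x0) * \<eta>"
      if x: "x \<in> ball x0 \<delta>" and z: "z \<in> C" for x z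
    proof (rule differentiable_bound_linearization[where S = "ball x0 \<delta>" and f' = "\<lambda>x v. D v (x, z)" and f = "\<lambda>x. G (x, z)"])
      show "x0 + t *\<^sub>R (x - x0) \<in> ball x0 \<delta>" if "t \<in> {0..1}" for t
      proof -
        have "norm (t *\<^sub>R (x - x0)) \<le> norm (x - x0)"
          using that by (simp add: mult_left_le_one_le)
        then show ?thesis using x by (simp add: dist_norm norm_minus_commute)
      qed
      show "x0 \<in> ball x0 \<delta>" using \<delta> by simp
      fix y assume y: "y \<in> ball x0 \<delta>"
      then have yU: "y \<in> U" using \<delta> by auto
      then have yW: "(y, z) \<in> W" using z by (auto simp: U_def)
      have "((\<lambda>x. (x, z)) has_derivative (\<lambda>v. (v, 0))) (at y within ball x0 \<delta>)"
        by (auto intro!: derivative_eq_intros)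
      from has_derivative_compose[OF this smooth_open_has_derivative[OF G yW]]
      show "((\<lambda>x. G (x, z)) has_derivative (\<lambda>v. D v (y, z))) (at y within ball x0 \<delta>)"
        by (simp add: D_def)
      show "onorm ((\<lambda>v. D v (y, z)) - (\<lambda>v. D v (x0, z))) \<le> \<eta>"
      proof (rule onorm_le)
        fix v :: 'a
        define R where "R u = D u (y, z) - D u (x0, z)" for u
        have x0W: "(x0, z) \<in> W" using x0 z by auto
        have linR: "linear R" unfolding R_def by (intro linear_compose_sub linD yW x0W)
        have "R v = R (\<Sum>b\<in>Basis. (v \<bullet> b) *\<^sub>R b)" by (simp add: euclidean_representation)
        also have "\<dots> = (\<Sum>b\<in>Basis. (v \<bullet> b) * R b)"
          by (simp add: linear_sum[OF linR] linear_cmul[OF linR])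
        finally have "norm (R v) \<le> (\<Sum>b\<in>Basis. norm ((v \<bullet> b) * R b))" by (simp add: sum_norm_le)
        also have "\<dots> \<le> (\<Sum>b\<in>(Basis :: 'a set). norm v * (\<eta> / DIM('a)))"
        proof (rule sum_mono)
          fix b :: 'a assume b: "b \<in> Basis"
          have "norm (R b) \<le> \<eta> / DIM('a)"
            using X(3)[of y b z] y \<delta> yU z b by (auto simp: R_def dist_norm)
          then show "norm ((v \<bullet> b) * R b) \<le> norm v * (\<eta> / DIM('a))"
            using Basis_le_norm[OF b, of v] by (simp add: abs_mult mult_mono del: times_divide_eq_right)
        qed
        also have "\<dots> = \<eta> * norm v" by simp
        finally show "norm (((\<lambda>v. D v (y, z)) - (\<lambda>v. D v (x0, z))) v) \<le> \<eta> * norm v" by (simp add: R_def)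
      qed
    qed
    show ?thesis
    proof (intro exI[of _ \<delta>] conjI allI impI)
      fix x assume "norm (x - x0) < \<delta>"
      then have x: "x \<in> ball x0 \<delta>" by (simp add: dist_norm norm_minus_commute)
      then have xU: "x \<in> U" using \<delta> by auto
      have i: "integrable \<mu> (\<lambda>t. G (x, c t))" "integrable \<mu> (\<lambda>t. G (x0, c t))" "integrable \<mu> (\<lambda>t. D (x - x0) (x0, c t))"
        using int G sD xU x0U by auto
      have "norm (\<integral>t. G (x, c t) - G (x0, c t) - D (x - x0) (x0, c t) \<partial>\<mu>) \<le>
          (\<integral>t. norm (G (x, c t) - G (x0, c t) - D (x - x0) (x0, c t)) \<partial>\<mu>)"
        by (rule integral_norm_bound)
      also have "\<dots> \<le> (\<integral>t. norm (x - x0) * \<eta> \<partial>\<mu>)"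
        by (rule integral_mono) (use i est[OF x] C(2) in \<open>auto simp del: real_norm_def\<close>)
      also have "\<dots> \<le> \<epsilon> * norm (x - x0)"
        using \<eta>mm by (simp add: mm_def[symmetric]) (metis mult.assoc mult.commute mult_left_mono norm_ge_zero)
      finally show "norm ((\<integral>t. G (x, c t) \<partial>\<mu>) - (\<integral>t. G (x0, c t) \<partial>\<mu>) - (\<integral>t. D (x - x0) (x0, c t) \<partial>\<mu>)) \<le> \<epsilon> * norm (x - x0)"
        using i by simp
    qed (use \<delta> in simp)
  qed
  with bl show ?thesis unfolding has_derivative_at_alt D_def by blast
qed

lemma smooth_open_parameter_integral:
  fixes G :: "'a::euclidean_space \<times> 'b::euclidean_space \<Rightarrow> real"
  assumes fm: "finite_measure \<mu>" and c: "c \<in> borel_measurable \<mu>" and C: "compact C" "c ` space \<mu> \<subseteq> C"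
    and G: "smooth_open W G"
  shows "smooth_open {x. \<forall>z\<in>C. (x, z) \<in> W} (\<lambda>x. \<integral>t. G (x, c t) \<partial>\<mu>)"
proof -
  let ?U = "{x. \<forall>z\<in>C. (x, z) \<in> W}"
  have openU: "open ?U" using G smooth_open_open C(1) by (intro open_parameters) auto
  have der: "((\<lambda>x. \<integral>t. G (x, c t) \<partial>\<mu>) has_derivative
           (\<lambda>v. \<integral>t. frechet_derivative G (at (x, c t)) (v, 0) \<partial>\<mu>)) (at x)" if "smooth_open W G" "x \<in> ?U" for G x
    using has_derivative_parameter_integral[OF fm c C that(1), of x] that(2) by simp
  have "Ck_on m ?U (\<lambda>x. \<integral>t. G (x, c t) \<partial>\<mu>)" if "smooth_open W G" for m G
    using that
  proof (induction m arbitrary: G)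
    case 0
    have "isCont (\<lambda>x. \<integral>t. G (x, c t) \<partial>\<mu>) x" if "x \<in> ?U" for x
      using der[OF 0 that] by (rule has_derivative_continuous)
    then show ?case by (simp add: continuous_at_imp_continuous_on)
  next
    case (Suc m)
    have "Ck_on m ?U (\<lambda>y. frechet_derivative (\<lambda>x. \<integral>t. G (x, c t) \<partial>\<mu>) (at y) v)" for v
    proof (rule Ck_on_cong[OF openU])
      show "Ck_on m ?U (\<lambda>x. \<integral>t. frechet_derivative G (at (x, c t)) (v, 0) \<partial>\<mu>)"
        using smooth_openD(2)[OF Suc.prems, of "(v, 0)"] by (rule Suc.IH)
      show "(\<integral>t. frechet_derivative G (at (z, c t)) (v, 0) \<partial>\<mu>) =
          frechet_derivative (\<lambda>x. \<integral>t. G (x, c t) \<partial>\<mu>) (at z) v" if "z \<in> ?U" for z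
        using frechet_derivative_at[OF der[OF Suc.prems that]] by metis
    qed
    moreover have "(\<lambda>x. \<integral>t. G (x, c t) \<partial>\<mu>) differentiable (at y)" if "y \<in> ?U" for y
      using der[OF Suc.prems that] differentiableI by blast
    ultimately show ?case by simp
  qed
  then show ?thesis using G openU by (simp add: smooth_open_def[of ?U])
qed

lemma smooth_open_compose_linear:
  fixes h :: "'a::euclidean_space \<Rightarrow> 'b::euclidean_space"
  assumes "smooth_open UNIV f" "linear h"
  shows "smooth_open UNIV (\<lambda>p. f (h p))"
proof (rule smooth_open_compose[OF assms(1)])
  fix b :: 'b
  have "linear (\<lambda>y. h y \<bullet> b)"
    using assms(2) by (intro linearI) (auto simp: linear_add linear_cmul inner_add_left)
  then show "smooth_open UNIV (\<lambda>y. h y \<bullet> b)" by (rule smooth_open_linear) simp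
qed simp

text \<open>
  The fundamental theorem of calculus on the segment from \<open>q x\<close> to \<open>q x + l x *\<^sub>R (c t - z0)\<close> gives the
  increment as \<open>l x\<close> times an integral that is smooth in \<open>x\<close>.  Writing the remainder as an integral
  avoids a division by \<open>l x\<close>, which may vanish.
\<close>

lemma hadamard_integral:
  fixes q :: "'a::euclidean_space \<Rightarrow> 'a" and l :: "'a \<Rightarrow> real"
  assumes fm: "finite_measure \<mu>" and c: "c \<in> borel_measurable \<mu>" and C: "compact C" "c ` space \<mu> \<subseteq> C"
    and g: "smooth_open U g"
    and q: "\<And>b. b \<in> Basis \<Longrightarrow> smooth_open UNIV (\<lambda>x. q x \<bullet> b)" and l: "smooth_open UNIV l"
    and inU: "\<And>x y \<sigma>. x \<in> S \<Longrightarrow> y \<in> C \<Longrightarrow> \<sigma> \<in> {0..1} \<Longrightarrow> q x + (\<sigma> * l x) *\<^sub>R (y - z0) \<in> U"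
  shows "\<exists>h. smooth_on S h \<and>
    (\<forall>x\<in>S. (\<integral>t. g (q x + l x *\<^sub>R (c t - z0)) \<partial>\<mu>) = g (q x) * measure \<mu> (space \<mu>) + l x * h x)"
proof -
  interpret \<mu>: finite_measure \<mu> by fact
  define \<Gamma> :: "('a \<times> 'a) \<times> real \<Rightarrow> 'a"
    where "\<Gamma> p = q (fst (fst p)) + (snd p * l (fst (fst p))) *\<^sub>R (snd (fst p) - z0)" for p
  have lin1: "linear (\<lambda>p :: ('a \<times> 'a) \<times> real. fst (fst p))"
    and lin2: "linear (\<lambda>p :: ('a \<times> 'a) \<times> real. snd p)"
    and lin3: "\<And>b. linear (\<lambda>p :: ('a \<times> 'a) \<times> real. snd (fst p) \<bullet> b)"
    by (auto intro!: linearI simp: inner_add_left)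
  have dir: "smooth_open UNIV (\<lambda>p :: ('a \<times> 'a) \<times> real. (snd (fst p) - z0) \<bullet> b)" for b
    using smooth_open_add[OF smooth_open_linear[OF lin3[of b]] smooth_open_const[of UNIV "- (z0 \<bullet> b)"]]
    by (simp add: inner_diff_left)
  have \<Gamma>: "smooth_open UNIV (\<lambda>p. \<Gamma> p \<bullet> b)" if "b \<in> Basis" for b
    using smooth_open_add[OF smooth_open_compose_linear[OF q[OF that] lin1]
        smooth_open_mult[OF smooth_open_mult[OF smooth_open_linear[OF lin2] smooth_open_compose_linear[OF l lin1]] dir[of b]]]
    by (simp add: \<Gamma>_def inner_add_left)
  define W1 where "W1 = \<Gamma> -` U"
  have "continuous_on UNIV \<Gamma>"
    using \<Gamma> smooth_openD(3) by (subst continuous_on_componentwise) blast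
  then have W1: "open W1" unfolding W1_def using smooth_open_open[OF g] by (rule open_vimage[rotated])
  define G where "G p = (\<Sum>b\<in>Basis. frechet_derivative g (at (\<Gamma> p)) b * ((snd (fst p) - z0) \<bullet> b))" for p
  have G: "smooth_open W1 G"
    unfolding G_def
  proof (intro smooth_open_sum W1 smooth_open_mult)
    fix b :: 'a assume "b \<in> Basis"
    show "smooth_open W1 (\<lambda>p. (snd (fst p) - z0) \<bullet> b)" using dir W1 by (rule smooth_open_subset) simp
    show "smooth_open W1 (\<lambda>p. frechet_derivative g (at (\<Gamma> p)) b)"
    proof (rule smooth_open_compose[OF smooth_openD(2)[OF g]])
      show "smooth_open W1 (\<lambda>p. \<Gamma> p \<bullet> b)" if "b \<in> Basis" for b
        using \<Gamma>[OF that] W1 by (rule smooth_open_subset) simp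
    qed (simp add: W1_def)
  qed
  define \<nu> where "\<nu> = restrict_space lborel {0..1 :: real}"
  have fm\<nu>: "finite_measure \<nu>" unfolding \<nu>_def by (intro finite_measure_restrict_space finite_measureI) (auto simp: emeasure_restrict_space)
  have id\<nu>: "(\<lambda>t. t) \<in> borel_measurable \<nu>" unfolding \<nu>_def by (intro measurable_restrict_space1) simp
  have sp\<nu>: "(\<lambda>t. t) ` space \<nu> \<subseteq> {0..1}" by (simp add: \<nu>_def space_restrict_space)
  define W where "W = {w. \<forall>\<sigma>\<in>{0..1}. (w, \<sigma>) \<in> W1}"
  define H where "H w = (\<integral>\<sigma>. G (w, \<sigma>) \<partial>\<nu>)" for w
  have H: "smooth_open W H"
    unfolding W_def H_def by (rule smooth_open_parameter_integral[OF fm\<nu> id\<nu> compact_Icc sp\<nu> G])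
  define V where "V = {x. \<forall>y\<in>C. (x, y) \<in> W}"
  define h where "h x = (\<integral>t. H (x, c t) \<partial>\<mu>)" for x
  have h: "smooth_open V h"
    unfolding V_def h_def by (rule smooth_open_parameter_integral[OF fm c C H])
  have SW: "((x, y), \<sigma>) \<in> W1" if "x \<in> S" "y \<in> C" "\<sigma> \<in> {0..1}" for x y \<sigma>
    using inU[OF that] by (simp add: W1_def \<Gamma>_def)
  have SV: "S \<subseteq> V" using SW by (auto simp: V_def W_def)
  have step: "g (q x + l x *\<^sub>R (y - z0)) = g (q x) + l x * H (x, y)" if x: "x \<in> S" and y: "y \<in> C" for x y
  proof -
    have cont: "continuous_on {0..1} (\<lambda>\<sigma>. l x * G ((x, y), \<sigma>))"
      by (intro continuous_intros continuous_on_compose2[OF smooth_openD(3)[OF G]])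
         (use SW[OF x y] in auto)
    have der: "((\<lambda>\<sigma>. g (\<Gamma> ((x, y), \<sigma>))) has_vector_derivative l x * G ((x, y), \<sigma>)) (at \<sigma> within {0..1})"
      if "\<sigma> \<in> {0..1}" for \<sigma>
    proof -
      have U: "\<Gamma> ((x, y), \<sigma>) \<in> U" using SW[OF x y that] by (simp add: W1_def)
      have lin: "linear (frechet_derivative g (at (\<Gamma> ((x, y), \<sigma>))))"
        using smooth_openD(1)[OF g U] by (rule linear_frechet_derivative)
      have "frechet_derivative g (at (\<Gamma> ((x, y), \<sigma>))) (y - z0) =
          frechet_derivative g (at (\<Gamma> ((x, y), \<sigma>))) (\<Sum>b\<in>Basis. ((y - z0) \<bullet> b) *\<^sub>R b)"
        by (simp only: euclidean_representation)
      also have "\<dots> = G ((x, y), \<sigma>)"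
        by (simp add: linear_sum[OF lin] linear_cmul[OF lin] G_def mult.commute)
      finally have Geq: "G ((x, y), \<sigma>) = frechet_derivative g (at (\<Gamma> ((x, y), \<sigma>))) (y - z0)" by simp
      have "((\<lambda>\<sigma>. \<Gamma> ((x, y), \<sigma>)) has_derivative (\<lambda>s. (s * l x) *\<^sub>R (y - z0))) (at \<sigma> within {0..1})"
        unfolding \<Gamma>_def by (auto intro!: derivative_eq_intros)
      from has_derivative_compose[OF this smooth_open_has_derivative[OF g U]]
      show ?thesis
        by (simp add: has_vector_derivative_def linear_cmul[OF lin] Geq mult_ac)
    qed
    have "integral\<^sup>L lborel (\<lambda>\<sigma>. indicator {0..1} \<sigma> *\<^sub>R (l x * G ((x, y), \<sigma>))) =
       g (\<Gamma> ((x, y), 1)) - g (\<Gamma> ((x, y), 0))"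
      by (rule integral_FTC_atLeastAtMost) (use der cont in auto)
    moreover have "l x * H (x, y) = integral\<^sup>L lborel (\<lambda>\<sigma>. indicator {0..1} \<sigma> *\<^sub>R (l x * G ((x, y), \<sigma>)))"
      unfolding H_def \<nu>_def by (subst integral_restrict_space) (auto simp: mult_ac)
    ultimately show ?thesis by (simp add: \<Gamma>_def)
  qed
  have "(\<integral>t. g (q x + l x *\<^sub>R (c t - z0)) \<partial>\<mu>) = g (q x) * measure \<mu> (space \<mu>) + l x * h x" if x: "x \<in> S" for x
  proof -
    have "(\<integral>t. g (q x + l x *\<^sub>R (c t - z0)) \<partial>\<mu>) = (\<integral>t. g (q x) + l x * H (x, c t) \<partial>\<mu>)"
      using step[OF x] C(2) by (intro Bochner_Integration.integral_cong) auto
    moreover have "integrable \<mu> (\<lambda>t. H (x, c t))"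
    proof (rule integrable_continuous_compact[OF fm c C])
      show "continuous_on C (\<lambda>y. H (x, y))"
        by (rule continuous_on_compose2[OF smooth_openD(3)[OF H]]) (use SV x in \<open>auto simp: V_def intro!: continuous_intros\<close>)
    qed
    ultimately show ?thesis by (simp add: h_def mult.commute)
  qed
  moreover have "smooth_on S h" unfolding smooth_on_iff using h SV by blast
  ultimately show ?thesis by blast
qed

section \<open>Barycentric coordinates\<close>

locale simplex =
  fixes X :: "nat \<Rightarrow> 'a::euclidean_space"
  assumes nondeg: "nondegenerate X"
begin

abbreviation "S \<equiv> the_simplex X"

text \<open>\<open>lin i\<close> is the constant differential of the barycentric coordinate \<open>bary X i\<close>.\<close>

definition "lin i v = bary X i v - bary X i 0"

lemma ex_barycentric_function:
  assumes "i \<le> DIM('a)"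
  shows "\<exists>g c. linear g \<and> (\<forall>j\<le>DIM('a). g (X j) + c = (if i = j then 1 else (0 :: real)))"
proof -
  let ?A = "X ` {..DIM('a)}"
  have inj: "inj_on X {..DIM('a)}" and aff: "\<not> affine_dependent ?A" using nondeg by (auto simp: nondegenerate_def)
  have X0: "X 0 \<in> ?A" by auto
  define B where "B = (\<lambda>x. - X 0 + x) ` (?A - {X 0})"
  have ind: "independent B"
    using affine_dependent_iff_dependent2[OF X0] aff by (simp add: B_def)
  define f :: "'a \<Rightarrow> real" where "f v = (if i = 0 then -1 else if v = X i - X 0 then 1 else 0)" for v
  define g where "g = real_vector.construct B f"
  have lin: "linear g" unfolding g_def by (rule real_vector.linear_construct[OF ind])
  have val: "g (X j - X 0) = f (X j - X 0)" if "j \<le> DIM('a)" "j \<noteq> 0" for j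
  proof -
    have "X j \<noteq> X 0" using inj that by (auto dest: inj_onD)
    then have "X j - X 0 \<in> B" using that unfolding B_def by (intro image_eqI[of _ _ "X j"]) auto
    then show ?thesis unfolding g_def by (rule real_vector.construct_basis[OF ind])
  qed
  have eq: "X j - X 0 = X i - X 0 \<longleftrightarrow> j = i" if "j \<le> DIM('a)" for j using inj that assms by (auto dest: inj_onD)
  define c where "c = (if i = 0 then 1 else 0) - g (X 0)"
  have "g (X j) + c = (if i = j then 1 else 0)" if "j \<le> DIM('a)" for j
  proof (cases "j = 0")
    case False
    have "g (X j) = g (X j - X 0) + g (X 0)" using linear_diff[OF lin, of "X j" "X 0"] by simp
    then show ?thesis using val[OF that False] eq[OF that] False by (auto simp: c_def f_def)
  qed (auto simp: c_def)
  then show ?thesis using lin by blast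
qed

lemma affine_hull_vertices: "affine hull (X ` {..DIM('a)}) = UNIV"
proof -
  have "card (X ` {..DIM('a)}) = DIM('a) + 1" using nondeg by (simp add: nondegenerate_def card_image)
  moreover have "aff_dim (X ` {..DIM('a)}) = int (card (X ` {..DIM('a)})) - 1" 
    using nondeg aff_dim_affine_independent[of "X ` {..DIM('a)}"] by (simp add: nondegenerate_def)
  ultimately have "aff_dim (X ` {..DIM('a)}) = DIM('a)" by simp
  then show ?thesis by (simp add: aff_dim_eq_full)
qed

lemma affine_combination:
  "\<exists>c. (\<Sum>j\<le>DIM('a). c j) = 1 \<and> y = (\<Sum>j\<le>DIM('a). c j *\<^sub>R X j)"
proof -
  have "y \<in> affine hull (X ` {..DIM('a)})" by (simp add: affine_hull_vertices)
  then obtain u where u: "sum u (X ` {..DIM('a)}) = 1" "(\<Sum>v\<in>X ` {..DIM('a)}. u v *\<^sub>R v) = y"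
    by (auto simp: affine_hull_finite)
  have inj: "inj_on X {..DIM('a)}" using nondeg by (simp add: nondegenerate_def)
  show ?thesis using u inj by (intro exI[of _ "u \<circ> X"]) (simp add: sum.reindex)
qed

lemma affine_eqI:
  assumes "linear g" "linear g'" "\<And>j. j \<le> DIM('a) \<Longrightarrow> g (X j) + c = g' (X j) + (c' :: real)"
  shows "g y + c = g' y + c'"
proof -
  obtain a where a: "(\<Sum>j\<le>DIM('a). a j) = 1" "y = (\<Sum>j\<le>DIM('a). a j *\<^sub>R X j)" using affine_combination by blast
  have "f y + b = (\<Sum>j\<le>DIM('a). a j * (f (X j) + b))" if "linear f" for f :: "'a \<Rightarrow> real" and b
    using a by (simp add: linear_sum[OF that] linear_cmul[OF that] distrib_left sum.distrib sum_distrib_right[symmetric])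
  from this[OF assms(1)] this[OF assms(2)] show ?thesis using assms(3) by simp
qed

lemma bary_exists:
  assumes "i \<le> DIM('a)"
  shows "\<exists>g c. linear g \<and> bary X i = (\<lambda>y. g y + c) \<and> (\<forall>j\<le>DIM('a). g (X j) + c = (if i = j then 1 else 0))"
proof -
  obtain g c where g: "linear g" "\<forall>j\<le>DIM('a). g (X j) + c = (if i = j then 1 else (0 :: real))"
    using ex_barycentric_function[OF assms] by blast
  have "bary X i = (\<lambda>y. g y + c)"
    unfolding bary_def
  proof (rule the_equality)
    show "(\<exists>g' c'. linear g' \<and> (\<lambda>y. g y + c) = (\<lambda>y. g' y + c')) \<and> (\<forall>j\<le>DIM('a). g (X j) + c = (if i = j then 1 else 0))"
      using g by blast
    fix l :: "'a \<Rightarrow> real" assume "(\<exists>g c. linear g \<and> l = (\<lambda>y. g y + c)) \<and> (\<forall>j\<le>DIM('a). l (X j) = (if i = j then 1 else 0))"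
    then obtain g' c' where l: "linear g'" "l = (\<lambda>y. g' y + c')" "\<forall>j\<le>DIM('a). g' (X j) + c' = (if i = j then 1 else 0)"
      by auto
    show "l = (\<lambda>y. g y + c)"
    proof
      fix y
      show "l y = g y + c" unfolding l(2) by (rule affine_eqI[OF l(1) g(1)]) (use l(3) g(2) in simp)
    qed
  qed
  then show ?thesis using g by blast
qed

lemma bary_eq: "i \<le> DIM('a) \<Longrightarrow> bary X i y = lin i y + bary X i 0"
  by (simp add: lin_def)

lemma linear_lin: "i \<le> DIM('a) \<Longrightarrow> linear (lin i)"
proof -
  assume "i \<le> DIM('a)"
  then obtain g c where g: "linear g" "bary X i = (\<lambda>y. g y + c)" using bary_exists by blast
  have "lin i v = g v" for v using linear_0[OF g(1)] by (simp add: lin_def g(2))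
  then have "lin i = g" by auto
  then show "linear (lin i)" using g(1) by simp
qed

lemma bary_vertex: "i \<le> DIM('a) \<Longrightarrow> j \<le> DIM('a) \<Longrightarrow> bary X i (X j) = (if i = j then 1 else 0)"
  using bary_exists[of i] by auto

lemma bary_sum_one: "(\<Sum>i\<le>DIM('a). bary X i y) = 1"
proof -
  have "(\<Sum>i\<le>DIM('a). lin i y) + (\<Sum>i\<le>DIM('a). bary X i 0) = (\<lambda>_. 0) y + 1"
  proof (rule affine_eqI)
    show "linear (\<lambda>y. \<Sum>i\<le>DIM('a). lin i y)" using linear_lin by (intro linear_compose_sum) auto
    show "linear (\<lambda>_::'a. 0::real)" by (intro linearI) auto
    fix j assume "j \<le> DIM('a)"
    then show "(\<Sum>i\<le>DIM('a). lin i (X j)) + (\<Sum>i\<le>DIM('a). bary X i 0) = 0 + 1"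
      by (simp add: sum.distrib[symmetric] lin_def bary_vertex)
  qed
  then show ?thesis by (simp add: sum.distrib[symmetric] lin_def)
qed

lemma bary_combination:
  assumes "(\<Sum>j\<le>DIM('a). c j) = 1" "i \<le> DIM('a)"
  shows "bary X i (\<Sum>j\<le>DIM('a). c j *\<^sub>R X j) = c i"
proof -
  have "bary X i (\<Sum>j\<le>DIM('a). c j *\<^sub>R X j) = (\<Sum>j\<le>DIM('a). c j * lin i (X j)) + (\<Sum>j\<le>DIM('a). c j) * bary X i 0"
    using assms linear_lin[OF assms(2)] bary_eq[OF assms(2), of "\<Sum>j\<le>DIM('a). c j *\<^sub>R X j"]
    by (simp add: linear_sum linear_cmul)
  also have "\<dots> = (\<Sum>j\<le>DIM('a). c j * bary X i (X j))"
    unfolding sum_distrib_right sum.distrib[symmetric] distrib_left[symmetric] bary_eq[OF assms(2), symmetric] ..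
  also have "\<dots> = (\<Sum>j\<le>DIM('a). if j = i then c i else 0)" using assms by (intro sum.cong) (auto simp: bary_vertex)
  also have "\<dots> = c i" using assms by simp
  finally show ?thesis .
qed

lemma bary_representation: "(\<Sum>i\<le>DIM('a). bary X i y *\<^sub>R X i) = y"
proof -
  obtain c where c: "(\<Sum>j\<le>DIM('a). c j) = 1" "y = (\<Sum>j\<le>DIM('a). c j *\<^sub>R X j)" using affine_combination by blast
  have "bary X i y = c i" if "i \<le> DIM('a)" for i unfolding c(2) by (rule bary_combination[OF c(1) that])
  then have "(\<Sum>i\<le>DIM('a). bary X i y *\<^sub>R X i) = (\<Sum>i\<le>DIM('a). c i *\<^sub>R X i)" by (intro sum.cong) auto
  then show ?thesis using c(2) by simp
qed

lemma sum_lin: "(\<Sum>i\<le>DIM('a). lin i v) = 0"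
  by (simp add: lin_def sum_subtractf bary_sum_one)

lemma lin_representation: "(\<Sum>i\<le>DIM('a). lin i v *\<^sub>R X i) = v"
  by (simp add: lin_def scaleR_diff_left sum_subtractf bary_representation)

lemma bary_diff: "i \<le> DIM('a) \<Longrightarrow> bary X i y - bary X i z = lin i (y - z)"
  using linear_diff[OF linear_lin, of i y z] by (simp add: lin_def)

lemma lin_vertex_diff: "i \<le> DIM('a) \<Longrightarrow> j \<le> DIM('a) \<Longrightarrow> l \<le> DIM('a) \<Longrightarrow> lin i (X j - X l) = (if i = j then 1 else 0) - (if i = l then 1 else 0)"
  by (simp add: bary_diff[symmetric] bary_vertex)

lemma has_derivative_bary: "i \<le> DIM('a) \<Longrightarrow> (bary X i has_derivative lin i) (at y within T)"
proof -
  assume i: "i \<le> DIM('a)"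
  have "(\<lambda>y. lin i y + bary X i 0) = bary X i" using i by (auto simp: bary_eq[symmetric])
  moreover have "((\<lambda>y. lin i y + bary X i 0) has_derivative lin i) (at y within T)"
    using linear_lin[OF i] by (intro has_derivative_add_const bounded_linear_imp_has_derivative) (simp add: linear_conv_bounded_linear)
  ultimately show ?thesis by simp
qed

lemma dbary_eq: "i \<le> DIM('a) \<Longrightarrow> dbary X i y v = lin i v"
  using frechet_derivative_at[OF has_derivative_bary[of i y UNIV]] by (simp add: dbary_def)

text \<open>Barycentric coordinates are the coefficients of the unique affine combination of the vertices.\<close>

lemma mem_simplex: "y \<in> S \<longleftrightarrow> (\<forall>i\<le>DIM('a). 0 \<le> bary X i y)"
proof
  assume y: "\<forall>i\<le>DIM('a). 0 \<le> bary X i y"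
  have inj: "inj_on X {..DIM('a)}" using nondeg by (simp add: nondegenerate_def)
  have "(\<Sum>i\<le>DIM('a). bary X i y *\<^sub>R X i) \<in> S"
    unfolding the_simplex_def using y bary_sum_one
    by (intro convex_sum convex_convex_hull) (auto intro: hull_inc)
  then show "y \<in> S" by (simp add: bary_representation)
next
  assume y: "y \<in> S"
  show "\<forall>i\<le>DIM('a). 0 \<le> bary X i y"
  proof (intro allI impI)
    fix i assume i: "i \<le> DIM('a)"
    have "S \<subseteq> {y. 0 \<le> bary X i y}"
      unfolding the_simplex_def
    proof (rule hull_minimal)
      show "X ` {..DIM('a)} \<subseteq> {y. 0 \<le> bary X i y}" using i by (auto simp: bary_vertex)
      have "{y. 0 \<le> bary X i y} = lin i -` {- bary X i 0..}" by (auto simp: lin_def)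
      also have "convex \<dots>" using linear_lin[OF i] by (intro convex_linear_vimage) auto
      finally show "convex {y. 0 \<le> bary X i y}" .
    qed
    then show "0 \<le> bary X i y" using y by auto
  qed
qed

lemma vertex_in_simplex: "j \<le> DIM('a) \<Longrightarrow> X j \<in> S"
  by (auto simp: the_simplex_def intro: hull_inc)

lemma compact_simplex: "compact S"
  unfolding the_simplex_def by (intro finite_imp_compact_convex_hull) auto

lemma convex_simplex: "convex S"
  by (simp add: the_simplex_def)

lemma smooth_open_bary: "i \<le> DIM('a) \<Longrightarrow> smooth_open UNIV (bary X i)"
proof -
  assume i: "i \<le> DIM('a)"
  have "smooth_open UNIV (\<lambda>y. lin i y + bary X i 0)"
    using i by (intro smooth_open_add smooth_open_const smooth_open_linear linear_lin) auto
  moreover have "(\<lambda>y. lin i y + bary X i 0) = bary X i" by (simp add: lin_def)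
  ultimately show ?thesis by simp
qed

lemma facet_tangent_iff: "i \<le> DIM('a) \<Longrightarrow> v \<in> facet_tangent X i \<longleftrightarrow> lin i v = 0"
proof
  assume i: "i \<le> DIM('a)"
  assume "v \<in> facet_tangent X i"
  then have "v \<in> span {X a - X b | a b. a \<in> {..DIM('a)} - {i} \<and> b \<in> {..DIM('a)} - {i}}" by (simp add: tangent_def)
  then show "lin i v = 0"
  proof (induction rule: span_induct_alt)
    case base
    then show ?case using linear_0[OF linear_lin[OF i]] by simp
  next
    case (step c x y)
    then have "lin i x = 0" using i by (auto simp: lin_vertex_diff)
    then show ?case using step linear_lin[OF i] by (simp add: linear_add linear_cmul)
  qed
next
  assume i: "i \<le> DIM('a)" and v: "lin i v = 0"
  obtain b where b: "b \<le> DIM('a)" "b \<noteq> i"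
    using DIM_positive[where 'a = 'a] by (metis le0 neq0_conv order_refl)
  have "v = (\<Sum>j\<le>DIM('a). lin j v *\<^sub>R X j) - (\<Sum>j\<le>DIM('a). lin j v) *\<^sub>R X b" by (simp add: sum_lin lin_representation)
  also have "\<dots> = (\<Sum>j\<le>DIM('a). lin j v *\<^sub>R (X j - X b))"
    by (simp add: scaleR_diff_right sum_subtractf scaleR_sum_left)
  also have "\<dots> \<in> facet_tangent X i"
    unfolding tangent_def
  proof (intro span_sum)
    fix j assume j: "j \<in> {..DIM('a)}"
    show "lin j v *\<^sub>R (X j - X b) \<in> span {X a - X b | a b. a \<in> {..DIM('a)} - {i} \<and> b \<in> {..DIM('a)} - {i}}"
    proof (cases "j = i")
      case False
      then show ?thesis using j b by (intro span_scale span_base) auto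
    qed (simp add: v span_zero)
  qed
  finally show "v \<in> facet_tangent X i" .
qed

end

section \<open>Determinants and oriented orthonormal bases\<close>

lemma leibniz_det_transpose: "leibniz_det s (\<lambda>i j. M j i) = leibniz_det s M"
proof -
  have "leibniz_det s (\<lambda>i j. M j i) = (\<Sum>\<sigma> | \<sigma> permutes {..<s}. of_int (sign (inv \<sigma>)) * (\<Prod>i<s. M (inv \<sigma> i) i))"
    unfolding leibniz_det_def by (rule sum_permutations_inverse)
  also have "\<dots> = leibniz_det s M"
    unfolding leibniz_det_def
  proof (intro sum.cong refl)
    fix \<sigma> assume "\<sigma> \<in> {\<sigma>. \<sigma> permutes {..<s}}"
    then have \<sigma>: "\<sigma> permutes {..<s}" by simp
    have "(\<Prod>i<s. M (inv \<sigma> i) i) = (\<Prod>i<s. M (inv \<sigma> (\<sigma> i)) (\<sigma> i))"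
      using prod.permute[OF \<sigma>, of "\<lambda>i. M (inv \<sigma> i) i"] by (simp add: o_def)
    also have "\<dots> = (\<Prod>i<s. M i (\<sigma> i))" using permutes_inverses(2)[OF \<sigma>] by simp
    finally show "of_int (sign (inv \<sigma>)) * (\<Prod>i<s. M (inv \<sigma> i) i) = of_int (sign \<sigma>) * (\<Prod>i<s. M i (\<sigma> i))"
      using \<sigma> permutes_imp_permutation[OF finite_lessThan \<sigma>] by (simp add: sign_inverse)
  qed
  finally show ?thesis .
qed

lemma leibniz_det_cong:
  assumes "\<And>i j. i < s \<Longrightarrow> j < s \<Longrightarrow> M i j = M' i j"
  shows "leibniz_det s M = leibniz_det s M'"
  unfolding leibniz_det_def
proof (intro sum.cong refl)
  fix \<sigma> assume "\<sigma> \<in> {\<sigma>. \<sigma> permutes {..<s}}"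
  then have "\<sigma> i < s" if "i < s" for i using that permutes_in_image[of \<sigma> "{..<s}" i] by simp
  then show "of_int (sign \<sigma>) * (\<Prod>i<s. M i (\<sigma> i)) = of_int (sign \<sigma>) * (\<Prod>i<s. M' i (\<sigma> i))"
    using assms by simp
qed

lemma leibniz_det_identity: "leibniz_det s (\<lambda>i j. if i = j then 1 else 0) = 1"
proof -
  have "(\<Sum>\<sigma> | \<sigma> permutes {..<s}. of_int (sign \<sigma>) * (\<Prod>i<s. if i = \<sigma> i then 1 else 0)) =
     (\<Sum>\<sigma>\<in>{id}. of_int (sign \<sigma>) * (\<Prod>i<s. if i = \<sigma> i then 1 else (0::real)))"
  proof (rule sum.mono_neutral_right)
    show "\<forall>\<sigma>\<in>{\<sigma>. \<sigma> permutes {..<s}} - {id}. of_int (sign \<sigma>) * (\<Prod>i<s. if i = \<sigma> i then 1 else (0::real)) = 0"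
    proof
      fix \<sigma> assume "\<sigma> \<in> {\<sigma>. \<sigma> permutes {..<s}} - {id}"
      then have \<sigma>: "\<sigma> permutes {..<s}" "\<sigma> \<noteq> id" by auto
      then obtain i where i: "\<sigma> i \<noteq> i" by (auto simp: fun_eq_iff)
      then have "i < s" using permutes_not_in[OF \<sigma>(1), of i] by auto
      then have "(\<Prod>i<s. if i = \<sigma> i then 1 else (0::real)) = 0" using i by (intro prod_zero bexI[of _ i]) auto
      then show "of_int (sign \<sigma>) * (\<Prod>i<s. if i = \<sigma> i then 1 else (0::real)) = 0" by simp
    qed
  qed (auto simp: permutes_id finite_permutations)
  then show ?thesis by (simp add: leibniz_det_def sign_id)
qed

lemma alternating_leibniz_det:
  "alternating_on UNIV s (\<lambda>zs. leibniz_det s (\<lambda>i l. zs ! i \<bullet> e l))"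
proof (rule alternating_cong)
  let ?as = "map (\<lambda>l v. v \<bullet> e l) [0..<s]"
  show "alternating_on UNIV s (Alt s (\<lambda>ws. \<Prod>a<length ?as. (?as ! a) (ws ! a)))"
    by (intro alternating_Alt multilin_prod) (auto intro!: linearI simp: inner_add_left)
  fix vs :: "'a list" assume vs: "length vs = s"
  have "Alt s (\<lambda>ws. \<Prod>a<length ?as. (?as ! a) (ws ! a)) vs =
     (\<Sum>\<sigma> | \<sigma> permutes {..<s}. of_int (sign \<sigma>) * (\<Prod>i<s. vs ! \<sigma> i \<bullet> e i))"
    unfolding Alt_def using vs
    by (intro sum.cong refl arg_cong2[where f = "(*)"]) (auto simp: permute_list_nth intro!: prod.cong)
  also have "\<dots> = leibniz_det s (\<lambda>i l. vs ! i \<bullet> e l)"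
    using leibniz_det_transpose[of s "\<lambda>i l. vs ! i \<bullet> e l"] by (simp add: leibniz_det_def)
  finally show "Alt s (\<lambda>ws. \<Prod>a<length ?as. (?as ! a) (ws ! a)) vs = leibniz_det s (\<lambda>i l. vs ! i \<bullet> e l)" .
qed

lemma multilin_prefix:
  assumes "multilin (length us + k) f"
  shows "multilin k (\<lambda>vs. f (us @ vs))"
  unfolding multilin_def
proof (intro allI impI conjI)
  fix vs :: "'a list" and i assume *: "length vs = k" "i < k"
  have u: "us @ vs[i := z] = (us @ vs)[length us + i := z]" for z by (simp add: list_update_append)
  show "f (us @ vs[i := a + b]) = f (us @ vs[i := a]) + f (us @ vs[i := b])" for a b
    unfolding u by (rule multilin_add[OF assms]) (use * in auto)
  show "f (us @ vs[i := c *\<^sub>R a]) = c * f (us @ vs[i := a])" for a c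
    unfolding u by (rule multilin_scale[OF assms]) (use * in auto)
qed

lemma multilin_suffix:
  assumes "multilin (k + length us) f"
  shows "multilin k (\<lambda>vs. f (vs @ us))"
  unfolding multilin_def
proof (intro allI impI conjI)
  fix vs :: "'a list" and i assume *: "length vs = k" "i < k"
  have u: "vs[i := z] @ us = (vs @ us)[i := z]" for z using * by (simp add: list_update_append)
  show "f (vs[i := a + b] @ us) = f (vs[i := a] @ us) + f (vs[i := b] @ us)" for a b
    unfolding u by (rule multilin_add[OF assms]) (use * in auto)
  show "f (vs[i := c *\<^sub>R a] @ us) = c * f (vs[i := a] @ us)" for a c
    unfolding u by (rule multilin_scale[OF assms]) (use * in auto)
qed

lemma multilin_map:
  assumes "multilin k f" "linear g"
  shows "multilin k (\<lambda>vs. f (map g vs))"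
  using assms(1) unfolding multilin_def
  by (auto simp: map_update linear_add[OF assms(2)] linear_cmul[OF assms(2)])

lemma alternating_prefix:
  assumes "alternating_on UNIV (length us + k) f"
  shows "alternating_on UNIV k (\<lambda>vs. f (us @ vs))"
  unfolding alternating_on_UNIV_iff
proof (intro conjI allI impI)
  show "multilin k (\<lambda>vs. f (us @ vs))"
    using assms by (intro multilin_prefix) (simp add: alternating_on_UNIV_iff)
  fix vs :: "'a list" and i j assume *: "length vs = k" "i < k" "j < k" "i \<noteq> j \<and> vs ! i = vs ! j"
  then have "\<not> distinct vs" by (auto simp: distinct_conv_nth)
  then show "f (us @ vs) = 0" using * by (intro alternating_distinct[OF assms]) auto
qed

lemma alternating_expand_lists:
  fixes t :: "nat \<Rightarrow> 'a::real_vector"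
  assumes alt: "alternating_on UNIV k w" and "length ps + length as = k"
  shows "w (ps @ map (\<lambda>a. \<Sum>i<s. a i *\<^sub>R t i) as) =
    (\<Sum>xs | length xs = length as \<and> set xs \<subseteq> {..<s}. (\<Prod>m<length as. (as ! m) (xs ! m)) * w (ps @ map t xs))"
  using assms(2)
proof (induction as arbitrary: ps)
  case Nil
  have "{xs :: nat list. xs = [] \<and> set xs \<subseteq> {..<s}} = {[]}" by auto
  then show ?case by simp
next
  case (Cons a as)
  let ?r = "map (\<lambda>a. \<Sum>i<s. a i *\<^sub>R t i) as"
  let ?L = "\<lambda>m. {xs :: nat list. length xs = m \<and> set xs \<subseteq> {..<s}}"
  have ml: "multilin k w" using alt by (simp add: alternating_on_UNIV_iff)
  define f where "f z = w (ps @ z # ?r)" for z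
  have u: "ps @ z # ?r = (ps @ 0 # ?r)[length ps := z]" for z by (simp add: list_update_append)
  have lin: "linear f"
  proof (rule linearI)
    show "f (x + y) = f x + f y" for x y
      unfolding f_def u[of "x + y"] u[of x] u[of y] by (rule multilin_add[OF ml]) (use Cons.prems in auto)
    show "f (c *\<^sub>R x) = c *\<^sub>R f x" for c x
      unfolding f_def u[of "c *\<^sub>R x"] u[of x] real_scaleR_def by (rule multilin_scale[OF ml]) (use Cons.prems in auto)
  qed
  have "w (ps @ map (\<lambda>a. \<Sum>i<s. a i *\<^sub>R t i) (a # as)) = f (\<Sum>i<s. a i *\<^sub>R t i)" by (simp add: f_def)
  also have "\<dots> = (\<Sum>i<s. a i * f (t i))" by (simp add: linear_sum[OF lin] linear_cmul[OF lin])
  also have "\<dots> = (\<Sum>i<s. \<Sum>xs\<in>?L (length as). a i * ((\<Prod>m<length as. (as ! m) (xs ! m)) * w (ps @ t i # map t xs)))"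
  proof (intro sum.cong refl)
    fix i
    have "f (t i) = w ((ps @ [t i]) @ ?r)" by (simp add: f_def)
    also have "\<dots> = (\<Sum>xs\<in>?L (length as). (\<Prod>m<length as. (as ! m) (xs ! m)) * w ((ps @ [t i]) @ map t xs))"
      using Cons.prems by (intro Cons.IH) simp
    finally show "a i * f (t i) = (\<Sum>xs\<in>?L (length as). a i * ((\<Prod>m<length as. (as ! m) (xs ! m)) * w (ps @ t i # map t xs)))"
      by (simp add: sum_distrib_left)
  qed
  also have "\<dots> = (\<Sum>(i, xs)\<in>{..<s} \<times> ?L (length as). a i * ((\<Prod>m<length as. (as ! m) (xs ! m)) * w (ps @ t i # map t xs)))"
    by (simp add: sum.cartesian_product)
  also have "\<dots> = (\<Sum>xs\<in>?L (length (a # as)). (\<Prod>m<length (a # as). ((a # as) ! m) (xs ! m)) * w (ps @ map t xs))"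
    by (rule sum.reindex_bij_witness[of _ "\<lambda>xs. (hd xs, tl xs)" "\<lambda>(i, xs). i # xs"])
       (auto simp: length_Suc_conv prod.lessThan_Suc_shift simp del: prod.lessThan_Suc)
  finally show ?case .
qed

lemma distinct_lists_permutations:
  "bij_betw (\<lambda>\<sigma>. map \<sigma> [0..<s]) {\<sigma>. \<sigma> permutes {..<s}} {xs. length xs = s \<and> set xs \<subseteq> {..<s} \<and> distinct xs}"
proof (rule bij_betwI')
  fix \<sigma> \<tau> assume \<sigma>: "\<sigma> \<in> {\<sigma>. \<sigma> permutes {..<s}}" and \<tau>: "\<tau> \<in> {\<sigma>. \<sigma> permutes {..<s}}"
  show "(map \<sigma> [0..<s] = map \<tau> [0..<s]) = (\<sigma> = \<tau>)"
  proof
    assume "map \<sigma> [0..<s] = map \<tau> [0..<s]"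
    then have "\<sigma> i = \<tau> i" if "i < s" for i using that by (auto simp: map_eq_conv)
    moreover have "\<sigma> i = \<tau> i" if "\<not> i < s" for i
      using that \<sigma> \<tau> permutes_not_in[of \<sigma> "{..<s}" i] permutes_not_in[of \<tau> "{..<s}" i] by simp
    ultimately show "\<sigma> = \<tau>" by blast
  qed simp
next
  fix \<sigma> assume "\<sigma> \<in> {\<sigma>. \<sigma> permutes {..<s}}"
  then have \<sigma>: "\<sigma> permutes {..<s}" by simp
  have "inj \<sigma>" using \<sigma> by (rule permutes_inj)
  then have "distinct (map \<sigma> [0..<s])" by (simp add: distinct_map inj_on_def)
  moreover have "set (map \<sigma> [0..<s]) \<subseteq> {..<s}" using permutes_image[OF \<sigma>] by (auto simp: atLeast0LessThan)
  ultimately show "map \<sigma> [0..<s] \<in> {xs. length xs = s \<and> set xs \<subseteq> {..<s} \<and> distinct xs}" by simp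
next
  fix xs assume "xs \<in> {xs. length xs = s \<and> set xs \<subseteq> {..<s} \<and> distinct xs}"
  then have xs: "length xs = s" "set xs \<subseteq> {..<s}" "distinct xs" by auto
  define \<sigma> where "\<sigma> i = (if i < s then xs ! i else i)" for i
  have "\<sigma> permutes {..<s}"
  proof (rule bij_imp_permutes)
    have "card (set xs) = card {..<s}" using distinct_card[OF xs(3)] xs(1) by simp
    then have st: "set xs = {..<s}" by (rule card_subset_eq[OF finite_lessThan xs(2)])
    have "bij_betw (\<lambda>i. xs ! i) {..<s} {..<s}"
      by (rule bij_betw_nth[OF xs(3)]) (simp_all only: xs(1) st)
    then show "bij_betw \<sigma> {..<s} {..<s}" by (rule bij_betw_cong[THEN iffD1, rotated]) (simp add: \<sigma>_def)
  qed (simp add: \<sigma>_def)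
  moreover have "xs = map \<sigma> [0..<s]" using xs by (intro nth_equalityI) (auto simp: \<sigma>_def)
  ultimately show "\<exists>\<sigma>\<in>{\<sigma>. \<sigma> permutes {..<s}}. xs = map \<sigma> [0..<s]" by blast
qed

text \<open>
  In the multilinear expansion only the tuples without repetition survive, and these are the
  permutations of the frame.
\<close>

lemma alternating_expand_det:
  assumes alt: "alternating_on UNIV k w" and l: "length ps + s = k" "length ts = s" "length es = s"
    and e: "\<And>l. l < s \<Longrightarrow> es ! l = (\<Sum>i<s. A l i *\<^sub>R ts ! i)"
  shows "w (ps @ es) = leibniz_det s A * w (ps @ ts)"
proof -
  let ?as = "map A [0..<s]" and ?L = "{xs. length xs = s \<and> set xs \<subseteq> {..<s}}"
  let ?f = "\<lambda>xs. (\<Prod>m<s. A m (xs ! m)) * w (ps @ map (\<lambda>i. ts ! i) xs)"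
  have "es = map (\<lambda>a. \<Sum>i<s. a i *\<^sub>R ts ! i) ?as" using l e by (intro nth_equalityI) auto
  then have "w (ps @ es) = (\<Sum>xs\<in>?L. (\<Prod>m<s. (?as ! m) (xs ! m)) * w (ps @ map (\<lambda>i. ts ! i) xs))"
    using alternating_expand_lists[OF alt, of ps ?as "\<lambda>i. ts ! i" s] l by simp
  also have "\<dots> = (\<Sum>xs\<in>?L. ?f xs)" by (intro sum.cong) auto
  also have "\<dots> = (\<Sum>xs | length xs = s \<and> set xs \<subseteq> {..<s} \<and> distinct xs. ?f xs)"
  proof (rule sum.mono_neutral_right)
    show "finite ?L" using finite_lists_length_eq[of "{..<s}" s] by (simp add: conj_commute)
    show "\<forall>xs\<in>?L - {xs. length xs = s \<and> set xs \<subseteq> {..<s} \<and> distinct xs}. ?f xs = 0"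
    proof
      fix xs assume "xs \<in> ?L - {xs. length xs = s \<and> set xs \<subseteq> {..<s} \<and> distinct xs}"
      then have xs: "length xs = s" "\<not> distinct xs" by auto
      have "w (ps @ map (\<lambda>i. ts ! i) xs) = 0"
        using xs l by (intro alternating_distinct[OF alt]) (auto simp: distinct_map)
      then show "?f xs = 0" by simp
    qed
  qed auto
  also have "\<dots> = (\<Sum>\<sigma> | \<sigma> permutes {..<s}. ?f (map \<sigma> [0..<s]))"
    by (rule sum.reindex_bij_betw[OF distinct_lists_permutations, symmetric])
  also have "\<dots> = (\<Sum>\<sigma> | \<sigma> permutes {..<s}. (of_int (sign \<sigma>) * (\<Prod>m<s. A m (\<sigma> m))) * w (ps @ ts))"
  proof (intro sum.cong refl)
    fix \<sigma> assume "\<sigma> \<in> {\<sigma>. \<sigma> permutes {..<s}}"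
    then have \<sigma>: "\<sigma> permutes {..<s}" by simp
    have alt': "alternating_on UNIV s (\<lambda>zs. w (ps @ zs))" using alt l by (intro alternating_prefix) simp
    have "map (\<lambda>i. ts ! i) (map \<sigma> [0..<s]) = permute_list \<sigma> ts" using l by (simp add: permute_list_def)
    then have "w (ps @ map (\<lambda>i. ts ! i) (map \<sigma> [0..<s])) = of_int (sign \<sigma>) * w (ps @ ts)"
      using alternating_permute[OF alt' \<sigma> l(2)] by simp
    then show "?f (map \<sigma> [0..<s]) = (of_int (sign \<sigma>) * (\<Prod>m<s. A m (\<sigma> m))) * w (ps @ ts)" by simp
  qed
  also have "\<dots> = leibniz_det s A * w (ps @ ts)" by (simp add: leibniz_det_def sum_distrib_right)
  finally show ?thesis .
qed

context simplex
begin

abbreviation edges :: "nat list \<Rightarrow> 'a list" where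
  "edges J \<equiv> map (edge X J) [0..<length J - 1]"

lemma edges_Cons: "edges (p # K) = map (\<lambda>j. X j - X p) K"
  by (intro nth_equalityI) (auto simp: edge_def)

lemma edge_in_tangent: "l < length J - 1 \<Longrightarrow> edge X J l \<in> tangent X (set J)"
  unfolding tangent_def edge_def by (rule span_base) (auto intro!: nth_mem exI)

lemma independent_edges:
  assumes "distinct (p # K)" "set (p # K) \<subseteq> {..DIM('a)}"
  shows "independent ((\<lambda>j. X j - X p) ` set K)" "inj_on (\<lambda>j. X j - X p) (set K)"
proof -
  have lv: "lin i (X j - X p) = (if i = j then 1 else 0)" if "i \<in> set K" "j \<in> set K" for i j
  proof -
    have "i \<le> DIM('a)" "j \<le> DIM('a)" "p \<le> DIM('a)" "i \<noteq> p" using that assms by auto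
    then show ?thesis by (simp add: lin_vertex_diff)
  qed
  show inj: "inj_on (\<lambda>j. X j - X p) (set K)"
  proof (rule inj_onI)
    fix i j assume "i \<in> set K" "j \<in> set K" "X i - X p = X j - X p"
    then show "i = j" using lv[of i i] lv[of i j] by (simp split: if_splits)
  qed
  show "independent ((\<lambda>j. X j - X p) ` set K)"
  proof (rule independent_if_scalars_zero)
    fix f v assume s: "(\<Sum>v\<in>(\<lambda>j. X j - X p) ` set K. f v *\<^sub>R v) = 0" and "v \<in> (\<lambda>j. X j - X p) ` set K"
    then obtain i where i: "i \<in> set K" "v = X i - X p" by auto
    have li: "linear (lin i)" using i assms by (intro linear_lin) auto
    have "0 = lin i (\<Sum>j\<in>set K. f (X j - X p) *\<^sub>R (X j - X p))"
      using s inj linear_0[OF li] by (simp add: sum.reindex)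
    also have "\<dots> = (\<Sum>j\<in>set K. f (X j - X p) * lin i (X j - X p))"
      by (simp add: linear_sum[OF li] linear_cmul[OF li])
    also have "\<dots> = (\<Sum>j\<in>set K. if i = j then f (X i - X p) else 0)"
      using lv[OF i(1)] by (intro sum.cong) auto
    also have "\<dots> = f (X i - X p)" using i(1) by simp
    finally show "f v = 0" using i(2) by simp
  qed simp
qed

lemma tangent_Cons: "tangent X (set (p # K)) = span ((\<lambda>j. X j - X p) ` set K)"
proof
  show "span ((\<lambda>j. X j - X p) ` set K) \<subseteq> tangent X (set (p # K))"
    unfolding tangent_def by (rule span_mono) auto
  have "X a - X b \<in> span ((\<lambda>j. X j - X p) ` set K)" if "a \<in> set (p # K)" "b \<in> set (p # K)" for a b
  proof -
    have "X c - X p \<in> span ((\<lambda>j. X j - X p) ` set K)" if "c \<in> set (p # K)" for c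
      using that by (cases "c = p") (auto intro: span_base span_zero)
    from span_diff[OF this[OF that(1)] this[OF that(2)]] show ?thesis by simp
  qed
  then show "tangent X (set (p # K)) \<subseteq> span ((\<lambda>j. X j - X p) ` set K)"
    unfolding tangent_def by (intro span_minimal) auto
qed

lemma dim_tangent:
  assumes "distinct (p # K)" "set (p # K) \<subseteq> {..DIM('a)}"
  shows "dim (tangent X (set (p # K))) = length K"
proof -
  have "card (set K) = length K" using assms(1) by (simp add: distinct_card)
  then show ?thesis
    unfolding tangent_Cons dim_span dim_eq_card_independent[OF independent_edges(1)[OF assms]]
      card_image[OF independent_edges(2)[OF assms]] .
qed

definition "is_onb J ts \<longleftrightarrow> length ts = length J - 1 \<and> set ts \<subseteq> tangent X (set J) \<and>
     (\<forall>i<length ts. \<forall>l<length ts. ts ! i \<bullet> ts ! l = (if i = l then 1 else 0))"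

lemma onb_expand:
  assumes J: "distinct (p # K)" "set (p # K) \<subseteq> {..DIM('a)}" and ts: "is_onb (p # K) ts"
    and v: "v \<in> tangent X (set (p # K))"
  shows "v = (\<Sum>i<length K. (v \<bullet> ts ! i) *\<^sub>R ts ! i)"
proof -
  have len: "length ts = length K" and on: "\<And>i l. i < length ts \<Longrightarrow> l < length ts \<Longrightarrow> ts ! i \<bullet> ts ! l = (if i = l then 1 else 0)"
    and sub: "set ts \<subseteq> tangent X (set (p # K))" using ts by (auto simp: is_onb_def)
  have d: "distinct ts"
    unfolding distinct_conv_nth using on by (metis zero_neq_one)
  have orth: "pairwise orthogonal (set ts)"
    unfolding pairwise_def orthogonal_def by (auto simp: in_set_conv_nth on)
  have nrm: "norm b = 1" if "b \<in> set ts" for b using that on by (auto simp: in_set_conv_nth norm_eq_1)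
  have "independent (set ts)"
    using orth nrm[of 0] by (intro pairwise_orthogonal_independent) auto
  moreover have "card (set ts) = dim (tangent X (set (p # K)))"
    using dim_tangent[OF J] d len by (simp add: distinct_card)
  ultimately have "tangent X (set (p # K)) \<subseteq> span (set ts)"
    using card_eq_dim[OF sub] by simp
  then have "(\<Sum>b\<in>set ts. (v \<bullet> b) *\<^sub>R b) = v"
    using v by (intro orthonormal_basis_expand orth nrm) auto
  also have "(\<Sum>b\<in>set ts. (v \<bullet> b) *\<^sub>R b) = (\<Sum>i<length ts. (v \<bullet> ts ! i) *\<^sub>R ts ! i)"
    using bij_betw_nth[OF d refl refl] by (rule sum.reindex_bij_betw[symmetric])
  finally show ?thesis using len by simp
qed

text \<open>
  The determinant of an orthonormal basis against the edges does not vanish, because the edges form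
  a basis as well; replacing the first vector by its negative corrects the sign.
\<close>

lemma ex_oriented_onb:
  assumes J: "distinct (p # K)" "set (p # K) \<subseteq> {..DIM('a)}"
  shows "\<exists>ts. is_onb (p # K) ts \<and> leibniz_det (length ts) (\<lambda>i l. ts ! i \<bullet> edge X (p # K) l) > 0"
proof -
  let ?T = "tangent X (set (p # K))" and ?s = "length K"
  let ?D = "\<lambda>zs. leibniz_det ?s (\<lambda>i l. zs ! i \<bullet> edge X (p # K) l)"
  have altD: "alternating_on UNIV ?s ?D" by (rule alternating_leibniz_det)
  have "subspace ?T" by (simp add: tangent_def)
  then obtain B where B: "B \<subseteq> ?T" "pairwise orthogonal B" "\<And>x. x \<in> B \<Longrightarrow> norm x = 1" "card B = dim ?T" "independent B"
    using orthonormal_basis_subspace by metis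
  have finB: "finite B" using B(5) by (simp add: independent_imp_finite)
  then obtain ts where ts: "set ts = B" "distinct ts" using finite_distinct_list by blast
  have len: "length ts = ?s" using ts B(4) dim_tangent[OF J] by (simp add: distinct_card[symmetric])
  have onb: "is_onb (p # K) ts"
    unfolding is_onb_def
  proof (intro conjI allI impI)
    fix i l assume il: "i < length ts" "l < length ts"
    show "ts ! i \<bullet> ts ! l = (if i = l then 1 else 0)"
    proof (cases "i = l")
      case True
      then show ?thesis using B(3)[of "ts ! i"] il ts by (auto simp: norm_eq_1)
    next
      case False
      then have "ts ! i \<noteq> ts ! l" using ts il by (simp add: nth_eq_iff_index_eq)
      then show ?thesis using B(2) False il ts nth_mem unfolding pairwise_def orthogonal_def by metis
    qed
  qed (use len ts B in auto)
  have "?D ts \<noteq> 0"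
  proof
    assume zero: "?D ts = 0"
    let ?E = "\<lambda>zs. leibniz_det ?s (\<lambda>i l. zs ! i \<bullet> ts ! l)"
    have altE: "alternating_on UNIV ?s ?E" by (rule alternating_leibniz_det)
    have "?E (edges (p # K)) = leibniz_det ?s (\<lambda>i l. ts ! l \<bullet> edge X (p # K) i)"
      by (intro leibniz_det_cong) (auto simp: inner_commute)
    also have "\<dots> = 0" using zero leibniz_det_transpose[of ?s "\<lambda>i l. ts ! i \<bullet> edge X (p # K) l"] by simp
    finally have E0: "?E (edges (p # K)) = 0" .
    have "\<exists>c. t = (\<Sum>i<?s. c i *\<^sub>R edges (p # K) ! i)" if "t \<in> set ts" for t
    proof -
      have "t \<in> span ((\<lambda>j. X j - X p) ` set K)" using that ts B(1) tangent_Cons by auto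
      then obtain u where u: "t = (\<Sum>v\<in>(\<lambda>j. X j - X p) ` set K. u v *\<^sub>R v)"
        by (auto simp: span_finite)
      also have "\<dots> = (\<Sum>j\<in>set K. u (X j - X p) *\<^sub>R (X j - X p))"
        using independent_edges(2)[OF J] by (simp add: sum.reindex)
      also have "\<dots> = (\<Sum>i<?s. u (X (K ! i) - X p) *\<^sub>R (X (K ! i) - X p))"
        using bij_betw_nth[of K "{..<?s}" "set K"] J
        by (intro sum.reindex_bij_betw[symmetric, where h = "\<lambda>i. K ! i"]) auto
      finally show ?thesis by (intro exI[of _ "\<lambda>i. u (X (K ! i) - X p)"]) (simp add: edge_def)
    qed
    then obtain b where b: "\<And>t. t \<in> set ts \<Longrightarrow> t = (\<Sum>i<?s. b t i *\<^sub>R edges (p # K) ! i)" by metis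
    define c where "c m = b (ts ! m)" for m
    have c: "ts ! m = (\<Sum>i<?s. c m i *\<^sub>R edges (p # K) ! i)" if "m < ?s" for m
      unfolding c_def using that len by (intro b) simp
    have "?E ([] @ ts) = leibniz_det ?s c * ?E ([] @ edges (p # K))"
      by (rule alternating_expand_det[OF altE _ _ _ c]) (use len in auto)
    then have "?E ts = 0" using E0 by simp
    moreover have "?E ts = leibniz_det ?s (\<lambda>i l. if i = l then 1 else 0)"
      using onb len by (intro leibniz_det_cong) (auto simp: is_onb_def)
    ultimately show False by (simp add: leibniz_det_identity)
  qed
  then consider "?D ts > 0" | "?D ts < 0" by linarith
  then show ?thesis
  proof cases
    case 1
    then show ?thesis using onb len by auto
  next
    case 2
    have s: "0 < ?s"
    proof (rule ccontr)
      assume "\<not> 0 < ?s"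
      then have "?s = 0" by simp
      then have "?D ts = 1" using leibniz_det_identity[of 0] by (simp add: leibniz_det_def)
      then show False using 2 by simp
    qed
    let ?us = "ts[0 := (-1) *\<^sub>R ts ! 0]"
    have "?D ?us = (-1) * ?D (ts[0 := ts ! 0])"
      using altD s len by (intro multilin_scale) (auto simp: alternating_on_UNIV_iff)
    then have "?D ?us > 0" using 2 by simp
    moreover have "is_onb (p # K) ?us"
      unfolding is_onb_def
    proof (intro conjI allI impI)
      have "(-1) *\<^sub>R ts ! 0 \<in> ?T" using onb s len unfolding tangent_def is_onb_def
        by (intro span_scale) (auto simp: tangent_def)
      then show "set ?us \<subseteq> ?T" using onb set_update_subset_insert[of ts 0 "(-1) *\<^sub>R ts ! 0"]
        by (auto simp: is_onb_def)
      fix i l assume "i < length ?us" "l < length ?us"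
      then show "?us ! i \<bullet> ?us ! l = (if i = l then 1 else 0)"
        using onb s len by (auto simp: is_onb_def nth_list_update)
    qed (use len in auto)
    ultimately show ?thesis using len by (intro exI[of _ ?us]) auto
  qed
qed

lemma oriented_onb_props:
  assumes "distinct (p # K)" "set (p # K) \<subseteq> {..DIM('a)}"
  shows "is_onb (p # K) (oriented_onb X (p # K))"
    "leibniz_det (length K) (\<lambda>i l. oriented_onb X (p # K) ! i \<bullet> edge X (p # K) l) > 0"
proof -
  let ?ts = "oriented_onb X (p # K)"
  have "?ts = (SOME ts. is_onb (p # K) ts \<and> leibniz_det (length ts) (\<lambda>i l. ts ! i \<bullet> edge X (p # K) l) > 0)"
    unfolding oriented_onb_def is_onb_def conj_assoc ..
  then have "is_onb (p # K) ?ts \<and> leibniz_det (length ?ts) (\<lambda>i l. ?ts ! i \<bullet> edge X (p # K) l) > 0"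
    using someI_ex[OF ex_oriented_onb[OF assms]] by simp
  then show "is_onb (p # K) ?ts" "leibniz_det (length K) (\<lambda>i l. ?ts ! i \<bullet> edge X (p # K) l) > 0"
    by (auto simp: is_onb_def)
qed

text \<open>
  The surface measure factor and the orthonormal frame combine to the wedge of the edge vectors:
  the Gram determinant is the square of the determinant of the edges in the frame.
\<close>

lemma gram_onb:
  assumes J: "distinct (p # K)" "set (p # K) \<subseteq> {..DIM('a)}"
    and alt: "alternating_on UNIV k w" and l: "length vs + length K = k"
  shows "sqrt (leibniz_det (length K) (\<lambda>i l. edge X (p # K) i \<bullet> edge X (p # K) l)) *
           w (vs @ oriented_onb X (p # K)) = w (vs @ edges (p # K))"
proof -
  let ?s = "length K" and ?ts = "oriented_onb X (p # K)" and ?E = "edges (p # K)"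
  let ?A = "\<lambda>l i. ?E ! l \<bullet> ?ts ! i"
  let ?D = "\<lambda>zs. leibniz_det ?s (\<lambda>i l. zs ! i \<bullet> edge X (p # K) l)"
  note onb = oriented_onb_props[OF J]
  have len: "length ?ts = ?s" using onb(1) by (simp add: is_onb_def)
  have e: "?E ! l = (\<Sum>i<?s. ?A l i *\<^sub>R ?ts ! i)" if "l < ?s" for l
    using that edge_in_tangent[of l "p # K"] by (intro onb_expand[OF J onb(1)]) simp
  have "?D ([] @ ?E) = leibniz_det ?s ?A * ?D ([] @ ?ts)"
    by (rule alternating_expand_det[OF alternating_leibniz_det _ _ _ e]) (use len in auto)
  moreover have "leibniz_det ?s ?A = leibniz_det ?s (\<lambda>l i. ?ts ! i \<bullet> edge X (p # K) l)"
    by (intro leibniz_det_cong) (auto simp: inner_commute)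
  then have dA: "leibniz_det ?s ?A = ?D ?ts"
    using leibniz_det_transpose[of ?s "\<lambda>i l. ?ts ! i \<bullet> edge X (p # K) l"] by simp
  moreover have "?D ?E = leibniz_det ?s (\<lambda>i l. edge X (p # K) i \<bullet> edge X (p # K) l)"
    by (intro leibniz_det_cong) auto
  ultimately have "leibniz_det ?s (\<lambda>i l. edge X (p # K) i \<bullet> edge X (p # K) l) = (?D ?ts)\<^sup>2"
    by (simp add: power2_eq_square)
  then have "sqrt (leibniz_det ?s (\<lambda>i l. edge X (p # K) i \<bullet> edge X (p # K) l)) = leibniz_det ?s ?A"
    using onb(2) dA by simp
  moreover have "w (vs @ ?E) = leibniz_det ?s ?A * w (vs @ ?ts)"
    by (rule alternating_expand_det[OF alt _ _ _ e]) (use len l in auto)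
  ultimately show ?thesis by simp
qed

end

section \<open>Integrals over subsimplices\<close>

definition simplex_measure :: "nat \<Rightarrow> (nat \<Rightarrow> real) measure" where
  "simplex_measure s = restrict_space (Pi\<^sub>M {..<s} (\<lambda>_. lborel)) (std_simplex s)"

lemma std_simplex_eq:
  "std_simplex s = {x. (\<forall>i\<in>{..<s}. 0 \<le> x i) \<and> sum x {..<s} \<le> 1} \<inter> space (Pi\<^sub>M {..<s} (\<lambda>_. lborel))"
  by (auto simp: std_simplex_def space_PiM)

lemma sets_std_simplex: "std_simplex s \<in> sets (Pi\<^sub>M {..<s} (\<lambda>_. lborel))"
proof -
  have "{x \<in> space (Pi\<^sub>M {..<s} (\<lambda>_. lborel)). (\<forall>i\<in>{..<s}. 0 \<le> x i) \<and> (\<Sum>i\<in>{..<s}. x i) \<le> (1 :: real)}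
      \<in> sets (Pi\<^sub>M {..<s} (\<lambda>_. lborel))" by measurable
  also have "{x \<in> space (Pi\<^sub>M {..<s} (\<lambda>_. lborel)). (\<forall>i\<in>{..<s}. 0 \<le> x i) \<and> (\<Sum>i\<in>{..<s}. x i) \<le> (1 :: real)} = std_simplex s"
    by (auto simp: std_simplex_eq)
  finally show ?thesis .
qed

lemma space_simplex_measure: "space (simplex_measure s) = std_simplex s"
  using sets.sets_into_space[OF sets_std_simplex, of s]
  by (auto simp: simplex_measure_def space_restrict_space)

lemma emeasure_simplex_measure: "emeasure (simplex_measure s) (std_simplex s) = ennreal (1 / fact s)"
proof -
  have "emeasure (simplex_measure s) (std_simplex s) = emeasure (Pi\<^sub>M {..<s} (\<lambda>_. lborel)) (std_simplex s)"
    unfolding simplex_measure_def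
    using sets_std_simplex by (intro emeasure_restrict_space) (auto simp: sets.sets_into_space Int_absorb2)
  also have "\<dots> = ennreal (1 / fact s)"
    using emeasure_std_simplex_aux[of "{..<s}" 1] by (simp add: std_simplex_eq)
  finally show ?thesis .
qed

lemma finite_simplex_measure: "finite_measure (simplex_measure s)"
  by (intro finite_measureI) (simp add: space_simplex_measure emeasure_simplex_measure)

lemma measure_simplex_measure: "measure (simplex_measure s) (space (simplex_measure s)) = 1 / fact s"
  by (simp add: measure_def space_simplex_measure emeasure_simplex_measure)

lemma LINT_std_simplex:
  fixes f :: "(nat \<Rightarrow> real) \<Rightarrow> real"
  shows "(LINT \<tau>:std_simplex s|Pi\<^sub>M {..<s} (\<lambda>_. lborel). f \<tau>) = integral\<^sup>L (simplex_measure s) f"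
  unfolding set_lebesgue_integral_def simplex_measure_def
  using sets_std_simplex by (subst integral_restrict_space) (auto simp: sets.sets_into_space Int_absorb2)

lemma alternating_project:
  assumes alt: "alternating_on T k w" and pi: "linear \<pi>" "\<And>v. \<pi> v \<in> T"
  shows "alternating_on UNIV k (\<lambda>vs. w (map \<pi> vs))"
  unfolding alternating_on_def
proof (intro allI impI conjI ballI)
  fix vs :: "'b list" and i assume l: "length vs = k \<and> set vs \<subseteq> UNIV" "i < k"
  have m: "length (map \<pi> vs) = k \<and> set (map \<pi> vs) \<subseteq> T" using l pi(2) by auto
  show "w (map \<pi> (vs[i := a + b])) = w (map \<pi> (vs[i := a])) + w (map \<pi> (vs[i := b]))" for a b
    using alt[unfolded alternating_on_def, rule_format, OF m] l pi by (simp add: map_update linear_add[OF pi(1)])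
  show "w (map \<pi> (vs[i := c *\<^sub>R a])) = c * w (map \<pi> (vs[i := a]))" for a c
    using alt[unfolded alternating_on_def, rule_format, OF m] l pi by (simp add: map_update linear_cmul[OF pi(1)])
  fix j assume j: "j < k" "i \<noteq> j \<and> vs ! i = vs ! j"
  then show "w (map \<pi> vs) = 0"
    using alt[unfolded alternating_on_def, rule_format, OF m] l by (metis nth_map)
qed

text \<open>Every added multiple of an entry of \<open>es\<close> produces a repeated argument.\<close>

lemma alternating_absorb:
  assumes alt: "alternating_on UNIV k w" and l: "length vs + length es = k"
    and z: "z = (\<Sum>i<length es. \<tau> i *\<^sub>R es ! i)"
  shows "w (map (\<lambda>v. g v + c v *\<^sub>R z) vs @ es) = w (map g vs @ es)"
proof -
  let ?as = "map g vs @ es" and ?cs = "map c vs @ replicate (length es) 0"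
  have ml: "multilin k w" using alt by (simp add: alternating_on_UNIV_iff)
  have "map (\<lambda>v. g v + c v *\<^sub>R z) vs @ es = map2 (\<lambda>a c. a + c *\<^sub>R z) ?as ?cs"
    by (intro nth_equalityI) (auto simp: nth_append)
  then have "w (map (\<lambda>v. g v + c v *\<^sub>R z) vs @ es) = w ([] @ map2 (\<lambda>a c. a + c *\<^sub>R z) ?as ?cs)" by simp
  also have "\<dots> = w ([] @ ?as) + (\<Sum>m<length ?as. ?cs ! m * w ([] @ ?as[m := z]))"
    using l by (intro alternating_affine[OF alt]) auto
  also have "(\<Sum>m<length ?as. ?cs ! m * w ([] @ ?as[m := z])) = 0"
  proof (intro sum.neutral ballI)
    fix m assume m: "m \<in> {..<length ?as}"
    show "?cs ! m * w ([] @ ?as[m := z]) = 0"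
    proof (cases "m < length vs")
      case True
      define f where "f v = w (?as[m := v])" for v
      have mk: "m < k" "length ?as = k" using True l by auto
      have lin: "linear f"
        unfolding f_def using multilin_add[OF ml mk(2,1)] multilin_scale[OF ml mk(2,1)] by (intro linearI) auto
      have "f (es ! i) = 0" if "i < length es" for i
        unfolding f_def
      proof (rule alternating_distinct[OF alt])
        have "?as[m := es ! i] = (map g vs)[m := es ! i] @ es" using True by (simp add: list_update_append)
        moreover have "es ! i \<in> set ((map g vs)[m := es ! i])" using True by (simp add: set_update_memI)
        ultimately show "\<not> distinct (?as[m := es ! i])" using that nth_mem by auto
      qed (use l in simp)
      then have "f z = 0" unfolding z linear_sum[OF lin] linear_cmul[OF lin] by simp
      then show ?thesis by (simp add: f_def)
    next
      case False
      then show ?thesis using m by (simp add: nth_append)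
    qed
  qed
  finally show ?thesis by simp
qed

context simplex
begin

text \<open>The affine parametrisation of the simplex with the vertices \<open>p # K\<close> over the standard simplex.\<close>

definition simplex_point :: "nat \<Rightarrow> nat list \<Rightarrow> (nat \<Rightarrow> real) \<Rightarrow> 'a" where
  "simplex_point p K \<tau> = X p + (\<Sum>l<length K. \<tau> l *\<^sub>R (X (K ! l) - X p))"

definition hullX :: "nat list \<Rightarrow> 'a set" where
  "hullX J = convex hull (X ` set J)"

lemma compact_hullX: "compact (hullX J)"
  unfolding hullX_def by (intro finite_imp_compact_convex_hull) auto

lemma convex_hullX: "convex (hullX J)"
  by (simp add: hullX_def)

lemma hullX_vertex: "j \<in> set J \<Longrightarrow> X j \<in> hullX J"
  by (auto simp: hullX_def intro: hull_inc)

lemma convex_facet: "i \<le> DIM('a) \<Longrightarrow> convex (facet X i)"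
proof -
  assume i: "i \<le> DIM('a)"
  have "facet X i = S \<inter> lin i -` {- bary X i 0}"
    using i by (auto simp: facet_def lin_def)
  moreover have "convex (lin i -` {- bary X i 0})" using linear_lin[OF i] by (intro convex_linear_vimage) auto
  ultimately show ?thesis using convex_simplex by (simp add: convex_Int)
qed

lemma hullX_facet: "set J \<subseteq> {..DIM('a)} \<Longrightarrow> i \<le> DIM('a) \<Longrightarrow> i \<notin> set J \<Longrightarrow> hullX J \<subseteq> facet X i"
  unfolding hullX_def
  by (rule hull_minimal) (auto simp: facet_def vertex_in_simplex bary_vertex intro: convex_facet[unfolded facet_def])

lemma simplex_point_in_hull:
  assumes "\<tau> \<in> std_simplex (length K)"
  shows "simplex_point p K \<tau> \<in> hullX (p # K)"
proof -
  let ?c = "\<lambda>l. if l = length K then 1 - (\<Sum>i<length K. \<tau> i) else \<tau> l"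
  have "simplex_point p K \<tau> = (\<Sum>l<Suc (length K). ?c l *\<^sub>R X ((K @ [p]) ! l))"
    by (simp add: simplex_point_def nth_append scaleR_diff_right scaleR_diff_left sum_subtractf scaleR_sum_left algebra_simps)
  also have "\<dots> \<in> hullX (p # K)"
    using assms
    by (intro convex_sum convex_hullX hullX_vertex) (auto simp: std_simplex_def nth_append)
  finally show ?thesis .
qed

lemma measurable_simplex_point: "simplex_point p K \<in> borel_measurable (simplex_measure (length K))"
  unfolding simplex_measure_def simplex_point_def
  by (intro measurable_restrict_space1 borel_measurable_add borel_measurable_sum borel_measurable_scaleR
        borel_measurable_const) (auto intro!: measurable_component_singleton)

lemma simplex_point_image: "simplex_point p K ` space (simplex_measure (length K)) \<subseteq> hullX (p # K)"
  using simplex_point_in_hull by (auto simp: space_simplex_measure)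

lemma simplex_integral_eq:
  "simplex_integral X (p # K) g =
     sqrt (leibniz_det (length K) (\<lambda>i l. edge X (p # K) i \<bullet> edge X (p # K) l)) *
     (\<integral>\<tau>. g (simplex_point p K \<tau>) \<partial>simplex_measure (length K))"
  by (simp add: simplex_integral_def LINT_std_simplex simplex_point_def edge_def Let_def)

section \<open>The operators \<open>R\<close>\<close>

text \<open>
  \<open>DFy I y\<close> is the derivative of \<open>Fmap X I _ y\<close>, which is the same at all points, and \<open>linI I\<close> is the
  differential of \<open>bary_sum X I\<close>.
\<close>

definition "linI I v = (\<Sum>i\<in>set I. lin i v)"
definition "DFy I y v = v + (\<Sum>i\<in>set I. lin i v *\<^sub>R (y - X i))"
definition "DF I p = DFy I (X p)"

lemma frechet_derivative_Fmap:
  assumes "set I \<subseteq> {..DIM('a)}"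
  shows "frechet_derivative (\<lambda>x. Fmap X I x y) (at x) = DFy I y"
proof -
  have "((\<lambda>x. Fmap X I x y) has_derivative DFy I y) (at x)"
    unfolding Fmap_def DFy_def[abs_def] using assms
    by (intro has_derivative_add has_derivative_ident has_derivative_sum has_derivative_scaleR_left has_derivative_bary) auto
  then show ?thesis using frechet_derivative_at by metis
qed

lemma linear_DFy:
  assumes "set I \<subseteq> {..DIM('a)}"
  shows "linear (DFy I y)"
  unfolding DFy_def
proof (intro linear_compose_add linear_compose_sum linear_ident ballI)
  fix i assume "i \<in> set I"
  then have l: "linear (lin i)" using assms by (intro linear_lin) auto
  show "linear (\<lambda>v. lin i v *\<^sub>R (y - X i))"
    by (intro linearI) (auto simp: linear_add[OF l] linear_cmul[OF l] scaleR_left_distrib)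
qed

lemma DFy_diff: "DFy I y v = DFy I z v + linI I v *\<^sub>R (y - z)"
proof -
  have "(\<Sum>i\<in>set I. lin i v *\<^sub>R (y - X i)) = (\<Sum>i\<in>set I. lin i v *\<^sub>R (z - X i) + lin i v *\<^sub>R (y - z))"
    by (intro sum.cong refl) (simp add: scaleR_add_right[symmetric])
  then show ?thesis by (simp add: DFy_def linI_def scaleR_sum_left sum.distrib)
qed

lemma bary_Fmap:
  assumes I: "set I \<subseteq> {..DIM('a)}" and j: "j \<le> DIM('a)"
  shows "bary X j (Fmap X I x y) = (if j \<in> set I then 0 else bary X j x) + bary_sum X I x * bary X j y"
proof -
  note l = linear_lin[OF j]
  have "bary X j (Fmap X I x y) = bary X j x + (\<Sum>i\<in>set I. bary X i x * lin j (y - X i))"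
    unfolding Fmap_def bary_eq[OF j, of "x + _"] bary_eq[OF j, of x]
    by (simp add: linear_add[OF l] linear_sum[OF l] linear_cmul[OF l])
  also have "(\<Sum>i\<in>set I. bary X i x * lin j (y - X i)) =
      (\<Sum>i\<in>set I. bary X i x * bary X j y - (if i = j then bary X i x else 0))"
  proof (intro sum.cong refl)
    fix i assume "i \<in> set I"
    then have "lin j (y - X i) = bary X j y - (if j = i then 1 else 0)"
      using I j by (simp add: bary_diff[OF j, symmetric] bary_vertex subset_iff)
    then show "bary X i x * lin j (y - X i) = bary X i x * bary X j y - (if i = j then bary X i x else 0)"
      by (simp add: right_diff_distrib)
  qed
  also have "\<dots> = bary_sum X I x * bary X j y - (if j \<in> set I then bary X j x else 0)"
    by (simp add: sum_subtractf bary_sum_def sum_distrib_right)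
  finally show ?thesis by simp
qed

lemma bary_sum_nonneg: "set I \<subseteq> {..DIM('a)} \<Longrightarrow> x \<in> S \<Longrightarrow> 0 \<le> bary_sum X I x"
  unfolding bary_sum_def by (intro sum_nonneg) (auto simp: mem_simplex)

lemma Fmap_in_facet:
  assumes I: "set I \<subseteq> {..DIM('a)}" and i: "i \<in> set I" and x: "x \<in> S" and y: "y \<in> facet X i"
  shows "Fmap X I x y \<in> facet X i"
proof -
  have "i \<le> DIM('a)" using i I by auto
  have y': "y \<in> S" "bary X i y = 0" using y by (auto simp: facet_def)
  have "0 \<le> bary X j (Fmap X I x y)" if "j \<le> DIM('a)" for j
    using that x y' bary_sum_nonneg[OF I x] by (auto simp: bary_Fmap[OF I] mem_simplex)
  then have "Fmap X I x y \<in> S" by (simp add: mem_simplex)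
  moreover have "bary X i (Fmap X I x y) = 0" using i y' by (simp add: bary_Fmap[OF I \<open>i \<le> DIM('a)\<close>])
  ultimately show ?thesis by (simp add: facet_def)
qed

lemma DFy_in_facet_tangent:
  assumes I: "set I \<subseteq> {..DIM('a)}" and i: "i \<in> set I" and y: "bary X i y = 0"
  shows "DFy I y v \<in> facet_tangent X i"
proof -
  have iD: "i \<le> DIM('a)" using i I by auto
  note l = linear_lin[OF iD]
  have "lin i (DFy I y v) = lin i v + (\<Sum>j\<in>set I. lin j v * lin i (y - X j))"
    unfolding DFy_def by (simp add: linear_add[OF l] linear_sum[OF l] linear_cmul[OF l])
  also have "(\<Sum>j\<in>set I. lin j v * lin i (y - X j)) = (\<Sum>j\<in>set I. if j = i then - lin i v else 0)"
  proof (intro sum.cong refl)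
    fix j assume "j \<in> set I"
    then have "lin i (y - X j) = - (if i = j then 1 else 0)"
      using I iD y by (simp add: bary_diff[OF iD, symmetric] bary_vertex subset_iff)
    then show "lin j v * lin i (y - X j) = (if j = i then - lin i v else 0)" by simp
  qed
  also have "\<dots> = - lin i v" using i by simp
  finally show ?thesis using facet_tangent_iff[OF iD] by simp
qed

text \<open>The projection onto the tangent space of the facet opposite to \<open>X i\<close>, along \<open>X i - X p\<close>.\<close>

definition "proj i p v = v - lin i v *\<^sub>R (X i - X p)"

lemma proj_props:
  assumes "i \<le> DIM('a)" "p \<le> DIM('a)" "i \<noteq> p"
  shows "linear (proj i p)" "proj i p v \<in> facet_tangent X i" "v \<in> facet_tangent X i \<Longrightarrow> proj i p v = v"
proof -
  note l = linear_lin[OF assms(1)]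
  show "linear (proj i p)"
    unfolding proj_def by (intro linearI) (auto simp: linear_add[OF l] linear_cmul[OF l] algebra_simps)
  show "proj i p v \<in> facet_tangent X i"
  proof -
    have "lin i (proj i p v) = lin i v - lin i v * lin i (X i - X p)"
      unfolding proj_def by (simp only: linear_diff[OF l, of v] linear_cmul[OF l] real_scaleR_def)
    then show ?thesis using assms by (simp add: facet_tangent_iff lin_vertex_diff)
  qed
  show "v \<in> facet_tangent X i \<Longrightarrow> proj i p v = v" using assms by (simp add: facet_tangent_iff proj_def)
qed

definition "frame I p K vs = map (DF I p) vs @ map (\<lambda>j. X j - X p) K"

lemma frame_in_facet_tangent:
  assumes I: "set I \<subseteq> {..DIM('a)}" and i: "i \<in> set I" "i \<notin> set (p # K)" and J: "set (p # K) \<subseteq> {..DIM('a)}"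
  shows "set (frame I p K vs) \<subseteq> facet_tangent X i"
proof -
  have iD: "i \<le> DIM('a)" "i \<noteq> p" "p \<le> DIM('a)" using i I J by auto
  have "DF I p v \<in> facet_tangent X i" for v
    unfolding DF_def using iD by (intro DFy_in_facet_tangent I i) (simp add: bary_vertex)
  moreover have "X j - X p \<in> facet_tangent X i" if "j \<in> set K" for j
    using that i J iD by (auto simp: facet_tangent_iff lin_vertex_diff)
  ultimately show ?thesis by (auto simp: frame_def)
qed

text \<open>
  The Gram factor turns the orthonormal frame into the edges of the simplex of integration
  (\<open>gram_onb\<close>).  The derivatives of \<open>Fmap\<close> at two of its points differ by multiples of a tangent vector
  of this simplex (\<open>DFy_diff\<close>), which the edges absorb.
\<close>

lemma R_op_eq:
  assumes I: "set I \<subseteq> {..DIM('a)}" and i: "i \<in> set I" "i \<notin> set (p # K)"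
    and J: "distinct (p # K)" "set (p # K) \<subseteq> {..DIM('a)}"
    and u: "\<And>y. y \<in> facet X i \<Longrightarrow> alternating_on (facet_tangent X i) k (u y)"
    and x: "x \<in> S" and l: "length vs + length K = k"
  shows "R_op X k I (p # K) u x vs = bary_sum X I x ^ length K *
     (\<integral>\<tau>. u (Fmap X I x (simplex_point p K \<tau>)) (frame I p K vs) \<partial>simplex_measure (length K))"
proof -
  let ?s = "length K" and ?E = "map (\<lambda>j. X j - X p) K"
  have iD: "i \<le> DIM('a)" "i \<noteq> p" "p \<le> DIM('a)" using i I J by auto
  show ?thesis
  proof (cases "K = []")
    case True
    interpret finite_measure "simplex_measure 0" by (rule finite_simplex_measure)
    have "R_op X k I (p # K) u x vs = u (Fmap X I x (X p)) (map (DF I p) vs)"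
      by (simp add: R_op_def True pullback_def Pmap_def[abs_def] frechet_derivative_Fmap[OF I] DF_def)
    moreover have "simplex_point p K = (\<lambda>_. X p)" by (simp add: simplex_point_def[abs_def] True)
    ultimately show ?thesis
      using measure_simplex_measure[of 0] by (simp add: True frame_def)
  next
    case False
    have pw: "sqrt (leibniz_det ?s (\<lambda>i l. edge X (p # K) i \<bullet> edge X (p # K) l)) *
        u (Fmap X I x (simplex_point p K \<tau>)) (map (DFy I (simplex_point p K \<tau>)) vs @ oriented_onb X (p # K)) =
        u (Fmap X I x (simplex_point p K \<tau>)) (frame I p K vs)" if \<tau>: "\<tau> \<in> std_simplex ?s" for \<tau>
    proof -
      let ?y = "simplex_point p K \<tau>"
      have y: "?y \<in> facet X i" using simplex_point_in_hull[OF \<tau>] hullX_facet[OF J(2) iD(1) i(2)] by blast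
      \<comment> \<open>The form \<open>u\<close> is alternating only on the tangent space of the facet; the projection extends it to
        the whole space without changing the values that occur here.\<close>
      define w where "w = (\<lambda>zs. u (Fmap X I x ?y) (map (proj i p) zs))"
      have alt: "alternating_on UNIV k w"
        unfolding w_def using iD
        by (intro alternating_project[OF u] proj_props Fmap_in_facet I i x y)
      have weq: "w zs = u (Fmap X I x ?y) zs" if "set zs \<subseteq> facet_tangent X i" for zs
      proof -
        have "map (proj i p) zs = zs" using that iD by (intro map_idI proj_props(3)) auto
        then show ?thesis by (simp add: w_def)
      qed
      have DFt: "DFy I ?y v \<in> facet_tangent X i" for v
        using y by (intro DFy_in_facet_tangent I i) (simp add: facet_def)
      have onbt: "set (oriented_onb X (p # K)) \<subseteq> facet_tangent X i"
      proof -
        have "tangent X (set (p # K)) \<subseteq> facet_tangent X i"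
          unfolding tangent_def using J i by (intro span_mono) auto
        then show ?thesis using oriented_onb_props(1)[OF J] by (auto simp: is_onb_def)
      qed
      have fr: "set (frame I p K vs) \<subseteq> facet_tangent X i" by (rule frame_in_facet_tangent[OF I i J(2)])
      have "sqrt (leibniz_det ?s (\<lambda>i l. edge X (p # K) i \<bullet> edge X (p # K) l)) *
        w (map (DFy I ?y) vs @ oriented_onb X (p # K)) = w (map (DFy I ?y) vs @ ?E)"
        using gram_onb[OF J alt, of "map (DFy I ?y) vs"] l by (simp add: edges_Cons[simplified])
      also have "\<dots> = w (map (DF I p) vs @ ?E)"
      proof -
        have e: "map (DFy I ?y) vs = map (\<lambda>v. DF I p v + linI I v *\<^sub>R (?y - X p)) vs"
          using DFy_diff[of I ?y _ "X p"] by (simp add: DF_def)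
        show ?thesis
          unfolding e by (rule alternating_absorb[OF alt, where \<tau> = \<tau>]) (use l in \<open>auto simp: simplex_point_def\<close>)
      qed
      finally have fin: "sqrt (leibniz_det ?s (\<lambda>i l. edge X (p # K) i \<bullet> edge X (p # K) l)) *
        w (map (DFy I ?y) vs @ oriented_onb X (p # K)) = w (frame I p K vs)" by (simp only: frame_def)
      have "w (map (DFy I ?y) vs @ oriented_onb X (p # K)) = u (Fmap X I x ?y) (map (DFy I ?y) vs @ oriented_onb X (p # K))"
        by (rule weq) (use DFt onbt in auto)
      then show ?thesis using fin weq[OF fr] by simp
    qed
    have "R_op X k I (p # K) u x vs = bary_sum X I x ^ ?s *
       (\<integral>\<tau>. sqrt (leibniz_det ?s (\<lambda>i l. edge X (p # K) i \<bullet> edge X (p # K) l)) *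
        u (Fmap X I x (simplex_point p K \<tau>)) (map (DFy I (simplex_point p K \<tau>)) vs @ oriented_onb X (p # K)) \<partial>simplex_measure ?s)"
      using False l by (simp add: R_op_def Let_def simplex_integral_eq frechet_derivative_Fmap[OF I])
    also have "\<dots> = bary_sum X I x ^ ?s * (\<integral>\<tau>. u (Fmap X I x (simplex_point p K \<tau>)) (frame I p K vs) \<partial>simplex_measure ?s)"
      using pw by (intro arg_cong2[where f = "(*)"] refl Bochner_Integration.integral_cong)
        (auto simp: space_simplex_measure)
    finally show ?thesis .
  qed
qed

end

lemma alternating_sum:
  fixes f :: "'x \<Rightarrow> 'a::real_vector list \<Rightarrow> real"
  assumes "\<And>x. x \<in> A \<Longrightarrow> alternating_on UNIV k (f x)"
  shows "alternating_on UNIV k (\<lambda>vs. \<Sum>x\<in>A. f x vs)"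
  unfolding alternating_on_UNIV_iff
proof (intro conjI allI impI)
  show "multilin k (\<lambda>vs. \<Sum>x\<in>A. f x vs)"
    using assms by (intro multilin_sum) (auto simp: alternating_on_UNIV_iff)
  fix vs :: "'a list" and i j assume "length vs = k" "i < k" "j < k" "i \<noteq> j \<and> vs ! i = vs ! j"
  then show "(\<Sum>x\<in>A. f x vs) = 0" using assms by (intro sum.neutral) (auto simp: alternating_on_UNIV_iff)
qed

lemma alternating_scale:
  assumes "alternating_on UNIV k f"
  shows "alternating_on UNIV k (\<lambda>vs. c * f vs)"
  using assms by (auto simp: alternating_on_UNIV_iff intro: multilin_mult)

lemma wedge_sum_left:
  assumes "length vs = p + q"
  shows "wedge p q (\<lambda>ws. \<Sum>i\<in>A. c i * \<alpha> i ws) \<beta> vs = (\<Sum>i\<in>A. c i * wedge p q (\<alpha> i) \<beta> vs)"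
proof -
  have "wedge p q (\<lambda>ws. \<Sum>i\<in>A. c i * \<alpha> i ws) \<beta> vs =
     Alt (p + q) (\<lambda>ws. \<Sum>i\<in>A. c i * (\<alpha> i (take p ws) * \<beta> (drop p ws))) vs / (fact p * fact q)"
    using assms by (simp add: wedge_eq_Alt sum_distrib_right mult.assoc)
  also have "\<dots> = (\<Sum>i\<in>A. c i * (Alt (p + q) (\<lambda>ws. \<alpha> i (take p ws) * \<beta> (drop p ws)) vs / (fact p * fact q)))"
    by (simp add: Alt_sum Alt_mult sum_divide_distrib)
  finally show ?thesis using assms by (simp add: wedge_eq_Alt)
qed

context simplex
begin

lemma set_Gam: "J \<in> Gam s K \<Longrightarrow> length J = Suc s \<and> set J \<subseteq> K \<and> distinct J"
  by (auto simp: Gam_def strict_sorted_iff)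

lemma remove_nth_props:
  assumes "distinct J" "i < length J"
  shows "distinct (remove_nth i J)" "set (remove_nth i J) \<subseteq> set J" "J ! i \<notin> set (remove_nth i J)"
proof -
  have J: "take i J @ J ! i # drop (Suc i) J = J" using assms(2) by (simp add: id_take_nth_drop[symmetric])
  then have "distinct (take i J @ J ! i # drop (Suc i) J)" using assms(1) by simp
  then show "distinct (remove_nth i J)" "J ! i \<notin> set (remove_nth i J)" by (auto simp: remove_nth_def)
  show "set (remove_nth i J) \<subseteq> set J"
    unfolding remove_nth_def using set_take_subset set_drop_subset by fastforce
qed

section \<open>The terms of the extension operator\<close>

text \<open>
  A single summand of the extension operator; smoothness and the degree bounds are proved separately
  for every \<open>I\<close>.
\<close>

definition I_term :: "nat \<Rightarrow> ('a \<Rightarrow> 'a list \<Rightarrow> real) \<Rightarrow> nat list \<Rightarrow> 'a \<Rightarrow> 'a list \<Rightarrow> real" where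
  "I_term k u I x vs = (\<Sum>s=0..k. \<Sum>J\<in>Gam s (set I).
     wedge s (k - s) (\<lambda>ws. whitney X J x ws / bary_sum X I x ^ (s + 1)) (A_op X k I J u x) vs)"

text \<open>
  The wedge product \<open>\<phi>\<^sub>J \<and> \<beta>\<close>, in the form of an alternating sum to which the cancellation of the
  leading terms applies.
\<close>

definition whitney_wedge :: "nat \<Rightarrow> 'a \<Rightarrow> nat list \<Rightarrow> ('a list \<Rightarrow> real) \<Rightarrow> 'a list \<Rightarrow> real" where
  "whitney_wedge k x J \<beta> vs = alt_sum (\<lambda>j. bary X j x) (\<lambda>L. wedge_cov k (map lin L) \<beta> vs) J"

lemma wedge_whitney:
  assumes vs: "length vs = k" and J: "length J = Suc s" "s \<le> k" "set J \<subseteq> {..DIM('a)}" "distinct J"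
  shows "wedge s (k - s) (\<lambda>ws. whitney X J x ws / a) \<beta> vs = whitney_wedge k x J \<beta> vs / a"
proof -
  have l: "length vs = s + (k - s)" using vs J by simp
  have "wedge s (k - s) (\<lambda>ws. whitney X J x ws / a) \<beta> vs =
     wedge s (k - s) (\<lambda>ws. \<Sum>i<length J. ((-1) ^ i * bary X (J ! i) x / a) * wedge_list (map lin (remove_nth i J)) ws) \<beta> vs"
  proof -
    have m: "map (\<lambda>j. dbary X j x) (remove_nth i J) = map lin (remove_nth i J)" if "i < length J" for i
      using remove_nth_props[OF J(4) that] J(3) by (auto simp: dbary_eq fun_eq_iff)
    have "whitney X J x ws / a = (\<Sum>i<length J. ((-1) ^ i * bary X (J ! i) x / a) * wedge_list (map lin (remove_nth i J)) ws)" for ws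
      unfolding whitney_def sum_divide_distrib by (intro sum.cong refl) (simp add: m)
    then show ?thesis by simp
  qed
  also have "\<dots> = (\<Sum>i<length J. ((-1) ^ i * bary X (J ! i) x / a) * wedge s (k - s) (wedge_list (map lin (remove_nth i J))) \<beta> vs)"
    by (rule wedge_sum_left[OF l])
  also have "\<dots> = (\<Sum>i<length J. ((-1) ^ i * bary X (J ! i) x / a) * wedge_cov k (map lin (remove_nth i J)) \<beta> vs)"
  proof (intro sum.cong refl)
    fix i assume "i \<in> {..<length J}"
    then have "length (map lin (remove_nth i J)) = s" using J by simp
    then show "((-1) ^ i * bary X (J ! i) x / a) * wedge s (k - s) (wedge_list (map lin (remove_nth i J))) \<beta> vs =
         ((-1) ^ i * bary X (J ! i) x / a) * wedge_cov k (map lin (remove_nth i J)) \<beta> vs"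
      using wedge_wedge_list[OF vs, of "map lin (remove_nth i J)" \<beta>] J by simp
  qed
  also have "\<dots> = whitney_wedge k x J \<beta> vs / a"
    by (simp add: whitney_wedge_def alt_sum_def sum_divide_distrib)
  finally show ?thesis .
qed

lemma I_term_eq:
  assumes "length vs = k" "set I \<subseteq> {..DIM('a)}"
  shows "I_term k u I x vs = (\<Sum>s=0..k. \<Sum>J\<in>Gam s (set I). whitney_wedge k x J (A_op X k I J u x) vs / bary_sum X I x ^ (s + 1))"
  unfolding I_term_def
proof (rule sum.cong, rule refl, rule sum.cong, rule refl)
  fix s J assume "s \<in> {0..k}" "J \<in> Gam s (set I)"
  then show "wedge s (k - s) (\<lambda>ws. whitney X J x ws / bary_sum X I x ^ (s + 1)) (A_op X k I J u x) vs =
      whitney_wedge k x J (A_op X k I J u x) vs / bary_sum X I x ^ (s + 1)"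
    using assms set_Gam[of J s "set I"] by (intro wedge_whitney) auto
qed

lemma whitney_wedge_cong:
  assumes "length vs = k" "length J = Suc s" "s \<le> k" "\<And>ws. length ws = k - s \<Longrightarrow> \<beta> ws = \<beta>' ws"
  shows "whitney_wedge k x J \<beta> vs = whitney_wedge k x J \<beta>' vs"
  unfolding whitney_wedge_def using assms by (intro alt_sum_cong wedge_cov_cong) auto

lemma whitney_wedge_add: "whitney_wedge k x J (\<lambda>ws. \<beta> ws + \<beta>' ws) vs = whitney_wedge k x J \<beta> vs + whitney_wedge k x J \<beta>' vs"
  by (simp add: whitney_wedge_def wedge_cov_add alt_sum_add)

lemma whitney_wedge_mult: "whitney_wedge k x J (\<lambda>ws. c * \<beta> ws) vs = c * whitney_wedge k x J \<beta> vs"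
  by (simp add: whitney_wedge_def wedge_cov_mult alt_sum_mult)

lemma whitney_wedge_sum: "whitney_wedge k x J (\<lambda>ws. \<Sum>y\<in>A. \<beta> y ws) vs = (\<Sum>y\<in>A. whitney_wedge k x J (\<beta> y) vs)"
  by (simp add: whitney_wedge_def wedge_cov_sum alt_sum_sum)

lemma smooth_on_bary: "i \<le> DIM('a) \<Longrightarrow> smooth_on M (bary X i)"
  unfolding smooth_on_iff using smooth_open_bary by blast

lemma smooth_on_cmult: "smooth_on M f \<Longrightarrow> smooth_on M (\<lambda>y. c * f y)"
  by (intro smooth_on_mult smooth_on_const)

lemma smooth_wedge_cov:
  assumes "length vs = k" "length as \<le> k" "\<And>ws. length ws = k - length as \<Longrightarrow> smooth_on M (\<beta> ws)"
  shows "smooth_on M (\<lambda>x. wedge_cov k as (\<lambda>ws. \<beta> ws x) vs)"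
proof -
  have "smooth_on M (\<lambda>x. inverse (fact (k - length as)) * Alt k (\<lambda>ws. (\<Prod>a<length as. (as ! a) (ws ! a)) * \<beta> (drop (length as) ws) x) vs)"
    unfolding Alt_def using assms by (intro smooth_on_cmult smooth_on_sum) auto
  then show ?thesis by (simp add: wedge_cov_def divide_inverse mult.commute)
qed

lemma smooth_whitney_wedge:
  assumes "length vs = k" "length J = Suc s" "s \<le> k" "set J \<subseteq> {..DIM('a)}"
    "\<And>ws. length ws = k - s \<Longrightarrow> smooth_on M (\<beta> ws)"
  shows "smooth_on M (\<lambda>x. whitney_wedge k x J (\<lambda>ws. \<beta> ws x) vs)"
  unfolding whitney_wedge_def alt_sum_def
proof (intro smooth_on_sum)
  fix i assume i: "i \<in> {..<length J}"
  have "J ! i \<le> DIM('a)" using i assms(4) nth_mem by fastforce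
  then show "smooth_on M (\<lambda>x. (-1) ^ i * bary X (J ! i) x * wedge_cov k (map lin (remove_nth i J)) (\<lambda>ws. \<beta> ws x) vs)"
    using assms i by (intro smooth_on_mult smooth_on_const smooth_on_bary smooth_wedge_cov) auto
qed

lemma Fmap_diff: "Fmap X I x y = Fmap X I x z + bary_sum X I x *\<^sub>R (y - z)"
proof -
  have "(\<Sum>i\<in>set I. bary X i x *\<^sub>R (y - X i)) = (\<Sum>i\<in>set I. bary X i x *\<^sub>R (z - X i) + bary X i x *\<^sub>R (y - z))"
    by (intro sum.cong refl) (simp add: scaleR_add_right[symmetric])
  then show ?thesis by (simp add: Fmap_def bary_sum_def scaleR_sum_left sum.distrib)
qed

lemma smooth_open_bary_sum: "set I \<subseteq> {..DIM('a)} \<Longrightarrow> smooth_open UNIV (bary_sum X I)"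
  unfolding bary_sum_def[abs_def] by (intro smooth_open_sum smooth_open_bary) auto

lemma smooth_open_Fmap:
  assumes "set I \<subseteq> {..DIM('a)}"
  shows "smooth_open UNIV (\<lambda>x. Fmap X I x y \<bullet> b)"
proof -
  have "linear (\<lambda>x. x \<bullet> b)" by (intro linearI) (auto simp: inner_add_left)
  then have "smooth_open UNIV (\<lambda>x. x \<bullet> b + (\<Sum>i\<in>set I. bary X i x * ((y - X i) \<bullet> b)))"
    using assms
    by (intro smooth_open_add smooth_open_linear smooth_open_sum smooth_open_mult smooth_open_const smooth_open_bary) auto
  then show ?thesis by (simp add: Fmap_def inner_add_left inner_sum_left)
qed

lemma Lam_bdD:
  assumes "u \<in> Lam_bd X k" "i \<le> DIM('a)"
  shows "y \<in> facet X i \<Longrightarrow> alternating_on (facet_tangent X i) k (u y)"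
    "length vs = k \<Longrightarrow> set vs \<subseteq> facet_tangent X i \<Longrightarrow> smooth_on (facet X i) (\<lambda>y. u y vs)"
  using assms by (auto simp: Lam_bd_def smooth_forms_def)

lemma continuous_on_Fmap: "continuous_on A (Fmap X I x)"
  unfolding Fmap_def[abs_def] by (intro continuous_intros)

lemma integrable_R:
  assumes I: "set I \<subseteq> {..DIM('a)}" and i: "i \<in> set I" "i \<notin> set (p # K)" and J: "set (p # K) \<subseteq> {..DIM('a)}"
    and x: "x \<in> S" and g: "continuous_on (facet X i) g"
  shows "integrable (simplex_measure (length K)) (\<lambda>\<tau>. g (Fmap X I x (simplex_point p K \<tau>)) :: real)"
proof (rule integrable_continuous_compact[OF finite_simplex_measure measurable_simplex_point compact_hullX simplex_point_image])
  have iD: "i \<le> DIM('a)" using i I by auto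
  show "continuous_on (hullX (p # K)) (\<lambda>y. g (Fmap X I x y))"
    using hullX_facet[OF J iD i(2)] Fmap_in_facet[OF I i(1) x]
    by (intro continuous_on_compose2[OF g continuous_on_Fmap]) auto
qed

text \<open>
  Since \<open>Fmap X I x y\<close> is \<open>Fmap X I x (X z)\<close> plus \<open>bary_sum X I x *\<^sub>R (y - X z)\<close>, the integral is over a copy
  of the simplex scaled by \<open>bary_sum X I x\<close>, to which \<open>hadamard_integral\<close> applies.  The arguments of \<open>u\<close> are
  constant, so only one scalar function on one facet is expanded.
\<close>

lemma R_op_decomposition:
  assumes I: "set I \<subseteq> {..DIM('a)}" and i: "i \<in> set I" "i \<notin> set (p # K)"
    and J: "distinct (p # K)" "set (p # K) \<subseteq> {..DIM('a)}"
    and z: "z \<le> DIM('a)" "z \<notin> set I"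
    and u: "u \<in> Lam_bd X k" and l: "length vs + length K = k"
  shows "\<exists>h. smooth_on S h \<and> (\<forall>x\<in>S. R_op X k I (p # K) u x vs = bary_sum X I x ^ length K *
     (u (Fmap X I x (X z)) (frame I p K vs) / fact (length K) + bary_sum X I x * h x))"
proof -
  let ?zs = "frame I p K vs" and ?s = "length K"
  have iD: "i \<le> DIM('a)" using i I by auto
  have lz: "length ?zs = k" using l by (simp add: frame_def)
  have st: "set ?zs \<subseteq> facet_tangent X i" by (rule frame_in_facet_tangent[OF I i J(2)])
  obtain U g where g: "smooth_open U g" "facet X i \<subseteq> U" "\<And>y. y \<in> facet X i \<Longrightarrow> u y ?zs = g y"
    using Lam_bdD(2)[OF u iD lz st] unfolding smooth_on_iff by auto
  have zf: "X z \<in> facet X i" using z i iD by (auto simp: facet_def vertex_in_simplex bary_vertex)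
  have hf: "hullX (p # K) \<subseteq> facet X i" by (rule hullX_facet[OF J(2) iD i(2)])
  \<comment> \<open>The segments of the Taylor expansion stay in the facet, where \<open>g\<close> represents \<open>u\<close>: \<open>Fmap X I x\<close>
    maps the segment from \<open>X z\<close> to \<open>y\<close> onto them.\<close>
  have seg: "Fmap X I x (X z) + (\<sigma> * bary_sum X I x) *\<^sub>R (y - X z) \<in> facet X i"
    if "x \<in> S" "y \<in> hullX (p # K)" "\<sigma> \<in> {0..1}" for x y \<sigma>
  proof -
    have "(1 - \<sigma>) *\<^sub>R X z + \<sigma> *\<^sub>R y \<in> facet X i"
      using that hf zf by (intro convexD[OF convex_facet[OF iD]]) auto
    then have "Fmap X I x ((1 - \<sigma>) *\<^sub>R X z + \<sigma> *\<^sub>R y) \<in> facet X i" by (rule Fmap_in_facet[OF I i(1) that(1)])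
    also have "Fmap X I x ((1 - \<sigma>) *\<^sub>R X z + \<sigma> *\<^sub>R y) = Fmap X I x (X z) + bary_sum X I x *\<^sub>R ((1 - \<sigma>) *\<^sub>R X z + \<sigma> *\<^sub>R y - X z)"
      by (rule Fmap_diff)
    also have "(1 - \<sigma>) *\<^sub>R X z + \<sigma> *\<^sub>R y - X z = \<sigma> *\<^sub>R (y - X z)" by (simp add: algebra_simps)
    finally show ?thesis by (simp add: mult.commute)
  qed
  have "\<exists>h. smooth_on S h \<and> (\<forall>x\<in>S. (\<integral>\<tau>. g (Fmap X I x (X z) + bary_sum X I x *\<^sub>R (simplex_point p K \<tau> - X z)) \<partial>simplex_measure ?s) =
      g (Fmap X I x (X z)) * measure (simplex_measure ?s) (space (simplex_measure ?s)) + bary_sum X I x * h x)"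
    using seg g(2)
    by (intro hadamard_integral[OF finite_simplex_measure measurable_simplex_point compact_hullX simplex_point_image g(1)]
        smooth_open_Fmap I smooth_open_bary_sum) auto
  then obtain h where h: "smooth_on S h" and eq: "\<And>x. x \<in> S \<Longrightarrow>
     (\<integral>\<tau>. g (Fmap X I x (X z) + bary_sum X I x *\<^sub>R (simplex_point p K \<tau> - X z)) \<partial>simplex_measure ?s) =
      g (Fmap X I x (X z)) / fact ?s + bary_sum X I x * h x"
    by (auto simp: measure_simplex_measure)
  show ?thesis
  proof (intro exI[of _ h] conjI ballI h)
    fix x assume x: "x \<in> S"
    have "(\<integral>\<tau>. u (Fmap X I x (simplex_point p K \<tau>)) ?zs \<partial>simplex_measure ?s) =
        (\<integral>\<tau>. g (Fmap X I x (X z) + bary_sum X I x *\<^sub>R (simplex_point p K \<tau> - X z)) \<partial>simplex_measure ?s)"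
    proof (intro Bochner_Integration.integral_cong refl)
      fix \<tau> assume "\<tau> \<in> space (simplex_measure ?s)"
      then have "simplex_point p K \<tau> \<in> facet X i" using simplex_point_image hf by blast
      then have "u (Fmap X I x (simplex_point p K \<tau>)) ?zs = g (Fmap X I x (simplex_point p K \<tau>))"
        by (intro g(3) Fmap_in_facet I i x)
      then show "u (Fmap X I x (simplex_point p K \<tau>)) ?zs = g (Fmap X I x (X z) + bary_sum X I x *\<^sub>R (simplex_point p K \<tau> - X z))"
        unfolding Fmap_diff[of I x "simplex_point p K \<tau>" "X z"] .
    qed
    moreover have "u (Fmap X I x (X z)) ?zs = g (Fmap X I x (X z))"
      by (intro g(3) Fmap_in_facet I i x zf)
    ultimately show "R_op X k I (p # K) u x vs = bary_sum X I x ^ ?s * (u (Fmap X I x (X z)) ?zs / fact ?s + bary_sum X I x * h x)"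
      using R_op_eq[OF I i J Lam_bdD(1)[OF u iD] x l] eq[OF x] by simp
  qed
qed

section \<open>Extension of single-valued traces at a point\<close>

text \<open>
  At a point lying in all facets opposite to \<open>X i\<close>, \<open>i \<in> I\<close>, a form \<open>\<omega>\<close> is given only on lists of
  vectors tangent to one of these facets.  It is the restriction of an alternating form on the whole
  space, obtained by inclusion-exclusion from the projections along \<open>X i - X z\<close>, \<open>i \<in> A\<close>, for \<open>A \<subseteq> I\<close>.
\<close>

definition "projs z A v = v - (\<Sum>i\<in>A. lin i v *\<^sub>R (X i - X z))"

definition ext_form :: "nat \<Rightarrow> nat set \<Rightarrow> ('a list \<Rightarrow> real) \<Rightarrow> 'a list \<Rightarrow> real" where
  "ext_form z I \<omega> zs = (\<Sum>A | A \<subseteq> I \<and> A \<noteq> {}. (-1) ^ (card A + 1) * \<omega> (map (projs z A) zs))"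

lemma linear_projs: "A \<subseteq> {..DIM('a)} \<Longrightarrow> linear (projs z A)"
proof -
  assume A: "A \<subseteq> {..DIM('a)}"
  have "linear (\<lambda>v. \<Sum>i\<in>A. lin i v *\<^sub>R (X i - X z))"
  proof (intro linear_compose_sum ballI)
    fix i assume "i \<in> A"
    then have l: "linear (lin i)" using A by (intro linear_lin) auto
    show "linear (\<lambda>v. lin i v *\<^sub>R (X i - X z))"
      by (intro linearI) (auto simp: linear_add[OF l] linear_cmul[OF l] scaleR_left_distrib)
  qed
  from linear_compose_sub[OF linear_ident this] show ?thesis unfolding projs_def .
qed

lemma projs_in_facet_tangent:
  assumes "A \<subseteq> {..DIM('a)}" "z \<le> DIM('a)" "z \<notin> A" "i \<in> A"
  shows "projs z A v \<in> facet_tangent X i"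
proof -
  have i: "i \<le> DIM('a)" using assms by auto
  note l = linear_lin[OF i]
  have fin: "finite A" using assms(1) finite_subset by blast
  have "lin i (projs z A v) = lin i v - (\<Sum>j\<in>A. lin j v * lin i (X j - X z))"
    unfolding projs_def by (simp only: linear_diff[OF l, of v] linear_sum[OF l] linear_cmul[OF l] real_scaleR_def)
  also have "(\<Sum>j\<in>A. lin j v * lin i (X j - X z)) = (\<Sum>j\<in>A. if j = i then lin i v else 0)"
    using assms i by (intro sum.cong) (auto simp: lin_vertex_diff)
  also have "\<dots> = lin i v" using assms(4) fin by simp
  finally show ?thesis using facet_tangent_iff[OF i] by simp
qed

lemma alternating_ext_form:
  assumes I: "I \<subseteq> {..DIM('a)}" and z: "z \<le> DIM('a)" "z \<notin> I"
    and \<omega>: "\<And>i. i \<in> I \<Longrightarrow> alternating_on (facet_tangent X i) k \<omega>"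
  shows "alternating_on UNIV k (ext_form z I \<omega>)"
  unfolding ext_form_def[abs_def]
proof (intro alternating_sum alternating_scale)
  fix A assume "A \<in> {A. A \<subseteq> I \<and> A \<noteq> {}}"
  then obtain i where A: "A \<subseteq> I" "i \<in> A" by auto
  then show "alternating_on UNIV k (\<lambda>zs. \<omega> (map (projs z A) zs))"
    using I z by (intro alternating_project[OF \<omega>[of i]] linear_projs projs_in_facet_tangent) auto
qed

text \<open>
  For vectors tangent to the facet \<open>j\<close> the projections for \<open>A\<close> and \<open>insert j A\<close> coincide, so the terms
  cancel in pairs; the term for \<open>{j}\<close>, whose partner is the excluded empty set, remains.
\<close>

lemma ext_form_eq:
  assumes I: "I \<subseteq> {..DIM('a)}" and j: "j \<in> I" and zs: "set zs \<subseteq> facet_tangent X j"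
  shows "ext_form z I \<omega> zs = \<omega> zs"
proof -
  define f where "f A = \<omega> (map (projs z A) zs)" for A
  have finI: "finite I" using I finite_subset by blast
  have jD: "j \<le> DIM('a)" using I j by auto
  have fj: "f (insert j A) = f A" if "A \<subseteq> I - {j}" for A
  proof -
    have "finite A" using that finI finite_subset by blast
    moreover have "j \<notin> A" using that by auto
    ultimately have "projs z (insert j A) v = projs z A v" if "v \<in> set zs" for v
      using that zs facet_tangent_iff[OF jD] by (auto simp: projs_def)
    then show ?thesis unfolding f_def by (intro arg_cong[where f = \<omega>]) simp
  qed
  have split: "{A. A \<subseteq> I \<and> A \<noteq> {}} = {A. A \<subseteq> I - {j} \<and> A \<noteq> {}} \<union> insert j ` {A. A \<subseteq> I - {j}}"
  proof (intro set_eqI iffI)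
    fix A assume A: "A \<in> {A. A \<subseteq> I \<and> A \<noteq> {}}"
    show "A \<in> {A. A \<subseteq> I - {j} \<and> A \<noteq> {}} \<union> insert j ` {A. A \<subseteq> I - {j}}"
    proof (cases "j \<in> A")
      case True
      then have "A = insert j (A - {j})" by auto
      moreover have "A - {j} \<in> {A. A \<subseteq> I - {j}}" using A by auto
      ultimately show ?thesis by blast
    qed (use A in auto)
  qed (use j in auto)
  have "ext_form z I \<omega> zs = (\<Sum>A | A \<subseteq> I - {j} \<and> A \<noteq> {}. (-1) ^ (card A + 1) * f A) +
     (\<Sum>A\<in>insert j ` {A. A \<subseteq> I - {j}}. (-1) ^ (card A + 1) * f A)"
    unfolding ext_form_def f_def[symmetric] split using finI by (intro sum.union_disjoint) auto
  also have "(\<Sum>A\<in>insert j ` {A. A \<subseteq> I - {j}}. (-1) ^ (card A + 1) * f A) =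
     (\<Sum>A | A \<subseteq> I - {j}. (-1) ^ (card (insert j A) + 1) * f (insert j A))"
    by (subst sum.reindex) (auto intro!: inj_onI)
  also have "\<dots> = (\<Sum>A | A \<subseteq> I - {j}. (-1) ^ card A * f A)"
  proof (intro sum.cong refl)
    fix A assume "A \<in> {A. A \<subseteq> I - {j}}"
    then have A: "A \<subseteq> I - {j}" by simp
    then have "card (insert j A) = Suc (card A)" using finI by (intro card_insert_disjoint) (auto intro: finite_subset)
    moreover have "(-1 :: real) ^ (Suc (card A) + 1) = (-1) ^ card A" by simp
    ultimately show "(-1) ^ (card (insert j A) + 1) * f (insert j A) = (-1) ^ card A * f A"
      unfolding fj[OF A] by (simp only:)
  qed
  also have "\<dots> = f {} + (\<Sum>A | A \<subseteq> I - {j} \<and> A \<noteq> {}. (-1) ^ card A * f A)"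
  proof -
    have "{A. A \<subseteq> I - {j}} = insert {} {A. A \<subseteq> I - {j} \<and> A \<noteq> {}}" by auto
    moreover have "finite {A. A \<subseteq> I - {j} \<and> A \<noteq> {}}" using finI by simp
    ultimately show ?thesis by simp
  qed
  finally show ?thesis by (simp add: sum_negf f_def projs_def[abs_def])
qed

end

lemma multilin_integral:
  fixes f :: "'t \<Rightarrow> 'a::real_vector list \<Rightarrow> real"
  assumes ml: "\<And>t. t \<in> space M \<Longrightarrow> multilin k (f t)"
    and int: "\<And>vs. length vs = k \<Longrightarrow> integrable M (\<lambda>t. f t vs)"
  shows "multilin k (\<lambda>vs. \<integral>t. f t vs \<partial>M)"
  unfolding multilin_def
proof (intro allI impI conjI)
  fix vs :: "'a list" and i assume l: "length vs = k" "i < k"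
  show "(\<integral>t. f t (vs[i := a + b]) \<partial>M) = (\<integral>t. f t (vs[i := a]) \<partial>M) + (\<integral>t. f t (vs[i := b]) \<partial>M)" for a b
  proof -
    have "(\<integral>t. f t (vs[i := a + b]) \<partial>M) = (\<integral>t. f t (vs[i := a]) + f t (vs[i := b]) \<partial>M)"
      using multilin_add[OF ml l] by (intro Bochner_Integration.integral_cong) auto
    then show ?thesis using int l by simp
  qed
  show "(\<integral>t. f t (vs[i := c *\<^sub>R a]) \<partial>M) = c * (\<integral>t. f t (vs[i := a]) \<partial>M)" for a c
  proof -
    have "(\<integral>t. f t (vs[i := c *\<^sub>R a]) \<partial>M) = (\<integral>t. c * f t (vs[i := a]) \<partial>M)"
      using multilin_scale[OF ml l] by (intro Bochner_Integration.integral_cong) auto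
    then show ?thesis by simp
  qed
qed

context simplex
begin

text \<open>
  The condition under which \<open>Fmap X I x\<close> maps the simplex with the vertices \<open>p # K\<close> into a single facet, so
  that the operator \<open>R\<close> is meaningful for forms on the boundary.
\<close>

definition "admissible I p K \<longleftrightarrow> distinct (p # K) \<and> set (p # K) \<subseteq> {..DIM('a)} \<and> (\<exists>i\<in>set I. i \<notin> set (p # K))"

lemma admissible_remove_nth:
  assumes "set I \<subseteq> {..DIM('a)}" "J \<in> Gam s (set I)" "p \<in> {..DIM('a)} - set J" "i \<le> s"
  shows "admissible I p (remove_nth i J)" "length (remove_nth i J) = s"
proof -
  have J: "length J = Suc s" "set J \<subseteq> set I" "distinct J" using set_Gam[OF assms(2)] by auto
  have i: "i < length J" using J assms(4) by simp
  note r = remove_nth_props[OF J(3) i]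
  have "J ! i \<in> set I" "J ! i \<noteq> p" using i J assms(3) nth_mem by auto
  then show "admissible I p (remove_nth i J)" unfolding admissible_def using r J assms by auto
  show "length (remove_nth i J) = s" using i J by simp
qed

lemma admissible_single:
  assumes "set I \<subseteq> {..DIM('a)}" "2 \<le> card (set I)" "j \<in> set I"
  shows "admissible I j []"
proof -
  have "\<not> set I \<subseteq> {j}" using assms(2) card_mono[of "{j}" "set I"] by auto
  then show ?thesis using assms by (auto simp: admissible_def)
qed

lemma A_op_eq_R_op:
  assumes "length J = Suc s"
  shows "A_op X k I J u x ws = (if s = 0 then R_op X k I [J ! 0] u x ws else A_coeff DIM('a) k s *
       (\<Sum>p\<in>{..DIM('a)} - set J. \<Sum>i=0..s. (-1) ^ i * R_op X k I (p # remove_nth i J) u x ws))"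
  using assms by (simp add: A_op_def R_op_def)

subsection \<open>Alternation\<close>

lemma multilin_R_op:
  assumes I: "set I \<subseteq> {..DIM('a)}" and admissible: "admissible I p K" and u: "u \<in> Lam_bd X k" and x: "x \<in> S" and l: "length K \<le> k"
  shows "multilin (k - length K) (R_op X k I (p # K) u x)"
proof -
  obtain i where i: "i \<in> set I" "i \<notin> set (p # K)" and J: "distinct (p # K)" "set (p # K) \<subseteq> {..DIM('a)}"
    using admissible by (auto simp: admissible_def)
  have iD: "i \<le> DIM('a)" "p \<le> DIM('a)" "i \<noteq> p" using i I J by auto
  let ?f = "\<lambda>\<tau> vs. u (Fmap X I x (simplex_point p K \<tau>)) (frame I p K vs)"
  have fr: "set (frame I p K vs) \<subseteq> facet_tangent X i" for vs by (rule frame_in_facet_tangent[OF I i J(2)])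
  have "multilin (k - length K) (\<lambda>vs. bary_sum X I x ^ length K * (\<integral>\<tau>. ?f \<tau> vs \<partial>simplex_measure (length K)))"
  proof (intro multilin_mult multilin_integral)
    fix \<tau> assume "\<tau> \<in> space (simplex_measure (length K))"
    then have "simplex_point p K \<tau> \<in> facet X i" using simplex_point_image hullX_facet[OF J(2) iD(1) i(2)] by blast
    then have "alternating_on UNIV k (\<lambda>zs. u (Fmap X I x (simplex_point p K \<tau>)) (map (proj i p) zs))"
      using iD by (intro alternating_project[OF Lam_bdD(1)[OF u iD(1)]] proj_props Fmap_in_facet I i x)
    then have "multilin k (\<lambda>zs. u (Fmap X I x (simplex_point p K \<tau>)) (map (proj i p) zs))"
      by (simp add: alternating_on_UNIV_iff)
    then have "multilin (k - length K + length (map (\<lambda>j. X j - X p) K)) (\<lambda>zs. u (Fmap X I x (simplex_point p K \<tau>)) (map (proj i p) zs))"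
      using l by simp
    from multilin_map[OF multilin_suffix[OF this] linear_DFy[OF I, of "X p"]]
    have "multilin (k - length K) (\<lambda>vs. u (Fmap X I x (simplex_point p K \<tau>)) (map (proj i p) (map (DF I p) vs @ map (\<lambda>j. X j - X p) K)))"
      by (simp only: DF_def)
    then show "multilin (k - length K) (?f \<tau>)"
    proof (rule multilin_cong)
      fix vs :: "'a list"
      have "map (proj i p) (frame I p K vs) = frame I p K vs"
        using fr iD by (intro map_idI proj_props(3)) auto
      then show "u (Fmap X I x (simplex_point p K \<tau>)) (map (proj i p) (map (DF I p) vs @ map (\<lambda>j. X j - X p) K)) = ?f \<tau> vs"
        by (simp only: frame_def)
    qed
  next
    fix vs :: "'a list" assume "length vs = k - length K"
    then have "length (frame I p K vs) = k" using l by (simp add: frame_def)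
    then show "integrable (simplex_measure (length K)) (\<lambda>\<tau>. ?f \<tau> vs)"
      by (intro integrable_R[OF I i J(2) x] smooth_on_continuous Lam_bdD(2)[OF u iD(1)] fr)
  qed
  then show ?thesis
    by (rule multilin_cong) (use R_op_eq[OF I i J Lam_bdD(1)[OF u iD(1)] x] l in simp)
qed

lemma multilin_A_op:
  assumes I: "set I \<subseteq> {..DIM('a)}" "2 \<le> card (set I)" and J: "J \<in> Gam s (set I)" and s: "s \<le> k"
    and u: "u \<in> Lam_bd X k" and x: "x \<in> S"
  shows "multilin (k - s) (A_op X k I J u x)"
proof (cases "s = 0")
  case True
  have l: "length J = Suc s" "J ! 0 \<in> set I" using set_Gam[OF J] nth_mem[of 0 J] by auto
  have "multilin k (R_op X k I [J ! 0] u x)"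
    using multilin_R_op[OF I(1) admissible_single[OF I l(2)] u x] by simp
  moreover have "A_op X k I J u x = R_op X k I [J ! 0] u x" using A_op_eq_R_op[OF l(1)] True by auto
  ultimately show ?thesis using True by simp
next
  case False
  have l: "length J = Suc s" using set_Gam[OF J] by auto
  have m: "multilin (k - s) (R_op X k I (p # remove_nth i J) u x)" if "p \<in> {..DIM('a)} - set J" "i \<le> s" for p i
    using multilin_R_op[OF I(1) admissible_remove_nth(1)[OF I(1) J that] u x] admissible_remove_nth(2)[OF I(1) J that] s by simp
  have "multilin (k - s) (\<lambda>ws. A_coeff DIM('a) k s *
       (\<Sum>p\<in>{..DIM('a)} - set J. \<Sum>i=0..s. (-1) ^ i * R_op X k I (p # remove_nth i J) u x ws))"
    using m by (intro multilin_mult multilin_sum) auto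
  then show ?thesis by (rule multilin_cong) (use A_op_eq_R_op[OF l, of k I u x] False in simp)
qed

lemma multilin_whitney:
  assumes "length J = Suc s" "distinct J" "set J \<subseteq> {..DIM('a)}"
  shows "multilin s (\<lambda>ws. whitney X J x ws / a)"
proof -
  have "multilin s (\<lambda>ws. \<Sum>i<length J. ((-1) ^ i * bary X (J ! i) x / a) * wedge_list (map (\<lambda>j. dbary X j x) (remove_nth i J)) ws)"
  proof (intro multilin_sum multilin_mult)
    fix i assume i: "i \<in> {..<length J}"
    then have r: "set (remove_nth i J) \<subseteq> {..DIM('a)}" using remove_nth_props(2)[OF assms(2), of i] assms(3) by auto
    have "linear (dbary X j x)" if "j \<in> set (remove_nth i J)" for j
    proof -
      have "j \<le> DIM('a)" using that r by auto
      then have "dbary X j x = lin j" by (simp add: dbary_eq fun_eq_iff)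
      then show ?thesis using linear_lin[OF \<open>j \<le> DIM('a)\<close>] by simp
    qed
    then have "alternating_on UNIV (length (map (\<lambda>j. dbary X j x) (remove_nth i J))) (wedge_list (map (\<lambda>j. dbary X j x) (remove_nth i J)))"
      by (intro alternating_wedge_list) auto
    then show "multilin s (wedge_list (map (\<lambda>j. dbary X j x) (remove_nth i J)))"
      using assms(1) i by (simp add: alternating_on_UNIV_iff)
  qed
  then show ?thesis by (simp add: whitney_def sum_divide_distrib)
qed

lemma alternating_I_term:
  assumes I: "set I \<subseteq> {..DIM('a)}" "2 \<le> card (set I)" and u: "u \<in> Lam_bd X k" and x: "x \<in> S"
  shows "alternating_on UNIV k (I_term k u I x)"
  unfolding I_term_def[abs_def]
proof (intro alternating_sum)
  fix s J assume "s \<in> {0..k}" and J: "J \<in> Gam s (set I)"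
  then have s: "s \<le> k" by simp
  have "alternating_on UNIV (s + (k - s)) (wedge s (k - s) (\<lambda>ws. whitney X J x ws / bary_sum X I x ^ (s + 1)) (A_op X k I J u x))"
    using set_Gam[OF J] I(1)
    by (intro alternating_wedge multilin_whitney multilin_A_op[OF I J s u x]) auto
  then show "alternating_on UNIV k (wedge s (k - s) (\<lambda>ws. whitney X J x ws / bary_sum X I x ^ (s + 1)) (A_op X k I J u x))"
    using s by simp
qed

subsection \<open>Smoothness\<close>

lemma Fmap_vertex_facet:
  assumes "set I \<subseteq> {..DIM('a)}" "i \<in> set I" "z \<le> DIM('a)" "z \<notin> set I" "x \<in> S"
  shows "Fmap X I x (X z) \<in> facet X i"
proof (rule Fmap_in_facet[OF assms(1,2,5)])
  have "i \<le> DIM('a)" using assms by auto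
  then show "X z \<in> facet X i" using assms by (auto simp: facet_def vertex_in_simplex bary_vertex)
qed

text \<open>
  Each term of the inclusion-exclusion sum involves the values of \<open>u\<close> on one facet and on fixed tangent
  vectors of this facet.
\<close>

lemma smooth_ext_form:
  assumes I: "set I \<subseteq> {..DIM('a)}" and z: "z \<le> DIM('a)" "z \<notin> set I" and u: "u \<in> Lam_bd X k" and l: "length zs = k"
  shows "smooth_on S (\<lambda>x. ext_form z (set I) (u (Fmap X I x (X z))) zs)"
  unfolding ext_form_def
proof (intro smooth_on_sum smooth_on_cmult)
  fix A assume "A \<in> {A. A \<subseteq> set I \<and> A \<noteq> {}}"
  then obtain i where A: "A \<subseteq> set I" "i \<in> A" by auto
  then have i: "i \<in> set I" "i \<le> DIM('a)" using I by auto
  have "set (map (projs z A) zs) \<subseteq> facet_tangent X i"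
  proof -
    have "projs z A v \<in> facet_tangent X i" for v
      by (rule projs_in_facet_tangent) (use A I z in auto)
    then show ?thesis by auto
  qed
  then have "smooth_on (facet X i) (\<lambda>y. u y (map (projs z A) zs))"
    using l by (intro Lam_bdD(2)[OF u i(2)]) auto
  then show "smooth_on S (\<lambda>x. u (Fmap X I x (X z)) (map (projs z A) zs))"
    by (rule smooth_on_compose) (use smooth_open_Fmap[OF I] Fmap_vertex_facet[OF I i(1) z] in auto)
qed

text \<open>
  The functions \<open>H\<close> below are the remainders in \<open>R_op_decomposition\<close>.  Their contribution to the
  summand is smooth, and the values of \<open>u\<close> at \<open>Fmap X I x (X z)\<close> give the leading terms treated by
  \<open>sum_leading\<close>.
\<close>

lemma I_term_smooth:
  assumes I: "set I \<subseteq> {..DIM('a)}" "2 \<le> card (set I)" and z: "z \<le> DIM('a)" "z \<notin> set I"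
    and u: "u \<in> Lam_bd X k" and k: "k < DIM('a)" and vs: "length vs = k"
  shows "\<exists>h. smooth_on S h \<and> (\<forall>x\<in>S. bary_sum X I x \<noteq> 0 \<longrightarrow> I_term k u I x vs = h x)"
proof -
  let ?\<Lambda> = "bary_sum X I" and ?N = "DIM('a)"
  define e where "e j = X j - X z" for j
  define Om where "Om x = ext_form z (set I) (u (Fmap X I x (X z)))" for x
  define edgO where "edgO x p K ws = Om x (map (\<lambda>v. DF I z v + linI I v *\<^sub>R e p) ws @ map (\<lambda>j. e j - e p) K)" for x p K ws
  have altOm: "alternating_on UNIV k (Om x)" if "x \<in> S" for x
    unfolding Om_def using I z that
    by (intro alternating_ext_form Lam_bdD(1)[OF u] Fmap_vertex_facet) auto
  have smoothOm: "smooth_on S (\<lambda>x. Om x zs)" if "length zs = k" for zs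
    unfolding Om_def by (rule smooth_ext_form[OF I(1) z u that])
  have frozen: "u (Fmap X I x (X z)) (frame I p K ws) = edgO x p K ws" if "admissible I p K" for x p K ws
  proof -
    obtain i where i: "i \<in> set I" "i \<notin> set (p # K)" and J: "set (p # K) \<subseteq> {..?N}" using \<open>admissible I p K\<close> by (auto simp: admissible_def)
    have "frame I p K ws = map (\<lambda>v. DF I z v + linI I v *\<^sub>R e p) ws @ map (\<lambda>j. e j - e p) K"
      using DFy_diff[of I "X p" _ "X z"] by (simp add: frame_def DF_def e_def)
    then show ?thesis
      using ext_form_eq[OF I(1) i(1) frame_in_facet_tangent[OF I(1) i J], of z "u (Fmap X I x (X z))" ws]
      by (simp add: edgO_def Om_def)
  qed
  have "\<exists>h. admissible I p K \<and> length ws + length K = k \<longrightarrow> smooth_on S h \<and> (\<forall>x\<in>S. R_op X k I (p # K) u x ws =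
      ?\<Lambda> x ^ length K * (u (Fmap X I x (X z)) (frame I p K ws) / fact (length K) + ?\<Lambda> x * h x))" for p K ws
  proof (cases "admissible I p K \<and> length ws + length K = k")
    case True
    then obtain i where "i \<in> set I" "i \<notin> set (p # K)" "distinct (p # K)" "set (p # K) \<subseteq> {..?N}" by (auto simp: admissible_def)
    from R_op_decomposition[OF I(1) this z u] True show ?thesis by blast
  qed blast
  then obtain H where H: "\<And>p K ws. admissible I p K \<Longrightarrow> length ws + length K = k \<Longrightarrow> smooth_on S (H p K ws)"
    "\<And>p K ws x. admissible I p K \<Longrightarrow> length ws + length K = k \<Longrightarrow> x \<in> S \<Longrightarrow> R_op X k I (p # K) u x ws =
      ?\<Lambda> x ^ length K * (u (Fmap X I x (X z)) (frame I p K ws) / fact (length K) + ?\<Lambda> x * H p K ws x)"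
    by metis
  \<comment> \<open>Leading part and remainder of the operator \<open>A\<close>, both without the factor \<open>\<Lambda>\<^sup>s\<close>.\<close>
  define A0 where "A0 s x J ws = (if s = 0 then edgO x (J ! 0) [] ws else A_coeff ?N k s / fact s *
       (\<Sum>p\<in>{..?N} - set J. \<Sum>i=0..s. (-1) ^ i * edgO x p (remove_nth i J) ws))" for s x J ws
  define AH where "AH s J ws x = (if s = 0 then H (J ! 0) [] ws x else A_coeff ?N k s *
       (\<Sum>p\<in>{..?N} - set J. \<Sum>i=0..s. (-1) ^ i * H p (remove_nth i J) ws x))" for s J ws x
  have A_op: "A_op X k I J u x ws = ?\<Lambda> x ^ s * (A0 s x J ws + ?\<Lambda> x * AH s J ws x)"
    if J: "J \<in> Gam s (set I)" and s: "s \<le> k" and ws: "length ws = k - s" and x: "x \<in> S" for s J ws x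
  proof (cases "s = 0")
    case True
    have l: "length J = Suc s" "J ! 0 \<in> set I" using set_Gam[OF J] nth_mem[of 0 J] by auto
    have a: "admissible I (J ! 0) []" by (rule admissible_single[OF I l(2)])
    show ?thesis using A_op_eq_R_op[OF l(1)] H(2)[OF a _ x, of ws] frozen[OF a] True ws by (simp add: A0_def AH_def)
  next
    case False
    have l: "length J = Suc s" using set_Gam[OF J] by auto
    have R: "R_op X k I (p # remove_nth i J) u x ws =
        ?\<Lambda> x ^ s * (edgO x p (remove_nth i J) ws / fact s + ?\<Lambda> x * H p (remove_nth i J) ws x)"
      if "p \<in> {..?N} - set J" "i \<in> {0..s}" for p i
    proof -
      have i: "i \<le> s" using that by simp
      note a = admissible_remove_nth[OF I(1) J that(1) i]
      show ?thesis using H(2)[OF a(1) _ x, of ws] frozen[OF a(1)] a(2) ws s by simp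
    qed
    have "A_op X k I J u x ws = A_coeff ?N k s * (\<Sum>p\<in>{..?N} - set J. \<Sum>i=0..s. (-1) ^ i *
        (?\<Lambda> x ^ s * (edgO x p (remove_nth i J) ws / fact s + ?\<Lambda> x * H p (remove_nth i J) ws x)))"
      unfolding A_op_eq_R_op[OF l] using False R
      by (simp only: if_False) (intro arg_cong2[where f = "(*)"] sum.cong refl; simp)
    then show ?thesis using False
      by (simp add: A0_def AH_def sum_distrib_left sum_divide_distrib sum.distrib[symmetric] algebra_simps)
  qed
  define tup where "tup s = {K. length K = s \<and> set K \<subseteq> set I}" for s
  define P where "P s x = (\<Sum>K\<in>tup s. wedge_cov k (map lin K) (\<lambda>ws. Om x (map (DF I z) ws @ map e K)) vs)" for s x
  define Q where "Q s x = (\<Sum>K\<in>tup s. \<Sum>p\<le>?N. wedge_cov k (map lin K)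
      (\<lambda>ws. \<Sum>m<length ws. linI I (ws ! m) * Om x ((map (DF I z) ws)[m := e p] @ map e K)) vs)" for s x
  define Z where "Z x = P 0 x + (\<Sum>s=1..k. A_coeff ?N k s / (fact s)\<^sup>2 * ((real ?N - real s) * P s x + Q s x))" for x
  have lead: "(\<Sum>s=0..k. \<Sum>J\<in>Gam s (set I). whitney_wedge k x J (A0 s x J) vs) = ?\<Lambda> x * Z x" if x: "x \<in> S" for x
  proof -
    interpret L: leading_term "set I" ?N k "\<lambda>j. bary X j x" lin e "DF I z" "Om x" vs
      by unfold_locales (use I k vs altOm[OF x] in auto)
    have dI: "L.dI = linI I" by (simp add: L.dI_def linI_def fun_eq_iff)
    have wh: "L.whit J \<beta> = whitney_wedge k x J \<beta> vs" for J \<beta> by (simp add: L.whit_def whitney_wedge_def)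
    have ed: "L.edg p K = edgO x p K" for p K by (simp add: L.edg_def edgO_def dI fun_eq_iff)
    have "(\<Sum>J\<in>Gam s (set I). whitney_wedge k x J (A0 s x J) vs) = L.leading s" for s
    proof (cases "s = 0")
      case True
      then show ?thesis by (simp add: L.leading_def wh ed A0_def[abs_def])
    next
      case False
      have "whitney_wedge k x J (A0 s x J) vs = A_coeff ?N k s / fact s *
         (\<Sum>p\<in>{..?N} - set J. \<Sum>i\<le>s. (-1) ^ i * whitney_wedge k x J (edgO x p (remove_nth i J)) vs)" for J
      proof -
        have "A0 s x J = (\<lambda>ws. A_coeff ?N k s / fact s *
           (\<Sum>p\<in>{..?N} - set J. \<Sum>i\<le>s. (-1) ^ i * edgO x p (remove_nth i J) ws))"
          using False by (simp add: A0_def fun_eq_iff atLeast0AtMost)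
        then show ?thesis by (simp only: whitney_wedge_mult whitney_wedge_sum)
      qed
      then show ?thesis using False by (simp add: L.leading_def wh ed sum_distrib_left)
    qed
    then have "(\<Sum>s=0..k. \<Sum>J\<in>Gam s (set I). whitney_wedge k x J (A0 s x J) vs) = (\<Sum>s\<le>k. L.leading s)"
      by (simp add: atLeast0AtMost)
    also have "\<dots> = L.lamI * (L.Ps 0 + (\<Sum>s=1..k. A_coeff ?N k s / (fact s)\<^sup>2 * ((real ?N - real s) * L.Ps s + L.Qs s)))"
      by (rule L.sum_leading)
    finally have sum: "(\<Sum>s=0..k. \<Sum>J\<in>Gam s (set I). whitney_wedge k x J (A0 s x J) vs) =
       L.lamI * (L.Ps 0 + (\<Sum>s=1..k. A_coeff ?N k s / (fact s)\<^sup>2 * ((real ?N - real s) * L.Ps s + L.Qs s)))" .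
    have Ps: "L.Ps s = P s x" for s by (simp add: L.Ps_def P_def L.tup_def tup_def L.om_def[abs_def])
    have Qs: "L.Qs s = Q s x" for s by (simp add: L.Qs_def Q_def L.tup_def tup_def L.sh_def[abs_def] dI)
    show ?thesis unfolding sum Ps Qs by (simp add: Z_def L.lamI_def bary_sum_def)
  qed
  have tupD: "length K = s" if "K \<in> tup s" for K s using that by (simp add: tup_def)
  have smP: "smooth_on S (P s)" if "s \<le> k" for s
    unfolding P_def[abs_def]
  proof (intro smooth_on_sum)
    fix K assume K: "K \<in> tup s"
    show "smooth_on S (\<lambda>x. wedge_cov k (map lin K) (\<lambda>ws. Om x (map (DF I z) ws @ map e K)) vs)"
      using that tupD[OF K] by (intro smooth_wedge_cov[OF vs] smoothOm) auto
  qed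
  have smQ: "smooth_on S (Q s)" if "s \<le> k" for s
    unfolding Q_def[abs_def]
  proof (intro smooth_on_sum)
    fix K p assume K: "K \<in> tup s"
    show "smooth_on S (\<lambda>x. wedge_cov k (map lin K)
        (\<lambda>ws. \<Sum>m<length ws. linI I (ws ! m) * Om x ((map (DF I z) ws)[m := e p] @ map e K)) vs)"
      using that tupD[OF K] by (intro smooth_wedge_cov[OF vs] smooth_on_sum smooth_on_cmult smoothOm) auto
  qed
  have smZ: "smooth_on S Z"
    unfolding Z_def[abs_def] using smP smQ by (intro smooth_on_add smooth_on_sum smooth_on_cmult) auto
  define h where "h x = Z x + (\<Sum>s=0..k. \<Sum>J\<in>Gam s (set I). whitney_wedge k x J (\<lambda>ws. AH s J ws x) vs)" for x
  have smAH: "smooth_on S (AH s J ws)" if J: "J \<in> Gam s (set I)" and s: "s \<le> k" and ws: "length ws = k - s" for s J ws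
  proof (cases "s = 0")
    case True
    have l: "J ! 0 \<in> set I" using set_Gam[OF J] nth_mem[of 0 J] by auto
    show ?thesis using H(1)[OF admissible_single[OF I l], of ws] True ws by (simp add: AH_def[abs_def])
  next
    case False
    have "smooth_on S (H p (remove_nth i J) ws)" if "p \<in> {..?N} - set J" "i \<in> {0..s}" for p i
    proof -
      have i: "i \<le> s" using that by simp
      note a = admissible_remove_nth[OF I(1) J that(1) i]
      show ?thesis using a(2) ws s by (intro H(1)[OF a(1)]) simp
    qed
    then have "smooth_on S (\<lambda>x. A_coeff ?N k s *
       (\<Sum>p\<in>{..?N} - set J. \<Sum>i=0..s. (-1) ^ i * H p (remove_nth i J) ws x))"
      by (intro smooth_on_cmult smooth_on_sum)
    then show ?thesis using False by (simp add: AH_def[abs_def])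
  qed
  have "smooth_on S h"
    unfolding h_def[abs_def]
  proof (intro smooth_on_add smZ smooth_on_sum)
    fix s J assume s: "s \<in> {0..k}" and J: "J \<in> Gam s (set I)"
    then show "smooth_on S (\<lambda>x. whitney_wedge k x J (\<lambda>ws. AH s J ws x) vs)"
      using set_Gam[OF J] I(1) by (intro smooth_whitney_wedge[OF vs, of _ s] smAH) auto
  qed
  moreover have "I_term k u I x vs = h x" if x: "x \<in> S" and nz: "?\<Lambda> x \<noteq> 0" for x
  proof -
    have "I_term k u I x vs = (\<Sum>s=0..k. \<Sum>J\<in>Gam s (set I). whitney_wedge k x J (A_op X k I J u x) vs / ?\<Lambda> x ^ (s + 1))"
      by (rule I_term_eq[OF vs I(1)])
    also have "\<dots> = (\<Sum>s=0..k. \<Sum>J\<in>Gam s (set I). whitney_wedge k x J (A0 s x J) vs / ?\<Lambda> x + whitney_wedge k x J (\<lambda>ws. AH s J ws x) vs)"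
    proof (rule sum.cong, rule refl, rule sum.cong, rule refl)
      fix s J assume s: "s \<in> {0..k}" and J: "J \<in> Gam s (set I)"
      have "whitney_wedge k x J (A_op X k I J u x) vs =
          whitney_wedge k x J (\<lambda>ws. ?\<Lambda> x ^ s * (A0 s x J ws + ?\<Lambda> x * AH s J ws x)) vs"
        using s set_Gam[OF J] A_op[OF J _ _ x] by (intro whitney_wedge_cong[OF vs, of _ s]) auto
      also have "\<dots> = ?\<Lambda> x ^ s * (whitney_wedge k x J (A0 s x J) vs + ?\<Lambda> x * whitney_wedge k x J (\<lambda>ws. AH s J ws x) vs)"
        by (simp only: whitney_wedge_mult whitney_wedge_add)
      finally show "whitney_wedge k x J (A_op X k I J u x) vs / ?\<Lambda> x ^ (s + 1) =
          whitney_wedge k x J (A0 s x J) vs / ?\<Lambda> x + whitney_wedge k x J (\<lambda>ws. AH s J ws x) vs"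
        using nz by (simp add: field_simps)
    qed
    also have "\<dots> = (\<Sum>s=0..k. \<Sum>J\<in>Gam s (set I). whitney_wedge k x J (A0 s x J) vs) / ?\<Lambda> x +
       (\<Sum>s=0..k. \<Sum>J\<in>Gam s (set I). whitney_wedge k x J (\<lambda>ws. AH s J ws x) vs)"
      by (simp add: sum.distrib sum_divide_distrib)
    finally show ?thesis using lead[OF x] nz by (simp add: h_def)
  qed
  ultimately show ?thesis by blast
qed

subsection \<open>The full index set\<close>

lemma Fmap_full:
  assumes "set I = {..DIM('a)}"
  shows "Fmap X I x y = y" "bary_sum X I x = 1" "DFy I y v = 0"
proof -
  show b: "bary_sum X I x = 1" for x by (simp add: bary_sum_def assms bary_sum_one)
  show "Fmap X I x y = y"
    by (simp add: Fmap_def assms scaleR_diff_right sum_subtractf scaleR_sum_left[symmetric] bary_sum_one bary_representation)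
  show "DFy I y v = 0"
    by (simp add: DFy_def assms scaleR_diff_right sum_subtractf scaleR_sum_left[symmetric] sum_lin lin_representation)
qed

text \<open>For the full index set \<open>Fmap X I x y = y\<close>, so the operators do not see the point \<open>x\<close>.\<close>

lemma A_op_full:
  assumes I: "set I = {..DIM('a)}" and J: "J \<in> Gam s (set I)" and s: "s \<le> k" and ws: "length ws = k - s"
    and u: "u \<in> Lam_bd X k" and x: "x \<in> S" and y: "y \<in> S"
  shows "A_op X k I J u x ws = A_op X k I J u y ws"
proof -
  have I': "set I \<subseteq> {..DIM('a)}" "2 \<le> card (set I)" using I DIM_positive[where 'a = 'a] by (auto simp: Suc_le_eq)
  have R: "R_op X k I (p # K) u x ws = R_op X k I (p # K) u y ws" if a: "admissible I p K" and l: "length ws + length K = k" for p K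
  proof -
    obtain i where i: "i \<in> set I" "i \<notin> set (p # K)" and J: "distinct (p # K)" "set (p # K) \<subseteq> {..DIM('a)}"
      using a by (auto simp: admissible_def)
    have iD: "i \<le> DIM('a)" using i I by auto
    show ?thesis
      using R_op_eq[OF I'(1) i J Lam_bdD(1)[OF u iD] x l] R_op_eq[OF I'(1) i J Lam_bdD(1)[OF u iD] y l]
      by (simp add: Fmap_full[OF I])
  qed
  have l: "length J = Suc s" "J ! 0 \<in> set I" using set_Gam[OF J] nth_mem[of 0 J] by auto
  show ?thesis
  proof (cases "s = 0")
    case True
    then show ?thesis using A_op_eq_R_op[OF l(1)] R[OF admissible_single[OF I' l(2)]] ws by simp
  next
    case False
    have "R_op X k I (p # remove_nth i J) u x ws = R_op X k I (p # remove_nth i J) u y ws"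
      if "p \<in> {..DIM('a)} - set J" "i \<in> {0..s}" for p i
    proof -
      have i: "i \<le> s" using that by simp
      note a = admissible_remove_nth[OF I'(1) J that(1) i]
      show ?thesis using a(2) ws s by (intro R[OF a(1)]) simp
    qed
    then have "(\<Sum>p\<in>{..DIM('a)} - set J. \<Sum>i=0..s. (-1) ^ i * R_op X k I (p # remove_nth i J) u x ws) =
      (\<Sum>p\<in>{..DIM('a)} - set J. \<Sum>i=0..s. (-1) ^ i * R_op X k I (p # remove_nth i J) u y ws)"
      by (intro sum.cong refl) simp
    then show ?thesis using A_op_eq_R_op[OF l(1)] False by simp
  qed
qed

lemma I_term_full:
  assumes I: "set I = {..DIM('a)}" and u: "u \<in> Lam_bd X k" and vs: "length vs = k" and x: "x \<in> S"
  shows "I_term k u I x vs = (\<Sum>s=0..k. \<Sum>J\<in>Gam s (set I). whitney_wedge k x J (A_op X k I J u (X 0)) vs)"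
proof -
  have "I_term k u I x vs = (\<Sum>s=0..k. \<Sum>J\<in>Gam s (set I). whitney_wedge k x J (A_op X k I J u x) vs / bary_sum X I x ^ (s + 1))"
    using I by (intro I_term_eq[OF vs]) auto
  also have "\<dots> = (\<Sum>s=0..k. \<Sum>J\<in>Gam s (set I). whitney_wedge k x J (A_op X k I J u (X 0)) vs)"
  proof (rule sum.cong, rule refl, rule sum.cong, rule refl)
    fix s J assume s: "s \<in> {0..k}" and J: "J \<in> Gam s (set I)"
    have "whitney_wedge k x J (A_op X k I J u x) vs = whitney_wedge k x J (A_op X k I J u (X 0)) vs"
      using s set_Gam[OF J] A_op_full[OF I J _ _ u x vertex_in_simplex[of 0]] by (intro whitney_wedge_cong[OF vs, of _ s]) auto
    then show "whitney_wedge k x J (A_op X k I J u x) vs / bary_sum X I x ^ (s + 1) = whitney_wedge k x J (A_op X k I J u (X 0)) vs"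
      by (simp add: Fmap_full[OF I])
  qed
  finally show ?thesis .
qed

lemma I_term_smooth_full:
  assumes I: "set I = {..DIM('a)}" and u: "u \<in> Lam_bd X k" and vs: "length vs = k"
  shows "\<exists>h. smooth_on S h \<and> (\<forall>x\<in>S. bary_sum X I x \<noteq> 0 \<longrightarrow> I_term k u I x vs = h x)"
proof (intro exI conjI ballI impI)
  show "smooth_on S (\<lambda>x. \<Sum>s=0..k. \<Sum>J\<in>Gam s (set I). whitney_wedge k x J (A_op X k I J u (X 0)) vs)"
  proof (intro smooth_on_sum)
    fix s J assume s: "s \<in> {0..k}" and J: "J \<in> Gam s (set I)"
    show "smooth_on S (\<lambda>x. whitney_wedge k x J (A_op X k I J u (X 0)) vs)"
      using smooth_whitney_wedge[OF vs, of J s S "\<lambda>ws x. A_op X k I J u (X 0) ws"] s set_Gam[OF J] I smooth_on_const by auto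
  qed
qed (rule I_term_full[OF I u vs])

subsection \<open>Passing from the interior to the closed simplex\<close>

definition "interiorS = {x. \<forall>i\<le>DIM('a). 0 < bary X i x}"

lemma interiorS_subset: "interiorS \<subseteq> S"
  by (auto simp: interiorS_def mem_simplex less_imp_le)

lemma bary_segment:
  "i \<le> DIM('a) \<Longrightarrow> bary X i (a + t *\<^sub>R (b - a)) = (1 - t) * bary X i a + t * bary X i b"
  using bary_diff[of i "a + t *\<^sub>R (b - a)" a] bary_diff[of i b a] linear_cmul[OF linear_lin, of i t "b - a"]
  by (simp add: algebra_simps)

lemma simplex_subset_closure: "S \<subseteq> closure interiorS"
proof
  fix y assume y: "y \<in> S"
  define c where "c = (\<Sum>j\<le>DIM('a). (1 / real (Suc DIM('a))) *\<^sub>R X j)"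
  have bc: "bary X i c = 1 / real (Suc DIM('a))" if "i \<le> DIM('a)" for i
    unfolding c_def using that by (intro bary_combination) auto
  define f where "f m = y + (1 / real (Suc m)) *\<^sub>R (c - y)" for m
  have "f m \<in> interiorS" for m
  proof -
    have "0 < bary X i (f m)" if i: "i \<le> DIM('a)" for i
    proof -
      have "0 \<le> (1 - 1 / real (Suc m)) * bary X i y" using y i by (intro mult_nonneg_nonneg) (auto simp: mem_simplex)
      moreover have "0 < (1 / real (Suc m)) * bary X i c" using bc[OF i] by simp
      ultimately show ?thesis unfolding f_def bary_segment[OF i] by linarith
    qed
    then show ?thesis by (simp add: interiorS_def)
  qed
  moreover have "f \<longlonglongrightarrow> y + 0 *\<^sub>R (c - y)"
    unfolding f_def by (intro tendsto_intros LIMSEQ_Suc[OF lim_1_over_n])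
  ultimately show "y \<in> closure interiorS" unfolding closure_sequential by auto
qed

lemma eq_on_simplex:
  assumes "continuous_on S f" "continuous_on S g" "\<And>x. x \<in> interiorS \<Longrightarrow> f x = (g x :: real)" "x \<in> S"
  shows "f x = g x"
proof -
  have "closed {x \<in> S. f x - g x = 0}"
    using assms compact_simplex compact_imp_closed
    by (intro continuous_closed_preimage_constant continuous_intros) auto
  moreover have "interiorS \<subseteq> {x \<in> S. f x - g x = 0}" using assms(3) interiorS_subset by auto
  ultimately have "closure interiorS \<subseteq> {x \<in> S. f x - g x = 0}" by (rule closure_minimal[rotated])
  then show ?thesis using simplex_subset_closure assms(4) by auto
qed

text \<open>
  The pointwise smooth extensions are unique by density of the interior, so that multilinearity and
  alternation pass from the interior to the whole simplex by continuity.
\<close>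

lemma Lam_extension:
  assumes h: "\<And>vs. length vs = k \<Longrightarrow> \<exists>h. smooth_on S h \<and> (\<forall>x\<in>S. P x \<longrightarrow> f x vs = h x)"
    and P: "\<And>x. x \<in> interiorS \<Longrightarrow> P x" and alt: "\<And>x. x \<in> interiorS \<Longrightarrow> alternating_on UNIV k (f x)"
  shows "\<exists>w\<in>Lam X k. \<forall>x\<in>S. P x \<longrightarrow> (\<forall>vs. length vs = k \<longrightarrow> f x vs = w x vs)"
proof -
  obtain H where H: "\<And>vs. length vs = k \<Longrightarrow> smooth_on S (H vs)"
    "\<And>vs x. length vs = k \<Longrightarrow> x \<in> S \<Longrightarrow> P x \<Longrightarrow> f x vs = H vs x"
    using h by metis
  have cont: "continuous_on S (H vs)" if "length vs = k" for vs using H(1)[OF that] by (rule smooth_on_continuous)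
  have fH: "f x vs = H vs x" if "length vs = k" "x \<in> interiorS" for vs x
    using that P interiorS_subset by (intro H(2)) auto
  have "alternating_on UNIV k (\<lambda>vs. H vs x)" if x: "x \<in> S" for x
    unfolding alternating_on_def
  proof (intro allI impI conjI ballI)
    fix vs :: "'a list" and i assume l: "length vs = k \<and> set vs \<subseteq> UNIV" "i < k"
    show "H (vs[i := a + b]) x = H (vs[i := a]) x + H (vs[i := b]) x" for a b
    proof (rule eq_on_simplex[OF _ _ _ x])
      fix x assume x: "x \<in> interiorS"
      show "H (vs[i := a + b]) x = H (vs[i := a]) x + H (vs[i := b]) x"
        using alt[OF x] l fH[OF _ x] by (simp add: alternating_on_def flip: fH)
    qed (use l in \<open>auto intro!: continuous_intros cont\<close>)
    show "H (vs[i := c *\<^sub>R a]) x = c * H (vs[i := a]) x" for a c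
    proof (rule eq_on_simplex[OF _ _ _ x])
      fix x assume x: "x \<in> interiorS"
      show "H (vs[i := c *\<^sub>R a]) x = c * H (vs[i := a]) x"
        using alt[OF x] l fH[OF _ x] by (simp add: alternating_on_def flip: fH)
    qed (use l in \<open>auto intro!: continuous_intros cont\<close>)
    fix j assume j: "j < k" "i \<noteq> j \<and> vs ! i = vs ! j"
    show "H vs x = 0"
    proof (rule eq_on_simplex[OF _ _ _ x])
      fix x assume x: "x \<in> interiorS"
      have "f x vs = 0" using alt[OF x] l j unfolding alternating_on_def by blast
      then show "H vs x = 0" using fH[OF _ x] l by simp
    qed (use l in \<open>auto intro!: continuous_intros cont\<close>)
  qed
  then have "(\<lambda>x vs. H vs x) \<in> Lam X k" using H(1) by (simp add: Lam_def smooth_forms_def)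
  then show ?thesis using H(2) by (intro bexI[of _ "\<lambda>x vs. H vs x"]) auto
qed

theorem I_term_extension:
  assumes I: "set I \<subseteq> {..DIM('a)}" "2 \<le> card (set I)" and u: "u \<in> Lam_bd X k" and k: "k < DIM('a)"
  shows "\<exists>w\<in>Lam X k. \<forall>x\<in>S. bary_sum X I x \<noteq> 0 \<longrightarrow> (\<forall>vs. length vs = k \<longrightarrow> I_term k u I x vs = w x vs)"
proof (rule Lam_extension)
  fix x assume x: "x \<in> interiorS"
  have "0 < bary_sum X I x"
    unfolding bary_sum_def using x I by (intro sum_pos) (auto simp: interiorS_def)
  then show "bary_sum X I x \<noteq> 0" by simp
  show "alternating_on UNIV k (I_term k u I x)"
    using x interiorS_subset by (intro alternating_I_term I u) auto
next
  fix vs :: "'a list" assume vs: "length vs = k"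
  show "\<exists>h. smooth_on S h \<and> (\<forall>x\<in>S. bary_sum X I x \<noteq> 0 \<longrightarrow> I_term k u I x vs = h x)"
  proof (cases "set I = {..DIM('a)}")
    case True
    then show ?thesis by (intro I_term_smooth_full u vs)
  next
    case False
    then obtain z where "z \<le> DIM('a)" "z \<notin> set I" using I(1) by auto
    then show ?thesis by (intro I_term_smooth[OF I _ _ u k vs])
  qed
qed

end

section \<open>Polynomials in one variable\<close>

text \<open>
  Polynomial dependence is needed only on the unit interval, since the rays leave the simplex
  beyond it.
\<close>

definition poly_Icc :: "nat \<Rightarrow> (real \<Rightarrow> real) \<Rightarrow> bool" where
  "poly_Icc r \<phi> \<longleftrightarrow> (\<exists>q :: real poly. degree q \<le> r \<and> (\<forall>t\<in>{0..1}. \<phi> t = poly q t))"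

lemma poly_Icc_cong: "poly_Icc r \<phi> \<Longrightarrow> (\<And>t. t \<in> {0..1} \<Longrightarrow> \<phi> t = \<psi> t) \<Longrightarrow> poly_Icc r \<psi>"
  unfolding poly_Icc_def by metis

lemma poly_Icc_const: "poly_Icc r (\<lambda>_. c)"
  unfolding poly_Icc_def by (intro exI[of _ "[:c:]"]) auto

lemma poly_Icc_affine: "1 \<le> r \<Longrightarrow> poly_Icc r (\<lambda>t. a + t * b)"
  unfolding poly_Icc_def by (intro exI[of _ "[:a, b:]"]) auto

lemma poly_Icc_mult:
  assumes "poly_Icc r \<phi>"
  shows "poly_Icc r (\<lambda>t. c * \<phi> t)"
proof -
  obtain q where "degree q \<le> r" "\<forall>t\<in>{0..1}. \<phi> t = poly q t" using assms by (auto simp: poly_Icc_def)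
  then show ?thesis
    unfolding poly_Icc_def by (intro exI[of _ "smult c q"]) (auto intro: order_trans[OF degree_smult_le])
qed

lemma poly_Icc_add:
  assumes "poly_Icc r \<phi>" "poly_Icc r \<psi>"
  shows "poly_Icc r (\<lambda>t. \<phi> t + \<psi> t)"
proof -
  obtain p q where "degree p \<le> r" "\<forall>t\<in>{0..1}. \<phi> t = poly p t" "degree q \<le> r" "\<forall>t\<in>{0..1}. \<psi> t = poly q t"
    using assms by (auto simp: poly_Icc_def)
  then show ?thesis
    unfolding poly_Icc_def by (intro exI[of _ "p + q"]) (auto intro: degree_add_le)
qed

lemma poly_Icc_sum: "(\<And>x. x \<in> A \<Longrightarrow> poly_Icc r (\<phi> x)) \<Longrightarrow> poly_Icc r (\<lambda>t. \<Sum>x\<in>A. \<phi> x t)"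
  by (induction A rule: infinite_finite_induct) (auto intro: poly_Icc_const poly_Icc_add)

text \<open>
  Interpolation at fixed nodes expresses polynomial dependence by linear identities, and these pass
  under the integral in \<open>poly_Icc_integral\<close>.  The nodes lie in \<open>{0..1}\<close>, where the integrand is known to
  be polynomial.
\<close>

lemma interpolation:
  "\<exists>L :: nat \<Rightarrow> real poly. (\<forall>i\<le>r. degree (L i) \<le> r) \<and>
     (\<forall>q t. degree q \<le> r \<longrightarrow> poly q t = (\<Sum>i\<le>r. poly q (real i / real (Suc r)) * poly (L i) t))"
proof -
  define x where "x i = real i / real (Suc r)" for i
  define L where "L i = (\<Prod>j\<in>{..r} - {i}. smult (1 / (x i - x j)) [:- x j, 1:])" for i
  have inj: "x i = x j \<longleftrightarrow> i = j" for i j by (simp add: x_def)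
  have deg: "degree (L i) \<le> r" if "i \<le> r" for i
  proof -
    have "degree (L i) \<le> (\<Sum>j\<in>{..r} - {i}. degree (smult (1 / (x i - x j)) [:- x j, 1:]))"
      unfolding L_def by (intro degree_prod_sum_le[unfolded o_def]) auto
    also have "\<dots> \<le> (\<Sum>j\<in>{..r} - {i}. 1)" by (intro sum_mono order_trans[OF degree_smult_le]) auto
    also have "\<dots> = r" using that by (simp add: card_Diff_singleton)
    finally show ?thesis .
  qed
  have val: "poly (L i) (x j) = (if i = j then 1 else 0)" if "i \<le> r" "j \<le> r" for i j
  proof (cases "i = j")
    case True
    have "poly (smult (1 / (x i - x l)) [:- x l, 1:]) (x i) = 1" if "l \<noteq> i" for l
    proof -
      have "poly (smult (1 / (x i - x l)) [:- x l, 1:]) (x i) = (x i - x l) / (x i - x l)"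
        by (simp add: diff_divide_distrib[symmetric] del: divide_self_if)
      also have "\<dots> = 1" by (rule divide_self) (use inj[of i l] that in simp)
      finally show ?thesis .
    qed
    then have "poly (L i) (x i) = 1" unfolding L_def poly_prod by (intro prod.neutral) blast
    then show ?thesis using True by simp
  next
    case False
    then have "(\<Prod>l\<in>{..r} - {i}. poly (smult (1 / (x i - x l)) [:- x l, 1:]) (x j)) = 0"
      using that by (intro prod_zero bexI[of _ j]) auto
    then show ?thesis using False by (simp add: L_def poly_prod)
  qed
  have "poly q t = (\<Sum>i\<le>r. poly q (x i) * poly (L i) t)" if q: "degree q \<le> r" for q t
  proof -
    let ?p = "\<Sum>i\<le>r. smult (poly q (x i)) (L i)"
    have card: "card (x ` {..r}) = Suc r" by (subst card_image) (auto simp: inj_on_def inj)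
    have "degree ?p \<le> r" using deg by (intro degree_sum_le) (auto intro: order_trans[OF degree_smult_le])
    moreover have "poly q y = poly ?p y" if y: "y \<in> x ` {..r}" for y
    proof -
      obtain j where j: "j \<le> r" "y = x j" using y by auto
      have "poly ?p y = (\<Sum>i\<le>r. if i = j then poly q (x j) else 0)"
        unfolding poly_sum poly_smult j(2) using val j(1) by (intro sum.cong) auto
      also have "\<dots> = poly q y" using j by simp
      finally show ?thesis by simp
    qed
    ultimately have "q = ?p" using q card by (intro poly_eqI_degree[of "x ` {..r}"]) auto
    then have "poly q t = poly ?p t" by simp
    then show ?thesis by (simp add: poly_sum)
  qed
  then show ?thesis using deg unfolding x_def by blast
qed

lemma poly_Icc_integral:
  assumes p: "\<And>\<tau>. \<tau> \<in> space M \<Longrightarrow> poly_Icc r (F \<tau>)"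
    and int: "\<And>t. t \<in> {0..1} \<Longrightarrow> integrable M (\<lambda>\<tau>. F \<tau> t)"
  shows "poly_Icc r (\<lambda>t. \<integral>\<tau>. F \<tau> t \<partial>M)"
proof -
  obtain L :: "nat \<Rightarrow> real poly" where L: "\<And>i. i \<le> r \<Longrightarrow> degree (L i) \<le> r"
    "\<And>q t. degree q \<le> r \<Longrightarrow> poly q t = (\<Sum>i\<le>r. poly q (real i / real (Suc r)) * poly (L i) t)"
    using interpolation[of r] by blast
  have node: "real i / real (Suc r) \<in> {0..1}" if "i \<le> r" for i using that by simp
  have F: "F \<tau> t = (\<Sum>i\<le>r. F \<tau> (real i / real (Suc r)) * poly (L i) t)" if \<tau>: "\<tau> \<in> space M" and t: "t \<in> {0..1}" for \<tau> t
  proof -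
    obtain q where q: "degree q \<le> r" "\<And>t. t \<in> {0..1} \<Longrightarrow> F \<tau> t = poly q t" using p[OF \<tau>] by (auto simp: poly_Icc_def)
    show ?thesis unfolding q(2)[OF t] L(2)[OF q(1), of t] using q(2) node by (intro sum.cong) auto
  qed
  let ?q = "\<Sum>i\<le>r. smult (\<integral>\<tau>. F \<tau> (real i / real (Suc r)) \<partial>M) (L i)"
  have "(\<integral>\<tau>. F \<tau> t \<partial>M) = poly ?q t" if t: "t \<in> {0..1}" for t
  proof -
    have "(\<integral>\<tau>. F \<tau> t \<partial>M) = (\<integral>\<tau>. (\<Sum>i\<le>r. F \<tau> (real i / real (Suc r)) * poly (L i) t) \<partial>M)"
      using F[OF _ t] by (intro Bochner_Integration.integral_cong) auto
    also have "\<dots> = (\<Sum>i\<le>r. (\<integral>\<tau>. F \<tau> (real i / real (Suc r)) * poly (L i) t \<partial>M))"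
      using int[OF node] by (intro Bochner_Integration.integral_sum) auto
    finally show ?thesis by (simp add: poly_sum)
  qed
  moreover have "degree ?q \<le> r" using L(1) by (intro degree_sum_le) (auto intro: order_trans[OF degree_smult_le])
  ultimately show ?thesis unfolding poly_Icc_def by blast
qed

section \<open>Polynomials in several variables\<close>

text \<open>The exponents and the monomials in the definition of \<open>poly_fun_on\<close>.\<close>

definition expo :: "nat \<Rightarrow> ('a::euclidean_space \<Rightarrow> nat) set" where
  "expo r = {\<alpha>. \<alpha> \<in> Basis \<rightarrow>\<^sub>E UNIV \<and> (\<Sum>b\<in>Basis. \<alpha> b) \<le> r}"

definition monomial :: "('a::euclidean_space \<Rightarrow> nat) \<Rightarrow> 'a \<Rightarrow> real" where
  "monomial \<alpha> y = (\<Prod>b\<in>Basis. (y \<bullet> b) ^ \<alpha> b)"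

lemma poly_fun_on_iff: "poly_fun_on M r f \<longleftrightarrow> (\<exists>c. \<forall>y\<in>M. f y = (\<Sum>\<alpha>\<in>expo r. c \<alpha> * monomial \<alpha> y))"
  by (simp add: poly_fun_on_def expo_def monomial_def)

lemma finite_expo: "finite (expo r :: ('a::euclidean_space \<Rightarrow> nat) set)"
proof (rule finite_subset)
  show "expo r \<subseteq> (Basis :: 'a set) \<rightarrow>\<^sub>E {..r}"
  proof
    fix \<alpha> :: "'a \<Rightarrow> nat" assume \<alpha>: "\<alpha> \<in> expo r"
    have "\<alpha> b \<le> r" if "b \<in> Basis" for b
      using member_le_sum[of b Basis \<alpha>] that \<alpha> by (auto simp: expo_def)
    then show "\<alpha> \<in> Basis \<rightarrow>\<^sub>E {..r}" using \<alpha> by (auto simp: expo_def PiE_iff)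
  qed
qed (intro finite_PiE; simp)

lemma poly_fun_on_line:
  fixes f :: "'a::euclidean_space \<Rightarrow> real"
  assumes f: "poly_fun_on M r f" and M: "\<And>t. t \<in> {0..1} \<Longrightarrow> a + t *\<^sub>R d \<in> M"
  shows "poly_Icc r (\<lambda>t. f (a + t *\<^sub>R d))"
proof -
  obtain c where c: "\<And>y. y \<in> M \<Longrightarrow> f y = (\<Sum>\<alpha>\<in>expo r. c \<alpha> * monomial \<alpha> y)"
    using f by (auto simp: poly_fun_on_iff)
  have "poly_Icc r (\<lambda>t. \<Sum>\<alpha>\<in>expo r. c \<alpha> * monomial \<alpha> (a + t *\<^sub>R d))"
  proof (intro poly_Icc_sum poly_Icc_mult)
    fix \<alpha> :: "'a \<Rightarrow> nat" assume \<alpha>: "\<alpha> \<in> expo r"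
    let ?q = "\<Prod>b\<in>Basis. [:a \<bullet> b, d \<bullet> b:] ^ \<alpha> b"
    have "degree ?q \<le> (\<Sum>b\<in>(Basis :: 'a set). degree ([:a \<bullet> b, d \<bullet> b:] ^ \<alpha> b))"
      by (intro degree_prod_sum_le[unfolded o_def]) auto
    also have "\<dots> \<le> (\<Sum>b\<in>Basis. \<alpha> b)"
    proof (intro sum_mono)
      fix b :: 'a
      have "degree ([:a \<bullet> b, d \<bullet> b:] ^ \<alpha> b) \<le> degree [:a \<bullet> b, d \<bullet> b:] * \<alpha> b" by (rule degree_power_le)
      also have "\<dots> \<le> 1 * \<alpha> b" by (intro mult_right_mono) auto
      finally show "degree ([:a \<bullet> b, d \<bullet> b:] ^ \<alpha> b) \<le> \<alpha> b" by simp
    qed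
    also have "\<dots> \<le> r" using \<alpha> by (simp add: expo_def)
    finally show "poly_Icc r (\<lambda>t. monomial \<alpha> (a + t *\<^sub>R d))"
      unfolding poly_Icc_def
      by (intro exI[of _ ?q]) (auto simp: monomial_def poly_prod inner_add_left)
  qed
  then show ?thesis by (rule poly_Icc_cong) (use c M in simp)
qed

lemma poly_fun_on_cong:
  assumes "poly_fun_on M r f" "\<And>y. y \<in> M \<Longrightarrow> f y = g y"
  shows "poly_fun_on M r g"
proof -
  obtain c where "\<forall>y\<in>M. f y = (\<Sum>\<alpha>\<in>expo r. c \<alpha> * monomial \<alpha> y)" using assms(1) by (auto simp: poly_fun_on_iff)
  then show ?thesis unfolding poly_fun_on_iff using assms(2) by (intro exI[of _ c]) simp
qed

lemma poly_fun_on_subset: "poly_fun_on M r f \<Longrightarrow> N \<subseteq> M \<Longrightarrow> poly_fun_on N r f"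
  unfolding poly_fun_on_def by blast

lemma poly_fun_on_add:
  assumes "poly_fun_on M r f" "poly_fun_on M r g"
  shows "poly_fun_on M r (\<lambda>y. f y + g y)"
proof -
  obtain c d where "\<forall>y\<in>M. f y = (\<Sum>\<alpha>\<in>expo r. c \<alpha> * monomial \<alpha> y)" "\<forall>y\<in>M. g y = (\<Sum>\<alpha>\<in>expo r. d \<alpha> * monomial \<alpha> y)"
    using assms by (auto simp: poly_fun_on_iff)
  then show ?thesis unfolding poly_fun_on_iff
    by (intro exI[of _ "\<lambda>\<alpha>. c \<alpha> + d \<alpha>"]) (auto simp: distrib_right sum.distrib)
qed

lemma poly_fun_on_cmult:
  assumes "poly_fun_on M r f"
  shows "poly_fun_on M r (\<lambda>y. a * f y)"
proof -
  obtain c where "\<forall>y\<in>M. f y = (\<Sum>\<alpha>\<in>expo r. c \<alpha> * monomial \<alpha> y)" using assms by (auto simp: poly_fun_on_iff)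
  then show ?thesis unfolding poly_fun_on_iff
    by (intro exI[of _ "\<lambda>\<alpha>. a * c \<alpha>"]) (auto simp: sum_distrib_left mult.assoc)
qed

lemma poly_fun_on_monomial: "\<alpha> \<in> expo r \<Longrightarrow> poly_fun_on M r (monomial \<alpha>)"
  unfolding poly_fun_on_iff
  by (intro exI[of _ "\<lambda>\<beta>. if \<beta> = \<alpha> then 1 else 0"]) (simp add: finite_expo if_distrib[of "\<lambda>c. c * _"] cong: if_cong)

lemma poly_fun_on_const: "poly_fun_on M r (\<lambda>_. a :: real)"
proof -
  have "(\<lambda>b. if b \<in> Basis then 0 else undefined) \<in> expo r" by (auto simp: expo_def PiE_iff extensional_def)
  from poly_fun_on_cmult[OF poly_fun_on_monomial[OF this], of M a] show ?thesis
    by (rule poly_fun_on_cong) (simp add: monomial_def)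
qed

lemma poly_fun_on_sum: "(\<And>x. x \<in> A \<Longrightarrow> poly_fun_on M r (f x)) \<Longrightarrow> poly_fun_on M r (\<lambda>y. \<Sum>x\<in>A. f x y)"
  by (induction A rule: infinite_finite_induct) (auto intro: poly_fun_on_const poly_fun_on_add)

lemma poly_fun_on_le:
  assumes "poly_fun_on M r f" "r \<le> r'"
  shows "poly_fun_on M r' f"
proof -
  obtain c where c: "\<forall>y\<in>M. f y = (\<Sum>\<alpha>\<in>expo r. c \<alpha> * monomial \<alpha> y)" using assms by (auto simp: poly_fun_on_iff)
  have "poly_fun_on M r' (\<lambda>y. \<Sum>\<alpha>\<in>expo r. c \<alpha> * monomial \<alpha> y)"
    using assms(2) by (intro poly_fun_on_sum poly_fun_on_cmult poly_fun_on_monomial) (auto simp: expo_def)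
  then show ?thesis by (rule poly_fun_on_cong) (use c in simp)
qed

lemma poly_fun_on_coordinate:
  assumes "poly_fun_on M r f" "b \<in> Basis"
  shows "poly_fun_on M (Suc r) (\<lambda>y. (y \<bullet> b) * f y)"
proof -
  obtain c where c: "\<forall>y\<in>M. f y = (\<Sum>\<alpha>\<in>expo r. c \<alpha> * monomial \<alpha> y)" using assms by (auto simp: poly_fun_on_iff)
  have m: "(y \<bullet> b) * monomial \<alpha> y = monomial (\<alpha>(b := Suc (\<alpha> b))) y" for \<alpha> y
  proof -
    have "monomial (\<alpha>(b := Suc (\<alpha> b))) y = (y \<bullet> b) ^ Suc (\<alpha> b) * (\<Prod>i\<in>Basis - {b}. (y \<bullet> i) ^ \<alpha> i)"
      unfolding monomial_def using assms(2) by (subst prod.remove[of _ b]) (auto intro!: prod.cong)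
    moreover have "monomial \<alpha> y = (y \<bullet> b) ^ \<alpha> b * (\<Prod>i\<in>Basis - {b}. (y \<bullet> i) ^ \<alpha> i)"
      unfolding monomial_def using assms(2) by (subst prod.remove[of _ b]) auto
    ultimately show ?thesis by simp
  qed
  have e: "\<alpha>(b := Suc (\<alpha> b)) \<in> expo (Suc r)" if "\<alpha> \<in> expo r" for \<alpha>
  proof -
    have "(\<Sum>i\<in>Basis. (\<alpha>(b := Suc (\<alpha> b))) i) = Suc (\<alpha> b) + (\<Sum>i\<in>Basis - {b}. \<alpha> i)"
      using assms(2) by (subst sum.remove[of _ b]) (auto intro!: sum.cong)
    also have "\<dots> = Suc (\<Sum>i\<in>Basis. \<alpha> i)" using assms(2) by (simp add: sum.remove[of _ b])
    finally show ?thesis using that assms(2) by (auto simp: expo_def PiE_iff extensional_def)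
  qed
  have "poly_fun_on M (Suc r) (\<lambda>y. \<Sum>\<alpha>\<in>expo r. c \<alpha> * monomial (\<alpha>(b := Suc (\<alpha> b))) y)"
    using e by (intro poly_fun_on_sum poly_fun_on_cmult poly_fun_on_monomial)
  then show ?thesis by (rule poly_fun_on_cong) (use c in \<open>simp add: sum_distrib_left m[symmetric] mult_ac\<close>)
qed

lemma continuous_on_poly_fun:
  assumes "poly_fun_on M r f"
  shows "continuous_on M f"
proof -
  obtain c where c: "\<forall>y\<in>M. f y = (\<Sum>\<alpha>\<in>expo r. c \<alpha> * monomial \<alpha> y)" using assms by (auto simp: poly_fun_on_iff)
  have "continuous_on M (\<lambda>y. \<Sum>\<alpha>\<in>expo r. c \<alpha> * monomial \<alpha> y)" unfolding monomial_def by (intro continuous_intros)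
  then show ?thesis using c by (simp cong: continuous_on_cong)
qed

section \<open>Iterated directional derivatives\<close>

definition Dn :: "nat \<Rightarrow> 'a \<Rightarrow> ('a::euclidean_space \<Rightarrow> real) \<Rightarrow> 'a \<Rightarrow> real" where
  "Dn m d g = ((\<lambda>f y. frechet_derivative f (at y) d) ^^ m) g"

lemma Dn_0 [simp]: "Dn 0 d g = g"
  by (simp add: Dn_def)

lemma Dn_Suc: "Dn (Suc m) d g = (\<lambda>y. frechet_derivative (Dn m d g) (at y) d)"
  by (simp add: Dn_def)

lemma Dn_Suc_inner: "Dn (Suc m) d g = Dn m d (\<lambda>y. frechet_derivative g (at y) d)"
  unfolding Dn_def funpow_Suc_right o_def ..

lemma smooth_Dn: "smooth_open U g \<Longrightarrow> smooth_open U (Dn m d g)"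
  by (induction m) (auto simp: Dn_Suc intro: smooth_openD(2))

lemma Dn_cong:
  assumes "open U" "\<And>y. y \<in> U \<Longrightarrow> f y = g y" "y \<in> U"
  shows "Dn m d f y = Dn m d g y"
  using assms(3)
proof (induction m arbitrary: y)
  case (Suc m)
  show ?case unfolding Dn_Suc using frechet_derivative_local[OF assms(1) Suc.prems Suc.IH] by simp
qed (use assms(2) in simp)

lemma Dn_sum:
  assumes g: "\<And>b. b \<in> A \<Longrightarrow> smooth_open U (g b)" and U: "open U" "y \<in> U"
  shows "Dn m d (\<lambda>y. \<Sum>b\<in>A. c b * g b y) y = (\<Sum>b\<in>A. c b * Dn m d (g b) y)"
  using U(2)
proof (induction m arbitrary: y)
  case (Suc m)
  have "Dn (Suc m) d (\<lambda>y. \<Sum>b\<in>A. c b * g b y) y =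
      frechet_derivative (\<lambda>y. \<Sum>b\<in>A. c b * Dn m d (g b) y) (at y) d"
    unfolding Dn_Suc using frechet_derivative_local[OF U(1) Suc.prems Suc.IH] by simp
  also have "\<dots> = (\<Sum>b\<in>A. c b * frechet_derivative (Dn m d (g b)) (at y) d)"
  proof -
    have D: "((\<lambda>y. \<Sum>b\<in>A. c b * Dn m d (g b) y) has_derivative
        (\<lambda>v. \<Sum>b\<in>A. c b * frechet_derivative (Dn m d (g b)) (at y) v)) (at y)"
      by (intro has_derivative_sum has_derivative_mult_right smooth_open_has_derivative[OF smooth_Dn[OF g] Suc.prems])
    show ?thesis unfolding frechet_derivative_at[OF D, symmetric] ..
  qed
  finally show ?case by (simp add: Dn_Suc)
qed simp

text \<open>
  The derivative in direction \<open>x - a\<close> is a linear combination of partial derivatives with the coordinates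
  of \<open>x - a\<close> as coefficients, so every differentiation raises the degree in \<open>x\<close> by one.
\<close>

lemma poly_fun_on_Dn:
  assumes "smooth_open U g" "y \<in> U"
  shows "poly_fun_on UNIV m (\<lambda>x. Dn m (x - a) g y)"
  using assms(1)
proof (induction m arbitrary: g)
  case 0
  then show ?case by (simp add: poly_fun_on_const)
next
  case (Suc m)
  let ?g = "\<lambda>b y. frechet_derivative g (at y) b"
  have "Dn (Suc m) d g y = (\<Sum>b\<in>Basis. (d \<bullet> b) * Dn m d (?g b) y)" for d
  proof -
    have "frechet_derivative g (at y) d = (\<Sum>b\<in>Basis. (d \<bullet> b) * ?g b y)" if "y \<in> U" for y
    proof -
      have lin: "linear (frechet_derivative g (at y))"
        using smooth_openD(1)[OF Suc.prems that] by (rule linear_frechet_derivative)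
      have "frechet_derivative g (at y) d = frechet_derivative g (at y) (\<Sum>b\<in>Basis. (d \<bullet> b) *\<^sub>R b)"
        by (simp add: euclidean_representation)
      then show ?thesis by (simp add: linear_sum[OF lin] linear_cmul[OF lin])
    qed
    then have "Dn (Suc m) d g y = Dn m d (\<lambda>y. \<Sum>b\<in>Basis. (d \<bullet> b) * ?g b y) y"
      unfolding Dn_Suc_inner using smooth_open_open[OF Suc.prems] assms(2) by (intro Dn_cong) auto
    then show ?thesis
      using Dn_sum[of Basis U ?g y m d "\<lambda>b. d \<bullet> b"] smooth_openD(2)[OF Suc.prems] smooth_open_open[OF Suc.prems] assms(2) by simp
  qed
  moreover have "poly_fun_on UNIV (Suc m) (\<lambda>x. \<Sum>b\<in>Basis. ((x - a) \<bullet> b) * Dn m (x - a) (?g b) y)"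
  proof (rule poly_fun_on_sum)
    fix b :: 'a assume b: "b \<in> Basis"
    have IH: "poly_fun_on UNIV m (\<lambda>x. Dn m (x - a) (?g b) y)" by (rule Suc.IH[OF smooth_openD(2)[OF Suc.prems]])
    have "poly_fun_on UNIV (Suc m) (\<lambda>x. (x \<bullet> b) * Dn m (x - a) (?g b) y + (- (a \<bullet> b)) * Dn m (x - a) (?g b) y)"
      using b by (intro poly_fun_on_add poly_fun_on_coordinate IH poly_fun_on_cmult poly_fun_on_le[OF IH]) auto
    then show "poly_fun_on UNIV (Suc m) (\<lambda>x. ((x - a) \<bullet> b) * Dn m (x - a) (?g b) y)"
      by (simp add: inner_diff_left algebra_simps)
  qed
  ultimately show ?case by simp
qed

text \<open>
  If a smooth function agrees with a polynomial along a segment, then the coefficients of the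
  polynomial are the Taylor coefficients at the initial point.
\<close>

lemma taylor_on_segment:
  assumes g: "smooth_open U g" and seg: "\<And>t. t \<in> {0..1} \<Longrightarrow> a + t *\<^sub>R d \<in> U"
    and q: "degree q \<le> r" "\<And>t. t \<in> {0<..1} \<Longrightarrow> g (a + t *\<^sub>R d) = poly q t"
  shows "g (a + d) = (\<Sum>m\<le>r. Dn m d g a / fact m)"
proof -
  define \<phi> where "\<phi> m t = Dn m d g (a + t *\<^sub>R d)" for m t
  have der: "(\<phi> m has_real_derivative \<phi> (Suc m) t) (at t)" if "t \<in> {0..1}" for m t
  proof -
    let ?D = "frechet_derivative (Dn m d g) (at (a + t *\<^sub>R d))"
    have sm: "smooth_open U (Dn m d g)" using g by (rule smooth_Dn)
    have lin: "linear ?D" using smooth_openD(1)[OF sm seg[OF that]] by (rule linear_frechet_derivative)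
    have "((\<lambda>t. a + t *\<^sub>R d) has_derivative (\<lambda>s. s *\<^sub>R d)) (at t)" by (auto intro!: derivative_eq_intros)
    from has_derivative_compose[OF this smooth_open_has_derivative[OF sm seg[OF that]]]
    show ?thesis
      unfolding \<phi>_def has_field_derivative_def by (simp add: linear_cmul[OF lin] Dn_Suc mult_commute_abs)
  qed
  have cont: "continuous_on {0..1} (\<phi> m)" for m
  proof (intro continuous_at_imp_continuous_on ballI)
    fix t :: real assume "t \<in> {0..1}"
    then show "isCont (\<phi> m) t" by (rule DERIV_isCont[OF der])
  qed
  have ext: "\<phi> m t = poly p t" if "\<And>t. t \<in> {0<..<1} \<Longrightarrow> \<phi> m t = poly p t" "t \<in> {0..1}" for m p t
  proof -
    have "closed {t \<in> {0..1}. \<phi> m t - poly p t = 0}"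
      by (intro continuous_closed_preimage_constant continuous_intros cont)
    moreover have "{0<..<1} \<subseteq> {t \<in> {0..1}. \<phi> m t - poly p t = 0}" using that(1) by auto
    ultimately have "closure {0<..<1} \<subseteq> {t \<in> {0..1}. \<phi> m t - poly p t = 0}" by (rule closure_minimal[rotated])
    then show ?thesis using that(2) by auto
  qed
  have eq: "\<forall>t\<in>{0..1}. \<phi> m t = poly ((pderiv ^^ m) q) t" for m
  proof (induction m)
    case 0
    have "\<phi> 0 t = poly q t" if "t \<in> {0<..<1}" for t using q(2)[of t] that by (simp add: \<phi>_def)
    then show ?case using ext[of 0 q] by simp
  next
    case (Suc m)
    have "\<phi> (Suc m) t = poly ((pderiv ^^ Suc m) q) t" if t: "t \<in> {0<..<1}" for t
    proof -
      have "(poly ((pderiv ^^ m) q) has_real_derivative \<phi> (Suc m) t) (at t)"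
      proof (rule has_field_derivative_transform_within_open)
        show "(\<phi> m has_real_derivative \<phi> (Suc m) t) (at t)" using t by (intro der) auto
        show "\<phi> m s = poly ((pderiv ^^ m) q) s" if "s \<in> {0<..<1}" for s using Suc that by auto
      qed (use t in auto)
      moreover have "(poly ((pderiv ^^ m) q) has_real_derivative poly (pderiv ((pderiv ^^ m) q)) t) (at t)"
        by (rule poly_DERIV)
      ultimately have "\<phi> (Suc m) t = poly (pderiv ((pderiv ^^ m) q)) t" by (rule DERIV_unique)
      then show ?thesis by simp
    qed
    then show ?case using ext[of "Suc m" "(pderiv ^^ Suc m) q"] by blast
  qed
  have coeff: "Dn m d g a = fact m * coeff q m" for m
  proof -
    have "Dn m d g a = \<phi> m 0" by (simp add: \<phi>_def)
    also have "\<dots> = poly ((pderiv ^^ m) q) 0" using eq[of m] by simp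
    also have "\<dots> = fact m * coeff q m"
      by (simp add: poly_0_coeff_0 coeff_higher_pderiv pochhammer_fact)
    finally show ?thesis .
  qed
  have "g (a + d) = \<phi> 0 1" by (simp add: \<phi>_def)
  also have "\<dots> = poly q 1" using eq[of 0] by simp
  also have "\<dots> = (\<Sum>m\<le>degree q. coeff q m)" by (simp add: poly_altdef)
  also have "\<dots> = (\<Sum>m\<le>r. coeff q m)"
    using q(1) by (intro sum.mono_neutral_left) (auto simp: coeff_eq_0)
  finally show ?thesis by (simp add: coeff)
qed

context simplex
begin

lemma interiorS_segment:
  assumes "x \<in> interiorS" "z \<in> S" "t \<in> {0<..1}"
  shows "z + t *\<^sub>R (x - z) \<in> interiorS"
proof -
  have "0 < bary X i (z + t *\<^sub>R (x - z))" if i: "i \<le> DIM('a)" for i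
  proof -
    have "0 \<le> (1 - t) * bary X i z" using assms i by (intro mult_nonneg_nonneg) (auto simp: mem_simplex)
    moreover have "0 < t * bary X i x" using assms i by (auto simp: interiorS_def)
    ultimately show ?thesis unfolding bary_segment[OF i] by linarith
  qed
  then show ?thesis by (simp add: interiorS_def)
qed

text \<open>
  The value at \<open>x\<close> is the Taylor polynomial at \<open>z\<close> of an extension of \<open>f\<close>, evaluated in direction \<open>x - z\<close>.
  Boundary points of the simplex follow by density.
\<close>

lemma poly_fun_on_rays:
  assumes f: "smooth_on S f" and z: "z \<in> S"
    and ray: "\<And>x. x \<in> interiorS \<Longrightarrow> \<exists>q. degree q \<le> r \<and> (\<forall>t\<in>{0<..1}. f (z + t *\<^sub>R (x - z)) = poly q t)"
  shows "poly_fun_on S r f"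
proof -
  obtain U g where g: "smooth_open U g" "S \<subseteq> U" "\<And>y. y \<in> S \<Longrightarrow> f y = g y"
    using f unfolding smooth_on_iff by auto
  let ?p = "\<lambda>x. \<Sum>m\<le>r. inverse (fact m) * Dn m (x - z) g z"
  have p: "poly_fun_on UNIV r ?p"
  proof (intro poly_fun_on_sum poly_fun_on_cmult)
    fix m assume "m \<in> {..r}"
    then show "poly_fun_on UNIV r (\<lambda>x. Dn m (x - z) g z)"
      using g(2) z by (intro poly_fun_on_le[OF poly_fun_on_Dn[OF g(1)]]) auto
  qed
  have "f x = ?p x" if x: "x \<in> interiorS" for x
  proof -
    have xS: "x \<in> S" using x interiorS_subset by auto
    have seg: "z + t *\<^sub>R (x - z) \<in> S" if "t \<in> {0..1}" for t
      using convexD_alt[OF convex_simplex z xS, of t] that by (simp add: algebra_simps)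
    obtain q where q: "degree q \<le> r" "\<And>t. t \<in> {0<..1} \<Longrightarrow> f (z + t *\<^sub>R (x - z)) = poly q t" using ray[OF x] by blast
    have "g (z + (x - z)) = (\<Sum>m\<le>r. Dn m (x - z) g z / fact m)"
    proof (rule taylor_on_segment[OF g(1) _ q(1)])
      show "z + t *\<^sub>R (x - z) \<in> U" if "t \<in> {0..1}" for t using seg[OF that] g(2) by auto
      show "g (z + t *\<^sub>R (x - z)) = poly q t" if "t \<in> {0<..1}" for t
        using q(2)[OF that] g(3)[OF seg[of t]] that by simp
    qed
    then show ?thesis using g(3)[OF xS] by (simp add: divide_inverse mult.commute)
  qed
  then have "f x = ?p x" if "x \<in> S" for x
    using eq_on_simplex[OF smooth_on_continuous[OF f] continuous_on_poly_fun[OF poly_fun_on_subset[OF p subset_UNIV]] _ that] by blast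
  then show ?thesis using poly_fun_on_subset[OF p subset_UNIV] by (rule poly_fun_on_cong[rotated, OF sym])
qed

end

section \<open>Contraction of Whitney forms with the radial field\<close>

text \<open>
  Moving the marked entry to the front costs the sign \<open>(-1)\<^sup>i\<close>, so under antisymmetrisation all summands
  of \<open>alt_sum\<close> become equal.
\<close>

lemma alt_sum_eq_Alt:
  assumes f: "antisym_list m f" and J: "length J = Suc m"
  shows "alt_sum c f J = Alt (Suc m) (\<lambda>L. c (hd L) * f (tl L)) J / fact m"
proof -
  define term0 where "term0 L = c (hd L) * f (tl L)" for L
  have as: "antisym_list (Suc m) (alt_sum c f)" by (rule antisym_list_alt_sum[OF f])
  have perm: "alt_sum c f (permute_list \<sigma> J) = of_int (sign \<sigma>) * alt_sum c f J" if "\<sigma> permutes {..<Suc m}" for \<sigma>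
  proof (rule permute_list_sign[of "{..<Suc m}" \<sigma> "Suc m"])
    fix L :: "'a list" and i j assume L: "length L = Suc m" "i \<in> {..<Suc m}" "j \<in> {..<Suc m}" "i \<noteq> j"
    have sw: "alt_sum c f (permute_list (Transposition.transpose i j) L) = - alt_sum c f L" if "i < j" "j < Suc m" for i j
    proof -
      define a where "a = take i L"
      define b where "b = take (j - Suc i) (drop (Suc i) L)"
      define d where "d = drop (Suc j) L"
      have L1: "L = a @ L ! i # b @ L ! j # d"
      proof -
        have "drop (Suc i) L = b @ drop (j - Suc i) (drop (Suc i) L)"
          unfolding b_def by (rule append_take_drop_id[symmetric])
        also have "drop (j - Suc i) (drop (Suc i) L) = drop j L" using that by simp
        also have "drop j L = L ! j # d" using that L by (simp add: d_def Cons_nth_drop_Suc)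
        finally have "drop (Suc i) L = b @ L ! j # d" .
        then show ?thesis using id_take_nth_drop[of i L] that L by (simp add: a_def)
      qed
      have la: "length a = i" "length b = j - Suc i" using that L by (auto simp: a_def b_def)
      have "permute_list (Transposition.transpose i j) L = L[i := L ! j, j := L ! i]"
        using that L by (intro permute_list_transpose) auto
      also have "\<dots> = a @ L ! j # b @ L ! i # d"
      proof -
        have "(a @ x # b @ y # d)[i := u, j := v] = a @ u # b @ v # d" for x y u v
        proof -
          have "j - i = Suc (length b)" using la that by simp
          then show ?thesis using la that by (simp add: list_update_append)
        qed
        then show ?thesis by (subst (1) L1) simp
      qed
      finally have "alt_sum c f (permute_list (Transposition.transpose i j) L) = alt_sum c f (a @ L ! j # b @ L ! i # d)" by simp
      also have "\<dots> = - alt_sum c f (a @ L ! i # b @ L ! j # d)"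
      proof (rule antisym_list_swap[OF as])
        have "length L = Suc m" by fact
        then show "length a + length b + length d + 2 = Suc m" by (subst (asm) L1) simp
      qed
      finally show ?thesis using L1 by simp
    qed
    show "alt_sum c f (permute_list (Transposition.transpose i j) L) = - alt_sum c f L"
    proof (cases "i < j")
      case True
      then show ?thesis using L by (intro sw) auto
    next
      case False
      then have "alt_sum c f (permute_list (Transposition.transpose j i) L) = - alt_sum c f L"
        using L by (intro sw) auto
      then show ?thesis by (simp add: transpose_commute)
    qed
  qed (use that J in auto)
  have "Alt (Suc m) (alt_sum c f) J = (\<Sum>\<sigma> | \<sigma> permutes {..<Suc m}. alt_sum c f J)"
    unfolding Alt_def
    by (intro sum.cong refl) (simp add: perm mult.assoc[symmetric] of_int_mult[symmetric] del: of_int_mult)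
  then have A: "Alt (Suc m) (alt_sum c f) J = fact (Suc m) * alt_sum c f J" by (simp add: card_permutations algebra_simps)
  have all_eq: "Alt (Suc m) (\<lambda>L. (-1) ^ i * c (L ! i) * f (remove_nth i L)) J = Alt (Suc m) term0 J" if i: "i < Suc m" for i
  proof (cases "i = 0")
    case True
    show ?thesis
      by (intro Alt_cong J) (auto simp: True term0_def remove_nth_def hd_conv_nth length_Suc_conv)
  next
    case False
    let ?t = "Transposition.transpose 0 i"
    have t: "?t permutes {..<Suc m}" using i by (intro permutes_swap_id) auto
    have "(-1) ^ i * c (L ! i) * f (remove_nth i L) = (-1) * term0 (permute_list ?t L)" if L: "length L = Suc m" for L
    proof -
      obtain a K where aK: "L = a # K" using L by (cases L) auto
      obtain i' where i': "i = Suc i'" using False by (cases i) auto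
      have iK: "i' < length K" using i i' L aK by simp
      have K: "K = take i' K @ K ! i' # drop (Suc i') K" using iK by (rule id_take_nth_drop)
      have "permute_list ?t L = K ! i' # K[i' := a]"
        using i L by (subst permute_list_transpose) (auto simp: aK i')
      moreover have "K[i' := a] = take i' K @ a # drop (Suc i') K" using iK by (rule upd_conv_take_nth_drop)
      ultimately have "term0 (permute_list ?t L) = c (K ! i') * f (take i' K @ a # drop (Suc i') K)"
        by (simp add: term0_def)
      moreover have "f ([] @ a # take i' K @ drop (Suc i') K) = (-1) ^ length (take i' K) * f ([] @ take i' K @ a # drop (Suc i') K)"
        using iK L aK by (intro antisym_list_move[OF f]) auto
      moreover have "remove_nth i L = a # take i' K @ drop (Suc i') K" by (simp add: aK i' remove_nth_def)
      moreover have "(-1 :: real) ^ i' * (-1) ^ i' = 1" by (simp flip: power_add)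
      ultimately show ?thesis using iK by (simp add: aK i')
    qed
    then have "Alt (Suc m) (\<lambda>L. (-1) ^ i * c (L ! i) * f (remove_nth i L)) J =
        Alt (Suc m) (\<lambda>L. (-1) * term0 (permute_list ?t L)) J"
      by (intro Alt_cong J)
    then show ?thesis
      unfolding Alt_mult Alt_permute_inside[OF t J] using False by (simp add: sign_swap_id)
  qed
  have "Alt (Suc m) (alt_sum c f) J = Alt (Suc m) (\<lambda>L. \<Sum>i<Suc m. (-1) ^ i * c (L ! i) * f (remove_nth i L)) J"
    by (intro Alt_cong J) (simp add: alt_sum_def)
  also have "\<dots> = (\<Sum>i<Suc m. Alt (Suc m) term0 J)"
    unfolding Alt_sum using all_eq by (intro sum.cong) auto
  finally have "fact (Suc m) * alt_sum c f J = real (Suc m) * Alt (Suc m) term0 J" using A by simp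
  then have "fact m * alt_sum c f J = Alt (Suc m) term0 J" by (simp del: of_nat_Suc)
  then show ?thesis by (simp add: term0_def[abs_def] field_simps)
qed

lemma wedge_list_eq_Alt_covectors:
  assumes "length vs = length as"
  shows "wedge_list as vs = Alt (length as) (\<lambda>L. \<Prod>a<length as. (L ! a) (vs ! a)) as"
proof -
  have "wedge_list as vs = leibniz_det (length as) (\<lambda>i j. (as ! i) (vs ! j))"
    unfolding wedge_list_eq_Alt[OF assms] Alt_def leibniz_det_def using assms
    by (intro sum.cong refl arg_cong2[where f = "(*)"] prod.cong) (auto simp: permute_list_nth)
  also have "\<dots> = leibniz_det (length as) (\<lambda>j i. (as ! i) (vs ! j))"
    by (rule leibniz_det_transpose[symmetric])
  also have "\<dots> = Alt (length as) (\<lambda>L. \<Prod>a<length as. (L ! a) (vs ! a)) as"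
    unfolding Alt_def leibniz_det_def
    by (intro sum.cong refl arg_cong2[where f = "(*)"] prod.cong) (auto simp: permute_list_nth)
  finally show ?thesis .
qed

text \<open>
  Laplace expansion of the determinant \<open>wedge_list\<close> along the vector \<open>\<rho>\<close>: by symmetry between covectors
  and vectors the antisymmetrisation may be taken over the covectors.
\<close>

lemma wedge_list_Cons_vector:
  assumes "length as = Suc m" "length ws = m"
  shows "wedge_list as (\<rho> # ws) = alt_sum (\<lambda>\<alpha>. \<alpha> \<rho>) (\<lambda>L. wedge_list L ws) as"
proof -
  let ?h = "\<lambda>L. \<Prod>a<m. (L ! a) (ws ! a)"
  have anti: "antisym_list m (\<lambda>L. wedge_cov m L (\<lambda>_. 1) ws)" using assms(2) by (intro antisym_list_wedge_cov) auto
  have eq: "wedge_cov m L (\<lambda>_. 1) ws = wedge_list L ws" if "length L = m" for L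
    using that assms(2) by (simp add: wedge_cov_def wedge_list_eq_Alt)
  have as: "antisym_list m (\<lambda>L. wedge_list L ws)"
    unfolding antisym_list_def
  proof (intro allI impI)
    fix xs ys :: "('a \<Rightarrow> real) list" and a b assume l: "length xs + length ys + 2 = m"
    have "length (xs @ a # b # ys) = m" "length (xs @ b # a # ys) = m" using l by auto
    from eq[OF this(1)] eq[OF this(2)] antisym_listD[OF anti l, of a b]
    show "wedge_list (xs @ a # b # ys) ws = - wedge_list (xs @ b # a # ys) ws" by (simp only:)
  qed
  have "alt_sum (\<lambda>\<alpha>. \<alpha> \<rho>) (\<lambda>L. wedge_list L ws) as =
      Alt (1 + m) (\<lambda>L. hd L \<rho> * wedge_list (tl L) ws) as / fact m"
    using alt_sum_eq_Alt[OF as assms(1)] by simp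
  also have "Alt (1 + m) (\<lambda>L. hd L \<rho> * wedge_list (tl L) ws) as =
      Alt (1 + m) (\<lambda>L. hd (take 1 L) \<rho> * Alt m ?h (drop 1 L)) as"
    using assms by (intro Alt_cong) (auto simp: wedge_list_eq_Alt_covectors drop_Suc)
  also have "\<dots> = fact m * Alt (1 + m) (\<lambda>L. hd (take 1 L) \<rho> * ?h (drop 1 L)) as"
    using assms by (intro Alt_drop) simp
  also have "Alt (1 + m) (\<lambda>L. hd (take 1 L) \<rho> * ?h (drop 1 L)) as =
      Alt (1 + m) (\<lambda>L. \<Prod>a<Suc m. (L ! a) ((\<rho> # ws) ! a)) as"
  proof (intro Alt_cong)
    fix L :: "('a \<Rightarrow> real) list" assume "length L = 1 + m"
    then obtain l L' where "L = l # L'" by (cases L) auto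
    then show "hd (take 1 L) \<rho> * ?h (drop 1 L) = (\<Prod>a<Suc m. (L ! a) ((\<rho> # ws) ! a))"
      by (simp add: prod.lessThan_Suc_shift del: prod.lessThan_Suc)
  qed (use assms in simp)
  also have "\<dots> = wedge_list as (\<rho> # ws)" using assms by (simp add: wedge_list_eq_Alt_covectors)
  finally show ?thesis by simp
qed

context simplex
begin

text \<open>
  The coordinate \<open>\<lambda>\<^sub>j\<close>, \<open>j \<noteq> z\<close>, vanishes at \<open>X z\<close>, so its differential takes the value \<open>\<lambda>\<^sub>j x\<close> on
  \<open>x - X z\<close>.  By Laplace expansion \<open>\<phi>\<^sub>J\<close> is therefore the contraction of \<open>d\<lambda>\<^sub>J\<close> with \<open>x - X z\<close>, and a second
  contraction with the same vector gives zero.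
\<close>

lemma whitney_radial:
  assumes J: "distinct J" "set J \<subseteq> {..DIM('a)}" "length J = Suc s" and z: "z \<le> DIM('a)" "z \<notin> set J"
    and ws: "length ws = s" "x - X z \<in> set ws"
  shows "whitney X J x ws = 0"
proof -
  have lin: "linear \<alpha>" if "\<alpha> \<in> set (map lin J)" for \<alpha> using that J linear_lin by auto
  have "whitney X J x ws = alt_sum (\<lambda>\<alpha>. \<alpha> (x - X z)) (\<lambda>L. wedge_list L ws) (map lin J)"
    unfolding whitney_def alt_sum_def length_map
  proof (intro sum.cong refl)
    fix i assume i: "i \<in> {..<length J}"
    then have Ji: "J ! i \<in> set J" by simp
    then have b: "bary X (J ! i) x = lin (J ! i) (x - X z)"
      using J z by (subst bary_diff[symmetric]) (auto simp: bary_vertex)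
    have m: "map (\<lambda>j. dbary X j x) (remove_nth i J) = map lin (remove_nth i J)"
      using remove_nth_props[OF J(1), of i] i J(2) by (auto simp: dbary_eq fun_eq_iff)
    show "(-1) ^ i * bary X (J ! i) x * wedge_list (map (\<lambda>j. dbary X j x) (remove_nth i J)) ws =
        (-1) ^ i * (map lin J ! i) (x - X z) * wedge_list (remove_nth i (map lin J)) ws"
      unfolding m b using i by (simp add: remove_nth_map)
  qed
  also have "\<dots> = wedge_list (map lin J) ((x - X z) # ws)"
    using J ws by (intro wedge_list_Cons_vector[symmetric]) auto
  also have "\<dots> = 0"
    using alternating_wedge_list[of "map lin J", OF lin] J ws
    by (intro alternating_distinct[of "Suc s"]) auto
  finally show ?thesis .
qed

section \<open>Dependence of the operators along rays\<close>

definition ray :: "nat \<Rightarrow> 'a \<Rightarrow> real \<Rightarrow> 'a" where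
  "ray z x t = X z + t *\<^sub>R (x - X z)"

lemma ray_in_simplex: "z \<le> DIM('a) \<Longrightarrow> x \<in> S \<Longrightarrow> t \<in> {0..1} \<Longrightarrow> ray z x t \<in> S"
  using convexD_alt[OF convex_simplex vertex_in_simplex, of z x t] by (simp add: ray_def algebra_simps)

lemma bary_ray: "i \<le> DIM('a) \<Longrightarrow> z \<le> DIM('a) \<Longrightarrow> i \<noteq> z \<Longrightarrow> bary X i (ray z x t) = t * bary X i x"
  unfolding ray_def by (simp add: bary_segment bary_vertex)

lemma bary_sum_ray:
  assumes "set I \<subseteq> {..DIM('a)}" "z \<le> DIM('a)" "z \<notin> set I"
  shows "bary_sum X I (ray z x t) = t * bary_sum X I x"
proof -
  have "bary X i (ray z x t) = t * bary X i x" if "i \<in> set I" for i using assms that by (intro bary_ray) auto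
  then show ?thesis by (simp add: bary_sum_def sum_distrib_left)
qed

lemma Fmap_ray:
  assumes "set I \<subseteq> {..DIM('a)}" "z \<le> DIM('a)" "z \<notin> set I"
  shows "Fmap X I (ray z x t) y = ray z (Fmap X I x y) t"
proof -
  have "bary X i (ray z x t) = t * bary X i x" if "i \<in> set I" for i using assms that by (intro bary_ray) auto
  then have "Fmap X I (ray z x t) y = ray z x t + (\<Sum>i\<in>set I. (t * bary X i x) *\<^sub>R (y - X i))"
    by (simp add: Fmap_def)
  then show ?thesis by (simp add: ray_def Fmap_def scaleR_sum_right algebra_simps)
qed

lemma whitney_ray:
  assumes J: "distinct J" "set J \<subseteq> {..DIM('a)}" and z: "z \<le> DIM('a)" "z \<notin> set J"
  shows "whitney X J (ray z x t) ws = t * whitney X J x ws"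
  unfolding whitney_def sum_distrib_left
proof (intro sum.cong refl)
  fix i assume i: "i \<in> {..<length J}"
  have Ji: "J ! i \<in> set J" using i by simp
  have b: "bary X (J ! i) (ray z x t) = t * bary X (J ! i) x"
    using Ji J(2) z by (intro bary_ray) auto
  have m: "map (\<lambda>j. dbary X j y) (remove_nth i J) = map lin (remove_nth i J)" for y
    using remove_nth_props[OF J(1), of i] i J(2) by (auto simp: dbary_eq fun_eq_iff)
  show "(-1) ^ i * bary X (J ! i) (ray z x t) * wedge_list (map (\<lambda>j. dbary X j (ray z x t)) (remove_nth i J)) ws =
     t * ((-1) ^ i * bary X (J ! i) x * wedge_list (map (\<lambda>j. dbary X j x) (remove_nth i J)) ws)"
    unfolding m b by simp
qed

lemma DFy_radial: 
  assumes "set I \<subseteq> {..DIM('a)}" "z \<le> DIM('a)" "z \<notin> set I"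
  shows "DFy I y (x - X z) = Fmap X I x y - X z"
proof -
  have "lin i (x - X z) = bary X i x" if "i \<in> set I" for i
    using assms that by (subst bary_diff[symmetric]) (auto simp: bary_vertex)
  then show ?thesis by (simp add: DFy_def Fmap_def)
qed

lemma tr_bd_in_Lam_bd:
  assumes "U \<in> Lam X k"
  shows "tr_bd X U \<in> Lam_bd X k"
proof -
  have eq: "tr_bd X U y vs = U y vs" if "i \<le> DIM('a)" "y \<in> facet X i" "set vs \<subseteq> facet_tangent X i" for i y vs
    using that by (auto simp: tr_bd_def)
  have "tr_bd X U \<in> smooth_forms (facet_tangent X i) (facet X i) k" if i: "i \<le> DIM('a)" for i
    unfolding smooth_forms_def
  proof (intro CollectI conjI ballI allI impI)
    fix y assume y: "y \<in> facet X i"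
    then have alt: "alternating_on UNIV k (U y)" using assms by (auto simp: Lam_def smooth_forms_def facet_def)
    show "alternating_on (facet_tangent X i) k (tr_bd X U y)"
      unfolding alternating_on_def
    proof (intro allI impI conjI ballI)
      fix vs j assume l: "length vs = k \<and> set vs \<subseteq> facet_tangent X i" "j < k"
      have sub: "set (vs[j := a]) \<subseteq> facet_tangent X i" if "a \<in> facet_tangent X i" for a
        using set_update_subset_insert[of vs j a] l that by auto
      have sp: "subspace (facet_tangent X i)" by (simp add: tangent_def)
      show "tr_bd X U y (vs[j := a + b]) = tr_bd X U y (vs[j := a]) + tr_bd X U y (vs[j := b])"
        if "a \<in> facet_tangent X i" "b \<in> facet_tangent X i" for a b
        using alt l that sub eq[OF i y] subspace_add[OF sp that] by (simp add: alternating_on_def)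
      show "tr_bd X U y (vs[j := c *\<^sub>R a]) = c * tr_bd X U y (vs[j := a])" if "a \<in> facet_tangent X i" for a c
        using alt l that sub eq[OF i y] subspace_scale[OF sp that] by (simp add: alternating_on_def)
      fix j' assume "j' < k" "j \<noteq> j' \<and> vs ! j = vs ! j'"
      then show "tr_bd X U y vs = 0" using alt l eq[OF i y, of vs] unfolding alternating_on_def by (metis subset_UNIV)
    qed
  next
    fix vs assume l: "length vs = k \<and> set vs \<subseteq> facet_tangent X i"
    then have "smooth_on S (\<lambda>y. U y vs)" using assms by (auto simp: Lam_def smooth_forms_def)
    then have "smooth_on (facet X i) (\<lambda>y. U y vs)" by (rule smooth_on_subset) (auto simp: facet_def)
    then show "smooth_on (facet X i) (\<lambda>y. tr_bd X U y vs)"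
      by (rule smooth_on_cong) (use l i eq in auto)
  qed
  then show ?thesis by (simp add: Lam_bd_def)
qed

text \<open>
  \<open>Fmap\<close> maps rays from \<open>X z\<close> to rays from \<open>X z\<close>, and the remaining arguments of \<open>u\<close> are constant.
  The factor \<open>\<rho>\<close> is \<open>1\<close> for polynomial forms; it is \<open>t\<close> when one of the arguments is radial and the form
  belongs to the trimmed space.
\<close>

lemma R_op_ray:
  assumes I: "set I \<subseteq> {..DIM('a)}" and admissible: "admissible I p K" and z: "z \<le> DIM('a)" "z \<notin> set I"
    and u: "u \<in> Lam_bd X k" and x: "x \<in> S" and l: "length vs + length K = k"
    and pol: "\<And>y. y \<in> hullX (p # K) \<Longrightarrow>
      poly_Icc r (\<lambda>t. \<rho> t * u (ray z (Fmap X I x y) t) (frame I p K vs))"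
  shows "\<exists>\<phi>. poly_Icc r \<phi> \<and> (\<forall>t\<in>{0..1}. \<rho> t * R_op X k I (p # K) u (ray z x t) vs = bary_sum X I (ray z x t) ^ length K * \<phi> t)"
proof -
  obtain i where i: "i \<in> set I" "i \<notin> set (p # K)" and J: "distinct (p # K)" "set (p # K) \<subseteq> {..DIM('a)}"
    using admissible by (auto simp: admissible_def)
  have iD: "i \<le> DIM('a)" using i I by auto
  let ?\<mu> = "simplex_measure (length K)" and ?zs = "frame I p K vs"
  let ?\<phi> = "\<lambda>t. \<integral>\<tau>. \<rho> t * u (Fmap X I (ray z x t) (simplex_point p K \<tau>)) ?zs \<partial>?\<mu>"
  have lz: "length ?zs = k" using l by (simp add: frame_def)
  have "poly_Icc r ?\<phi>"
  proof (rule poly_Icc_integral)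
    fix \<tau> assume "\<tau> \<in> space ?\<mu>"
    then have "simplex_point p K \<tau> \<in> hullX (p # K)" using simplex_point_image by blast
    from pol[OF this] show "poly_Icc r (\<lambda>t. \<rho> t * u (Fmap X I (ray z x t) (simplex_point p K \<tau>)) ?zs)"
      by (simp add: Fmap_ray[OF I z])
  next
    fix t :: real assume t: "t \<in> {0..1}"
    show "integrable ?\<mu> (\<lambda>\<tau>. \<rho> t * u (Fmap X I (ray z x t) (simplex_point p K \<tau>)) ?zs)"
      using ray_in_simplex[OF z(1) x t]
      by (intro integrable_mult_right integrable_R[OF I i J(2)] smooth_on_continuous Lam_bdD(2)[OF u iD lz]
          frame_in_facet_tangent[OF I i J(2)]) auto
  qed
  moreover have "\<rho> t * R_op X k I (p # K) u (ray z x t) vs = bary_sum X I (ray z x t) ^ length K * ?\<phi> t" if "t \<in> {0..1}" for t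
    using R_op_eq[OF I i J Lam_bdD(1)[OF u iD] ray_in_simplex[OF z(1) x that] l] by simp
  ultimately show ?thesis by blast
qed

lemma A_op_ray:
  assumes I: "set I \<subseteq> {..DIM('a)}" "2 \<le> card (set I)" and z: "z \<le> DIM('a)" "z \<notin> set I"
    and J: "J \<in> Gam s (set I)" and s: "s \<le> k" and ws: "length ws = k - s"
    and u: "u \<in> Lam_bd X k" and x: "x \<in> S"
    and pol: "\<And>p K y. admissible I p K \<Longrightarrow> y \<in> hullX (p # K) \<Longrightarrow> length K = s \<Longrightarrow>
      poly_Icc r (\<lambda>t. \<rho> t * u (ray z (Fmap X I x y) t) (frame I p K ws))"
  shows "\<exists>\<phi>. poly_Icc r \<phi> \<and> (\<forall>t\<in>{0..1}. \<rho> t * A_op X k I J u (ray z x t) ws = bary_sum X I (ray z x t) ^ s * \<phi> t)"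
proof -
  have R: "\<exists>\<phi>. poly_Icc r \<phi> \<and> (\<forall>t\<in>{0..1}. \<rho> t * R_op X k I (p # K) u (ray z x t) ws = bary_sum X I (ray z x t) ^ s * \<phi> t)"
    if "admissible I p K" "length K = s" for p K
    using R_op_ray[OF I(1) that(1) z u x _ pol[OF that(1) _ that(2)]] that(2) ws s by auto
  have l: "length J = Suc s" "J ! 0 \<in> set I" using set_Gam[OF J] nth_mem[of 0 J] by auto
  show ?thesis
  proof (cases "s = 0")
    case True
    then show ?thesis using R[OF admissible_single[OF I l(2)]] A_op_eq_R_op[OF l(1), of k I u] by simp
  next
    case False
    have "\<exists>\<phi>. \<forall>p\<in>{..DIM('a)} - set J. \<forall>i\<le>s. poly_Icc r (\<phi> p i) \<and>
        (\<forall>t\<in>{0..1}. \<rho> t * R_op X k I (p # remove_nth i J) u (ray z x t) ws = bary_sum X I (ray z x t) ^ s * \<phi> p i t)"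
      using R[OF admissible_remove_nth[OF I(1) J]] by metis
    then obtain \<phi> where \<phi>: "\<And>p i. p \<in> {..DIM('a)} - set J \<Longrightarrow> i \<le> s \<Longrightarrow> poly_Icc r (\<phi> p i)"
      "\<And>p i t. p \<in> {..DIM('a)} - set J \<Longrightarrow> i \<le> s \<Longrightarrow> t \<in> {0..1} \<Longrightarrow>
        \<rho> t * R_op X k I (p # remove_nth i J) u (ray z x t) ws = bary_sum X I (ray z x t) ^ s * \<phi> p i t"
      by blast
    let ?\<psi> = "\<lambda>t. A_coeff DIM('a) k s * (\<Sum>p\<in>{..DIM('a)} - set J. \<Sum>i=0..s. (-1) ^ i * \<phi> p i t)"
    have "poly_Icc r ?\<psi>" using \<phi>(1) by (intro poly_Icc_mult poly_Icc_sum) auto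
    moreover have "\<rho> t * A_op X k I J u (ray z x t) ws = bary_sum X I (ray z x t) ^ s * ?\<psi> t" if t: "t \<in> {0..1}" for t
    proof -
      have "\<rho> t * A_op X k I J u (ray z x t) ws = A_coeff DIM('a) k s *
         (\<Sum>p\<in>{..DIM('a)} - set J. \<Sum>i=0..s. (-1) ^ i * (\<rho> t * R_op X k I (p # remove_nth i J) u (ray z x t) ws))"
        using False by (simp add: A_op_eq_R_op[OF l(1)] sum_distrib_left mult_ac)
      also have "\<dots> = A_coeff DIM('a) k s *
         (\<Sum>p\<in>{..DIM('a)} - set J. \<Sum>i=0..s. (-1) ^ i * (bary_sum X I (ray z x t) ^ s * \<phi> p i t))"
      proof (rule arg_cong[where f = "\<lambda>s. A_coeff DIM('a) k _ * s"], rule sum.cong, rule refl, rule sum.cong, rule refl)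
        fix p i assume "p \<in> {..DIM('a)} - set J" "i \<in> {0..s}"
        then have "\<rho> t * R_op X k I (p # remove_nth i J) u (ray z x t) ws = bary_sum X I (ray z x t) ^ s * \<phi> p i t"
          using t by (intro \<phi>(2)) auto
        then show "(-1) ^ i * (\<rho> t * R_op X k I (p # remove_nth i J) u (ray z x t) ws) = (-1) ^ i * (bary_sum X I (ray z x t) ^ s * \<phi> p i t)"
          by (simp only:)
      qed
      finally show ?thesis by (simp add: sum_distrib_left mult_ac)
    qed
    ultimately show ?thesis by blast
  qed
qed

text \<open>
  Along a ray from \<open>X z\<close> both the Whitney forms and \<open>bary_sum X I\<close> are homogeneous of degree one, so
  only the operators \<open>A\<close> contribute to the degree.
\<close>

lemma I_term_ray:
  assumes I: "set I \<subseteq> {..DIM('a)}" "2 \<le> card (set I)" and z: "z \<le> DIM('a)" "z \<notin> set I"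
    and u: "u \<in> Lam_bd X k" and x: "x \<in> interiorS" and vs: "length vs = k"
    and A: "\<And>s J \<sigma>. s \<le> k \<Longrightarrow> J \<in> Gam s (set I) \<Longrightarrow> \<sigma> permutes {..<k} \<Longrightarrow>
       whitney X J x (map (\<lambda>i. vs ! \<sigma> i) [0..<s]) = 0 \<or>
       (\<exists>\<phi>. poly_Icc r \<phi> \<and> (\<forall>t\<in>{0..1}. \<rho> t * A_op X k I J u (ray z x t) (map (\<lambda>i. vs ! \<sigma> i) [s..<k]) =
          bary_sum X I (ray z x t) ^ s * \<phi> t))"
  shows "\<exists>\<phi>. poly_Icc r \<phi> \<and> (\<forall>t\<in>{0<..1}. \<rho> t * I_term k u I (ray z x t) vs = \<phi> t)"
proof -
  let ?\<Lambda> = "bary_sum X I"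
  let ?f = "\<lambda>\<sigma> s. map (\<lambda>i. vs ! \<sigma> i) [0..<s]" and ?b = "\<lambda>\<sigma> s. map (\<lambda>i. vs ! \<sigma> i) [s..<k]"
  have \<Lambda>: "0 < ?\<Lambda> x" unfolding bary_sum_def using x I by (intro sum_pos) (auto simp: interiorS_def)
  have ex: "\<exists>\<phi>. poly_Icc r \<phi> \<and> (\<forall>t\<in>{0<..1}. \<rho> t * (of_int (sign \<sigma>) * (whitney X J (ray z x t) (?f \<sigma> s) / ?\<Lambda> (ray z x t) ^ (s + 1)) *
       A_op X k I J u (ray z x t) (?b \<sigma> s)) = \<phi> t)"
    if s: "s \<le> k" and J: "J \<in> Gam s (set I)" and \<sigma>: "\<sigma> permutes {..<k}" for s J \<sigma>
  proof -
    have wr: "whitney X J (ray z x t) ws = t * whitney X J x ws" for t ws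
      using set_Gam[OF J] I z by (intro whitney_ray) auto
    show ?thesis
    proof (cases "whitney X J x (?f \<sigma> s) = 0")
      case True
      then show ?thesis by (intro exI[of _ "\<lambda>_. 0"]) (simp add: wr poly_Icc_const)
    next
      case False
      then obtain \<phi> where \<phi>: "poly_Icc r \<phi>" "\<And>t. t \<in> {0..1} \<Longrightarrow> \<rho> t * A_op X k I J u (ray z x t) (?b \<sigma> s) = ?\<Lambda> (ray z x t) ^ s * \<phi> t"
        using A[OF s J \<sigma>] by blast
      let ?c = "of_int (sign \<sigma>) * whitney X J x (?f \<sigma> s) / ?\<Lambda> x"
      have "\<rho> t * (of_int (sign \<sigma>) * (whitney X J (ray z x t) (?f \<sigma> s) / ?\<Lambda> (ray z x t) ^ (s + 1)) *
         A_op X k I J u (ray z x t) (?b \<sigma> s)) = ?c * \<phi> t" if t: "t \<in> {0<..1}" for t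
      proof -
        have nz: "?\<Lambda> (ray z x t) = t * ?\<Lambda> x" "t \<noteq> 0" using t bary_sum_ray[OF I(1) z, of x t] by auto
        have "\<rho> t * (of_int (sign \<sigma>) * (whitney X J (ray z x t) (?f \<sigma> s) / ?\<Lambda> (ray z x t) ^ (s + 1)) *
            A_op X k I J u (ray z x t) (?b \<sigma> s)) =
          of_int (sign \<sigma>) * (t * whitney X J x (?f \<sigma> s)) / ?\<Lambda> (ray z x t) ^ (s + 1) * (\<rho> t * A_op X k I J u (ray z x t) (?b \<sigma> s))"
          by (simp add: wr)
        also have "\<dots> = of_int (sign \<sigma>) * (t * whitney X J x (?f \<sigma> s)) / ?\<Lambda> (ray z x t) ^ (s + 1) * (?\<Lambda> (ray z x t) ^ s * \<phi> t)"
          using \<phi>(2)[of t] t by simp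
        also have "\<dots> = of_int (sign \<sigma>) * (t * whitney X J x (?f \<sigma> s)) / ?\<Lambda> (ray z x t) * \<phi> t"
          using nz \<Lambda> by simp
        also have "\<dots> = ?c * \<phi> t" using nz \<Lambda> by simp
        finally show ?thesis .
      qed
      then show ?thesis using poly_Icc_mult[OF \<phi>(1), of ?c] by blast
    qed
  qed
  have "\<exists>\<phi>. \<forall>s J \<sigma>. s \<le> k \<longrightarrow> J \<in> Gam s (set I) \<longrightarrow> \<sigma> permutes {..<k} \<longrightarrow>
      poly_Icc r (\<phi> s J \<sigma>) \<and> (\<forall>t\<in>{0<..1}. \<rho> t * (of_int (sign \<sigma>) * (whitney X J (ray z x t) (?f \<sigma> s) / ?\<Lambda> (ray z x t) ^ (s + 1)) *
       A_op X k I J u (ray z x t) (?b \<sigma> s)) = \<phi> s J \<sigma> t)"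
    using ex by metis
  then obtain \<phi> where \<phi>: "\<And>s J \<sigma>. s \<le> k \<Longrightarrow> J \<in> Gam s (set I) \<Longrightarrow> \<sigma> permutes {..<k} \<Longrightarrow> poly_Icc r (\<phi> s J \<sigma>)"
    "\<And>s J \<sigma> t. s \<le> k \<Longrightarrow> J \<in> Gam s (set I) \<Longrightarrow> \<sigma> permutes {..<k} \<Longrightarrow> t \<in> {0<..1} \<Longrightarrow>
      \<rho> t * (of_int (sign \<sigma>) * (whitney X J (ray z x t) (?f \<sigma> s) / ?\<Lambda> (ray z x t) ^ (s + 1)) *
       A_op X k I J u (ray z x t) (?b \<sigma> s)) = \<phi> s J \<sigma> t"
    by blast
  let ?\<psi> = "\<lambda>t. \<Sum>s=0..k. \<Sum>J\<in>Gam s (set I). (1 / (fact s * fact (k - s))) * (\<Sum>\<sigma> | \<sigma> permutes {..<k}. \<phi> s J \<sigma> t)"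
  have "poly_Icc r ?\<psi>" using \<phi>(1) by (intro poly_Icc_sum poly_Icc_mult) auto
  moreover have "\<rho> t * I_term k u I (ray z x t) vs = ?\<psi> t" if t: "t \<in> {0<..1}" for t
  proof -
   have "\<rho> t * I_term k u I (ray z x t) vs = (\<Sum>s=0..k. \<Sum>J\<in>Gam s (set I). \<rho> t *
      wedge s (k - s) (\<lambda>ws. whitney X J (ray z x t) ws / ?\<Lambda> (ray z x t) ^ (s + 1)) (A_op X k I J u (ray z x t)) vs)"
     by (simp only: I_term_def sum_distrib_left)
   also have "\<dots> = ?\<psi> t"
   proof (rule sum.cong, rule refl, rule sum.cong, rule refl)
    fix s J assume s: "s \<in> {0..k}" and J: "J \<in> Gam s (set I)"
    then have sk: "s \<le> k" by simp
    have "\<rho> t * wedge s (k - s) (\<lambda>ws. whitney X J (ray z x t) ws / ?\<Lambda> (ray z x t) ^ (s + 1)) (A_op X k I J u (ray z x t)) vs =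
       (1 / (fact s * fact (k - s))) * (\<Sum>\<sigma> | \<sigma> permutes {..<k}. \<rho> t * (of_int (sign \<sigma>) *
         (whitney X J (ray z x t) (?f \<sigma> s) / ?\<Lambda> (ray z x t) ^ (s + 1)) * A_op X k I J u (ray z x t) (?b \<sigma> s)))"
      unfolding wedge_def using sk by (simp add: sum_distrib_left sum_divide_distrib mult_ac)
    also have "(\<Sum>\<sigma> | \<sigma> permutes {..<k}. \<rho> t * (of_int (sign \<sigma>) *
         (whitney X J (ray z x t) (?f \<sigma> s) / ?\<Lambda> (ray z x t) ^ (s + 1)) * A_op X k I J u (ray z x t) (?b \<sigma> s))) =
         (\<Sum>\<sigma> | \<sigma> permutes {..<k}. \<phi> s J \<sigma> t)"
      using \<phi>(2)[OF sk J _ t] by (intro sum.cong refl) simp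
    finally show "\<rho> t * wedge s (k - s) (\<lambda>ws. whitney X J (ray z x t) ws / ?\<Lambda> (ray z x t) ^ (s + 1)) (A_op X k I J u (ray z x t)) vs =
       (1 / (fact s * fact (k - s))) * (\<Sum>\<sigma> | \<sigma> permutes {..<k}. \<phi> s J \<sigma> t)" .
   qed
   finally show ?thesis .
  qed
  ultimately show ?thesis by blast
qed

end

context simplex
begin

lemma PLamD:
  assumes "U \<in> PLam X r k"
  shows "U \<in> Lam X k" "length vs = k \<Longrightarrow> poly_fun_on S r (\<lambda>y. U y vs)"
    "y \<in> S \<Longrightarrow> alternating_on UNIV k (U y)"
  using assms by (auto simp: PLam_def Lam_def smooth_forms_def)

lemma ray_poly_Icc:
  assumes f: "poly_fun_on S r f" and z: "z \<le> DIM('a)" and y: "y \<in> S"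
  shows "poly_Icc r (\<lambda>t. f (ray z y t))"
  unfolding ray_def
  by (rule poly_fun_on_line[OF f]) (use ray_in_simplex[OF z y] in \<open>simp add: ray_def\<close>)

text \<open>The evaluation points and the frame belong to one facet, so the trace retains the value.\<close>

lemma tr_bd_frame:
  assumes I: "set I \<subseteq> {..DIM('a)}" and admissible: "admissible I p K" and x: "x \<in> S" and y: "y \<in> hullX (p # K)"
    and z: "z \<le> DIM('a)" "z \<notin> set I" and t: "t \<in> {0..1}"
  shows "tr_bd X U (ray z (Fmap X I x y) t) (frame I p K vs) = U (ray z (Fmap X I x y) t) (frame I p K vs)"
proof -
  obtain i where i: "i \<in> set I" "i \<notin> set (p # K)" and J: "set (p # K) \<subseteq> {..DIM('a)}"
    using admissible by (auto simp: admissible_def)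
  have iD: "i \<le> DIM('a)" using i I by auto
  have "y \<in> facet X i" using y hullX_facet[OF J iD i(2)] by auto
  then have "Fmap X I (ray z x t) y \<in> facet X i"
    using ray_in_simplex[OF z(1) x t] by (intro Fmap_in_facet I i)
  then have "ray z (Fmap X I x y) t \<in> facet X i" by (simp add: Fmap_ray[OF I z])
  then show ?thesis using frame_in_facet_tangent[OF I i J, of vs] iD by (auto simp: tr_bd_def)
qed

lemma Fmap_in_simplex:
  assumes I: "set I \<subseteq> {..DIM('a)}" and admissible: "admissible I p K" and x: "x \<in> S" and y: "y \<in> hullX (p # K)"
  shows "Fmap X I x y \<in> S"
proof -
  obtain i where i: "i \<in> set I" "i \<notin> set (p # K)" and J: "set (p # K) \<subseteq> {..DIM('a)}"
    using admissible by (auto simp: admissible_def)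
  have iD: "i \<le> DIM('a)" using i I by auto
  have "y \<in> facet X i" using y hullX_facet[OF J iD i(2)] by auto
  then show ?thesis using Fmap_in_facet[OF I i(1) x] by (auto simp: facet_def)
qed

lemma I_term_ray_PLam:
  assumes I: "set I \<subseteq> {..DIM('a)}" "2 \<le> card (set I)" and z: "z \<le> DIM('a)" "z \<notin> set I"
    and U: "U \<in> PLam X r k" and x: "x \<in> interiorS" and vs: "length vs = k"
  shows "\<exists>\<phi>. poly_Icc r \<phi> \<and> (\<forall>t\<in>{0<..1}. I_term k (tr_bd X U) I (ray z x t) vs = \<phi> t)"
proof -
  have xS: "x \<in> S" using x interiorS_subset by auto
  have u: "tr_bd X U \<in> Lam_bd X k" by (rule tr_bd_in_Lam_bd[OF PLamD(1)[OF U]])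
  have "\<exists>\<phi>. poly_Icc r \<phi> \<and> (\<forall>t\<in>{0<..1}. 1 * I_term k (tr_bd X U) I (ray z x t) vs = \<phi> t)"
  proof (rule I_term_ray[OF I z u x vs, where \<rho> = "\<lambda>_. 1"], rule disjI2, rule A_op_ray[OF I z _ _ _ u xS, where \<rho> = "\<lambda>_. 1"])
    fix s J \<sigma> p K y
    assume s: "s \<le> k" and admissible: "admissible I p K" and y: "y \<in> hullX (p # K)" and K: "length K = s"
    let ?zs = "frame I p K (map (\<lambda>i. vs ! \<sigma> i) [s..<k])"
    have "length ?zs = k" using s K by (simp add: frame_def)
    from ray_poly_Icc[OF PLamD(2)[OF U this] z(1) Fmap_in_simplex[OF I(1) admissible xS y]]
    show "poly_Icc r (\<lambda>t. 1 * tr_bd X U (ray z (Fmap X I x y) t) ?zs)"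
      by (rule poly_Icc_cong) (use tr_bd_frame[OF I(1) admissible xS y z] in simp)
  qed auto
  then show ?thesis by simp
qed

lemma poly_Icc_rayE:
  assumes "\<exists>\<phi>. poly_Icc r \<phi> \<and> (\<forall>t\<in>{0<..1}. f t = \<phi> t)"
  shows "\<exists>q. degree q \<le> r \<and> (\<forall>t\<in>{0<..1}. f t = poly q t)"
proof -
  obtain \<phi> q where "degree q \<le> r" "\<And>t. t \<in> {0..1} \<Longrightarrow> \<phi> t = poly q t" "\<And>t. t \<in> {0<..1} \<Longrightarrow> f t = \<phi> t"
    using assms by (auto simp: poly_Icc_def)
  then show ?thesis by (intro exI[of _ q]) auto
qed

text \<open>
  The Whitney forms of subsets of \<open>I\<close> vanish on the radial vector \<open>x - X z\<close>, hence it is an argument of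
  the operator \<open>A\<close>.  There the derivative of \<open>Fmap X I _ y\<close> maps it to the radial vector at
  \<open>Fmap X I x y\<close>, and \<open>u\<close> is contracted with the field that defines the trimmed space.  The radial vector at
  \<open>ray z x t\<close> is \<open>t *\<^sub>R (x - X z)\<close>, which accounts for the factor \<open>t\<close>.
\<close>

lemma I_term_ray_radial:
  assumes I: "set I \<subseteq> {..DIM('a)}" "2 \<le> card (set I)" and z: "z \<le> DIM('a)" "z \<notin> set I"
    and U: "U \<in> PLam_minus X r k" and x: "x \<in> interiorS" and k: "0 < k" and vs: "length vs = k - 1"
  shows "\<exists>\<phi>. poly_Icc r \<phi> \<and> (\<forall>t\<in>{0<..1}. I_term k (tr_bd X U) I (ray z x t) ((ray z x t - X z) # vs) = \<phi> t)"
proof -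
  have xS: "x \<in> S" using x interiorS_subset by auto
  have UP: "U \<in> PLam X r k" and C: "contract (X z) U \<in> PLam X r (k - 1)" using U k by (auto simp: PLam_minus_def)
  have u: "tr_bd X U \<in> Lam_bd X k" by (rule tr_bd_in_Lam_bd[OF PLamD(1)[OF UP]])
  let ?d = "x - X z" and ?vs = "(x - X z) # vs"
  have lvs: "length ?vs = k" using vs k by simp
  have "\<exists>\<phi>. poly_Icc r \<phi> \<and> (\<forall>t\<in>{0<..1}. t * I_term k (tr_bd X U) I (ray z x t) ?vs = \<phi> t)"
  proof (rule I_term_ray[OF I z u x lvs, where \<rho> = "\<lambda>t. t"])
    fix s J \<sigma> assume s: "s \<le> k" and J: "J \<in> Gam s (set I)" and \<sigma>: "\<sigma> permutes {..<k}"
    let ?f = "map (\<lambda>i. ?vs ! \<sigma> i) [0..<s]" and ?b = "map (\<lambda>i. ?vs ! \<sigma> i) [s..<k]"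
    define i where "i = inv \<sigma> 0"
    have i: "i < k" "\<sigma> i = 0"
      using \<sigma> k permutes_in_image[OF permutes_inv[OF \<sigma>], of 0] permutes_inverses(1)[OF \<sigma>, of 0] by (auto simp: i_def)
    show "whitney X J x ?f = 0 \<or> (\<exists>\<phi>. poly_Icc r \<phi> \<and> (\<forall>t\<in>{0..1}. t * A_op X k I J (tr_bd X U) (ray z x t) ?b =
          bary_sum X I (ray z x t) ^ s * \<phi> t))"
    proof (cases "i < s")
      case True
      have "?d \<in> set ?f" using True i by (auto simp: image_iff intro!: bexI[of _ i])
      then have "whitney X J x ?f = 0"
        using set_Gam[OF J] I z by (intro whitney_radial[of J s z]) auto
      then show ?thesis by simp
    next
      case False
      let ?m = "i - s"
      have m: "?m < length ?b" "?b ! ?m = ?d" using False i by auto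
      show ?thesis
      proof (rule disjI2, rule A_op_ray[OF I z J s _ u xS])
        fix p K y assume admissible: "admissible I p K" and y: "y \<in> hullX (p # K)" and K: "length K = s"
        have J': "set (p # K) \<subseteq> {..DIM('a)}" using admissible by (auto simp: admissible_def)
        let ?zs = "frame I p K ?b" and ?E = "map (\<lambda>j. X j - X p) K" and ?F = "Fmap X I x y"
        let ?L = "map (DFy I y) (take ?m ?b)" and ?R = "map (DFy I y) (drop (Suc ?m) ?b) @ ?E"
        have FS: "?F \<in> S" by (rule Fmap_in_simplex[OF I(1) admissible xS y])
        have lL: "length (?L @ ?R) = k - 1" using m s K by simp
        have main: "t * tr_bd X U (ray z ?F t) ?zs = (-1) ^ ?m * contract (X z) U (ray z ?F t) (?L @ ?R)"
          if t: "t \<in> {0..1}" for t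
        proof -
          have FtS: "ray z ?F t \<in> S" by (rule ray_in_simplex[OF z(1) FS t])
          have alt: "alternating_on UNIV k (U (ray z ?F t))" by (rule PLamD(3)[OF UP FtS])
          obtain \<tau> where \<tau>: "y - X p = (\<Sum>l<length ?E. \<tau> l *\<^sub>R ?E ! l)"
          proof -
            have "y - X p = (\<Sum>j\<le>DIM('a). bary X j y *\<^sub>R X j) - (\<Sum>j\<le>DIM('a). bary X j y) *\<^sub>R X p"
              by (simp add: bary_representation bary_sum_one)
            also have "\<dots> = (\<Sum>j\<le>DIM('a). bary X j y *\<^sub>R (X j - X p))"
              by (simp add: scaleR_diff_right sum_subtractf scaleR_sum_left)
            also have "\<dots> = (\<Sum>j\<in>set K. bary X j y *\<^sub>R (X j - X p))"
            proof (rule sum.mono_neutral_right)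
              show "\<forall>j\<in>{..DIM('a)} - set K. bary X j y *\<^sub>R (X j - X p) = 0"
              proof
                fix j assume j: "j \<in> {..DIM('a)} - set K"
                show "bary X j y *\<^sub>R (X j - X p) = 0"
                proof (cases "j = p")
                  case False
                  then have "y \<in> facet X j" using j y hullX_facet[OF J', of j] by auto
                  then show ?thesis by (simp add: facet_def)
                qed simp
              qed
            qed (use J' in auto)
            also have "\<dots> = (\<Sum>l<length K. bary X (K ! l) y *\<^sub>R (X (K ! l) - X p))"
              using bij_betw_nth[of K "{..<length K}" "set K"] admissible
              by (intro sum.reindex_bij_betw[symmetric, where h = "\<lambda>l. K ! l"]) (auto simp: admissible_def)
            finally show thesis by (intro that[of "\<lambda>l. bary X (K ! l) y"]) simp
          qed
          have DFy: "map (DFy I y) ?b = map (\<lambda>v. DF I p v + linI I v *\<^sub>R (y - X p)) ?b"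
            using DFy_diff[of I y _ "X p"] by (simp add: DF_def)
          have absorb: "U (ray z ?F t) (map (DFy I y) ?b @ ?E) = U (ray z ?F t) ?zs"
            unfolding DFy using alternating_absorb[OF alt, of ?b ?E "y - X p" \<tau> "DF I p" "linI I"] \<tau> s K
            by (simp add: frame_def)
          have "map (DFy I y) ?b @ ?E = ?L @ (?F - X z) # ?R"
          proof -
            have "?b = take ?m ?b @ ?d # drop (Suc ?m) ?b" using id_take_nth_drop[OF m(1)] m(2) by simp
            then have "map (DFy I y) ?b = ?L @ DFy I y ?d # map (DFy I y) (drop (Suc ?m) ?b)"
              by (metis list.simps(9) map_append)
            then show ?thesis by (simp add: DFy_radial[OF I(1) z])
          qed
          then have "t * U (ray z ?F t) ?zs = t * U (ray z ?F t) (?L @ (?F - X z) # ?R)" using absorb by simp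
          also have "\<dots> = U (ray z ?F t) (?L @ (ray z ?F t - X z) # ?R)"
          proof -
            have "multilin k (U (ray z ?F t))" using alt by (simp add: alternating_on_UNIV_iff)
            from multilin_scale[OF this, of "?L @ 0 # ?R" "length ?L" t "?F - X z"]
            show ?thesis using lL k by (simp add: ray_def list_update_append)
          qed
          also have "\<dots> = (-1) ^ ?m * U (ray z ?F t) ((ray z ?F t - X z) # ?L @ ?R)"
          proof -
            have "U (ray z ?F t) ([] @ (ray z ?F t - X z) # ?L @ ?R) =
                (-1) ^ length ?L * U (ray z ?F t) ([] @ ?L @ (ray z ?F t - X z) # ?R)"
              using lL k by (intro antisym_list_move[OF alternating_antisym_list[OF alt]]) auto
            moreover have "length ?L = ?m" using m by simp
            moreover have "(-1 :: real) ^ ?m * (-1) ^ ?m = 1" by (simp flip: power_add)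
            ultimately show ?thesis by (simp del: length_map)
          qed
          finally show ?thesis
            by (simp add: tr_bd_frame[OF I(1) admissible xS y z t] contract_def)
        qed
        have "poly_Icc r (\<lambda>t. (-1) ^ ?m * contract (X z) U (ray z ?F t) (?L @ ?R))"
          by (intro poly_Icc_mult ray_poly_Icc[OF PLamD(2)[OF C lL] z(1) FS])
        then show "poly_Icc r (\<lambda>t. t * tr_bd X U (ray z ?F t) ?zs)"
          by (rule poly_Icc_cong) (simp only: main)
      qed (use s in auto)
    qed
  qed
  moreover have "I_term k (tr_bd X U) I (ray z x t) ((ray z x t - X z) # vs) = t * I_term k (tr_bd X U) I (ray z x t) ?vs"
    if t: "t \<in> {0<..1}" for t
  proof -
    have "ray z x t \<in> S" using t by (intro ray_in_simplex z xS) auto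
    from alternating_I_term[OF I u this] have "multilin k (I_term k (tr_bd X U) I (ray z x t))"
      by (simp add: alternating_on_UNIV_iff)
    from multilin_scale[OF this, of ?vs 0 t ?d] show ?thesis using lvs k by (simp add: ray_def)
  qed
  ultimately show ?thesis by auto
qed

section \<open>The full index set, polynomial case\<close>

text \<open>
  For the full index set \<open>Fmap X I x y = y\<close> does not depend on \<open>x\<close>.  Its derivative with respect to \<open>x\<close>
  therefore vanishes, and for \<open>s < k\<close> the values of this derivative occur among the arguments of \<open>u\<close>.
\<close>

lemma A_op_full_zero:
  assumes I: "set I = {..DIM('a)}" and J: "J \<in> Gam s (set I)" and s: "s < k" and ws: "length ws = k - s"
    and u: "u \<in> Lam_bd X k" and x: "x \<in> S"
  shows "A_op X k I J u x ws = 0"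
proof -
  have I': "set I \<subseteq> {..DIM('a)}" "2 \<le> card (set I)" using I DIM_positive[where 'a = 'a] by (auto simp: Suc_le_eq)
  have R: "R_op X k I (p # K) u x ws = 0" if a: "admissible I p K" and l: "length K = s" for p K
  proof -
    obtain i where i: "i \<in> set I" "i \<notin> set (p # K)" and J: "distinct (p # K)" "set (p # K) \<subseteq> {..DIM('a)}"
      using a by (auto simp: admissible_def)
    have iD: "i \<le> DIM('a)" using i I by auto
    let ?ws = "map (\<lambda>_. 0) ws"
    have "frame I p K ws = frame I p K ?ws" by (simp add: frame_def DF_def Fmap_full[OF I])
    then have "R_op X k I (p # K) u x ws = R_op X k I (p # K) u x ?ws"
      using R_op_eq[OF I'(1) i J Lam_bdD(1)[OF u iD] x, where vs = ws] R_op_eq[OF I'(1) i J Lam_bdD(1)[OF u iD] x, where vs = ?ws] l ws s by simp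
    also have "\<dots> = 0"
      using multilin_R_op[OF I'(1) a u x] l ws s by (intro multilin_zero[of "k - s" _ _ 0]) auto
    finally show ?thesis .
  qed
  have l: "length J = Suc s" "J ! 0 \<in> set I" using set_Gam[OF J] nth_mem[of 0 J] by auto
  show ?thesis
  proof (cases "s = 0")
    case True
    then show ?thesis using A_op_eq_R_op[OF l(1)] R[OF admissible_single[OF I' l(2)]] by simp
  next
    case False
    have "R_op X k I (p # remove_nth i J) u x ws = 0" if "p \<in> {..DIM('a)} - set J" "i \<in> {0..s}" for p i
      using R admissible_remove_nth[OF I'(1) J that(1)] that(2) by auto
    then show ?thesis using A_op_eq_R_op[OF l(1)] False by simp
  qed
qed

lemma I_term_full_eq_whitney:
  assumes I: "set I = {..DIM('a)}" and u: "u \<in> Lam_bd X k" and vs: "length vs = k" and x: "x \<in> S"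
  shows "I_term k u I x vs = (\<Sum>J\<in>Gam k (set I). (1 / fact k) * (\<Sum>\<sigma> | \<sigma> permutes {..<k}.
      (of_int (sign \<sigma>) * A_op X k I J u (X 0) []) * whitney X J x (map (\<lambda>i. vs ! \<sigma> i) [0..<k])))"
proof -
  have z: "wedge s (k - s) (\<lambda>ws. whitney X J x ws / bary_sum X I x ^ (s + 1)) (A_op X k I J u x) vs = 0"
    if s: "s < k" and J: "J \<in> Gam s (set I)" for s J
    unfolding wedge_def using A_op_full_zero[OF I J s _ u x] s by simp
  have "I_term k u I x vs = (\<Sum>s\<in>{k}. \<Sum>J\<in>Gam s (set I).
     wedge s (k - s) (\<lambda>ws. whitney X J x ws / bary_sum X I x ^ (s + 1)) (A_op X k I J u x) vs)"
    unfolding I_term_def by (rule sum.mono_neutral_right) (use z in auto)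
  also have "\<dots> = (\<Sum>J\<in>Gam k (set I). (1 / fact k) * (\<Sum>\<sigma> | \<sigma> permutes {..<k}.
      (of_int (sign \<sigma>) * A_op X k I J u (X 0) []) * whitney X J x (map (\<lambda>i. vs ! \<sigma> i) [0..<k])))"
  proof -
    have "wedge k (k - k) (\<lambda>ws. whitney X J x ws / bary_sum X I x ^ (k + 1)) (A_op X k I J u x) vs =
      (1 / fact k) * (\<Sum>\<sigma> | \<sigma> permutes {..<k}.
      (of_int (sign \<sigma>) * A_op X k I J u (X 0) []) * whitney X J x (map (\<lambda>i. vs ! \<sigma> i) [0..<k]))"
      if J: "J \<in> Gam k (set I)" for J
      using A_op_full[OF I J order_refl _ u x vertex_in_simplex[of 0], of "[]"]
      by (simp add: wedge_def Fmap_full[OF I] mult_ac)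
    then show "(\<Sum>s\<in>{k}. \<Sum>J\<in>Gam s (set I).
     wedge s (k - s) (\<lambda>ws. whitney X J x ws / bary_sum X I x ^ (s + 1)) (A_op X k I J u x) vs) =
      (\<Sum>J\<in>Gam k (set I). (1 / fact k) * (\<Sum>\<sigma> | \<sigma> permutes {..<k}.
      (of_int (sign \<sigma>) * A_op X k I J u (X 0) []) * whitney X J x (map (\<lambda>i. vs ! \<sigma> i) [0..<k])))"
      by simp
  qed
  finally show ?thesis .
qed

lemma whitney_segment:
  assumes J: "distinct J" "set J \<subseteq> {..DIM('a)}" and z: "z \<le> DIM('a)"
  shows "whitney X J (ray z x t) ws = whitney X J (X z) ws + t * (whitney X J x ws - whitney X J (X z) ws)"
proof -
  have m: "map (\<lambda>j. dbary X j y) (remove_nth i J) = map lin (remove_nth i J)" if "i < length J" for y i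
    using remove_nth_props[OF J(1), of i] that J(2) by (auto simp: dbary_eq fun_eq_iff)
  have w: "whitney X J y ws = (\<Sum>i<length J. bary X (J ! i) y * ((-1) ^ i * wedge_list (map lin (remove_nth i J)) ws))" for y
    unfolding whitney_def by (intro sum.cong refl) (simp add: m mult_ac)
  have b: "bary X (J ! i) (ray z x t) = bary X (J ! i) (X z) + t * (bary X (J ! i) x - bary X (J ! i) (X z))" if "i < length J" for i
  proof -
    have "J ! i \<le> DIM('a)" using that J(2) nth_mem by fastforce
    then show ?thesis unfolding ray_def by (subst bary_segment) (simp_all add: left_diff_distrib right_diff_distrib)
  qed
  show ?thesis
    unfolding w sum_subtractf[symmetric] sum_distrib_left sum.distrib[symmetric]
    by (intro sum.cong refl) (simp add: b algebra_simps)
qed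

text \<open>
  By \<open>whitney_radial\<close> the Whitney form vanishes on \<open>x - X l\<close>, so contraction with \<open>x - a\<close> agrees with
  contraction with a constant vector and does not raise the degree.
\<close>

lemma whitney_translate:
  assumes J: "distinct J" "set J \<subseteq> {..DIM('a)}" "length J = Suc s" and l: "l \<le> DIM('a)" "l \<notin> set J"
    and ws: "length ws = s" "m < s"
  shows "whitney X J x (ws[m := x - a]) = whitney X J x (ws[m := X l - a])"
proof -
  have ml: "multilin s (\<lambda>ws. whitney X J x ws / 1)" by (rule multilin_whitney[OF J(3,1,2)])
  have "whitney X J x (ws[m := (x - X l) + (X l - a)]) = whitney X J x (ws[m := x - X l]) + whitney X J x (ws[m := X l - a])"
    using multilin_add[OF ml ws, of "x - X l" "X l - a"] by (simp only: div_by_1)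
  moreover have "whitney X J x (ws[m := x - X l]) = 0"
    using ws by (intro whitney_radial[OF J l]) (auto simp: set_update_memI)
  ultimately show ?thesis by simp
qed

lemma I_term_full_ray:
  assumes I: "set I = {..DIM('a)}" and r: "1 \<le> r" and u: "u \<in> Lam_bd X k" and x: "x \<in> S" and vs: "length vs = k"
  shows "\<exists>\<phi>. poly_Icc r \<phi> \<and> (\<forall>t\<in>{0<..1}. I_term k u I (ray 0 x t) vs = \<phi> t)"
proof (intro exI conjI ballI)
  show "poly_Icc r (\<lambda>t. \<Sum>J\<in>Gam k (set I). (1 / fact k) * (\<Sum>\<sigma> | \<sigma> permutes {..<k}.
      (of_int (sign \<sigma>) * A_op X k I J u (X 0) []) * whitney X J (ray 0 x t) (map (\<lambda>i. vs ! \<sigma> i) [0..<k])))"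
  proof (intro poly_Icc_sum poly_Icc_mult)
    fix J \<sigma> assume "J \<in> Gam k (set I)"
    then show "poly_Icc r (\<lambda>t. whitney X J (ray 0 x t) (map (\<lambda>i. vs ! \<sigma> i) [0..<k]))"
      using set_Gam[of J k "set I"] I r by (subst whitney_segment) (auto intro: poly_Icc_affine)
  qed
  fix t :: real assume "t \<in> {0<..1}"
  then show "I_term k u I (ray 0 x t) vs = (\<Sum>J\<in>Gam k (set I). (1 / fact k) * (\<Sum>\<sigma> | \<sigma> permutes {..<k}.
      (of_int (sign \<sigma>) * A_op X k I J u (X 0) []) * whitney X J (ray 0 x t) (map (\<lambda>i. vs ! \<sigma> i) [0..<k])))"
    using ray_in_simplex[of 0 x t] x by (intro I_term_full_eq_whitney I u vs) auto
qed

text \<open>An index \<open>l\<close> outside \<open>J\<close> exists because \<open>J\<close> has \<open>k + 1 \<le> DIM('a)\<close> elements.\<close>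

lemma I_term_full_ray_contract:
  assumes I: "set I = {..DIM('a)}" and r: "1 \<le> r" and u: "u \<in> Lam_bd X k" and x: "x \<in> S" and vs: "length vs = k - 1"
    and k: "0 < k" "k < DIM('a)"
  shows "\<exists>\<phi>. poly_Icc r \<phi> \<and> (\<forall>t\<in>{0<..1}. I_term k u I (ray 0 x t) ((ray 0 x t - a) # vs) = \<phi> t)"
proof -
  define l where "l J = (SOME l. l \<le> DIM('a) \<and> l \<notin> set J)" for J :: "nat list"
  have l: "l J \<le> DIM('a) \<and> l J \<notin> set J" if "J \<in> Gam k (set I)" for J
  proof -
    have "card (set J) = Suc k" using set_Gam[OF that] by (simp add: distinct_card)
    then have "\<not> {..DIM('a)} \<subseteq> set J" using k card_mono[of "set J" "{..DIM('a)}"] by auto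
    then have "\<exists>l. l \<le> DIM('a) \<and> l \<notin> set J" by auto
    then show ?thesis unfolding l_def by (rule someI_ex)
  qed
  let ?w = "\<lambda>J \<sigma>. map (\<lambda>i. ((X (l J) - a) # vs) ! \<sigma> i) [0..<k]"
  let ?\<psi> = "\<lambda>t. \<Sum>J\<in>Gam k (set I). (1 / fact k) * (\<Sum>\<sigma> | \<sigma> permutes {..<k}.
      (of_int (sign \<sigma>) * A_op X k I J u (X 0) []) * whitney X J (ray 0 x t) (?w J \<sigma>))"
  have "poly_Icc r ?\<psi>"
  proof (intro poly_Icc_sum poly_Icc_mult)
    fix J \<sigma> assume "J \<in> Gam k (set I)"
    then show "poly_Icc r (\<lambda>t. whitney X J (ray 0 x t) (?w J \<sigma>))"
      using set_Gam[of J k "set I"] I r by (subst whitney_segment) (auto intro: poly_Icc_affine)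
  qed
  moreover have "I_term k u I (ray 0 x t) ((ray 0 x t - a) # vs) = ?\<psi> t" if t: "t \<in> {0<..1}" for t
  proof -
    let ?y = "ray 0 x t"
    have y: "?y \<in> S" using ray_in_simplex[of 0 x t] x t by auto
    have lvs: "length ((?y - a) # vs) = k" using vs k by simp
    have "whitney X J ?y (map (\<lambda>i. ((?y - a) # vs) ! \<sigma> i) [0..<k]) = whitney X J ?y (?w J \<sigma>)"
      if J: "J \<in> Gam k (set I)" and \<sigma>: "\<sigma> permutes {..<k}" for J \<sigma>
    proof -
      define i where "i = inv \<sigma> 0"
      have i: "i < k" "\<sigma> i = 0"
        using \<sigma> k permutes_in_image[OF permutes_inv[OF \<sigma>], of 0] permutes_inverses(1)[OF \<sigma>, of 0] by (auto simp: i_def)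
      have inj: "\<sigma> j = 0 \<longleftrightarrow> j = i" for j using i(2) permutes_inj[OF \<sigma>] by (metis injD)
      have upd: "map (\<lambda>i. (v # vs) ! \<sigma> i) [0..<k] = (?w J \<sigma>)[i := v]" for v
      proof (rule nth_equalityI)
        fix j assume "j < length (map (\<lambda>i. (v # vs) ! \<sigma> i) [0..<k])"
        then have j: "j < k" by simp
        show "map (\<lambda>i. (v # vs) ! \<sigma> i) [0..<k] ! j = (?w J \<sigma>)[i := v] ! j"
        proof (cases "j = i")
          case True
          then show ?thesis using i by simp
        next
          case False
          then have "\<sigma> j \<noteq> 0" using inj by simp
          then show ?thesis using False j by (simp add: nth_Cons')
        qed
      qed simp
      have "whitney X J ?y ((?w J \<sigma>)[i := ?y - a]) = whitney X J ?y ((?w J \<sigma>)[i := X (l J) - a])"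
        using set_Gam[OF J] l[OF J] I i by (intro whitney_translate[of J k]) auto
      then show ?thesis unfolding upd[symmetric] by simp
    qed
    then show ?thesis
      unfolding I_term_full_eq_whitney[OF I u lvs y] by (intro sum.cong refl arg_cong2[where f = "(*)"]) auto
  qed
  ultimately show ?thesis by blast
qed

section \<open>Membership in the spaces of forms\<close>

lemma Lam_sum:
  assumes "\<And>i. i \<in> A \<Longrightarrow> w i \<in> Lam X k"
  shows "(\<lambda>x vs. \<Sum>i\<in>A. c i * w i x vs) \<in> Lam X k"
  using assms unfolding Lam_def smooth_forms_def
  by (auto intro!: alternating_sum alternating_scale smooth_on_sum smooth_on_cmult)

lemma PLam_sum:
  assumes "\<And>i. i \<in> A \<Longrightarrow> w i \<in> PLam X r k"
  shows "(\<lambda>x vs. \<Sum>i\<in>A. c i * w i x vs) \<in> PLam X r k"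
  using assms Lam_sum[of A w k c] unfolding PLam_def
  by (auto intro!: poly_fun_on_sum poly_fun_on_cmult)

lemma PLam_minus_sum:
  assumes "\<And>i. i \<in> A \<Longrightarrow> w i \<in> PLam_minus X r k"
  shows "(\<lambda>x vs. \<Sum>i\<in>A. c i * w i x vs) \<in> PLam_minus X r k"
  unfolding PLam_minus_def
proof (intro CollectI conjI impI allI)
  show "(\<lambda>x vs. \<Sum>i\<in>A. c i * w i x vs) \<in> PLam X r k" using assms by (intro PLam_sum) (auto simp: PLam_minus_def)
  fix a assume "0 < k"
  then have "(\<lambda>x vs. \<Sum>i\<in>A. c i * contract a (w i) x vs) \<in> PLam X r (k - 1)"
    using assms by (intro PLam_sum) (auto simp: PLam_minus_def)
  then show "contract a (\<lambda>x vs. \<Sum>i\<in>A. c i * w i x vs) \<in> PLam X r (k - 1)"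
    by (simp add: contract_def[abs_def])
qed

lemma contract_Lam:
  assumes w: "w \<in> Lam X k" and k: "0 < k"
  shows "contract a w \<in> Lam X (k - 1)"
  unfolding Lam_def smooth_forms_def
proof (intro CollectI conjI ballI allI impI)
  fix y assume "y \<in> S"
  then have "alternating_on UNIV k (w y)" using w by (auto simp: Lam_def smooth_forms_def)
  then have "alternating_on UNIV (length [y - a] + (k - 1)) (w y)" using k by simp
  from alternating_prefix[OF this] show "alternating_on UNIV (k - 1) (contract a w y)" by (simp add: contract_def[abs_def])
next
  fix vs :: "'a list" assume vs: "length vs = k - 1 \<and> set vs \<subseteq> UNIV"
  have sm: "smooth_on S (\<lambda>y. w y (b # vs))" for b using w vs k by (auto simp: Lam_def smooth_forms_def)
  have "smooth_on S (\<lambda>y. \<Sum>b\<in>Basis. (y \<bullet> b + - (a \<bullet> b)) * w y (b # vs))"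
    by (intro smooth_on_sum smooth_on_mult smooth_on_add smooth_on_const smooth_on_linear sm)
       (auto intro!: linearI simp: inner_add_left)
  then show "smooth_on S (\<lambda>y. contract a w y vs)"
  proof (rule smooth_on_cong)
    fix y assume y: "y \<in> S"
    have "multilin k (w y)" using w y by (auto simp: Lam_def smooth_forms_def alternating_on_UNIV_iff)
    have lin: "linear (\<lambda>v. w y (v # vs))"
    proof (rule linearI)
      show "w y ((u + v) # vs) = w y (u # vs) + w y (v # vs)" for u v
        using multilin_add[OF \<open>multilin k (w y)\<close>, of "0 # vs" 0 u v] vs k by simp
      show "w y ((c *\<^sub>R v) # vs) = c *\<^sub>R w y (v # vs)" for c v
        using multilin_scale[OF \<open>multilin k (w y)\<close>, of "0 # vs" 0 c v] vs k by simp
    qed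
    have "contract a w y vs = w y ((\<Sum>b\<in>Basis. ((y - a) \<bullet> b) *\<^sub>R b) # vs)"
      by (simp add: contract_def euclidean_representation)
    also have "\<dots> = (\<Sum>b\<in>Basis. ((y - a) \<bullet> b) * w y (b # vs))"
      by (simp add: linear_sum[OF lin] linear_cmul[OF lin])
    finally show "(\<Sum>b\<in>Basis. (y \<bullet> b + - (a \<bullet> b)) * w y (b # vs)) = contract a w y vs"
      by (simp add: inner_diff_left)
  qed
qed

lemma bary_sum_interior:
  assumes "set I \<subseteq> {..DIM('a)}" "2 \<le> card (set I)" "x \<in> interiorS"
  shows "bary_sum X I x \<noteq> 0"
proof -
  have "0 < bary_sum X I x"
    unfolding bary_sum_def using assms by (intro sum_pos) (auto simp: interiorS_def)
  then show ?thesis by simp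
qed

text \<open>
  For polynomial data the extension \<open>w\<close> of a summand is polynomial.  The base point of the rays is a
  vertex \<open>X z\<close> with \<open>z\<close> outside \<open>I\<close> if there is one; for the full index set any vertex will do.
\<close>

context
  fixes I :: "nat list" and w :: "'a \<Rightarrow> 'a list \<Rightarrow> real" and r k :: nat and U :: "'a \<Rightarrow> 'a list \<Rightarrow> real"
  assumes I: "set I \<subseteq> {..DIM('a)}" "2 \<le> card (set I)" and k: "k < DIM('a)" and r: "1 \<le> r"
    and w: "w \<in> Lam X k"
    and eq: "\<And>x vs. x \<in> S \<Longrightarrow> bary_sum X I x \<noteq> 0 \<Longrightarrow> length vs = k \<Longrightarrow> I_term k (tr_bd X U) I x vs = w x vs"
begin

lemma w_ray:
  assumes "x \<in> interiorS" "z \<le> DIM('a)" "t \<in> {0<..1}" "length vs = k"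
  shows "w (ray z x t) vs = I_term k (tr_bd X U) I (ray z x t) vs"
proof -
  have "ray z x t \<in> interiorS" unfolding ray_def using assms by (intro interiorS_segment vertex_in_simplex)
  then show ?thesis using eq[of "ray z x t" vs] bary_sum_interior[OF I] interiorS_subset assms(4) by auto
qed

lemma extension_PLam:
  assumes U: "U \<in> PLam X r k"
  shows "w \<in> PLam X r k"
  unfolding PLam_def
proof (intro CollectI conjI allI impI w)
  fix vs :: "'a list" assume vs: "length vs = k"
  obtain z where z: "z \<le> DIM('a)"
    and T: "\<And>x. x \<in> interiorS \<Longrightarrow> \<exists>\<phi>. poly_Icc r \<phi> \<and> (\<forall>t\<in>{0<..1}. I_term k (tr_bd X U) I (ray z x t) vs = \<phi> t)"
  proof (cases "set I = {..DIM('a)}")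
    case True
    show thesis
      by (rule that[of 0]) (use I_term_full_ray[OF True r tr_bd_in_Lam_bd[OF PLamD(1)[OF U]] _ vs] interiorS_subset in auto)
  next
    case False
    then obtain z where z: "z \<le> DIM('a)" "z \<notin> set I" using I(1) by auto
    show thesis by (rule that[OF z(1)]) (rule I_term_ray_PLam[OF I z U _ vs])
  qed
  have "smooth_on S (\<lambda>y. w y vs)" using w vs by (auto simp: Lam_def smooth_forms_def)
  then show "poly_fun_on S r (\<lambda>y. w y vs)"
  proof (rule poly_fun_on_rays[OF _ vertex_in_simplex[OF z]])
    fix x assume x: "x \<in> interiorS"
    have "\<exists>q. degree q \<le> r \<and> (\<forall>t\<in>{0<..1}. I_term k (tr_bd X U) I (ray z x t) vs = poly q t)"
      by (rule poly_Icc_rayE[OF T[OF x]])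
    then show "\<exists>q. degree q \<le> r \<and> (\<forall>t\<in>{0<..1}. w (X z + t *\<^sub>R (x - X z)) vs = poly q t)"
      using w_ray[OF x z _ vs] by (auto simp: ray_def)
  qed
qed

lemma extension_PLam_minus:
  assumes U: "U \<in> PLam_minus X r k"
  shows "w \<in> PLam_minus X r k"
  unfolding PLam_minus_def
proof (intro CollectI conjI allI impI)
  have UP: "U \<in> PLam X r k" using U by (simp add: PLam_minus_def)
  have u: "tr_bd X U \<in> Lam_bd X k" by (rule tr_bd_in_Lam_bd[OF PLamD(1)[OF UP]])
  show "w \<in> PLam X r k" by (rule extension_PLam[OF UP])
  fix a :: 'a assume k0: "0 < k"
  have cL: "contract a w \<in> Lam X (k - 1)" by (rule contract_Lam[OF w k0])
  show "contract a w \<in> PLam X r (k - 1)"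
    unfolding PLam_def
  proof (intro CollectI conjI allI impI cL)
    fix vs :: "'a list" assume vs: "length vs = k - 1"
    obtain z where z: "z \<le> DIM('a)"
      and T: "\<And>x. x \<in> interiorS \<Longrightarrow> \<exists>\<phi>. poly_Icc r \<phi> \<and>
        (\<forall>t\<in>{0<..1}. I_term k (tr_bd X U) I (ray z x t) ((ray z x t - a) # vs) = \<phi> t)"
    proof (cases "set I = {..DIM('a)}")
      case True
      show thesis
        by (rule that[of 0]) (use I_term_full_ray_contract[OF True r u _ vs k0 k] interiorS_subset in auto)
    next
      case False
      then obtain z where z: "z \<le> DIM('a)" "z \<notin> set I" using I(1) by auto
      show thesis
      proof (rule that[OF z(1)])
        fix x assume x: "x \<in> interiorS"
        then have xS: "x \<in> S" using interiorS_subset by auto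
        have l: "length ((X z - a) # vs) = k" using vs k0 by simp
        obtain \<phi> \<psi> where \<phi>: "poly_Icc r \<phi>" "\<And>t. t \<in> {0<..1} \<Longrightarrow> I_term k (tr_bd X U) I (ray z x t) ((ray z x t - X z) # vs) = \<phi> t"
          and \<psi>: "poly_Icc r \<psi>" "\<And>t. t \<in> {0<..1} \<Longrightarrow> I_term k (tr_bd X U) I (ray z x t) ((X z - a) # vs) = \<psi> t"
          using I_term_ray_radial[OF I z U x k0 vs] I_term_ray_PLam[OF I z UP x l] by blast
        show "\<exists>\<phi>. poly_Icc r \<phi> \<and> (\<forall>t\<in>{0<..1}. I_term k (tr_bd X U) I (ray z x t) ((ray z x t - a) # vs) = \<phi> t)"
        proof (intro exI conjI ballI)
          \<comment> \<open>The two summands are the contractions with the radial vector and with the constant \<open>X z - a\<close>.\<close>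
          show "poly_Icc r (\<lambda>t. \<phi> t + \<psi> t)" by (rule poly_Icc_add[OF \<phi>(1) \<psi>(1)])
          fix t :: real assume t: "t \<in> {0<..1}"
          have "ray z x t \<in> S" using t by (intro ray_in_simplex z xS) auto
          from alternating_I_term[OF I u this] have ml: "multilin k (I_term k (tr_bd X U) I (ray z x t))"
            by (simp add: alternating_on_UNIV_iff)
          show "I_term k (tr_bd X U) I (ray z x t) ((ray z x t - a) # vs) = \<phi> t + \<psi> t"
            using multilin_add[OF ml, of "0 # vs" 0 "ray z x t - X z" "X z - a"] \<phi>(2)[OF t] \<psi>(2)[OF t] vs k0 by simp
        qed
      qed
    qed
    have "smooth_on S (\<lambda>y. contract a w y vs)" using cL vs by (auto simp: Lam_def smooth_forms_def)
    then show "poly_fun_on S r (\<lambda>y. contract a w y vs)"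
    proof (rule poly_fun_on_rays[OF _ vertex_in_simplex[OF z]])
      fix x assume x: "x \<in> interiorS"
      have "\<exists>q. degree q \<le> r \<and> (\<forall>t\<in>{0<..1}. I_term k (tr_bd X U) I (ray z x t) ((ray z x t - a) # vs) = poly q t)"
        by (rule poly_Icc_rayE[OF T[OF x]])
      moreover have "contract a w (ray z x t) vs = I_term k (tr_bd X U) I (ray z x t) ((ray z x t - a) # vs)"
        if "t \<in> {0<..1}" for t
        using w_ray[OF x z that, of "(ray z x t - a) # vs"] vs k0 by (simp add: contract_def)
      ultimately show "\<exists>q. degree q \<le> r \<and> (\<forall>t\<in>{0<..1}. contract a w (X z + t *\<^sub>R (x - X z)) vs = poly q t)"
        by (auto simp: ray_def)
    qed
  qed
qed

end

lemma E_op_eq_I_term: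
  "E_op X k u x vs = (\<Sum>(m, I)\<in>Sigma {1..DIM('a)} (\<lambda>m. Gam m {..DIM('a)}).
     ((-1) ^ (m + 1) / real DIM('a)) * I_term k u I x vs)"
proof -
  have "E_op X k u x vs = (\<Sum>m=1..DIM('a). \<Sum>I\<in>Gam m {..DIM('a)}. ((-1) ^ (m + 1) / real DIM('a)) * I_term k u I x vs)"
    by (simp add: E_op_def I_term_def sum_distrib_left mult_ac)
  also have "\<dots> = (\<Sum>(m, I)\<in>Sigma {1..DIM('a)} (\<lambda>m. Gam m {..DIM('a)}). ((-1) ^ (m + 1) / real DIM('a)) * I_term k u I x vs)"
    by (rule sum.Sigma) (auto intro: finite_Gam)
  finally show ?thesis .
qed

lemma Gam_index_set:
  assumes "(m, I) \<in> Sigma {1..DIM('a)} (\<lambda>m. Gam m {..DIM('a)})"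
  shows "set I \<subseteq> {..DIM('a)}" "2 \<le> card (set I)"
  using assms set_Gam[of I m "{..DIM('a)}"] by (auto simp: distinct_card)

text \<open>
  The extensions of the summands are returned separately, because each of them has to be shown to
  be polynomial.
\<close>

lemma E_op_extension:
  assumes u: "u \<in> Lam_bd X k" and k: "k < DIM('a)"
  shows "\<exists>w. (\<forall>mI\<in>Sigma {1..DIM('a)} (\<lambda>m. Gam m {..DIM('a)}). w mI \<in> Lam X k \<and>
      (\<forall>x\<in>S. bary_sum X (snd mI) x \<noteq> 0 \<longrightarrow> (\<forall>vs. length vs = k \<longrightarrow> I_term k u (snd mI) x vs = w mI x vs))) \<and>
    (\<forall>x\<in>E_domain X. \<forall>vs. length vs = k \<longrightarrow> E_op X k u x vs =
      (\<Sum>mI\<in>Sigma {1..DIM('a)} (\<lambda>m. Gam m {..DIM('a)}). ((-1) ^ (fst mI + 1) / real DIM('a)) * w mI x vs))"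
proof -
  let ?A = "Sigma {1..DIM('a)} (\<lambda>m. Gam m {..DIM('a)})"
  have "\<exists>w\<in>Lam X k. \<forall>x\<in>S. bary_sum X (snd mI) x \<noteq> 0 \<longrightarrow> (\<forall>vs. length vs = k \<longrightarrow> I_term k u (snd mI) x vs = w x vs)"
    if "mI \<in> ?A" for mI
    using that Gam_index_set[of "fst mI" "snd mI"] by (intro I_term_extension u k) auto
  then obtain w where w: "\<And>mI. mI \<in> ?A \<Longrightarrow> w mI \<in> Lam X k"
    "\<And>mI x vs. mI \<in> ?A \<Longrightarrow> x \<in> S \<Longrightarrow> bary_sum X (snd mI) x \<noteq> 0 \<Longrightarrow> length vs = k \<Longrightarrow> I_term k u (snd mI) x vs = w mI x vs"
    by metis
  have "E_op X k u x vs = (\<Sum>mI\<in>?A. ((-1) ^ (fst mI + 1) / real DIM('a)) * w mI x vs)"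
    if "x \<in> E_domain X" "length vs = k" for x vs
    unfolding E_op_eq_I_term
  proof (rule sum.cong, rule refl)
    fix mI assume mI: "mI \<in> ?A"
    have "x \<in> S" "bary_sum X (snd mI) x \<noteq> 0" using that(1) mI by (auto simp: E_domain_def)
    then show "(case mI of (m, I) \<Rightarrow> ((-1) ^ (m + 1) / real DIM('a)) * I_term k u I x vs) =
        ((-1) ^ (fst mI + 1) / real DIM('a)) * w mI x vs"
      using w(2)[OF mI _ _ that(2)] by (simp add: case_prod_unfold)
  qed
  then show ?thesis using w by (intro exI[of _ w]) blast
qed

end

theorem theorem6p3:
  fixes X :: "nat \<Rightarrow> 'a::euclidean_space" and k r :: nat
  assumes "nondegenerate X" and "k \<le> DIM('a) - 1" and "r \<ge> 1"
  shows "E_maps_into X k (Lam_bd X k) (Lam X k) \<and>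
         E_maps_into X k (PLam_bd X r k) (PLam X r k) \<and>
         E_maps_into X k (PLam_minus_bd X r k) (PLam_minus X r k)"
proof -
  interpret simplex X by unfold_locales fact
  have k: "k < DIM('a)" using assms(2) DIM_positive[where 'a = 'a] by linarith
  let ?A = "Sigma {1..DIM('a)} (\<lambda>m. Gam m {..DIM('a)})"
  let ?sum = "\<lambda>w x vs. \<Sum>mI\<in>?A. ((-1) ^ (fst mI + 1) / real DIM('a)) * w mI x vs"
  have Lam: "E_maps_into X k (Lam_bd X k) (Lam X k)"
    unfolding E_maps_into_def
  proof
    fix u assume "u \<in> Lam_bd X k"
    from E_op_extension[OF this k] obtain w where w: "\<forall>mI\<in>?A. w mI \<in> Lam X k \<and>
      (\<forall>x\<in>S. bary_sum X (snd mI) x \<noteq> 0 \<longrightarrow> (\<forall>vs. length vs = k \<longrightarrow> I_term k u (snd mI) x vs = w mI x vs))"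
      "\<forall>x\<in>E_domain X. \<forall>vs. length vs = k \<longrightarrow> E_op X k u x vs = ?sum w x vs" by blast
    have "?sum w \<in> Lam X k" by (rule Lam_sum[of ?A w]) (use w(1) in blast)
    with w(2) show "\<exists>w\<in>Lam X k. \<forall>x\<in>E_domain X. \<forall>vs. length vs = k \<longrightarrow> E_op X k u x vs = w x vs"
      by (rule bexI)
  qed
  have PLam: "E_maps_into X k (PLam_bd X r k) (PLam X r k)"
    unfolding E_maps_into_def
  proof
    fix u assume "u \<in> PLam_bd X r k"
    then obtain U where U: "U \<in> PLam X r k" "u = tr_bd X U" by (auto simp: PLam_bd_def)
    from E_op_extension[OF tr_bd_in_Lam_bd[OF PLamD(1)[OF U(1)]] k] obtain w where
      w: "\<forall>mI\<in>?A. w mI \<in> Lam X k \<and>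
      (\<forall>x\<in>S. bary_sum X (snd mI) x \<noteq> 0 \<longrightarrow> (\<forall>vs. length vs = k \<longrightarrow> I_term k (tr_bd X U) (snd mI) x vs = w mI x vs))"
      "\<forall>x\<in>E_domain X. \<forall>vs. length vs = k \<longrightarrow> E_op X k (tr_bd X U) x vs = ?sum w x vs" by blast
    have "w mI \<in> PLam X r k" if mI: "mI \<in> ?A" for mI
    proof -
      have "set (snd mI) \<subseteq> {..DIM('a)}" "2 \<le> card (set (snd mI))"
        using Gam_index_set[of "fst mI" "snd mI"] mI by simp_all
      from extension_PLam[OF this k assms(3) _ _ U(1), of "w mI"] bspec[OF w(1) mI] show ?thesis by blast
    qed
    then have "?sum w \<in> PLam X r k" by (intro PLam_sum)
    with w(2) show "\<exists>w\<in>PLam X r k. \<forall>x\<in>E_domain X. \<forall>vs. length vs = k \<longrightarrow> E_op X k u x vs = w x vs"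
      unfolding U(2) by (rule bexI)
  qed
  have PLam_minus: "E_maps_into X k (PLam_minus_bd X r k) (PLam_minus X r k)"
    unfolding E_maps_into_def
  proof
    fix u assume "u \<in> PLam_minus_bd X r k"
    then obtain U where U: "U \<in> PLam_minus X r k" "u = tr_bd X U" by (auto simp: PLam_minus_bd_def)
    then have UL: "U \<in> Lam X k" by (auto simp: PLam_minus_def PLam_def)
    from E_op_extension[OF tr_bd_in_Lam_bd[OF UL] k] obtain w where
      w: "\<forall>mI\<in>?A. w mI \<in> Lam X k \<and>
      (\<forall>x\<in>S. bary_sum X (snd mI) x \<noteq> 0 \<longrightarrow> (\<forall>vs. length vs = k \<longrightarrow> I_term k (tr_bd X U) (snd mI) x vs = w mI x vs))"
      "\<forall>x\<in>E_domain X. \<forall>vs. length vs = k \<longrightarrow> E_op X k (tr_bd X U) x vs = ?sum w x vs" by blast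
    have "w mI \<in> PLam_minus X r k" if mI: "mI \<in> ?A" for mI
    proof -
      have "set (snd mI) \<subseteq> {..DIM('a)}" "2 \<le> card (set (snd mI))"
        using Gam_index_set[of "fst mI" "snd mI"] mI by simp_all
      from extension_PLam_minus[OF this k assms(3) _ _ U(1), of "w mI"] bspec[OF w(1) mI] show ?thesis by blast
    qed
    then have "?sum w \<in> PLam_minus X r k" by (intro PLam_minus_sum)
    with w(2) show "\<exists>w\<in>PLam_minus X r k. \<forall>x\<in>E_domain X. \<forall>vs. length vs = k \<longrightarrow> E_op X k u x vs = w x vs"
      unfolding U(2) by (rule bexI)
  qed
  show ?thesis using Lam PLam PLam_minus by blast
qed

end
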